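(* Let $G$ be a finite abelian group, $\chi:G\times G\to k^\times$ a bicharacter and $\mathcal{B}=(\mathrm{Vec}_G,\chi)$. Let $\varsigma(x)=\chi(x,x^{-1})$ be the canonical anti-twist, and for $\lambda\in\hat G$ let $\mathcal{B}_\lambda=\mathcal{B}_{\varsigma\lambda}$ be the stable braided $\mathcal{B}$-module $\mathcal{B}$ with stable braided structure given by the anti-twist $\varsigma\lambda$. Then $$HH(\mathcal{B})=\bigoplus_{\lambda\in\hat G}\mathcal{B}_\lambda$$ as stable braided $\mathcal{B}$-modules.
   Context: $k$ is an algebraically closed field of characteristic $0$. $\mathrm{Vec}_G$ is the monoidal category of $G$-graded finite dimensional vector spaces, with braiding $\tau(v\otimes w)=\chi(x,y)w\otimes v$ for $v\in V_x$, $w\in W_y$; $\hat G=\mathrm{Hom}(G,k^\times)$. A function $f:G\to k^\times$ is viewed as the automorphism of $Id_{\mathcal{B}}$ acting on $V_x$ by $f(x)$. $\tau^{-1}_{X,Y}:=(\tau_{Y,X})^{-1}$. An anti-twist is an automorphism $\varsigma$ of $Id_{\mathcal{B}}$ with $\varsigma_{X\otimes Y}=(\tau_{Y,X}\tau_{X,Y})^{-1}(\varsigma_X\otimes\varsigma_Y)$. A $\mathcal{B}$-module category $\mathcal{M}$ is braided if equipped with a natural automorphism $E_{X,M}$ of $X\cdot M$ with $E_{Y,X\cdot M}=\tau^{-1}_{X,Y}E_{Y,M}\tau^{-1}_{Y,X}$, $E_{Y\otimes X,M}=E_{Y,X\cdot M}E_{X,M}$; it is stable if equipped with an automorphism $\varsigma$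 of $Id_{\mathcal{M}}$ with $E_{X,M}=\varsigma_{X\cdot M}(Id_X\cdot\varsigma_M)^{-1}$. A $\mathcal{B}$-equivariant functor $F$ between stable braided modules is stable if $F(\varsigma_M)=\varsigma_{F(M)}$; equality of stable braided modules means equivalence by such a functor. For an anti-twist $\varsigma'$, $\mathcal{B}_{\varsigma'}$ is $\mathcal{B}$ as a left module over itself with the stable structure $\varsigma'$ and $E_{X,M}=\varsigma'_{X\otimes M}(Id_X\otimes\varsigma'_M)^{-1}$. $HH(\mathcal{B})$: with $X^*$ the left dual ($X^*\otimes X\to1$) and $X^\#=X^{**}$, objects are $M\in\mathcal{B}$ with natural isomorphisms $\tau^\circ_{X,M}:X\otimes M\to M\otimes X^\#$, $\tau^\circ_{1,M}=Id$, $\tau^\circ_{X\otimes Y,M}=(\tau^\circ_{X,M}\otimes Id)(Id\otimes\tau^\circ_{Y,M})$. The action is $X\cdot M=X\otimes M$ with $\tau^\circ_{Y,X\cdot M}=(Id_X\otimes\tau^\circ_{Y,M})(\tau^{-1}_{Y,X}\otimes Id_M)$; the stable structure is $\varsigma_M=(Id_M\otimes ev)(\tau^\circ_{M,M}\otimes Id_{M^*})(Id_M\otimes coev)$ with $coev:1\to M\otimes M^*$, $ev:M^\#\otimes M^*\to1$; $E_{X,M}=\varsigma_{X\cdot M}(Id_X\otimes\varsigma_M)^{-1}$. *)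

theory Defs
  imports
    "Jordan_Normal_Form.Matrix"
    "HOL-Library.FuncSet"
    "HOL-Computational_Algebra.Computational_Algebra"
begin

section \<open>Categories, functors, equivalences\<close>

text \<open>Hom-sets need not be disjoint (a matrix does not know the gradings of its source and target).
  For this reason the morphism part of a functor, and inverses, take source and target
  as explicit arguments.\<close>

record ('o, 'm) category =
  Ob :: "'o set"
  Hom :: "'o \<Rightarrow> 'o \<Rightarrow> 'm set"
  Ident :: "'o \<Rightarrow> 'm"
  Cmp :: "'m \<Rightarrow> 'm \<Rightarrow> 'm"  (infixr \<open>\<cdot>\<index>\<close> 55)

locale category =
  fixes C (structure)
  assumes ident_hom: "X \<in> Ob C \<Longrightarrow> Ident C X \<in> Hom C X X"
    and cmp_hom: "\<lbrakk>X \<in> Ob C; Y \<in> Ob C; Z \<in> Ob C; f \<in> Hom C X Y; g \<in> Hom C Y Z\<rbrakk>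
      \<Longrightarrow> g \<cdot> f \<in> Hom C X Z"
    and cmp_ident_right: "\<lbrakk>X \<in> Ob C; Y \<in> Ob C; f \<in> Hom C X Y\<rbrakk> \<Longrightarrow> f \<cdot> Ident C X = f"
    and cmp_ident_left: "\<lbrakk>X \<in> Ob C; Y \<in> Ob C; f \<in> Hom C X Y\<rbrakk> \<Longrightarrow> Ident C Y \<cdot> f = f"
    and cmp_assoc: "\<lbrakk>W \<in> Ob C; X \<in> Ob C; Y \<in> Ob C; Z \<in> Ob C;
        f \<in> Hom C W X; g \<in> Hom C X Y; h \<in> Hom C Y Z\<rbrakk>
      \<Longrightarrow> (h \<cdot> g) \<cdot> f = h \<cdot> (g \<cdot> f)"

definition inverse_arrows :: "('o, 'm, 'z) category_scheme \<Rightarrow> 'o \<Rightarrow> 'o \<Rightarrow> 'm \<Rightarrow> 'm \<Rightarrow> bool" where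
  "inverse_arrows C X Y f g \<longleftrightarrow>
     f \<in> Hom C X Y \<and> g \<in> Hom C Y X \<and> g \<cdot>\<^bsub>C\<^esub> f = Ident C X \<and> f \<cdot>\<^bsub>C\<^esub> g = Ident C Y"

definition iso_arrow :: "('o, 'm, 'z) category_scheme \<Rightarrow> 'o \<Rightarrow> 'o \<Rightarrow> 'm \<Rightarrow> bool" where
  "iso_arrow C X Y f \<longleftrightarrow> (\<exists>g. inverse_arrows C X Y f g)"

definition inv_arrow :: "('o, 'm, 'z) category_scheme \<Rightarrow> 'o \<Rightarrow> 'o \<Rightarrow> 'm \<Rightarrow> 'm" where
  "inv_arrow C X Y f = (THE g. inverse_arrows C X Y f g)"

definition is_functor :: "('o, 'm, 'z) category_scheme \<Rightarrow> ('p, 'n, 'y) category_scheme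
    \<Rightarrow> ('o \<Rightarrow> 'p) \<Rightarrow> ('o \<Rightarrow> 'o \<Rightarrow> 'm \<Rightarrow> 'n) \<Rightarrow> bool" where
  "is_functor C D Fo Fm \<longleftrightarrow>
     (\<forall>X\<in>Ob C. Fo X \<in> Ob D) \<and>
     (\<forall>X\<in>Ob C. \<forall>Y\<in>Ob C. \<forall>f\<in>Hom C X Y. Fm X Y f \<in> Hom D (Fo X) (Fo Y)) \<and>
     (\<forall>X\<in>Ob C. Fm X X (Ident C X) = Ident D (Fo X)) \<and>
     (\<forall>X\<in>Ob C. \<forall>Y\<in>Ob C. \<forall>Z\<in>Ob C. \<forall>f\<in>Hom C X Y. \<forall>g\<in>Hom C Y Z.
        Fm X Z (g \<cdot>\<^bsub>C\<^esub> f) = Fm Y Z g \<cdot>\<^bsub>D\<^esub> Fm X Y f)"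

definition natural_iso :: "('o, 'm, 'z) category_scheme \<Rightarrow> ('p, 'n, 'y) category_scheme
    \<Rightarrow> ('o \<Rightarrow> 'p) \<Rightarrow> ('o \<Rightarrow> 'o \<Rightarrow> 'm \<Rightarrow> 'n) \<Rightarrow> ('o \<Rightarrow> 'p) \<Rightarrow> ('o \<Rightarrow> 'o \<Rightarrow> 'm \<Rightarrow> 'n)
    \<Rightarrow> ('o \<Rightarrow> 'n) \<Rightarrow> bool" where
  "natural_iso C D Fo Fm Go Gm \<eta> \<longleftrightarrow>
     (\<forall>X\<in>Ob C. iso_arrow D (Fo X) (Go X) (\<eta> X)) \<and>
     (\<forall>X\<in>Ob C. \<forall>Y\<in>Ob C. \<forall>f\<in>Hom C X Y. \<eta> Y \<cdot>\<^bsub>D\<^esub> Fm X Y f = Gm X Y f \<cdot>\<^bsub>D\<^esub> \<eta> X)"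

definition is_equivalence :: "('o, 'm, 'z) category_scheme \<Rightarrow> ('p, 'n, 'y) category_scheme
    \<Rightarrow> ('o \<Rightarrow> 'p) \<Rightarrow> ('o \<Rightarrow> 'o \<Rightarrow> 'm \<Rightarrow> 'n) \<Rightarrow> bool" where
  "is_equivalence C D Fo Fm \<longleftrightarrow> is_functor C D Fo Fm \<and>
     (\<exists>Go Gm \<eta> \<epsilon>. is_functor D C Go Gm \<and>
        natural_iso C C (\<lambda>X. X) (\<lambda>X Y f. f) (\<lambda>X. Go (Fo X)) (\<lambda>X Y f. Gm (Fo X) (Fo Y) (Fm X Y f)) \<eta> \<and>
        natural_iso D D (\<lambda>X. Fo (Go X)) (\<lambda>X Y f. Fm (Go X) (Go Y) (Gm X Y f)) (\<lambda>X. X) (\<lambda>X Y f. f) \<epsilon>)"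

definition ident_automorphism :: "('o, 'm, 'z) category_scheme \<Rightarrow> ('o \<Rightarrow> 'm) \<Rightarrow> bool" where
  "ident_automorphism C s \<longleftrightarrow> natural_iso C C (\<lambda>X. X) (\<lambda>X Y f. f) (\<lambda>X. X) (\<lambda>X Y f. f) s"


section \<open>Strict braided monoidal categories with left duals\<close>

record ('o, 'm) rigid_braided_category = "('o, 'm) category" +
  tensor_ob :: "'o \<Rightarrow> 'o \<Rightarrow> 'o"  (infixr \<open>\<otimes>\<^sub>o\<index>\<close> 70)
  tensor_arr :: "'m \<Rightarrow> 'm \<Rightarrow> 'm"  (infixr \<open>\<otimes>\<^sub>m\<index>\<close> 70)
  unit_ob :: 'o
  braid :: "'o \<Rightarrow> 'o \<Rightarrow> 'm"
  ldual :: "'o \<Rightarrow> 'o"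
  ev :: "'o \<Rightarrow> 'm"
  coev :: "'o \<Rightarrow> 'm"

locale strict_monoidal_category = category B for B (structure) +
  assumes tensor_ob: "\<lbrakk>X \<in> Ob B; Y \<in> Ob B\<rbrakk> \<Longrightarrow> X \<otimes>\<^sub>o Y \<in> Ob B"
    and unit_ob: "unit_ob B \<in> Ob B"
    and tensor_hom: "\<lbrakk>X \<in> Ob B; X' \<in> Ob B; Y \<in> Ob B; Y' \<in> Ob B; f \<in> Hom B X X'; g \<in> Hom B Y Y'\<rbrakk>
      \<Longrightarrow> f \<otimes>\<^sub>m g \<in> Hom B (X \<otimes>\<^sub>o Y) (X' \<otimes>\<^sub>o Y')"
    and tensor_ident: "\<lbrakk>X \<in> Ob B; Y \<in> Ob B\<rbrakk> \<Longrightarrow> Ident B X \<otimes>\<^sub>m Ident B Y = Ident B (X \<otimes>\<^sub>o Y)"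
    and tensor_cmp: "\<lbrakk>X \<in> Ob B; X' \<in> Ob B; X'' \<in> Ob B; Y \<in> Ob B; Y' \<in> Ob B; Y'' \<in> Ob B;
        f \<in> Hom B X X'; f' \<in> Hom B X' X''; g \<in> Hom B Y Y'; g' \<in> Hom B Y' Y''\<rbrakk>
      \<Longrightarrow> (f' \<cdot> f) \<otimes>\<^sub>m (g' \<cdot> g) = (f' \<otimes>\<^sub>m g') \<cdot> (f \<otimes>\<^sub>m g)"
    and tensor_ob_assoc: "\<lbrakk>X \<in> Ob B; Y \<in> Ob B; Z \<in> Ob B\<rbrakk>
      \<Longrightarrow> (X \<otimes>\<^sub>o Y) \<otimes>\<^sub>o Z = X \<otimes>\<^sub>o (Y \<otimes>\<^sub>o Z)"
    and tensor_arr_assoc: "\<lbrakk>X \<in> Ob B; X' \<in> Ob B; Y \<in> Ob B; Y' \<in> Ob B; Z \<in> Ob B; Z' \<in> Ob B;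
        f \<in> Hom B X X'; g \<in> Hom B Y Y'; h \<in> Hom B Z Z'\<rbrakk>
      \<Longrightarrow> (f \<otimes>\<^sub>m g) \<otimes>\<^sub>m h = f \<otimes>\<^sub>m (g \<otimes>\<^sub>m h)"
    and tensor_ob_unit_left: "X \<in> Ob B \<Longrightarrow> unit_ob B \<otimes>\<^sub>o X = X"
    and tensor_ob_unit_right: "X \<in> Ob B \<Longrightarrow> X \<otimes>\<^sub>o unit_ob B = X"
    and tensor_arr_unit_left: "\<lbrakk>X \<in> Ob B; X' \<in> Ob B; f \<in> Hom B X X'\<rbrakk>
      \<Longrightarrow> Ident B (unit_ob B) \<otimes>\<^sub>m f = f"
    and tensor_arr_unit_right: "\<lbrakk>X \<in> Ob B; X' \<in> Ob B; f \<in> Hom B X X'\<rbrakk>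
      \<Longrightarrow> f \<otimes>\<^sub>m Ident B (unit_ob B) = f"

locale strict_braided_category = strict_monoidal_category +
  assumes braid_iso: "\<lbrakk>X \<in> Ob B; Y \<in> Ob B\<rbrakk> \<Longrightarrow> iso_arrow B (X \<otimes>\<^sub>o Y) (Y \<otimes>\<^sub>o X) (braid B X Y)"
    and braid_natural: "\<lbrakk>X \<in> Ob B; X' \<in> Ob B; Y \<in> Ob B; Y' \<in> Ob B; f \<in> Hom B X X'; g \<in> Hom B Y Y'\<rbrakk>
      \<Longrightarrow> braid B X' Y' \<cdot> (f \<otimes>\<^sub>m g) = (g \<otimes>\<^sub>m f) \<cdot> braid B X Y"
    and braid_tensor_left: "\<lbrakk>X \<in> Ob B; Y \<in> Ob B; Z \<in> Ob B\<rbrakk>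
      \<Longrightarrow> braid B (X \<otimes>\<^sub>o Y) Z = (braid B X Z \<otimes>\<^sub>m Ident B Y) \<cdot> (Ident B X \<otimes>\<^sub>m braid B Y Z)"
    and braid_tensor_right: "\<lbrakk>X \<in> Ob B; Y \<in> Ob B; Z \<in> Ob B\<rbrakk>
      \<Longrightarrow> braid B X (Y \<otimes>\<^sub>o Z) = (Ident B Y \<otimes>\<^sub>m braid B X Z) \<cdot> (braid B X Y \<otimes>\<^sub>m Ident B Z)"

locale strict_rigid_braided_category = strict_braided_category +
  assumes ldual_ob: "X \<in> Ob B \<Longrightarrow> ldual B X \<in> Ob B"
    and ev_hom: "X \<in> Ob B \<Longrightarrow> ev B X \<in> Hom B (ldual B X \<otimes>\<^sub>o X) (unit_ob B)"
    and coev_hom: "X \<in> Ob B \<Longrightarrow> coev B X \<in> Hom B (unit_ob B) (X \<otimes>\<^sub>o ldual B X)"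
    and zigzag: "X \<in> Ob B \<Longrightarrow>
      (Ident B X \<otimes>\<^sub>m ev B X) \<cdot> (coev B X \<otimes>\<^sub>m Ident B X) = Ident B X"
    and zigzag_ldual: "X \<in> Ob B \<Longrightarrow>
      (ev B X \<otimes>\<^sub>m Ident B (ldual B X)) \<cdot> (Ident B (ldual B X) \<otimes>\<^sub>m coev B X) = Ident B (ldual B X)"

text \<open>\<open>braid_inv B X Y\<close> is \<open>\<tau>\<^sup>-\<^sup>1\<close> with indices \<open>X, Y\<close>, that is the inverse of \<open>braid B Y X\<close>;
  it goes from \<open>X \<otimes> Y\<close> to \<open>Y \<otimes> X\<close>.\<close>

definition braid_inv :: "('o, 'm, 'z) rigid_braided_category_scheme \<Rightarrow> 'o \<Rightarrow> 'o \<Rightarrow> 'm" where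
  "braid_inv B X Y = inv_arrow B (Y \<otimes>\<^sub>o\<^bsub>B\<^esub> X) (X \<otimes>\<^sub>o\<^bsub>B\<^esub> Y) (braid B Y X)"

definition anti_twist :: "('o, 'm, 'z) rigid_braided_category_scheme \<Rightarrow> ('o \<Rightarrow> 'm) \<Rightarrow> bool" where
  "anti_twist B s \<longleftrightarrow> ident_automorphism B s \<and>
     (\<forall>X\<in>Ob B. \<forall>Y\<in>Ob B. s (X \<otimes>\<^sub>o\<^bsub>B\<^esub> Y) =
        inv_arrow B (X \<otimes>\<^sub>o\<^bsub>B\<^esub> Y) (X \<otimes>\<^sub>o\<^bsub>B\<^esub> Y) (braid B Y X \<cdot>\<^bsub>B\<^esub> braid B X Y) \<cdot>\<^bsub>B\<^esub> (s X \<otimes>\<^sub>m\<^bsub>B\<^esub> s Y))"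

text \<open>The transpose of \<open>f : X \<rightarrow> Y\<close>, a morphism from the dual of \<open>Y\<close> to the dual of \<open>X\<close>.\<close>

definition transpose_arr :: "('o, 'm, 'z) rigid_braided_category_scheme \<Rightarrow> 'o \<Rightarrow> 'o \<Rightarrow> 'm \<Rightarrow> 'm" where
  "transpose_arr B X Y f =
     (ev B Y \<otimes>\<^sub>m\<^bsub>B\<^esub> Ident B (ldual B X)) \<cdot>\<^bsub>B\<^esub>
     (Ident B (ldual B Y) \<otimes>\<^sub>m\<^bsub>B\<^esub> f \<otimes>\<^sub>m\<^bsub>B\<^esub> Ident B (ldual B X)) \<cdot>\<^bsub>B\<^esub>
     (Ident B (ldual B Y) \<otimes>\<^sub>m\<^bsub>B\<^esub> coev B X)"

abbreviation ddual :: "('o, 'm, 'z) rigid_braided_category_scheme \<Rightarrow> 'o \<Rightarrow> 'o" where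
  "ddual B X \<equiv> ldual B (ldual B X)"

definition ddual_arr :: "('o, 'm, 'z) rigid_braided_category_scheme \<Rightarrow> 'o \<Rightarrow> 'o \<Rightarrow> 'm \<Rightarrow> 'm" where
  "ddual_arr B X Y f = transpose_arr B (ldual B Y) (ldual B X) (transpose_arr B X Y f)"

text \<open>The canonical comparison \<open>D \<rightarrow> D'\<close> between two left duals of the same object, the first one
  having evaluation \<open>e\<close> and the second one having coevaluation \<open>c'\<close>.\<close>

definition ldual_comparison ::
  "('o, 'm, 'z) rigid_braided_category_scheme \<Rightarrow> 'o \<Rightarrow> 'm \<Rightarrow> 'o \<Rightarrow> 'm \<Rightarrow> 'm" where
  "ldual_comparison B D e D' c' =
     (e \<otimes>\<^sub>m\<^bsub>B\<^esub> Ident B D') \<cdot>\<^bsub>B\<^esub> (Ident B D \<otimes>\<^sub>m\<^bsub>B\<^esub> c')"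

text \<open>The tensor product of the duals of \<open>Y\<close> and \<open>X\<close>, in this order, is a left dual of \<open>X \<otimes> Y\<close>.
  The next two definitions give the resulting canonical isomorphism with the chosen dual
  of \<open>X \<otimes> Y\<close> and its inverse.\<close>

definition ldual_tensor :: "('o, 'm, 'z) rigid_braided_category_scheme \<Rightarrow> 'o \<Rightarrow> 'o \<Rightarrow> 'm" where
  "ldual_tensor B X Y =
     ldual_comparison B
       (ldual B Y \<otimes>\<^sub>o\<^bsub>B\<^esub> ldual B X)
       (ev B Y \<cdot>\<^bsub>B\<^esub> (Ident B (ldual B Y) \<otimes>\<^sub>m\<^bsub>B\<^esub> ev B X \<otimes>\<^sub>m\<^bsub>B\<^esub> Ident B Y))
       (ldual B (X \<otimes>\<^sub>o\<^bsub>B\<^esub> Y))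
       (coev B (X \<otimes>\<^sub>o\<^bsub>B\<^esub> Y))"

definition ldual_untensor :: "('o, 'm, 'z) rigid_braided_category_scheme \<Rightarrow> 'o \<Rightarrow> 'o \<Rightarrow> 'm" where
  "ldual_untensor B X Y =
     ldual_comparison B
       (ldual B (X \<otimes>\<^sub>o\<^bsub>B\<^esub> Y))
       (ev B (X \<otimes>\<^sub>o\<^bsub>B\<^esub> Y))
       (ldual B Y \<otimes>\<^sub>o\<^bsub>B\<^esub> ldual B X)
       ((Ident B X \<otimes>\<^sub>m\<^bsub>B\<^esub> coev B Y \<otimes>\<^sub>m\<^bsub>B\<^esub> Ident B (ldual B X)) \<cdot>\<^bsub>B\<^esub> coev B X)"

text \<open>The monoidal structure of the double dual functor: the canonical isomorphisms from
  \<open>X\<^sup># \<otimes> Y\<^sup>#\<close> to \<open>(X \<otimes> Y)\<^sup>#\<close> and from the unit \<open>1\<close> to \<open>1\<^sup>#\<close>. These are usually treated as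
  equalities.\<close>

definition ddual_tensor :: "('o, 'm, 'z) rigid_braided_category_scheme \<Rightarrow> 'o \<Rightarrow> 'o \<Rightarrow> 'm" where
  "ddual_tensor B X Y =
     transpose_arr B (ldual B (X \<otimes>\<^sub>o\<^bsub>B\<^esub> Y)) (ldual B Y \<otimes>\<^sub>o\<^bsub>B\<^esub> ldual B X) (ldual_untensor B X Y) \<cdot>\<^bsub>B\<^esub>
     ldual_tensor B (ldual B Y) (ldual B X)"

definition ddual_unit :: "('o, 'm, 'z) rigid_braided_category_scheme \<Rightarrow> 'm" where
  "ddual_unit B =
     transpose_arr B (ldual B (unit_ob B)) (unit_ob B) (ev B (unit_ob B)) \<cdot>\<^bsub>B\<^esub> coev B (unit_ob B)"


section \<open>Stable braided module categories\<close>

record ('o, 'm, 'x, 'f) stable_braided_module = "('x, 'f) category" +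
  act_ob :: "'o \<Rightarrow> 'x \<Rightarrow> 'x"  (infixr \<open>\<rhd>\<^sub>o\<index>\<close> 65)
  act_arr :: "'m \<Rightarrow> 'f \<Rightarrow> 'f"  (infixr \<open>\<rhd>\<^sub>m\<index>\<close> 65)
  mbraid :: "'o \<Rightarrow> 'x \<Rightarrow> 'f"
  mstable :: "'x \<Rightarrow> 'f"

locale strict_module_category = strict_rigid_braided_category B + M: category M
  for B :: "('o, 'm, 'z) rigid_braided_category_scheme" (structure)
    and M :: "('o, 'm, 'x, 'f, 'y) stable_braided_module_scheme" (structure) +
  assumes act_ob: "\<lbrakk>X \<in> Ob B; N \<in> Ob M\<rbrakk> \<Longrightarrow> X \<rhd>\<^sub>o\<^bsub>M\<^esub> N \<in> Ob M"
    and act_hom: "\<lbrakk>X \<in> Ob B; X' \<in> Ob B; N \<in> Ob M; N' \<in> Ob M; f \<in> Hom B X X'; h \<in> Hom M N N'\<rbrakk>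
      \<Longrightarrow> f \<rhd>\<^sub>m\<^bsub>M\<^esub> h \<in> Hom M (X \<rhd>\<^sub>o\<^bsub>M\<^esub> N) (X' \<rhd>\<^sub>o\<^bsub>M\<^esub> N')"
    and act_ident: "\<lbrakk>X \<in> Ob B; N \<in> Ob M\<rbrakk> \<Longrightarrow> Ident B X \<rhd>\<^sub>m\<^bsub>M\<^esub> Ident M N = Ident M (X \<rhd>\<^sub>o\<^bsub>M\<^esub> N)"
    and act_cmp: "\<lbrakk>X \<in> Ob B; X' \<in> Ob B; X'' \<in> Ob B; N \<in> Ob M; N' \<in> Ob M; N'' \<in> Ob M;
        f \<in> Hom B X X'; f' \<in> Hom B X' X''; h \<in> Hom M N N'; h' \<in> Hom M N' N''\<rbrakk>
      \<Longrightarrow> (f' \<cdot>\<^bsub>B\<^esub> f) \<rhd>\<^sub>m\<^bsub>M\<^esub> (h' \<cdot>\<^bsub>M\<^esub> h) = (f' \<rhd>\<^sub>m\<^bsub>M\<^esub> h') \<cdot>\<^bsub>M\<^esub> (f \<rhd>\<^sub>m\<^bsub>M\<^esub> h)"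
    and act_ob_tensor: "\<lbrakk>X \<in> Ob B; Y \<in> Ob B; N \<in> Ob M\<rbrakk>
      \<Longrightarrow> (X \<otimes>\<^sub>o\<^bsub>B\<^esub> Y) \<rhd>\<^sub>o\<^bsub>M\<^esub> N = X \<rhd>\<^sub>o\<^bsub>M\<^esub> (Y \<rhd>\<^sub>o\<^bsub>M\<^esub> N)"
    and act_arr_tensor: "\<lbrakk>X \<in> Ob B; X' \<in> Ob B; Y \<in> Ob B; Y' \<in> Ob B; N \<in> Ob M; N' \<in> Ob M;
        f \<in> Hom B X X'; g \<in> Hom B Y Y'; h \<in> Hom M N N'\<rbrakk>
      \<Longrightarrow> (f \<otimes>\<^sub>m\<^bsub>B\<^esub> g) \<rhd>\<^sub>m\<^bsub>M\<^esub> h = f \<rhd>\<^sub>m\<^bsub>M\<^esub> (g \<rhd>\<^sub>m\<^bsub>M\<^esub> h)"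
    and act_ob_unit: "N \<in> Ob M \<Longrightarrow> unit_ob B \<rhd>\<^sub>o\<^bsub>M\<^esub> N = N"
    and act_arr_unit: "\<lbrakk>N \<in> Ob M; N' \<in> Ob M; h \<in> Hom M N N'\<rbrakk>
      \<Longrightarrow> Ident B (unit_ob B) \<rhd>\<^sub>m\<^bsub>M\<^esub> h = h"

locale braided_module_category = strict_module_category +
  assumes mbraid_iso: "\<lbrakk>X \<in> Ob B; N \<in> Ob M\<rbrakk>
      \<Longrightarrow> iso_arrow M (X \<rhd>\<^sub>o\<^bsub>M\<^esub> N) (X \<rhd>\<^sub>o\<^bsub>M\<^esub> N) (mbraid M X N)"
    and mbraid_natural: "\<lbrakk>X \<in> Ob B; X' \<in> Ob B; N \<in> Ob M; N' \<in> Ob M; f \<in> Hom B X X'; h \<in> Hom M N N'\<rbrakk>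
      \<Longrightarrow> mbraid M X' N' \<cdot>\<^bsub>M\<^esub> (f \<rhd>\<^sub>m\<^bsub>M\<^esub> h) = (f \<rhd>\<^sub>m\<^bsub>M\<^esub> h) \<cdot>\<^bsub>M\<^esub> mbraid M X N"
    and mbraid_act: "\<lbrakk>X \<in> Ob B; Y \<in> Ob B; N \<in> Ob M\<rbrakk>
      \<Longrightarrow> mbraid M Y (X \<rhd>\<^sub>o\<^bsub>M\<^esub> N) =
        (braid_inv B X Y \<rhd>\<^sub>m\<^bsub>M\<^esub> Ident M N) \<cdot>\<^bsub>M\<^esub>
        (Ident B X \<rhd>\<^sub>m\<^bsub>M\<^esub> mbraid M Y N) \<cdot>\<^bsub>M\<^esub>
        (braid_inv B Y X \<rhd>\<^sub>m\<^bsub>M\<^esub> Ident M N)"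
    and mbraid_tensor: "\<lbrakk>X \<in> Ob B; Y \<in> Ob B; N \<in> Ob M\<rbrakk>
      \<Longrightarrow> mbraid M (Y \<otimes>\<^sub>o\<^bsub>B\<^esub> X) N =
        mbraid M Y (X \<rhd>\<^sub>o\<^bsub>M\<^esub> N) \<cdot>\<^bsub>M\<^esub> (Ident B Y \<rhd>\<^sub>m\<^bsub>M\<^esub> mbraid M X N)"

locale stable_braided_module_category = braided_module_category +
  assumes mstable_automorphism: "ident_automorphism M (mstable M)"
    and mbraid_eq_mstable: "\<lbrakk>X \<in> Ob B; N \<in> Ob M\<rbrakk>
      \<Longrightarrow> mbraid M X N =
        mstable M (X \<rhd>\<^sub>o\<^bsub>M\<^esub> N) \<cdot>\<^bsub>M\<^esub>
        inv_arrow M (X \<rhd>\<^sub>o\<^bsub>M\<^esub> N) (X \<rhd>\<^sub>o\<^bsub>M\<^esub> N) (Ident B X \<rhd>\<^sub>m\<^bsub>M\<^esub> mstable M N)"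

text \<open>The family \<open>s\<close> is the equivariance structure \<open>F (X \<cdot> N) \<cong> X \<cdot> F N\<close>.\<close>

definition equivariant_functor :: "('o, 'm, 'z) rigid_braided_category_scheme
    \<Rightarrow> ('o, 'm, 'x, 'f, 'y) stable_braided_module_scheme
    \<Rightarrow> ('o, 'm, 'p, 'h, 'w) stable_braided_module_scheme
    \<Rightarrow> ('x \<Rightarrow> 'p) \<Rightarrow> ('x \<Rightarrow> 'x \<Rightarrow> 'f \<Rightarrow> 'h) \<Rightarrow> ('o \<Rightarrow> 'x \<Rightarrow> 'h) \<Rightarrow> bool" where
  "equivariant_functor B M M' Fo Fm s \<longleftrightarrow> is_functor M M' Fo Fm \<and>
     (\<forall>X\<in>Ob B. \<forall>N\<in>Ob M. iso_arrow M' (Fo (X \<rhd>\<^sub>o\<^bsub>M\<^esub> N)) (X \<rhd>\<^sub>o\<^bsub>M'\<^esub> Fo N) (s X N)) \<and>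
     (\<forall>X\<in>Ob B. \<forall>X'\<in>Ob B. \<forall>N\<in>Ob M. \<forall>N'\<in>Ob M. \<forall>f\<in>Hom B X X'. \<forall>g\<in>Hom M N N'.
        s X' N' \<cdot>\<^bsub>M'\<^esub> Fm (X \<rhd>\<^sub>o\<^bsub>M\<^esub> N) (X' \<rhd>\<^sub>o\<^bsub>M\<^esub> N') (f \<rhd>\<^sub>m\<^bsub>M\<^esub> g) = (f \<rhd>\<^sub>m\<^bsub>M'\<^esub> Fm N N' g) \<cdot>\<^bsub>M'\<^esub> s X N) \<and>
     (\<forall>X\<in>Ob B. \<forall>Y\<in>Ob B. \<forall>N\<in>Ob M.
        s (X \<otimes>\<^sub>o\<^bsub>B\<^esub> Y) N = (Ident B X \<rhd>\<^sub>m\<^bsub>M'\<^esub> s Y N) \<cdot>\<^bsub>M'\<^esub> s X (Y \<rhd>\<^sub>o\<^bsub>M\<^esub> N)) \<and>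
     (\<forall>N\<in>Ob M. s (unit_ob B) N = Ident M' (Fo N))"

definition stable_functor :: "('o, 'm, 'z) rigid_braided_category_scheme
    \<Rightarrow> ('o, 'm, 'x, 'f, 'y) stable_braided_module_scheme
    \<Rightarrow> ('o, 'm, 'p, 'h, 'w) stable_braided_module_scheme
    \<Rightarrow> ('x \<Rightarrow> 'p) \<Rightarrow> ('x \<Rightarrow> 'x \<Rightarrow> 'f \<Rightarrow> 'h) \<Rightarrow> ('o \<Rightarrow> 'x \<Rightarrow> 'h) \<Rightarrow> bool" where
  "stable_functor B M M' Fo Fm s \<longleftrightarrow> equivariant_functor B M M' Fo Fm s \<and>
     (\<forall>N\<in>Ob M. Fm N N (mstable M N) = mstable M' (Fo N))"

definition stable_braided_equivalent :: "('o, 'm, 'z) rigid_braided_category_scheme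
    \<Rightarrow> ('o, 'm, 'x, 'f, 'y) stable_braided_module_scheme
    \<Rightarrow> ('o, 'm, 'p, 'h, 'w) stable_braided_module_scheme \<Rightarrow> bool" where
  "stable_braided_equivalent B M M' \<longleftrightarrow>
     stable_braided_module_category B M \<and> stable_braided_module_category B M' \<and>
     (\<exists>Fo Fm s. stable_functor B M M' Fo Fm s \<and> is_equivalence M M' Fo Fm)"

text \<open>The direct sum of a finite family of (additive) categories is their product.\<close>

definition module_direct_sum :: "'i set \<Rightarrow> ('i \<Rightarrow> ('o, 'm, 'x, 'f) stable_braided_module)
    \<Rightarrow> ('o, 'm, 'i \<Rightarrow> 'x, 'i \<Rightarrow> 'f) stable_braided_module" where
  "module_direct_sum I M = \<lparr>
     Ob = (\<Pi>\<^sub>E i\<in>I. Ob (M i)),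
     Hom = (\<lambda>N N'. \<Pi>\<^sub>E i\<in>I. Hom (M i) (N i) (N' i)),
     Ident = (\<lambda>N. \<lambda>i\<in>I. Ident (M i) (N i)),
     Cmp = (\<lambda>g f. \<lambda>i\<in>I. g i \<cdot>\<^bsub>M i\<^esub> f i),
     act_ob = (\<lambda>X N. \<lambda>i\<in>I. X \<rhd>\<^sub>o\<^bsub>M i\<^esub> N i),
     act_arr = (\<lambda>f g. \<lambda>i\<in>I. f \<rhd>\<^sub>m\<^bsub>M i\<^esub> g i),
     mbraid = (\<lambda>X N. \<lambda>i\<in>I. mbraid (M i) X (N i)),
     mstable = (\<lambda>N. \<lambda>i\<in>I. mstable (M i) (N i))\<rparr>"

text \<open>The module of an anti-twist \<open>s\<close>: the category \<open>B\<close> as a left module over itself.\<close>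

definition anti_twist_module :: "('o, 'm, 'z) rigid_braided_category_scheme \<Rightarrow> ('o \<Rightarrow> 'm)
    \<Rightarrow> ('o, 'm, 'o, 'm) stable_braided_module" where
  "anti_twist_module B s = \<lparr>
     Ob = Ob B,
     Hom = Hom B,
     Ident = Ident B,
     Cmp = Cmp B,
     act_ob = tensor_ob B,
     act_arr = tensor_arr B,
     mbraid = (\<lambda>X N. s (X \<otimes>\<^sub>o\<^bsub>B\<^esub> N) \<cdot>\<^bsub>B\<^esub>
       inv_arrow B (X \<otimes>\<^sub>o\<^bsub>B\<^esub> N) (X \<otimes>\<^sub>o\<^bsub>B\<^esub> N) (Ident B X \<otimes>\<^sub>m\<^bsub>B\<^esub> s N)),
     mstable = s\<rparr>"


section \<open>The module category \<open>HH(B)\<close>\<close>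

text \<open>\<open>HH_structure B M t\<close>: the family \<open>t X : X \<otimes> M \<rightarrow> M \<otimes> X\<^sup>#\<close> makes \<open>M\<close> an object of \<open>HH(B)\<close>.
  The family is required to be undefined outside the objects of \<open>B\<close>, so that it is determined by
  its components.\<close>

definition HH_structure :: "('o, 'm, 'z) rigid_braided_category_scheme \<Rightarrow> 'o \<Rightarrow> ('o \<Rightarrow> 'm) \<Rightarrow> bool" where
  "HH_structure B M t \<longleftrightarrow>
     t \<in> extensional (Ob B) \<and>
     (\<forall>X\<in>Ob B. iso_arrow B (X \<otimes>\<^sub>o\<^bsub>B\<^esub> M) (M \<otimes>\<^sub>o\<^bsub>B\<^esub> ddual B X) (t X)) \<and>
     (\<forall>X\<in>Ob B. \<forall>Y\<in>Ob B. \<forall>f\<in>Hom B X Y.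
        t Y \<cdot>\<^bsub>B\<^esub> (f \<otimes>\<^sub>m\<^bsub>B\<^esub> Ident B M) = (Ident B M \<otimes>\<^sub>m\<^bsub>B\<^esub> ddual_arr B X Y f) \<cdot>\<^bsub>B\<^esub> t X) \<and>
     t (unit_ob B) = Ident B M \<otimes>\<^sub>m\<^bsub>B\<^esub> ddual_unit B \<and>
     (\<forall>X\<in>Ob B. \<forall>Y\<in>Ob B.
        t (X \<otimes>\<^sub>o\<^bsub>B\<^esub> Y) =
          (Ident B M \<otimes>\<^sub>m\<^bsub>B\<^esub> ddual_tensor B X Y) \<cdot>\<^bsub>B\<^esub>
          (t X \<otimes>\<^sub>m\<^bsub>B\<^esub> Ident B (ddual B Y)) \<cdot>\<^bsub>B\<^esub> (Ident B X \<otimes>\<^sub>m\<^bsub>B\<^esub> t Y))"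

definition HH_act :: "('o, 'm, 'z) rigid_braided_category_scheme \<Rightarrow> 'o \<Rightarrow> 'o \<times> ('o \<Rightarrow> 'm)
    \<Rightarrow> 'o \<times> ('o \<Rightarrow> 'm)" where
  "HH_act B X = (\<lambda>(M, t).
     (X \<otimes>\<^sub>o\<^bsub>B\<^esub> M,
      \<lambda>Y\<in>Ob B. (Ident B X \<otimes>\<^sub>m\<^bsub>B\<^esub> t Y) \<cdot>\<^bsub>B\<^esub> (braid_inv B Y X \<otimes>\<^sub>m\<^bsub>B\<^esub> Ident B M)))"

definition HH_stable :: "('o, 'm, 'z) rigid_braided_category_scheme \<Rightarrow> 'o \<times> ('o \<Rightarrow> 'm) \<Rightarrow> 'm" where
  "HH_stable B = (\<lambda>(M, t).
     (Ident B M \<otimes>\<^sub>m\<^bsub>B\<^esub> ev B (ldual B M)) \<cdot>\<^bsub>B\<^esub>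
     (t M \<otimes>\<^sub>m\<^bsub>B\<^esub> Ident B (ldual B M)) \<cdot>\<^bsub>B\<^esub>
     (Ident B M \<otimes>\<^sub>m\<^bsub>B\<^esub> coev B M))"

definition HH :: "('o, 'm, 'z) rigid_braided_category_scheme
    \<Rightarrow> ('o, 'm, 'o \<times> ('o \<Rightarrow> 'm), 'm) stable_braided_module" where
  "HH B = \<lparr>
     Ob = {(M, t). M \<in> Ob B \<and> HH_structure B M t},
     Hom = (\<lambda>(M, t) (N, u). {f \<in> Hom B M N. \<forall>X\<in>Ob B.
       u X \<cdot>\<^bsub>B\<^esub> (Ident B X \<otimes>\<^sub>m\<^bsub>B\<^esub> f) = (f \<otimes>\<^sub>m\<^bsub>B\<^esub> Ident B (ddual B X)) \<cdot>\<^bsub>B\<^esub> t X}),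
     Ident = (\<lambda>(M, t). Ident B M),
     Cmp = Cmp B,
     act_ob = HH_act B,
     act_arr = tensor_arr B,
     mbraid = (\<lambda>X N. HH_stable B (HH_act B X N) \<cdot>\<^bsub>B\<^esub>
       inv_arrow B (X \<otimes>\<^sub>o\<^bsub>B\<^esub> fst N) (X \<otimes>\<^sub>o\<^bsub>B\<^esub> fst N) (Ident B X \<otimes>\<^sub>m\<^bsub>B\<^esub> HH_stable B N)),
     mstable = HH_stable B\<rparr>"


section \<open>Graded vector spaces\<close>

text \<open>A finite dimensional vector space is a coordinate space \<open>carrier_vec n\<close>, and a linear map is a
  matrix. The grading is arbitrary: a decomposition of \<open>carrier_vec n\<close> as an internal
  direct sum of subspaces, not necessarily spanned by standard basis vectors. The tensor product
  of coordinate spaces is the Kronecker product, which is strictly associative and unital.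
  The grading group is written additively.\<close>

definition vec_subspace :: "nat \<Rightarrow> 'k::field vec set \<Rightarrow> bool" where
  "vec_subspace n S \<longleftrightarrow> S \<subseteq> carrier_vec n \<and> 0\<^sub>v n \<in> S \<and>
     (\<forall>u\<in>S. \<forall>v\<in>S. u + v \<in> S) \<and> (\<forall>a. \<forall>v\<in>S. a \<cdot>\<^sub>v v \<in> S)"

definition vec_span :: "nat \<Rightarrow> 'k::field vec set \<Rightarrow> 'k vec set" where
  "vec_span n S = \<Inter>{T. vec_subspace n T \<and> S \<subseteq> T}"

record ('g, 'k) graded_space =
  gdim :: nat
  gcomp :: "'g \<Rightarrow> 'k vec set"

definition graded_space :: "('g::{ab_group_add,finite}, 'k::field) graded_space \<Rightarrow> bool" where
  "graded_space V \<longleftrightarrow> (\<forall>x. vec_subspace (gdim V) (gcomp V x)) \<and>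
     (\<forall>v\<in>carrier_vec (gdim V). \<exists>!c. (\<forall>x. c x \<in> gcomp V x) \<and>
        (\<forall>i<gdim V. v $ i = (\<Sum>x\<in>UNIV. c x $ i)))"

definition graded_hom :: "('g, 'k::field) graded_space \<Rightarrow> ('g, 'k) graded_space \<Rightarrow> 'k mat set" where
  "graded_hom V W = {A \<in> carrier_mat (gdim W) (gdim V). \<forall>x. \<forall>v\<in>gcomp V x. A *\<^sub>v v \<in> gcomp W x}"

definition tensor_vec :: "'k::field vec \<Rightarrow> 'k vec \<Rightarrow> 'k vec" where
  "tensor_vec v w = vec (dim_vec v * dim_vec w) (\<lambda>i. v $ (i div dim_vec w) * w $ (i mod dim_vec w))"

definition tensor_mat :: "'k::field mat \<Rightarrow> 'k mat \<Rightarrow> 'k mat" where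
  "tensor_mat A C = mat (dim_row A * dim_row C) (dim_col A * dim_col C)
     (\<lambda>(i, j). A $$ (i div dim_row C, j div dim_col C) * C $$ (i mod dim_row C, j mod dim_col C))"

definition graded_tensor :: "('g::{ab_group_add,finite}, 'k::field) graded_space
    \<Rightarrow> ('g, 'k) graded_space \<Rightarrow> ('g, 'k) graded_space" where
  "graded_tensor V W = \<lparr>
     gdim = gdim V * gdim W,
     gcomp = (\<lambda>z. vec_span (gdim V * gdim W)
       {tensor_vec v w | v w x y. v \<in> gcomp V x \<and> w \<in> gcomp W y \<and> x + y = z})\<rparr>"

definition graded_unit :: "('g::{ab_group_add,finite}, 'k::field) graded_space" where
  "graded_unit = \<lparr>gdim = 1, gcomp = (\<lambda>x. if x = 0 then carrier_vec 1 else {0\<^sub>v 1})\<rparr>"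

definition graded_braid :: "('g \<Rightarrow> 'g \<Rightarrow> 'k) \<Rightarrow> ('g::{ab_group_add,finite}, 'k::field) graded_space
    \<Rightarrow> ('g, 'k) graded_space \<Rightarrow> 'k mat" where
  "graded_braid \<chi> V W = (THE A. A \<in> carrier_mat (gdim W * gdim V) (gdim V * gdim W) \<and>
     (\<forall>x y. \<forall>v\<in>gcomp V x. \<forall>w\<in>gcomp W y. A *\<^sub>v tensor_vec v w = \<chi> x y \<cdot>\<^sub>v tensor_vec w v))"

text \<open>The dual space is again \<open>carrier_vec (gdim V)\<close>, a vector being viewed as a functional by means
  of the scalar product. Functionals of degree \<open>x\<close> vanish on all components but the one of degree \<open>- x\<close>.
  Evaluation is the scalar product, and coevaluation maps \<open>1\<close> to the sum of all
  \<open>e\<^sub>i \<otimes> e\<^sub>i\<close>.\<close>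

definition graded_dual :: "('g::{ab_group_add,finite}, 'k::field) graded_space
    \<Rightarrow> ('g, 'k) graded_space" where
  "graded_dual V = \<lparr>
     gdim = gdim V,
     gcomp = (\<lambda>x. {\<phi> \<in> carrier_vec (gdim V). \<forall>y. y \<noteq> - x \<longrightarrow> (\<forall>v\<in>gcomp V y. \<phi> \<bullet> v = 0)})\<rparr>"

definition graded_ev :: "('g, 'k::field) graded_space \<Rightarrow> 'k mat" where
  "graded_ev V = mat 1 (gdim V * gdim V) (\<lambda>(_, j). if j div gdim V = j mod gdim V then 1 else 0)"

definition graded_coev :: "('g, 'k::field) graded_space \<Rightarrow> 'k mat" where
  "graded_coev V = mat (gdim V * gdim V) 1 (\<lambda>(i, _). if i div gdim V = i mod gdim V then 1 else 0)"

definition Vec :: "('g \<Rightarrow> 'g \<Rightarrow> 'k)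
    \<Rightarrow> (('g::{ab_group_add,finite}, 'k::field) graded_space, 'k mat) rigid_braided_category" where
  "Vec \<chi> = \<lparr>
     Ob = {V. graded_space V},
     Hom = graded_hom,
     Ident = (\<lambda>V. 1\<^sub>m (gdim V)),
     Cmp = (\<lambda>A C. A * C),
     tensor_ob = graded_tensor,
     tensor_arr = tensor_mat,
     unit_ob = graded_unit,
     braid = graded_braid \<chi>,
     ldual = graded_dual,
     ev = graded_ev,
     coev = graded_coev\<rparr>"

text \<open>A function on the group, viewed as the endomorphism acting by \<open>f x\<close> on degree \<open>x\<close>.\<close>

definition graded_scaling :: "('g \<Rightarrow> 'k) \<Rightarrow> ('g::{ab_group_add,finite}, 'k::field) graded_space
    \<Rightarrow> 'k mat" where
  "graded_scaling f V = (THE A. A \<in> carrier_mat (gdim V) (gdim V) \<and>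
     (\<forall>x. \<forall>v\<in>gcomp V x. A *\<^sub>v v = f x \<cdot>\<^sub>v v))"

definition bicharacter :: "('g::ab_group_add \<Rightarrow> 'g \<Rightarrow> 'k::field) \<Rightarrow> bool" where
  "bicharacter \<chi> \<longleftrightarrow> (\<forall>x y. \<chi> x y \<noteq> 0) \<and>
     (\<forall>x x' y. \<chi> (x + x') y = \<chi> x y * \<chi> x' y) \<and>
     (\<forall>x y y'. \<chi> x (y + y') = \<chi> x y * \<chi> x y')"

definition character_group :: "('g::ab_group_add \<Rightarrow> 'k::field) set" where
  "character_group = {l. (\<forall>x. l x \<noteq> 0) \<and> (\<forall>x y. l (x + y) = l x * l y)}"

text \<open>The canonical anti-twist multiplied by a character \<open>l\<close>.\<close>

definition character_anti_twist :: "('g \<Rightarrow> 'g \<Rightarrow> 'k) \<Rightarrow> ('g \<Rightarrow> 'k)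
    \<Rightarrow> ('g::{ab_group_add,finite}, 'k::field) graded_space \<Rightarrow> 'k mat" where
  "character_anti_twist \<chi> l = graded_scaling (\<lambda>x. \<chi> x (- x) * l x)"

end

theory Submission
  imports Defs "Jordan_Normal_Form.Determinant"
begin

text \<open>Since \<open>X\<^sup># = X\<close> for graded spaces, an object of \<open>HH(B)\<close> is a graded space \<open>M\<close> with a half
  braiding. By naturality the half braiding is determined by its components \<open>T z : M \<rightarrow> M\<close> at the lines
  of degree \<open>z\<close>: it maps \<open>v \<otimes> m\<close> to \<open>T x m \<otimes> v\<close> for \<open>v\<close> of degree \<open>x\<close>. The axioms say that \<open>T\<close> is a
  representation of the group which preserves the grading, and the stable structure is \<open>T y\<close> in
  degree \<open>y\<close>. Acting by an object of degree \<open>x\<close> multiplies \<open>T z\<close> by the inverse of \<open>\<chi> x z\<close>, so the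
  representation \<open>U\<close> which is \<open>\<chi> y z\<close> times \<open>T z\<close> in degree \<open>y\<close> is not changed by the action. On the
  component where \<open>U\<close> acts by a character \<open>l\<close>, the stable structure is \<open>\<chi> y (- y) * l y\<close> in degree \<open>y\<close>,
  which is the anti-twist of \<open>B\<^sub>l\<close>. The equivalence sends \<open>M\<close> to the family of its isotypic components.
  Objects of \<open>B\<close> are coordinate spaces, so these components are obtained by splitting the
  idempotent matrices given by the characters, which exist in sufficient number because \<open>k\<close> is
  algebraically closed of characteristic 0.\<close>

section \<open>Kronecker products\<close>

text \<open>The splittings of the isotypic idempotents \<open>Q N l\<close> are arbitrary choices,
  so the functor is never computed on objects. Only four facts are used:
  \<open>proj N l * incl N l\<close> is an identity, \<open>incl N l * proj N l = Q N l\<close>,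
  \<open>Q N l\<close> commutes with morphisms, and the action turns it into 1 \<otimes>
  \<open>Q N l\<close>. Functoriality and equivariance then amount to sliding \<open>Q\<close>
  through a product until a splitting absorbs it. No quasi-inverse is written down: the functor is
  shown to be fully faithful and essentially surjective. Faithfulness rests on the projectors
  \<open>Q N l\<close> adding up to 1, hence on division by the order of the group and on characters
  separating its elements. The equality of \<open>X\<close> with its double dual does not by itself
  dispose of the canonical isomorphisms in the definition of \<open>HH(B)\<close>. They are built
  from evaluations and coevaluations and have to be computed; two flips of tensor factors cancel.
  The axioms of a stable braided module are verified once, for spaces with a representation
  \<open>R\<close>. There E maps v \<otimes> w, with degrees x and y, to
  \<open>\<chi> x (- (x + y))\<close> times v \<otimes> \<open>R x\<close> w, and each axiom becomes
  an identity between values of \<chi>.\<close>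

lemma less_mult_imp_div_mod:
  fixes i m n :: nat
  assumes "i < m * n"
  shows "i div n < m" "i mod n < n"
proof -
  show "i div n < m"
    using assms by (simp add: less_mult_imp_div_less)
  have "n > 0" using assms by (cases n) auto
  then show "i mod n < n" by simp
qed

text \<open>An index \<open>k\<close> of a Kronecker product stands for the pair
  \<open>(k div n, k mod n)\<close>. All entrywise computations with tensor products pass through
  this reindexing.\<close>

lemma sum_div_mod:
  fixes f :: "nat \<Rightarrow> nat \<Rightarrow> 'a::comm_monoid_add"
  shows "(\<Sum>k = 0..<m * n. f (k div n) (k mod n)) = (\<Sum>i = 0..<m. \<Sum>j = 0..<n. f i j)"
proof -
  have "(\<Sum>i = 0..<m. \<Sum>j = 0..<n. f i j) = (\<Sum>(i, j)\<in>{0..<m} \<times> {0..<n}. f i j)"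
    by (simp add: sum.cartesian_product)
  also have "\<dots> = (\<Sum>k = 0..<m * n. f (k div n) (k mod n))"
  proof (rule sum.reindex_bij_witness[where j = "\<lambda>(i, j). i * n + j" and i = "\<lambda>k. (k div n, k mod n)"])
    fix a assume "a \<in> {0..<m} \<times> {0..<n}"
    then obtain i j where a: "a = (i, j)" "i < m" "j < n" by auto
    have "i * n + j < Suc i * n" using a by simp
    also have "\<dots> \<le> m * n" using a by (intro mult_right_mono) auto
    finally show "(case a of (i, j) \<Rightarrow> i * n + j) \<in> {0..<m * n}" using a by simp
  qed (auto simp: less_mult_imp_div_mod)
  finally show ?thesis ..
qed

lemma dim_tensor_mat [simp]:
  "dim_row (tensor_mat A B) = dim_row A * dim_row B"
  "dim_col (tensor_mat A B) = dim_col A * dim_col B"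
  by (simp_all add: tensor_mat_def)

lemma index_tensor_mat:
  assumes "i < dim_row A * dim_row B" "j < dim_col A * dim_col B"
  shows "tensor_mat A B $$ (i, j) =
    A $$ (i div dim_row B, j div dim_col B) * B $$ (i mod dim_row B, j mod dim_col B)"
  using assms by (simp add: tensor_mat_def)

lemma tensor_mat_carrier:
  assumes "A \<in> carrier_mat a b" "B \<in> carrier_mat c d"
  shows "tensor_mat A B \<in> carrier_mat (a * c) (b * d)"
  using assms by auto

lemma dim_tensor_vec [simp]: "dim_vec (tensor_vec v w) = dim_vec v * dim_vec w"
  by (simp add: tensor_vec_def)

lemma index_tensor_vec:
  assumes "i < dim_vec v * dim_vec w"
  shows "tensor_vec v w $ i = v $ (i div dim_vec w) * w $ (i mod dim_vec w)"
  using assms by (simp add: tensor_vec_def)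

lemma tensor_vec_carrier:
  assumes "v \<in> carrier_vec m" "w \<in> carrier_vec n"
  shows "tensor_vec v w \<in> carrier_vec (m * n)"
  using assms by (auto intro: carrier_vecI)

lemma tensor_mat_mult:
  assumes "dim_col A = dim_row C" "dim_col B = dim_row D"
  shows "tensor_mat (A * C) (B * D) = tensor_mat A B * tensor_mat C D"
proof (rule eq_matI)
  fix i j assume "i < dim_row (tensor_mat A B * tensor_mat C D)" "j < dim_col (tensor_mat A B * tensor_mat C D)"
  then have i: "i < dim_row A * dim_row B" and j: "j < dim_col C * dim_col D" by auto
  note ij = less_mult_imp_div_mod[OF i] less_mult_imp_div_mod[OF j]
  have "(tensor_mat A B * tensor_mat C D) $$ (i, j) =
      (\<Sum>k = 0..<dim_row C * dim_row D. tensor_mat A B $$ (i, k) * tensor_mat C D $$ (k, j))"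
    using i j assms by (simp add: scalar_prod_def)
  \<comment> \<open>The summand is put in the form \<open>f (k div n) (k mod n)\<close> to which
    \<open>sum_div_mod\<close> applies; the double sum then factors.\<close>
  also have "\<dots> = (\<Sum>k = 0..<dim_row C * dim_row D.
      (\<lambda>a b. A $$ (i div dim_row B, a) * C $$ (a, j div dim_col D) *
        (B $$ (i mod dim_row B, b) * D $$ (b, j mod dim_col D))) (k div dim_row D) (k mod dim_row D))"
    using i j assms by (intro sum.cong) (auto simp: index_tensor_mat ac_simps)
  also have "\<dots> = (\<Sum>a = 0..<dim_row C. A $$ (i div dim_row B, a) * C $$ (a, j div dim_col D)) *
      (\<Sum>b = 0..<dim_row D. B $$ (i mod dim_row B, b) * D $$ (b, j mod dim_col D))"
    by (subst sum_div_mod) (simp add: sum_product)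
  also have "\<dots> = tensor_mat (A * C) (B * D) $$ (i, j)"
    using i j ij assms by (simp add: index_tensor_mat scalar_prod_def)
  finally show "tensor_mat (A * C) (B * D) $$ (i, j) = (tensor_mat A B * tensor_mat C D) $$ (i, j)" ..
qed auto

lemma tensor_mat_vec_mult:
  assumes "dim_col A = dim_vec v" "dim_col B = dim_vec w"
  shows "tensor_mat A B *\<^sub>v tensor_vec v w = tensor_vec (A *\<^sub>v v) (B *\<^sub>v w)"
proof (rule eq_vecI)
  fix i assume "i < dim_vec (tensor_vec (A *\<^sub>v v) (B *\<^sub>v w))"
  then have i: "i < dim_row A * dim_row B" by auto
  note ij = less_mult_imp_div_mod[OF i]
  have "(tensor_mat A B *\<^sub>v tensor_vec v w) $ i =
      (\<Sum>k = 0..<dim_vec v * dim_vec w. tensor_mat A B $$ (i, k) * tensor_vec v w $ k)"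
    using i assms by (simp add: scalar_prod_def)
  also have "\<dots> = (\<Sum>k = 0..<dim_vec v * dim_vec w.
      (\<lambda>a b. A $$ (i div dim_row B, a) * v $ a *
        (B $$ (i mod dim_row B, b) * w $ b)) (k div dim_vec w) (k mod dim_vec w))"
    using i assms by (intro sum.cong) (auto simp: index_tensor_mat index_tensor_vec ac_simps)
  also have "\<dots> = (\<Sum>a = 0..<dim_vec v. A $$ (i div dim_row B, a) * v $ a) *
      (\<Sum>b = 0..<dim_vec w. B $$ (i mod dim_row B, b) * w $ b)"
    by (subst sum_div_mod) (simp add: sum_product)
  also have "\<dots> = tensor_vec (A *\<^sub>v v) (B *\<^sub>v w) $ i"
    using i ij assms by (simp add: index_tensor_vec scalar_prod_def)
  finally show "(tensor_mat A B *\<^sub>v tensor_vec v w) $ i = tensor_vec (A *\<^sub>v v) (B *\<^sub>v w) $ i" .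
qed auto

text \<open>Digits in a mixed radix: they do not depend on whether the first two or the last two of
  three digits are grouped. This is why the Kronecker product is strictly associative.\<close>

lemma div_mod_mult: "(i mod (m * n)) div n = (i div n) mod m" "(i mod (m * n)) mod n = i mod n"
  for i m n :: nat
  by (cases "n = 0"; simp add: mult.commute[of m n] mod_mult2_eq)+

lemma tensor_mat_assoc:
  "tensor_mat (tensor_mat A B) C = tensor_mat A (tensor_mat B C)"
proof (rule eq_matI)
  fix i j assume "i < dim_row (tensor_mat A (tensor_mat B C))" "j < dim_col (tensor_mat A (tensor_mat B C))"
  then have i: "i < dim_row A * dim_row B * dim_row C" and j: "j < dim_col A * dim_col B * dim_col C"
    by (auto simp: mult.assoc)
  have i': "i < dim_row A * (dim_row B * dim_row C)" and j': "j < dim_col A * (dim_col B * dim_col C)"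
    using i j by (simp_all add: mult.assoc)
  note ij = less_mult_imp_div_mod[OF i] less_mult_imp_div_mod[OF j]
    less_mult_imp_div_mod[OF i'] less_mult_imp_div_mod[OF j']
  show "tensor_mat (tensor_mat A B) C $$ (i, j) = tensor_mat A (tensor_mat B C) $$ (i, j)"
    using i j i' j' ij
    by (simp add: index_tensor_mat div_mod_mult mult.assoc flip: div_mult2_eq)
       (simp add: mult.commute)
qed (auto simp: mult.assoc)

lemma tensor_vec_assoc:
  "tensor_vec (tensor_vec u v) w = tensor_vec u (tensor_vec v w)"
proof (rule eq_vecI)
  fix i assume "i < dim_vec (tensor_vec u (tensor_vec v w))"
  then have i: "i < dim_vec u * dim_vec v * dim_vec w" by (auto simp: mult.assoc)
  have i': "i < dim_vec u * (dim_vec v * dim_vec w)"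
    using i by (simp_all add: mult.assoc)
  note ij = less_mult_imp_div_mod[OF i] less_mult_imp_div_mod[OF i'] 
  show "tensor_vec (tensor_vec u v) w $ i = tensor_vec u (tensor_vec v w) $ i"
    using i i' ij
    by (simp add: index_tensor_vec div_mod_mult mult.assoc flip: div_mult2_eq)
       (simp add: mult.commute)
qed (auto simp: mult.assoc)

lemma tensor_mat_one [simp]: "tensor_mat (1\<^sub>m m) (1\<^sub>m n) = 1\<^sub>m (m * n)"
proof (rule eq_matI)
  fix i j assume "i < dim_row (1\<^sub>m (m * n) :: 'a mat)" "j < dim_col (1\<^sub>m (m * n) :: 'a mat)"
  then have i: "i < m * n" and j: "j < m * n" by auto
  have "i div n = j div n \<and> i mod n = j mod n \<longleftrightarrow> i = j"
    by (metis mult_div_mod_eq)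
  then show "tensor_mat (1\<^sub>m m) (1\<^sub>m n) $$ (i, j) = (1\<^sub>m (m * n) :: 'a mat) $$ (i, j)"
    using i j less_mult_imp_div_mod[OF i] less_mult_imp_div_mod[OF j]
    by (auto simp: index_tensor_mat)
qed auto

lemma tensor_mat_unit_left [simp]: "tensor_mat (1\<^sub>m 1) A = A"
  by (rule eq_matI) (auto simp: index_tensor_mat)

lemma tensor_mat_unit_right [simp]: "tensor_mat A (1\<^sub>m 1) = A"
  by (rule eq_matI) (auto simp: index_tensor_mat)

lemma tensor_vec_add_left:
  "dim_vec u = dim_vec v \<Longrightarrow> tensor_vec (u + v) w = tensor_vec u w + tensor_vec v w"
  by (rule eq_vecI) (auto simp: index_tensor_vec less_mult_imp_div_mod algebra_simps)

lemma tensor_vec_add_right: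
  "dim_vec v = dim_vec w \<Longrightarrow> tensor_vec u (v + w) = tensor_vec u v + tensor_vec u w"
  by (rule eq_vecI) (auto simp: index_tensor_vec less_mult_imp_div_mod algebra_simps)

lemma tensor_vec_smult_left [simp]: "tensor_vec (a \<cdot>\<^sub>v v) w = a \<cdot>\<^sub>v tensor_vec v w"
  by (rule eq_vecI) (auto simp: index_tensor_vec less_mult_imp_div_mod)

lemma tensor_vec_smult_right [simp]: "tensor_vec v (a \<cdot>\<^sub>v w) = a \<cdot>\<^sub>v tensor_vec v w"
  by (rule eq_vecI) (auto simp: index_tensor_vec less_mult_imp_div_mod)

lemma tensor_vec_zero_left [simp]: "tensor_vec (0\<^sub>v n) w = 0\<^sub>v (n * dim_vec w)"
  by (rule eq_vecI) (auto simp: index_tensor_vec less_mult_imp_div_mod)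

lemma tensor_vec_zero_right [simp]: "tensor_vec w (0\<^sub>v n) = 0\<^sub>v (dim_vec w * n)"
  by (rule eq_vecI) (auto simp: index_tensor_vec less_mult_imp_div_mod)

lemma mult_mat_vec_smult [simp]:
  fixes A :: "'a::field mat"
  assumes "dim_col A = dim_vec v"
  shows "A *\<^sub>v (a \<cdot>\<^sub>v v) = a \<cdot>\<^sub>v (A *\<^sub>v v)"
  by (rule mult_mat_vec[of A "dim_row A" "dim_col A"]) (use assms in \<open>auto intro: carrier_vecI\<close>)

text \<open>With hypotheses on dimensions only, this simp rule turns products of matrices into
  successive applications to a vector. Most identities of morphisms below are checked in this
  way.\<close>

lemma mult_mat_vec_assoc [simp]:
  fixes A :: "'a::field mat"
  assumes "dim_col A = dim_row B" "dim_col B = dim_vec v"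
  shows "A * B *\<^sub>v v = A *\<^sub>v (B *\<^sub>v v)"
  by (rule assoc_mult_mat_vec[of A "dim_row A" "dim_row B" B "dim_vec v"])
     (use assms in \<open>auto intro: carrier_vecI\<close>)

lemma mult_mat_vec_add:
  fixes A :: "'a::field mat"
  assumes "dim_col A = dim_vec v" "dim_vec v = dim_vec w"
  shows "A *\<^sub>v (v + w) = A *\<^sub>v v + A *\<^sub>v w"
  by (rule mult_add_distrib_mat_vec[of A "dim_row A" "dim_col A"])
     (use assms in \<open>auto intro: carrier_vecI\<close>)

lemma mult_mat_vec_zero [simp]:
  fixes A :: "'a::field mat"
  shows "dim_col A = n \<Longrightarrow> A *\<^sub>v 0\<^sub>v n = 0\<^sub>v (dim_row A)"
  by (rule eq_vecI) auto

lemma one_mult_mat_vec_dim [simp]: "dim_vec v = n \<Longrightarrow> 1\<^sub>m n *\<^sub>v (v :: 'a::field vec) = v"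
  by (metis carrier_vecI one_mult_mat_vec)

lemma smult_smult_vec [simp]: "a \<cdot>\<^sub>v (b \<cdot>\<^sub>v (v :: 'a::field vec)) = (a * b) \<cdot>\<^sub>v v"
  by (rule eq_vecI) (auto simp: mult.assoc)

lemma smult_mat_vec [simp]:
  fixes A :: "'a::field mat"
  shows "dim_col A = dim_vec v \<Longrightarrow> (a \<cdot>\<^sub>m A) *\<^sub>v v = a \<cdot>\<^sub>v (A *\<^sub>v v)"
  by (rule eq_vecI) (auto simp: scalar_prod_def sum_distrib_left mult.assoc)

lemma mat_eq_if_unit_vec:
  fixes A B :: "'a::field mat"
  assumes "A \<in> carrier_mat m n" "B \<in> carrier_mat m n"
    and "\<And>i. i < n \<Longrightarrow> A *\<^sub>v unit_vec n i = B *\<^sub>v unit_vec n i"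
  shows "A = B"
proof (rule eq_matI)
  fix i j assume "i < dim_row B" "j < dim_col B"
  then have ij: "i < m" "j < n" using assms by auto
  have "(A *\<^sub>v unit_vec n j) $ i = (B *\<^sub>v unit_vec n j) $ i" using assms ij by simp
  then show "A $$ (i, j) = B $$ (i, j)"
    using ij assms(1,2) by (simp add: scalar_prod_right_unit)
qed (use assms in auto)

lemma unit_vec_tensor:
  assumes "k < m * n"
  shows "(unit_vec (m * n) k :: 'a::field vec) = tensor_vec (unit_vec m (k div n)) (unit_vec n (k mod n))"
proof (rule eq_vecI)
  fix i assume "i < dim_vec (tensor_vec (unit_vec m (k div n)) (unit_vec n (k mod n)) :: 'a vec)"
  then have i: "i < m * n" by simp
  have "i div n = k div n \<and> i mod n = k mod n \<longleftrightarrow> i = k"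
    by (metis mult_div_mod_eq)
  then show "(unit_vec (m * n) k :: 'a vec) $ i = tensor_vec (unit_vec m (k div n)) (unit_vec n (k mod n)) $ i"
    using i assms less_mult_imp_div_mod[OF i] less_mult_imp_div_mod[OF assms]
    by (auto simp: index_tensor_vec unit_vec_def)
qed simp

text \<open>Each basis vector of the product space is a pure tensor by
  \<open>unit_vec_tensor\<close>, so linear maps may be compared on pure tensors.\<close>

lemma mat_eq_if_tensor_vec:
  fixes A B :: "'a::field mat"
  assumes "A \<in> carrier_mat r (m * n)" "B \<in> carrier_mat r (m * n)"
    and "\<And>v w. v \<in> carrier_vec m \<Longrightarrow> w \<in> carrier_vec n \<Longrightarrow>
      A *\<^sub>v tensor_vec v w = B *\<^sub>v tensor_vec v w"
  shows "A = B"
  by (rule mat_eq_if_unit_vec[OF assms(1,2)]) (simp add: unit_vec_tensor assms(3))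

text \<open>The types of vectors and matrices have no zero element, as the dimension is not part of the
  type. Hence finite sums take the dimensions as arguments.\<close>

definition vec_sum :: "nat \<Rightarrow> 'i set \<Rightarrow> ('i \<Rightarrow> 'a::comm_monoid_add vec) \<Rightarrow> 'a vec" where
  "vec_sum n S f = vec n (\<lambda>i. \<Sum>x\<in>S. f x $ i)"

definition mat_sum :: "nat \<Rightarrow> nat \<Rightarrow> 'i set \<Rightarrow> ('i \<Rightarrow> 'a::comm_monoid_add mat) \<Rightarrow> 'a mat" where
  "mat_sum m n S F = mat m n (\<lambda>ij. \<Sum>x\<in>S. F x $$ ij)"

lemma dim_vec_sum [simp]: "dim_vec (vec_sum n S f) = n"
  by (simp add: vec_sum_def)

lemma dim_mat_sum [simp]:
  "dim_row (mat_sum m n S F) = m" "dim_col (mat_sum m n S F) = n"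
  by (simp_all add: mat_sum_def)

lemma vec_sum_carrier [simp]: "vec_sum n S f \<in> carrier_vec n"
  by (auto intro: carrier_vecI)

lemma mat_sum_carrier [simp]: "mat_sum m n S F \<in> carrier_mat m n"
  by auto

lemma vec_sum_cong:
  "S = S' \<Longrightarrow> (\<And>x. x \<in> S' \<Longrightarrow> f x = g x) \<Longrightarrow> vec_sum n S f = vec_sum n S' g"
  by (simp add: vec_sum_def)

lemma mat_sum_cong:
  "S = S' \<Longrightarrow> (\<And>x. x \<in> S' \<Longrightarrow> F x = G x) \<Longrightarrow> mat_sum m n S F = mat_sum m n S' G"
  by (simp add: mat_sum_def)

lemma vec_sum_empty [simp]: "vec_sum n {} f = 0\<^sub>v n"
  by (rule eq_vecI) (auto simp: vec_sum_def)

lemma vec_sum_insert: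
  assumes "finite S" "x \<notin> S" "f x \<in> carrier_vec n"
  shows "vec_sum n (insert x S) f = f x + vec_sum n S f"
  using assms by (intro eq_vecI) (auto simp: vec_sum_def)

lemma vec_sum_delta:
  assumes "finite S" "v \<in> carrier_vec n" "y \<in> S"
  shows "vec_sum n S (\<lambda>x. if x = y then v else 0\<^sub>v n) = v"
proof (rule eq_vecI)
  fix i assume "i < dim_vec v"
  then have "i < n" using assms by simp
  then have "(\<Sum>x\<in>S. (if x = y then v else 0\<^sub>v n) $ i) = (\<Sum>x\<in>S. if x = y then v $ i else 0)"
    by (intro sum.cong) auto
  then show "vec_sum n S (\<lambda>x. if x = y then v else 0\<^sub>v n) $ i = v $ i"
    using \<open>i < n\<close> assms by (simp add: vec_sum_def)
qed (use assms in auto)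

lemma mult_mat_vec_sum:
  fixes A :: "'a::field mat"
  assumes "A \<in> carrier_mat m n" "\<And>x. x \<in> S \<Longrightarrow> f x \<in> carrier_vec n"
  shows "A *\<^sub>v vec_sum n S f = vec_sum m S (\<lambda>x. A *\<^sub>v f x)"
proof (rule eq_vecI)
  fix i assume "i < dim_vec (vec_sum m S (\<lambda>x. A *\<^sub>v f x))"
  then have i: "i < m" by simp
  have f: "dim_vec (f x) = n" if "x \<in> S" for x using assms(2)[OF that] by simp
  have "(A *\<^sub>v vec_sum n S f) $ i = (\<Sum>k = 0..<n. A $$ (i, k) * (\<Sum>x\<in>S. f x $ k))"
    using assms(1) i by (simp add: scalar_prod_def vec_sum_def)
  also have "\<dots> = (\<Sum>x\<in>S. \<Sum>k = 0..<n. A $$ (i, k) * f x $ k)"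
    by (simp add: sum_distrib_left sum.swap[of _ S])
  also have "\<dots> = vec_sum m S (\<lambda>x. A *\<^sub>v f x) $ i"
    using assms(1) i f by (simp add: vec_sum_def scalar_prod_def)
  finally show "(A *\<^sub>v vec_sum n S f) $ i = vec_sum m S (\<lambda>x. A *\<^sub>v f x) $ i" .
qed (use assms in auto)

lemma mat_sum_mult_vec:
  fixes v :: "'a::field vec"
  assumes "\<And>x. x \<in> S \<Longrightarrow> F x \<in> carrier_mat m n" "v \<in> carrier_vec n"
  shows "mat_sum m n S F *\<^sub>v v = vec_sum m S (\<lambda>x. F x *\<^sub>v v)"
proof (rule eq_vecI)
  fix i assume "i < dim_vec (vec_sum m S (\<lambda>x. F x *\<^sub>v v))"
  then have i: "i < m" by simp
  have "(mat_sum m n S F *\<^sub>v v) $ i = (\<Sum>k = 0..<n. (\<Sum>x\<in>S. F x $$ (i, k)) * v $ k)"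
    using assms(2) i by (simp add: scalar_prod_def mat_sum_def)
  also have "\<dots> = (\<Sum>x\<in>S. \<Sum>k = 0..<n. F x $$ (i, k) * v $ k)"
    by (simp add: sum_distrib_right sum.swap[of _ S])
  also have "\<dots> = vec_sum m S (\<lambda>x. F x *\<^sub>v v) $ i"
    using assms i by (simp add: vec_sum_def scalar_prod_def carrier_matD[OF assms(1)])
  finally show "(mat_sum m n S F *\<^sub>v v) $ i = vec_sum m S (\<lambda>x. F x *\<^sub>v v) $ i" .
qed auto

lemma tensor_vec_sum_left:
  assumes "v \<in> carrier_vec n" "\<And>x. x \<in> S \<Longrightarrow> f x \<in> carrier_vec m"
  shows "tensor_vec (vec_sum m S f) v = vec_sum (m * n) S (\<lambda>x. tensor_vec (f x) v)"
proof -
  have "dim_vec (f x) = m" if "x \<in> S" for x using assms(2)[OF that] by simp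
  then show ?thesis using assms(1) by (intro eq_vecI)
    (auto simp: vec_sum_def index_tensor_vec less_mult_imp_div_mod sum_distrib_right intro!: sum.cong)
qed

lemma tensor_vec_sum_right:
  assumes "v \<in> carrier_vec m" "\<And>x. x \<in> S \<Longrightarrow> f x \<in> carrier_vec n"
  shows "tensor_vec v (vec_sum n S f) = vec_sum (m * n) S (\<lambda>x. tensor_vec v (f x))"
proof -
  have "dim_vec (f x) = n" if "x \<in> S" for x using assms(2)[OF that] by simp
  then show ?thesis using assms(1) by (intro eq_vecI)
    (auto simp: vec_sum_def index_tensor_vec less_mult_imp_div_mod sum_distrib_left intro!: sum.cong)
qed

lemma mult_mat_sum:
  fixes A :: "'a::field mat"
  assumes A: "A \<in> carrier_mat l m" and F: "\<And>x. x \<in> S \<Longrightarrow> F x \<in> carrier_mat m n"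
  shows "A * mat_sum m n S F = mat_sum l n S (\<lambda>x. A * F x)"
proof (rule mat_eq_if_unit_vec)
  fix i assume "i < n"
  have "A * mat_sum m n S F *\<^sub>v unit_vec n i = A *\<^sub>v vec_sum m S (\<lambda>x. F x *\<^sub>v unit_vec n i)"
    using A F by (subst mult_mat_vec_assoc) (auto simp: mat_sum_mult_vec)
  also have "\<dots> = vec_sum l S (\<lambda>x. A *\<^sub>v (F x *\<^sub>v unit_vec n i))"
    using A by (intro mult_mat_vec_sum) (auto intro!: carrier_vecI simp: carrier_matD[OF F])
  also have "\<dots> = vec_sum l S (\<lambda>x. A * F x *\<^sub>v unit_vec n i)"
    using A by (intro vec_sum_cong) (auto simp: carrier_matD[OF F])
  also have "\<dots> = mat_sum l n S (\<lambda>x. A * F x) *\<^sub>v unit_vec n i"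
    using A by (intro mat_sum_mult_vec[symmetric]) (auto intro!: carrier_matI simp: carrier_matD[OF F])
  finally show "A * mat_sum m n S F *\<^sub>v unit_vec n i = mat_sum l n S (\<lambda>x. A * F x) *\<^sub>v unit_vec n i" .
qed (use A in auto)

lemma mat_sum_mult:
  fixes A :: "'a::field mat"
  assumes A: "A \<in> carrier_mat m n" and F: "\<And>x. x \<in> S \<Longrightarrow> F x \<in> carrier_mat l m"
  shows "mat_sum l m S F * A = mat_sum l n S (\<lambda>x. F x * A)"
proof (rule mat_eq_if_unit_vec)
  fix i assume "i < n"
  have "mat_sum l m S F * A *\<^sub>v unit_vec n i = vec_sum l S (\<lambda>x. F x *\<^sub>v (A *\<^sub>v unit_vec n i))"
    using A F by (subst mult_mat_vec_assoc) (auto simp: mat_sum_mult_vec)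
  also have "\<dots> = vec_sum l S (\<lambda>x. F x * A *\<^sub>v unit_vec n i)"
    using A by (intro vec_sum_cong) (auto simp: carrier_matD[OF F])
  also have "\<dots> = mat_sum l n S (\<lambda>x. F x * A) *\<^sub>v unit_vec n i"
    using A by (intro mat_sum_mult_vec[symmetric]) (auto intro!: carrier_matI simp: carrier_matD[OF F])
  finally show "mat_sum l m S F * A *\<^sub>v unit_vec n i = mat_sum l n S (\<lambda>x. F x * A) *\<^sub>v unit_vec n i" .
qed (use A in auto)

section \<open>Graded spaces and homogeneous projections\<close>

lemma vec_subspaceD:
  assumes "vec_subspace n S"
  shows "S \<subseteq> carrier_vec n" "0\<^sub>v n \<in> S" "u \<in> S \<Longrightarrow> v \<in> S \<Longrightarrow> u + v \<in> S" "v \<in> S \<Longrightarrow> a \<cdot>\<^sub>v v \<in> S"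
  using assms by (auto simp: vec_subspace_def)

lemma vec_subspace_sum:
  assumes "vec_subspace n S" "finite J" "\<And>x. x \<in> J \<Longrightarrow> f x \<in> S"
  shows "vec_sum n J f \<in> S"
  using assms(2,3)
proof (induction J rule: finite_induct)
  case (insert x J)
  then have "vec_sum n (insert x J) f = f x + vec_sum n J f"
    using vec_subspaceD(1)[OF assms(1)] by (intro vec_sum_insert) auto
  then show ?case using insert vec_subspaceD(3)[OF assms(1)] by simp
qed (simp add: vec_subspaceD(2)[OF assms(1)])

lemma vec_subspace_carrier [simp]: "vec_subspace n (carrier_vec n)"
  by (simp add: vec_subspace_def)

lemma vec_span_superset: "S \<subseteq> vec_span n S"
  by (auto simp: vec_span_def)

lemma vec_span_least: "vec_subspace n T \<Longrightarrow> S \<subseteq> T \<Longrightarrow> vec_span n S \<subseteq> T"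
  by (auto simp: vec_span_def)

lemma vec_subspace_span:
  assumes "S \<subseteq> carrier_vec n"
  shows "vec_subspace n (vec_span n S)"
proof -
  have "vec_span n S \<subseteq> carrier_vec n"
    using assms by (intro vec_span_least) auto
  then show ?thesis by (auto simp: vec_subspace_def vec_span_def)
qed

lemma mult_mat_vec_eq_sum_cols:
  fixes A :: "'a::field mat"
  assumes "A \<in> carrier_mat m n" "v \<in> carrier_vec n"
  shows "A *\<^sub>v v = vec_sum m {0..<n} (\<lambda>j. v $ j \<cdot>\<^sub>v col A j)"
  using assms by (intro eq_vecI) (auto simp: vec_sum_def scalar_prod_def ac_simps intro!: sum.cong)

lemma vec_eq_sum_unit_vec:
  fixes v :: "'a::field vec"
  assumes "v \<in> carrier_vec n"
  shows "vec_sum n {0..<n} (\<lambda>j. v $ j \<cdot>\<^sub>v unit_vec n j) = v"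
proof -
  have "vec_sum n {0..<n} (\<lambda>j. v $ j \<cdot>\<^sub>v unit_vec n j) = 1\<^sub>m n *\<^sub>v v"
    using assms by (subst mult_mat_vec_eq_sum_cols) (auto intro!: vec_sum_cong)
  then show ?thesis using assms by simp
qed

lemma graded_space_subspace: "graded_space V \<Longrightarrow> vec_subspace (gdim V) (gcomp V x)"
  by (simp add: graded_space_def)

lemma gcomp_carrier: "graded_space V \<Longrightarrow> v \<in> gcomp V x \<Longrightarrow> v \<in> carrier_vec (gdim V)"
  using vec_subspaceD(1)[OF graded_space_subspace] by blast

lemma gcomp_dim: "graded_space V \<Longrightarrow> v \<in> gcomp V x \<Longrightarrow> dim_vec v = gdim V"
  using gcomp_carrier by fastforce

lemma gcomp_zero [simp]: "graded_space V \<Longrightarrow> 0\<^sub>v (gdim V) \<in> gcomp V x"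
  by (rule vec_subspaceD(2)[OF graded_space_subspace])

lemma gcomp_add: "graded_space V \<Longrightarrow> u \<in> gcomp V x \<Longrightarrow> v \<in> gcomp V x \<Longrightarrow> u + v \<in> gcomp V x"
  by (rule vec_subspaceD(3)[OF graded_space_subspace])

lemma gcomp_smult: "graded_space V \<Longrightarrow> v \<in> gcomp V x \<Longrightarrow> a \<cdot>\<^sub>v v \<in> gcomp V x"
  by (rule vec_subspaceD(4)[OF graded_space_subspace])

lemma gcomp_sum:
  "graded_space V \<Longrightarrow> finite J \<Longrightarrow> (\<And>j. j \<in> J \<Longrightarrow> f j \<in> gcomp V x) \<Longrightarrow> vec_sum (gdim V) J f \<in> gcomp V x"
  by (rule vec_subspace_sum[OF graded_space_subspace])

definition homogeneous_part :: "('g::{ab_group_add,finite}, 'k::field) graded_space \<Rightarrow> 'k vec \<Rightarrow> 'g \<Rightarrow> 'k vec" where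
  "homogeneous_part V v = (THE c. (\<forall>x. c x \<in> gcomp V x) \<and>
     (\<forall>i<gdim V. v $ i = (\<Sum>x\<in>UNIV. c x $ i)))"

definition gproj :: "('g::{ab_group_add,finite}, 'k::field) graded_space \<Rightarrow> 'g \<Rightarrow> 'k mat" where
  "gproj V x = mat (gdim V) (gdim V) (\<lambda>(i, j). homogeneous_part V (unit_vec (gdim V) j) x $ i)"

lemma gproj_carrier [simp]: "gproj V x \<in> carrier_mat (gdim V) (gdim V)"
  by (simp add: gproj_def)

lemma dim_gproj [simp]: "dim_row (gproj V x) = gdim V" "dim_col (gproj V x) = gdim V"
  by (simp_all add: gproj_def)

lemma homogeneous_part:
  assumes "graded_space V" "v \<in> carrier_vec (gdim V)"
  shows "homogeneous_part V v x \<in> gcomp V x"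
    "vec_sum (gdim V) UNIV (homogeneous_part V v) = v"
proof -
  let ?P = "\<lambda>c. (\<forall>x. c x \<in> gcomp V x) \<and> (\<forall>i<gdim V. v $ i = (\<Sum>x\<in>UNIV. c x $ i))"
  have "\<exists>!c. ?P c" using assms by (simp add: graded_space_def)
  then have *: "?P (homogeneous_part V v)"
    unfolding homogeneous_part_def by (rule theI')
  then show "homogeneous_part V v x \<in> gcomp V x" by simp
  show "vec_sum (gdim V) UNIV (homogeneous_part V v) = v"
    using * assms by (intro eq_vecI) (auto simp: vec_sum_def)
qed

lemma homogeneous_part_unique:
  assumes "graded_space V" "\<And>x. c x \<in> gcomp V x" "vec_sum (gdim V) UNIV c = v"
  shows "homogeneous_part V v = c"
proof -
  have v: "v \<in> carrier_vec (gdim V)" using assms(3) by auto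
  then have *: "\<exists>!c. (\<forall>x. c x \<in> gcomp V x) \<and> (\<forall>i<gdim V. v $ i = (\<Sum>x\<in>UNIV. c x $ i))"
    using assms(1) by (simp add: graded_space_def)
  show ?thesis unfolding homogeneous_part_def
    by (rule the1_equality[OF *]) (use assms in \<open>auto simp: vec_sum_def\<close>)
qed

text \<open>Taking homogeneous parts is linear: the combination of the parts of the basis vectors
  with the coordinates of \<open>v\<close> is a homogeneous decomposition of \<open>v\<close>, and
  decompositions are unique.\<close>

lemma gproj_mult_vec:
  assumes V: "graded_space V" and v: "v \<in> carrier_vec (gdim V)"
  shows "gproj V x *\<^sub>v v = homogeneous_part V v x"
proof -
  let ?n = "gdim V"
  define h where "h = (\<lambda>j. homogeneous_part V (unit_vec ?n j))"
  define c where "c = (\<lambda>x. vec_sum ?n {0..<?n} (\<lambda>j. v $ j \<cdot>\<^sub>v h j x))"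
  have h: "h j x \<in> gcomp V x" for j x
    using homogeneous_part(1)[OF V] by (simp add: h_def)
  have dh: "dim_vec (h j x) = ?n" for j x using gcomp_dim[OF V h] .
  have hsum: "(\<Sum>x\<in>UNIV. h j x $ i) = unit_vec ?n j $ i" if "i < ?n" for i j
    using homogeneous_part(2)[OF V unit_vec_carrier[of ?n j]] that
    unfolding h_def vec_sum_def by (metis (lifting) index_vec)
  have "homogeneous_part V v = c"
  proof (rule homogeneous_part_unique[OF V])
    show "c x \<in> gcomp V x" for x
      unfolding c_def by (rule gcomp_sum[OF V]) (auto intro: gcomp_smult[OF V] h)
    show "vec_sum ?n UNIV c = v"
    proof (rule eq_vecI)
      fix i assume "i < dim_vec v"
      then have i: "i < ?n" using v by simp
      have "vec_sum ?n UNIV c $ i = (\<Sum>x\<in>UNIV. \<Sum>j = 0..<?n. v $ j * h j x $ i)"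
        using i by (simp add: vec_sum_def c_def dh)
      also have "\<dots> = (\<Sum>j = 0..<?n. v $ j * (\<Sum>x\<in>UNIV. h j x $ i))"
        by (subst sum.swap) (simp add: sum_distrib_left)
      also have "\<dots> = vec_sum ?n {0..<?n} (\<lambda>j. v $ j \<cdot>\<^sub>v unit_vec ?n j) $ i"
        using i by (simp add: hsum vec_sum_def)
      also have "\<dots> = v $ i" using v by (simp add: vec_eq_sum_unit_vec)
      finally show "vec_sum ?n UNIV c $ i = v $ i" .
    qed (use v in auto)
  qed
  moreover have "gproj V x *\<^sub>v v = c x"
  proof -
    have "col (gproj V x) j = h j x" if "j < ?n" for j
      using that dh by (intro eq_vecI) (auto simp: gproj_def h_def)
    then show ?thesis
      using v by (subst mult_mat_vec_eq_sum_cols[OF gproj_carrier]) (auto simp: c_def intro!: vec_sum_cong)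
  qed
  ultimately show ?thesis by simp
qed

lemma gproj_mem:
  "graded_space V \<Longrightarrow> v \<in> carrier_vec (gdim V) \<Longrightarrow> gproj V x *\<^sub>v v \<in> gcomp V x"
  by (simp add: gproj_mult_vec homogeneous_part)

lemma gproj_sum:
  assumes "graded_space V" "v \<in> carrier_vec (gdim V)"
  shows "vec_sum (gdim V) UNIV (\<lambda>x. gproj V x *\<^sub>v v) = v"
  using homogeneous_part(2)[OF assms] assms by (simp add: gproj_mult_vec)

lemma gproj_homogeneous:
  assumes "graded_space V" "v \<in> gcomp V y"
  shows "gproj V x *\<^sub>v v = (if x = y then v else 0\<^sub>v (gdim V))"
proof -
  have v: "v \<in> carrier_vec (gdim V)" using gcomp_carrier assms by blast
  have "homogeneous_part V v = (\<lambda>x. if x = y then v else 0\<^sub>v (gdim V))"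
    by (rule homogeneous_part_unique) (use assms v in \<open>auto simp: vec_sum_delta\<close>)
  then show ?thesis using assms v by (simp add: gproj_mult_vec)
qed

text \<open>Candidates for the projections replace the unique existence in the definition:
  \<open>mem\<close> and \<open>sum\<close> provide a decomposition, and by \<open>hom\<close> the
  matrix \<open>P x\<close> extracts the component of degree \<open>x\<close> from any other
  one.\<close>

lemma graded_spaceI:
  fixes V :: "('g::{ab_group_add,finite}, 'k::field) graded_space"
  assumes sub: "\<And>x. vec_subspace (gdim V) (gcomp V x)"
    and P: "\<And>x. P x \<in> carrier_mat (gdim V) (gdim V)"
    and mem: "\<And>x v. v \<in> carrier_vec (gdim V) \<Longrightarrow> P x *\<^sub>v v \<in> gcomp V x"
    and sum: "\<And>v. v \<in> carrier_vec (gdim V) \<Longrightarrow> vec_sum (gdim V) UNIV (\<lambda>x. P x *\<^sub>v v) = v"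
    and hom: "\<And>x y v. v \<in> gcomp V y \<Longrightarrow> P x *\<^sub>v v = (if x = y then v else 0\<^sub>v (gdim V))"
  shows "graded_space V"
  unfolding graded_space_def
proof (intro conjI allI ballI)
  fix v :: "'k vec" assume v: "v \<in> carrier_vec (gdim V)"
  show "\<exists>!c. (\<forall>x. c x \<in> gcomp V x) \<and> (\<forall>i<gdim V. v $ i = (\<Sum>x\<in>UNIV. c x $ i))"
  proof (rule ex1I[of _ "\<lambda>x. P x *\<^sub>v v"])
    have "v $ i = (\<Sum>x\<in>UNIV. (P x *\<^sub>v v) $ i)" if "i < gdim V" for i
      using sum[OF v] that unfolding vec_sum_def by (metis (lifting) index_vec)
    then show "(\<forall>x. P x *\<^sub>v v \<in> gcomp V x) \<and> (\<forall>i<gdim V. v $ i = (\<Sum>x\<in>UNIV. (P x *\<^sub>v v) $ i))"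
      using mem[OF v] by blast
  next
    fix c assume c: "(\<forall>x. c x \<in> gcomp V x) \<and> (\<forall>i<gdim V. v $ i = (\<Sum>x\<in>UNIV. c x $ i))"
    have cc: "c x \<in> carrier_vec (gdim V)" for x
      using c vec_subspaceD(1)[OF sub] by blast
    have vc: "v = vec_sum (gdim V) UNIV c" using c v by (intro eq_vecI) (auto simp: vec_sum_def)
    show "c = (\<lambda>x. P x *\<^sub>v v)"
    proof
      fix x
      have "P x *\<^sub>v v = vec_sum (gdim V) UNIV (\<lambda>y. P x *\<^sub>v c y)"
        unfolding vc by (rule mult_mat_vec_sum[OF P cc])
      also have "\<dots> = vec_sum (gdim V) UNIV (\<lambda>y. if y = x then c x else 0\<^sub>v (gdim V))"
      proof (intro vec_sum_cong refl)
        fix y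
        have "c y \<in> gcomp V y" using c by blast
        from hom[OF this] show "P x *\<^sub>v c y = (if y = x then c x else 0\<^sub>v (gdim V))" by auto
      qed
      also have "\<dots> = c x" using cc by (simp add: vec_sum_delta)
      finally show "c x = P x *\<^sub>v v" ..
    qed
  qed
qed (rule sub)

lemma graded_induct [consumes 2, case_names add homogeneous]:
  assumes V: "graded_space V" and v: "v \<in> carrier_vec (gdim V)"
    and add: "\<And>u v. u \<in> carrier_vec (gdim V) \<Longrightarrow> v \<in> carrier_vec (gdim V) \<Longrightarrow> Q u \<Longrightarrow> Q v \<Longrightarrow> Q (u + v)"
    and hom: "\<And>x v. v \<in> gcomp V x \<Longrightarrow> Q v"
  shows "Q v"
proof -
  have "Q (vec_sum (gdim V) J (\<lambda>x. gproj V x *\<^sub>v v))" for J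
    using finite[of J]
  proof (induction J rule: finite_induct)
    case empty
    then show ?case using hom[OF gcomp_zero[OF V]] by simp
  next
    case (insert x J)
    have "gproj V x *\<^sub>v v \<in> carrier_vec (gdim V)" by (auto intro: carrier_vecI)
    with insert show ?case
      using hom[OF gproj_mem[OF V v]] by (auto simp: vec_sum_insert intro: add)
  qed
  from this[of UNIV] show ?thesis by (simp add: gproj_sum[OF V v])
qed

lemma graded_ext:
  fixes A B :: "'k::field mat"
  assumes V: "graded_space V"
    and dim: "dim_row A = dim_row B" "dim_col A = gdim V" "dim_col B = gdim V"
    and eq: "\<And>x v. v \<in> gcomp V x \<Longrightarrow> A *\<^sub>v v = B *\<^sub>v v"
  shows "A = B"
proof (rule mat_eq_if_unit_vec[of _ "dim_row B" "gdim V"])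
  fix i
  have "A *\<^sub>v v = B *\<^sub>v v" if "v \<in> carrier_vec (gdim V)" for v
    using V that by (induction v rule: graded_induct) (auto simp: mult_mat_vec_add dim eq)
  then show "A *\<^sub>v unit_vec (gdim V) i = B *\<^sub>v unit_vec (gdim V) i" by simp
qed (use dim in auto)

text \<open>One inclusion suffices: on homogeneous vectors of \<open>V\<close> the projections of
  both gradings act alike, so the projections coincide, and they determine the components.\<close>

lemma graded_space_eqI:
  fixes V W :: "('g::{ab_group_add,finite}, 'k::field) graded_space"
  assumes "graded_space V" "graded_space W" "gdim V = gdim W"
    and sub: "\<And>x v. v \<in> gcomp V x \<Longrightarrow> v \<in> gcomp W x"
  shows "V = W"
proof -
  have "gcomp V x = gcomp W x" for x
  proof
    show "gcomp W x \<subseteq> gcomp V x"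
    proof
      fix v assume v: "v \<in> gcomp W x"
      then have vc: "v \<in> carrier_vec (gdim V)" using assms gcomp_carrier by metis
      have "gproj W x = gproj V x"
      proof (rule graded_ext[OF assms(1)])
        fix y u assume "u \<in> gcomp V y"
        then show "gproj W x *\<^sub>v u = gproj V x *\<^sub>v u"
          using gproj_homogeneous[OF assms(2) sub] gproj_homogeneous[OF assms(1)] assms(3) by simp
      qed (use assms(3) in auto)
      then have "gproj V x *\<^sub>v v = v" using gproj_homogeneous[OF assms(2) v, of x] by simp
      then show "v \<in> gcomp V x" using gproj_mem[OF assms(1) vc, of x] by simp
    qed
  qed (use sub in blast)
  then show ?thesis using assms(3) by (intro graded_space.equality) auto
qed

lemma mem_gcomp_iff:
  assumes "graded_space V"
  shows "v \<in> gcomp V x \<longleftrightarrow> v \<in> carrier_vec (gdim V) \<and> gproj V x *\<^sub>v v = v"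
  using gproj_mem[OF assms, of v x] gproj_homogeneous[OF assms, of v x x] gcomp_carrier[OF assms, of v x]
  by auto

lemma graded_homI:
  assumes "A \<in> carrier_mat (gdim W) (gdim V)" "\<And>x v. v \<in> gcomp V x \<Longrightarrow> A *\<^sub>v v \<in> gcomp W x"
  shows "A \<in> graded_hom V W"
  using assms by (simp add: graded_hom_def)

lemma graded_homD:
  assumes "A \<in> graded_hom V W"
  shows "A \<in> carrier_mat (gdim W) (gdim V)" "dim_row A = gdim W" "dim_col A = gdim V"
    "v \<in> gcomp V x \<Longrightarrow> A *\<^sub>v v \<in> gcomp W x"
  using assms by (auto simp: graded_hom_def)

lemma graded_hom_one [simp]: "graded_space V \<Longrightarrow> 1\<^sub>m (gdim V) \<in> graded_hom V V"
  by (rule graded_homI) (auto simp: gcomp_dim)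

lemma graded_hom_mult:
  assumes "graded_space U" "B \<in> graded_hom U V" "A \<in> graded_hom V W"
  shows "A * B \<in> graded_hom U W"
  by (rule graded_homI) (use assms in \<open>auto simp: graded_homD gcomp_dim\<close>)

lemma graded_hom_smult:
  assumes "graded_space V" "graded_space W" "A \<in> graded_hom V W"
  shows "a \<cdot>\<^sub>m A \<in> graded_hom V W"
  by (rule graded_homI) (use assms in \<open>auto simp: graded_homD gcomp_dim gcomp_smult\<close>)

lemma graded_hom_sum:
  assumes "graded_space V" "graded_space W" "finite S" "\<And>s. s \<in> S \<Longrightarrow> F s \<in> graded_hom V W"
  shows "mat_sum (gdim W) (gdim V) S F \<in> graded_hom V W"
proof (rule graded_homI)
  fix x v assume v: "v \<in> gcomp V x"
  have "mat_sum (gdim W) (gdim V) S F *\<^sub>v v = vec_sum (gdim W) S (\<lambda>s. F s *\<^sub>v v)"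
    by (rule mat_sum_mult_vec) (use assms gcomp_carrier[OF _ v] in \<open>auto intro: graded_homD(1)\<close>)
  also have "\<dots> \<in> gcomp W x"
    by (rule gcomp_sum[OF assms(2,3)]) (rule graded_homD(4)[OF assms(4) v])
  finally show "mat_sum (gdim W) (gdim V) S F *\<^sub>v v \<in> gcomp W x" .
qed simp

text \<open>A matrix that preserves degrees commutes with the homogeneous projections. This relation
  passes to the inverse matrix, where it gives back the preservation of degrees.\<close>

lemma inverse_graded_hom:
  assumes V: "graded_space V" and W: "graded_space W" and A: "A \<in> graded_hom V W"
    and B: "B \<in> carrier_mat (gdim V) (gdim W)" and BA: "B * A = 1\<^sub>m (gdim V)" and AB: "A * B = 1\<^sub>m (gdim W)"
  shows "B \<in> graded_hom W V"
proof (rule graded_homI[OF B])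
  fix x w assume w: "w \<in> gcomp W x"
  note dims = graded_homD(2,3)[OF A] carrier_matD[OF B]
  have dw: "dim_vec w = gdim W" using gcomp_dim[OF W w] .
  have "gproj W x * A = A * gproj V x"
  proof (rule graded_ext[OF V])
    fix y v assume v: "v \<in> gcomp V y"
    show "gproj W x * A *\<^sub>v v = A * gproj V x *\<^sub>v v"
      using v graded_homD(4)[OF A v] by (simp add: dims gcomp_dim[OF V v] gproj_homogeneous V W)
  qed (use dims in auto)
  then have "gproj W x *\<^sub>v (A *\<^sub>v (B *\<^sub>v w)) = A *\<^sub>v (gproj V x *\<^sub>v (B *\<^sub>v w))"
    using dims dw by (metis dim_gproj dim_mult_mat_vec mult_mat_vec_assoc)
  moreover have "A *\<^sub>v (B *\<^sub>v w) = w" "\<And>v. dim_vec v = gdim V \<Longrightarrow> B *\<^sub>v (A *\<^sub>v v) = v"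
    using AB BA dims dw by (metis mult_mat_vec_assoc one_mult_mat_vec_dim)+
  ultimately have "gproj V x *\<^sub>v (B *\<^sub>v w) = B *\<^sub>v (gproj W x *\<^sub>v w)"
    by simp
  then have "gproj V x *\<^sub>v (B *\<^sub>v w) = B *\<^sub>v w"
    by (simp add: gproj_homogeneous[OF W w])
  then show "B *\<^sub>v w \<in> gcomp V x"
    using mem_gcomp_iff[OF V] dims by (auto intro!: carrier_vecI)
qed

definition graded_op :: "('g::{ab_group_add,finite}, 'k::field) graded_space \<Rightarrow> nat \<Rightarrow> ('g \<Rightarrow> 'k mat) \<Rightarrow> 'k mat" where
  "graded_op V m F = mat_sum m (gdim V) UNIV (\<lambda>x. F x * gproj V x)"

lemma graded_op_carrier [simp]: "graded_op V m F \<in> carrier_mat m (gdim V)"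
  by (simp add: graded_op_def)

lemma graded_op_apply:
  assumes V: "graded_space V" and F: "\<And>x. F x \<in> carrier_mat m (gdim V)" and v: "v \<in> gcomp V y"
  shows "graded_op V m F *\<^sub>v v = F y *\<^sub>v v"
proof -
  note vc = gcomp_carrier[OF V v]
  have "graded_op V m F *\<^sub>v v = vec_sum m UNIV (\<lambda>x. F x * gproj V x *\<^sub>v v)"
    unfolding graded_op_def by (rule mat_sum_mult_vec) (use vc in \<open>auto intro: mult_carrier_mat[OF F]\<close>)
  also have "\<dots> = vec_sum m UNIV (\<lambda>x. if x = y then F y *\<^sub>v v else 0\<^sub>v m)"
    using vc by (intro vec_sum_cong) (auto simp: carrier_matD[OF F] gproj_homogeneous[OF V v])
  also have "\<dots> = F y *\<^sub>v v"
    by (rule vec_sum_delta) (auto intro!: carrier_vecI simp: carrier_matD[OF F])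
  finally show ?thesis .
qed

lemma
  assumes V: "graded_space V"
  shows graded_scaling_carrier: "graded_scaling f V \<in> carrier_mat (gdim V) (gdim V)"
    and graded_scaling_apply: "v \<in> gcomp V x \<Longrightarrow> graded_scaling f V *\<^sub>v v = f x \<cdot>\<^sub>v v"
proof -
  let ?P = "\<lambda>A. A \<in> carrier_mat (gdim V) (gdim V) \<and> (\<forall>x. \<forall>v\<in>gcomp V x. A *\<^sub>v v = f x \<cdot>\<^sub>v v)"
  have "\<exists>!A. ?P A"
  proof (rule ex_ex1I)
    have "?P (graded_op V (gdim V) (\<lambda>x. f x \<cdot>\<^sub>m 1\<^sub>m (gdim V)))"
      using V by (auto simp: graded_op_apply gcomp_dim)
    then show "\<exists>A. ?P A" by blast
    show "A = B" if "?P A" "?P B" for A B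
      by (rule graded_ext[OF V]) (use that in auto)
  qed
  then have "?P (graded_scaling f V)" unfolding graded_scaling_def by (rule theI')
  then show "graded_scaling f V \<in> carrier_mat (gdim V) (gdim V)"
    and "v \<in> gcomp V x \<Longrightarrow> graded_scaling f V *\<^sub>v v = f x \<cdot>\<^sub>v v" by auto
qed

lemma dim_graded_scaling [simp]:
  assumes "graded_space V"
  shows "dim_row (graded_scaling f V) = gdim V" "dim_col (graded_scaling f V) = gdim V"
  using graded_scaling_carrier[OF assms, of f] by auto

lemma graded_scaling_hom: "graded_space V \<Longrightarrow> graded_scaling f V \<in> graded_hom V V"
  by (rule graded_homI) (auto simp: graded_scaling_carrier graded_scaling_apply gcomp_smult)

lemma graded_scaling_commute:
  assumes "graded_space V" "graded_space W" "A \<in> graded_hom V W"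
  shows "graded_scaling f W * A = A * graded_scaling f V"
  by (rule graded_ext[OF assms(1)])
    (use assms in \<open>auto simp: graded_homD gcomp_dim graded_scaling_apply\<close>)

lemma graded_scaling_mult:
  assumes V: "graded_space V"
  shows "graded_scaling f V * graded_scaling g V = graded_scaling (\<lambda>x. f x * g x) V"
  by (rule graded_ext[OF V]) (use V in \<open>auto simp: gcomp_dim graded_scaling_apply ac_simps\<close>)

lemma graded_scaling_one:
  assumes V: "graded_space V"
  shows "graded_scaling (\<lambda>x. 1) V = 1\<^sub>m (gdim V)"
  by (rule graded_ext[OF V]) (use V in \<open>auto simp: gcomp_dim graded_scaling_apply\<close>)

section \<open>Tensor products of graded spaces\<close>

lemma gdim_graded_tensor [simp]: "gdim (graded_tensor V W) = gdim V * gdim W"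
  by (simp add: graded_tensor_def)

lemma vec_subspace_graded_tensor:
  assumes "graded_space V" "graded_space W"
  shows "vec_subspace (gdim V * gdim W) (gcomp (graded_tensor V W) z)"
  unfolding graded_tensor_def using assms by (auto intro!: vec_subspace_span tensor_vec_carrier gcomp_carrier)

lemma tensor_vec_mem:
  "v \<in> gcomp V x \<Longrightarrow> w \<in> gcomp W y \<Longrightarrow> tensor_vec v w \<in> gcomp (graded_tensor V W) (x + y)"
  unfolding graded_tensor_def using vec_span_superset by fastforce

text \<open>The elimination rule for homogeneous elements of a tensor product: a property that cuts
  out a subspace needs to be checked only on pure tensors of homogeneous vectors.\<close>

lemma gcomp_tensor_least:
  assumes "vec_subspace (gdim V * gdim W) T"
    and "\<And>x y v w. v \<in> gcomp V x \<Longrightarrow> w \<in> gcomp W y \<Longrightarrow> x + y = z \<Longrightarrow> tensor_vec v w \<in> T"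
    and "t \<in> gcomp (graded_tensor V W) z"
  shows "t \<in> T"
proof -
  have "gcomp (graded_tensor V W) z \<subseteq> T"
    unfolding graded_tensor_def graded_space.simps
    by (rule vec_span_least[OF assms(1)]) (use assms(2) in blast)
  then show ?thesis using assms(3) by blast
qed

lemma vec_subspace_preimage:
  assumes "vec_subspace m S" "A \<in> carrier_mat m n"
  shows "vec_subspace n {v \<in> carrier_vec n. A *\<^sub>v v \<in> S}"
  using assms vec_subspaceD[OF assms(1)] unfolding vec_subspace_def[of n]
  by (auto simp: mult_mat_vec_add)

lemma vec_subspace_equalizer:
  fixes A B :: "'a::field mat"
  assumes "A \<in> carrier_mat m n" "B \<in> carrier_mat m n"
  shows "vec_subspace n {v \<in> carrier_vec n. A *\<^sub>v v = B *\<^sub>v v}"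
  using assms unfolding vec_subspace_def by (auto simp: mult_mat_vec_add)

lemma mat_tensor_subspace:
  fixes A :: "'a::field mat"
  assumes A: "A \<in> carrier_mat r (m * n)" and S: "vec_subspace r S" and t: "t \<in> carrier_vec (m * n)"
    and mem: "\<And>v w. v \<in> carrier_vec m \<Longrightarrow> w \<in> carrier_vec n \<Longrightarrow> A *\<^sub>v tensor_vec v w \<in> S"
  shows "A *\<^sub>v t \<in> S"
proof -
  have "A *\<^sub>v t = vec_sum r {0..<m * n} (\<lambda>j. A *\<^sub>v (t $ j \<cdot>\<^sub>v unit_vec (m * n) j))"
    by (subst mult_mat_vec_sum[OF A, symmetric]) (use t in \<open>auto simp: vec_eq_sum_unit_vec\<close>)
  also have "\<dots> \<in> S"
    using A by (intro vec_subspace_sum[OF S])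
      (auto simp: unit_vec_tensor intro!: vec_subspaceD(4)[OF S] mem)
  finally show ?thesis .
qed

text \<open>The projection onto degree \<open>z\<close> has to be the sum, over all ways to write z
  = x + (z - x), of the tensor products of the projections of the factors. The conditions of
  \<open>graded_spaceI\<close> are then checked on pure tensors.\<close>

lemma graded_space_tensor [simp]:
  fixes V W :: "('g::{ab_group_add,finite}, 'k::field) graded_space"
  assumes V: "graded_space V" and W: "graded_space W"
  shows "graded_space (graded_tensor V W)"
proof -
  let ?m = "gdim V" and ?n = "gdim W"
  define P where "P = (\<lambda>z. mat_sum (?m * ?n) (?m * ?n) UNIV (\<lambda>x. tensor_mat (gproj V x) (gproj W (z - x))))"
  have c: "tensor_mat (gproj V x) (gproj W y) \<in> carrier_mat (?m * ?n) (?m * ?n)" for x y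
    by (rule tensor_mat_carrier) auto
  have P: "P z \<in> carrier_mat (?m * ?n) (?m * ?n)" for z by (simp add: P_def)
  have Papp: "P z *\<^sub>v tensor_vec v w = vec_sum (?m * ?n) UNIV (\<lambda>x. tensor_vec (gproj V x *\<^sub>v v) (gproj W (z - x) *\<^sub>v w))"
    if "v \<in> carrier_vec ?m" "w \<in> carrier_vec ?n" for z and v w :: "'k vec"
    unfolding P_def using that
    by (subst mat_sum_mult_vec) (auto intro!: tensor_vec_carrier vec_sum_cong c simp: tensor_mat_vec_mult)
  have Phom: "P z *\<^sub>v tensor_vec v w = (if z = x + y then tensor_vec v w else 0\<^sub>v (?m * ?n))"
    if v: "v \<in> gcomp V x" and w: "w \<in> gcomp W y" for x y z v w
  proof -
    have "P z *\<^sub>v tensor_vec v w = vec_sum (?m * ?n) UNIV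
        (\<lambda>a. if a = x then (if z = x + y then tensor_vec v w else 0\<^sub>v (?m * ?n)) else 0\<^sub>v (?m * ?n))"
      using gcomp_carrier[OF V v] gcomp_carrier[OF W w]
      by (subst Papp) (auto intro!: vec_sum_cong simp: gproj_homogeneous[OF V v] gproj_homogeneous[OF W w] diff_eq_eq add.commute)
    also have "\<dots> = (if z = x + y then tensor_vec v w else 0\<^sub>v (?m * ?n))"
      using gcomp_carrier[OF V v] gcomp_carrier[OF W w] by (intro vec_sum_delta) (auto intro!: tensor_vec_carrier)
    finally show ?thesis .
  qed
  show ?thesis
  proof (rule graded_spaceI[where P = P])
    note sub = vec_subspace_graded_tensor[OF V W]
    show "vec_subspace (gdim (graded_tensor V W)) (gcomp (graded_tensor V W) z)" for z
      using sub by simp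
    show "P x \<in> carrier_mat (gdim (graded_tensor V W)) (gdim (graded_tensor V W))" for x
      using P by simp
    show "P z *\<^sub>v t \<in> gcomp (graded_tensor V W) z" if "t \<in> carrier_vec (gdim (graded_tensor V W))" for z and t :: "'k vec"
    proof (rule mat_tensor_subspace[OF P sub])
      fix v w :: "'k vec" assume vw: "v \<in> carrier_vec ?m" "w \<in> carrier_vec ?n"
      have "tensor_vec (gproj V x *\<^sub>v v) (gproj W (z - x) *\<^sub>v w) \<in> gcomp (graded_tensor V W) (x + (z - x))" for x
        using vw by (intro tensor_vec_mem gproj_mem V W)
      then show "P z *\<^sub>v tensor_vec v w \<in> gcomp (graded_tensor V W) z"
        unfolding Papp[OF vw] by (intro vec_subspace_sum[OF sub]) auto
    qed (use that in simp)
    show "P x *\<^sub>v t = (if x = y then t else 0\<^sub>v (gdim (graded_tensor V W)))"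
      if "t \<in> gcomp (graded_tensor V W) y" for x y t
    proof -
      let ?T = "{t \<in> carrier_vec (?m * ?n). P x *\<^sub>v t = (if x = y then t else 0\<^sub>v (?m * ?n))}"
      have "vec_subspace (?m * ?n) ?T"
        using carrier_matD[OF P, of x] by (auto simp: vec_subspace_def mult_mat_vec_add)
      then have "t \<in> ?T"
        by (rule gcomp_tensor_least[OF _ _ that])
           (use gcomp_carrier[OF V] gcomp_carrier[OF W] in \<open>auto simp: Phom intro!: tensor_vec_carrier\<close>)
      then show ?thesis by simp
    qed
    have "mat_sum (?m * ?n) (?m * ?n) UNIV P = 1\<^sub>m (?m * ?n)"
    proof (rule mat_eq_if_tensor_vec)
      fix v w :: "'k vec" assume v: "v \<in> carrier_vec ?m" and w: "w \<in> carrier_vec ?n"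
      have "mat_sum (?m * ?n) (?m * ?n) UNIV P *\<^sub>v tensor_vec v w = tensor_vec v w" 
        using V v
      proof (induction v rule: graded_induct)
        case (homogeneous x v)
        note dv = gcomp_dim[OF V homogeneous]
        show ?case using W w
        proof (induction w rule: graded_induct)
          case (homogeneous y w)
          note dw = gcomp_dim[OF W homogeneous]
          have c: "tensor_vec v w \<in> carrier_vec (?m * ?n)" using dv dw by (auto intro: carrier_vecI)
          show ?case
            by (subst mat_sum_mult_vec[OF P c]) (simp add: Phom[OF \<open>v \<in> gcomp V x\<close> homogeneous] vec_sum_delta[OF _ c])
        qed (simp_all add: tensor_vec_add_right mult_mat_vec_add dv)
      qed (use w in \<open>simp_all add: tensor_vec_add_left mult_mat_vec_add\<close>)
      then show "mat_sum (?m * ?n) (?m * ?n) UNIV P *\<^sub>v tensor_vec v w = 1\<^sub>m (?m * ?n) *\<^sub>v tensor_vec v w"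
        using v w by simp
    qed auto
    then show "vec_sum (gdim (graded_tensor V W)) UNIV (\<lambda>x. P x *\<^sub>v t) = t"
      if "t \<in> carrier_vec (gdim (graded_tensor V W))" for t :: "'k vec"
      using that mat_sum_mult_vec[of UNIV P "?m * ?n" "?m * ?n" t] P by simp
  qed
qed

lemma graded_tensor_ext:
  fixes A B :: "'k::field mat"
    and U V W :: "('g::{ab_group_add,finite}, 'k) graded_space"
  assumes V: "graded_space V" and W: "graded_space W"
    and dim: "dim_row A = dim_row B" "dim_col A = gdim V * gdim W" "dim_col B = gdim V * gdim W"
    and eq: "\<And>x y v w. v \<in> gcomp V x \<Longrightarrow> w \<in> gcomp W y \<Longrightarrow> A *\<^sub>v tensor_vec v w = B *\<^sub>v tensor_vec v w"
  shows "A = B"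
proof (rule graded_ext[OF graded_space_tensor[OF V W]])
  have A: "A \<in> carrier_mat (dim_row B) (gdim V * gdim W)" and B: "B \<in> carrier_mat (dim_row B) (gdim V * gdim W)"
    using dim by auto
  fix z t assume "t \<in> gcomp (graded_tensor V W) z"
  then show "A *\<^sub>v t = B *\<^sub>v t"
    by (rule gcomp_tensor_least[OF vec_subspace_equalizer[OF A B], THEN CollectD, THEN conjunct2, rotated])
       (use V W in \<open>auto intro!: tensor_vec_carrier gcomp_carrier eq\<close>)
qed (use dim in auto)

lemma graded_tensor_homI:
  fixes A :: "'k::field mat"
    and U V W :: "('g::{ab_group_add,finite}, 'k) graded_space"
  assumes V: "graded_space V" and W: "graded_space W" and U: "graded_space U"
    and A: "dim_row A = gdim U" "dim_col A = gdim V * gdim W"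
    and mem: "\<And>x y v w. v \<in> gcomp V x \<Longrightarrow> w \<in> gcomp W y \<Longrightarrow> A *\<^sub>v tensor_vec v w \<in> gcomp U (x + y)"
  shows "A \<in> graded_hom (graded_tensor V W) U"
proof (rule graded_homI)
  have A': "A \<in> carrier_mat (gdim U) (gdim V * gdim W)" using A by auto
  fix z t assume "t \<in> gcomp (graded_tensor V W) z"
  then show "A *\<^sub>v t \<in> gcomp U z"
    by (rule gcomp_tensor_least[OF vec_subspace_preimage[OF graded_space_subspace[OF U] A'], THEN CollectD, THEN conjunct2, rotated])
       (use V W mem in \<open>auto intro!: tensor_vec_carrier gcomp_carrier\<close>)
qed (use A in auto)

lemma graded_tensor3_ext:
  fixes A B :: "'k::field mat"
    and U V W :: "('g::{ab_group_add,finite}, 'k) graded_space"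
  assumes U: "graded_space U" and V: "graded_space V" and W: "graded_space W"
    and dim: "dim_row A = dim_row B" "dim_col A = gdim U * (gdim V * gdim W)" "dim_col B = gdim U * (gdim V * gdim W)"
    and eq: "\<And>x y z u v w. u \<in> gcomp U x \<Longrightarrow> v \<in> gcomp V y \<Longrightarrow> w \<in> gcomp W z \<Longrightarrow>
      A *\<^sub>v tensor_vec u (tensor_vec v w) = B *\<^sub>v tensor_vec u (tensor_vec v w)"
  shows "A = B"
proof (rule graded_tensor_ext[OF U graded_space_tensor[OF V W]])
  fix x yz u t assume u: "u \<in> gcomp U x" and t: "t \<in> gcomp (graded_tensor V W) yz"
  \<comment> \<open>\<open>C\<close> is the map that sends s to u \<otimes> s. Composing with it
    reduces the claim to two factors; the vector \<open>t\<close> itself need not be a pure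
    tensor.\<close>
  define C where "C = tensor_mat (mat_of_cols (gdim U) [u]) (1\<^sub>m (gdim V * gdim W))"
  have [simp]: "dim_row C = gdim U * (gdim V * gdim W)" "dim_col C = gdim V * gdim W"
    by (simp_all add: C_def)
  have Ct: "C *\<^sub>v s = tensor_vec u s" if "dim_vec s = gdim V * gdim W" for s
  proof -
    have s: "s = tensor_vec (unit_vec 1 0) s"
      by (rule eq_vecI) (auto simp: index_tensor_vec)
    have "mat_of_cols (gdim U) [u] *\<^sub>v unit_vec 1 0 = u"
      using gcomp_dim[OF U u] by (intro eq_vecI) (auto simp: scalar_prod_def mat_of_cols_def)
    then show ?thesis using that
      by (subst s) (simp add: C_def tensor_mat_vec_mult)
  qed
  have "A * C = B * C"
    by (rule graded_tensor_ext[OF V W]) (use V W dim in \<open>auto simp: gcomp_dim Ct intro!: eq u\<close>)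
  moreover have "dim_vec t = gdim V * gdim W" using gcomp_dim[OF graded_space_tensor[OF V W] t] by simp
  ultimately show "A *\<^sub>v tensor_vec u t = B *\<^sub>v tensor_vec u t"
    using dim Ct by (metis \<open>dim_col C = _\<close> \<open>dim_row C = _\<close> mult_mat_vec_assoc)
qed (use dim in auto)

section \<open>Braiding, lines and duals\<close>

lemma if_one_mult: "(if P then 1 else 0) * q = (if P then q else (0::'a::semiring_1))"
  by simp

lemma zero_mat_mult_vec [simp]: "dim_vec v = n \<Longrightarrow> 0\<^sub>m m n *\<^sub>v v = 0\<^sub>v m" for v :: "'a::field vec"
  by (rule eq_vecI) (auto simp: scalar_prod_def)

lemma tensor_mat_vec_mult_assoc:
  assumes "dim_col A = dim_vec u * dim_vec v" "dim_col B = dim_vec w"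
  shows "tensor_mat A B *\<^sub>v tensor_vec u (tensor_vec v w) = tensor_vec (A *\<^sub>v tensor_vec u v) (B *\<^sub>v w)"
  using assms by (simp add: tensor_mat_vec_mult flip: tensor_vec_assoc)

lemmas tensor_apply = tensor_mat_vec_mult tensor_mat_vec_mult_assoc tensor_vec_assoc

lemma tensor_vec_unit [simp]: "tensor_vec (unit_vec (Suc 0) 0) v = v" "tensor_vec v (unit_vec (Suc 0) 0) = v"
  by (rule eq_vecI; simp add: index_tensor_vec)+

lemma vec_one_eq: "v \<in> carrier_vec (Suc 0) \<Longrightarrow> v = v $ 0 \<cdot>\<^sub>v (unit_vec (Suc 0) 0 :: 'a::field vec)"
  by (rule eq_vecI) auto

lemma tensor_mat_unit_left_Suc [simp]: "tensor_mat (1\<^sub>m (Suc 0)) A = A"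
  using tensor_mat_unit_left by simp

lemma tensor_mat_unit_right_Suc [simp]: "tensor_mat A (1\<^sub>m (Suc 0)) = A"
  using tensor_mat_unit_right by simp

text \<open>Row \<open>i\<close> stands for the pair \<open>(i div m, i mod m)\<close> of the
  target, and the exchanged pair has the index \<open>(i mod m) * n + i div m\<close> in the
  source.\<close>

definition swap_mat :: "nat \<Rightarrow> nat \<Rightarrow> 'a::field mat" where
  "swap_mat m n = mat (n * m) (m * n) (\<lambda>(i, j). if j = (i mod m) * n + i div m then 1 else 0)"

lemma dim_swap_mat [simp]: "dim_row (swap_mat m n) = n * m" "dim_col (swap_mat m n) = m * n"
  by (simp_all add: swap_mat_def)

lemma swap_mat_apply:
  fixes v w :: "'a::field vec"
  assumes "dim_vec v = m" "dim_vec w = n"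
  shows "swap_mat m n *\<^sub>v tensor_vec v w = tensor_vec w v"
proof (rule eq_vecI)
  fix i assume "i < dim_vec (tensor_vec w v)"
  then have i: "i < n * m" using assms by simp
  note im = less_mult_imp_div_mod[OF i]
  have "(i mod m) * n + i div m < Suc (i mod m) * n" using im by simp
  also have "\<dots> \<le> m * n" using im by (intro mult_right_mono) auto
  finally have less: "(i mod m) * n + i div m < m * n" .
  have "(swap_mat m n *\<^sub>v tensor_vec v w) $ i =
      (\<Sum>j = 0..<m * n. if j = (i mod m) * n + i div m then tensor_vec v w $ j else 0)"
    using i assms by (simp add: swap_mat_def scalar_prod_def if_one_mult)
  also have "\<dots> = tensor_vec v w $ ((i mod m) * n + i div m)"
    using less by simp
  also have "\<dots> = tensor_vec w v $ i"
    using less i im assms by (simp add: index_tensor_vec)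
  finally show "(swap_mat m n *\<^sub>v tensor_vec v w) $ i = tensor_vec w v $ i" .
qed (use assms in auto)

lemma swap_mat_involution: "swap_mat n m * swap_mat m n = (1\<^sub>m (m * n) :: 'a::field mat)"
  by (rule mat_eq_if_tensor_vec[of _ "m * n" m n]) (auto simp: swap_mat_apply)

lemma
  fixes \<chi> :: "'g::{ab_group_add,finite} \<Rightarrow> 'g \<Rightarrow> 'k::field"
  assumes V: "graded_space V" and W: "graded_space W"
  shows graded_braid_carrier: "graded_braid \<chi> V W \<in> carrier_mat (gdim W * gdim V) (gdim V * gdim W)"
    and graded_braid_apply: "v \<in> gcomp V x \<Longrightarrow> w \<in> gcomp W y \<Longrightarrow>
      graded_braid \<chi> V W *\<^sub>v tensor_vec v w = \<chi> x y \<cdot>\<^sub>v tensor_vec w v"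
proof -
  let ?m = "gdim V" and ?n = "gdim W"
  let ?P = "\<lambda>A. A \<in> carrier_mat (?n * ?m) (?m * ?n) \<and>
     (\<forall>x y. \<forall>v\<in>gcomp V x. \<forall>w\<in>gcomp W y. A *\<^sub>v tensor_vec v w = \<chi> x y \<cdot>\<^sub>v tensor_vec w v)"
  \<comment> \<open>\<open>D\<close> multiplies homogeneous tensors by the value of \<chi> without
    exchanging the factors. Followed by the flip it is the matrix whose existence the definite
    description in \<open>graded_braid\<close> requires.\<close>
  define D where "D = mat_sum (?m * ?n) (?m * ?n) UNIV
    (\<lambda>x. tensor_mat (gproj V x) (graded_scaling (\<chi> x) W))"
  have D: "D *\<^sub>v tensor_vec v w = \<chi> x y \<cdot>\<^sub>v tensor_vec v w" if v: "v \<in> gcomp V x" and w: "w \<in> gcomp W y" for x y v w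
  proof -
    have vw: "tensor_vec v w \<in> carrier_vec (?m * ?n)"
      using v w by (intro tensor_vec_carrier gcomp_carrier V W)
    have "D *\<^sub>v tensor_vec v w = vec_sum (?m * ?n) UNIV
        (\<lambda>a. tensor_mat (gproj V a) (graded_scaling (\<chi> a) W) *\<^sub>v tensor_vec v w)"
      unfolding D_def using vw W by (intro mat_sum_mult_vec) auto
    also have "\<dots> = vec_sum (?m * ?n) UNIV (\<lambda>a. if a = x then \<chi> x y \<cdot>\<^sub>v tensor_vec v w else 0\<^sub>v (?m * ?n))"
      using gcomp_dim[OF V v] gcomp_dim[OF W w] W
      by (intro vec_sum_cong) (auto simp: tensor_apply gproj_homogeneous[OF V v] graded_scaling_apply[OF W w])
    also have "\<dots> = \<chi> x y \<cdot>\<^sub>v tensor_vec v w" using vw by (intro vec_sum_delta) auto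
    finally show ?thesis .
  qed
  have "\<exists>!A. ?P A"
  proof (rule ex_ex1I)
    have [simp]: "dim_row D = ?m * ?n" "dim_col D = ?m * ?n" by (simp_all add: D_def)
    have "?P (swap_mat ?m ?n * D)"
      using V W by (auto simp: D swap_mat_apply gcomp_dim)
    then show "\<exists>A. ?P A" by blast
    show "A = B" if "?P A" "?P B" for A B
      by (rule graded_tensor_ext[OF V W]) (use that in auto)
  qed
  then have "?P (graded_braid \<chi> V W)" unfolding graded_braid_def by (rule theI')
  then show "graded_braid \<chi> V W \<in> carrier_mat (gdim W * gdim V) (gdim V * gdim W)"
    and "v \<in> gcomp V x \<Longrightarrow> w \<in> gcomp W y \<Longrightarrow>
      graded_braid \<chi> V W *\<^sub>v tensor_vec v w = \<chi> x y \<cdot>\<^sub>v tensor_vec w v" by auto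
qed

lemma dim_graded_braid [simp]:
  assumes "graded_space V" "graded_space W"
  shows "dim_row (graded_braid \<chi> V W) = gdim W * gdim V" "dim_col (graded_braid \<chi> V W) = gdim V * gdim W"
  using graded_braid_carrier[OF assms, of \<chi>] by auto

lemma graded_braid_hom:
  assumes V: "graded_space V" and W: "graded_space W"
  shows "graded_braid \<chi> V W \<in> graded_hom (graded_tensor V W) (graded_tensor W V)"
proof (rule graded_tensor_homI[OF V W graded_space_tensor[OF W V]])
  fix x y v w assume v: "v \<in> gcomp V x" and w: "w \<in> gcomp W y"
  show "graded_braid \<chi> V W *\<^sub>v tensor_vec v w \<in> gcomp (graded_tensor W V) (x + y)"
    using gcomp_smult[OF graded_space_tensor[OF W V] tensor_vec_mem[OF w v]]
    by (simp add: graded_braid_apply[OF V W v w] add.commute)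
qed (use V W in auto)

lemma tensor_mat_hom:
  assumes V: "graded_space V" "graded_space V'" and W: "graded_space W" "graded_space W'"
    and f: "f \<in> graded_hom V V'" and g: "g \<in> graded_hom W W'"
  shows "tensor_mat f g \<in> graded_hom (graded_tensor V W) (graded_tensor V' W')"
proof (rule graded_tensor_homI[OF V(1) W(1) graded_space_tensor[OF V(2) W(2)]])
  fix x y v w assume v: "v \<in> gcomp V x" and w: "w \<in> gcomp W y"
  show "tensor_mat f g *\<^sub>v tensor_vec v w \<in> gcomp (graded_tensor V' W') (x + y)"
    using tensor_vec_mem[OF graded_homD(4)[OF f v] graded_homD(4)[OF g w]]
    by (simp add: tensor_apply graded_homD[OF f] graded_homD[OF g] gcomp_dim[OF V(1) v] gcomp_dim[OF W(1) w])
qed (use f g in \<open>auto simp: graded_homD\<close>)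

text \<open>Generators of the left side are tensors t \<otimes> w with \<open>t\<close> not
  necessarily pure. Membership in a component of the right side is expressed by a projection, hence
  is a linear condition on \<open>t\<close>, and so \<open>t\<close> may be replaced by a pure
  tensor.\<close>

lemma graded_tensor_assoc:
  fixes U V W :: "('g::{ab_group_add,finite}, 'k::field) graded_space"
  assumes U: "graded_space U" and V: "graded_space V" and W: "graded_space W"
  shows "graded_tensor (graded_tensor U V) W = graded_tensor U (graded_tensor V W)"
proof (rule graded_space_eqI)
  note UV = graded_space_tensor[OF U V] and VW = graded_space_tensor[OF V W]
  show "graded_space (graded_tensor (graded_tensor U V) W)" "graded_space (graded_tensor U (graded_tensor V W))"
    using U V W by auto
  let ?N = "gdim U * (gdim V * gdim W)"
  let ?R = "\<lambda>x. gproj (graded_tensor U (graded_tensor V W)) x"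
  have R: "?R z *\<^sub>v tensor_vec t w = (if z = x + y then tensor_vec t w else 0\<^sub>v ?N)"
    if t: "t \<in> gcomp (graded_tensor U V) x" and w: "w \<in> gcomp W y" for t w x y z
  proof -
    have dt: "dim_vec t = gdim U * gdim V" and dw: "dim_vec w = gdim W"
      using gcomp_dim[OF UV t] gcomp_dim[OF W w] by simp_all
    \<comment> \<open>Both cases of the claim are written as a matrix \<open>?B\<close>, so that
      \<open>?T\<close> is the equalizer of two linear maps and therefore a subspace.\<close>
    let ?A = "?R z" and ?B = "if z = x + y then 1\<^sub>m ?N else (0\<^sub>m ?N ?N :: 'k mat)"
    let ?T = "{t \<in> carrier_vec (gdim U * gdim V). ?A *\<^sub>v tensor_vec t w = ?B *\<^sub>v tensor_vec t w}"
    have [simp]: "dim_row ?B = ?N" "dim_col ?B = ?N" by auto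
    have "vec_subspace (gdim U * gdim V) ?T"
      unfolding vec_subspace_def using dw
      by (auto simp: tensor_vec_add_left mult_mat_vec_add mult.assoc)
    then have "t \<in> ?T"
    proof (rule gcomp_tensor_least[OF _ _ t])
      fix a b u v assume u: "u \<in> gcomp U a" and v: "v \<in> gcomp V b" and ab: "a + b = x"
      have mem: "tensor_vec u (tensor_vec v w) \<in> gcomp (graded_tensor U (graded_tensor V W)) (a + (b + y))"
        by (intro tensor_vec_mem u v w)
      have "a + (b + y) = x + y" using ab by (simp add: add.assoc)
      then have "?A *\<^sub>v tensor_vec u (tensor_vec v w) = ?B *\<^sub>v tensor_vec u (tensor_vec v w)"
        using gproj_homogeneous[OF graded_space_tensor[OF U VW] mem, of z]
          gcomp_dim[OF U u] gcomp_dim[OF V v] dw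
        by (simp add: mult.assoc split: if_splits)
      then show "tensor_vec u v \<in> ?T"
        using u v by (auto simp: tensor_vec_assoc intro!: tensor_vec_carrier gcomp_carrier U V)
    qed
    then have "?A *\<^sub>v tensor_vec t w = ?B *\<^sub>v tensor_vec t w" by simp
    also have "\<dots> = (if z = x + y then tensor_vec t w else 0\<^sub>v ?N)"
      using dt dw by (auto simp: mult.assoc intro!: eq_vecI)
    finally show ?thesis .
  qed
  fix z t assume t: "t \<in> gcomp (graded_tensor (graded_tensor U V) W) z"
  have "vec_subspace (gdim (graded_tensor U V) * gdim W) (gcomp (graded_tensor U (graded_tensor V W)) z)"
    using graded_space_subspace[OF graded_space_tensor[OF U VW], of z] by (simp add: mult.assoc)
  then show "t \<in> gcomp (graded_tensor U (graded_tensor V W)) z"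
  proof (rule gcomp_tensor_least[OF _ _ t])
    fix x y s w assume s: "s \<in> gcomp (graded_tensor U V) x" and w: "w \<in> gcomp W y" and xy: "x + y = z"
    have "tensor_vec s w \<in> carrier_vec ?N"
      using gcomp_dim[OF UV s] gcomp_dim[OF W w] by (auto intro!: carrier_vecI)
    then show "tensor_vec s w \<in> gcomp (graded_tensor U (graded_tensor V W)) z"
      using R[OF s w, of z] xy graded_space_tensor[OF U VW] by (subst mem_gcomp_iff) auto
  qed
qed (simp add: mult.assoc)

section \<open>Lines and the unit object\<close>

definition line :: "'g \<Rightarrow> ('g, 'k::field) graded_space" where
  "line x = \<lparr>gdim = 1, gcomp = (\<lambda>y. if y = x then carrier_vec 1 else {0\<^sub>v 1})\<rparr>"

lemma gdim_line [simp]: "gdim (line x) = Suc 0"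
  by (simp add: line_def)

lemma gcomp_line: "gcomp (line x) y = (if y = x then carrier_vec (Suc 0) else {0\<^sub>v (Suc 0)})"
  by (simp add: line_def)

lemma line_mem [simp]: "unit_vec (Suc 0) 0 \<in> gcomp (line x) x"
  by (simp add: gcomp_line)

lemma line_zero: "line 0 = graded_unit"
  by (simp add: line_def graded_unit_def)

lemma graded_space_line [simp]: "graded_space (line x :: ('g::{ab_group_add,finite}, 'k::field) graded_space)"
proof (rule graded_spaceI[where P = "\<lambda>y. if y = x then 1\<^sub>m 1 else 0\<^sub>m 1 1"])
  show "vec_subspace (gdim (line x)) (gcomp (line x) y)" for y
    by (auto simp: gcomp_line vec_subspace_def)
  fix v :: "'k vec" assume v: "v \<in> carrier_vec (gdim (line x))"
  have "vec_sum 1 UNIV (\<lambda>y. (if y = x then 1\<^sub>m 1 else 0\<^sub>m 1 1) *\<^sub>v v) = vec_sum 1 UNIV (\<lambda>y. if y = x then v else 0\<^sub>v 1)"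
    using v by (intro vec_sum_cong) (auto intro!: eq_vecI)
  then show "vec_sum (gdim (line x)) UNIV (\<lambda>y. (if y = x then 1\<^sub>m 1 else 0\<^sub>m 1 1) *\<^sub>v v) = v"
    using v vec_sum_delta[of UNIV v 1 x] by simp
qed (auto simp: gcomp_line intro!: eq_vecI split: if_splits)

lemma graded_space_unit [simp]: "graded_space (graded_unit :: ('g::{ab_group_add,finite}, 'k::field) graded_space)"
  unfolding line_zero[symmetric] by (rule graded_space_line)

lemma gdim_unit [simp]: "gdim graded_unit = Suc 0"
  by (simp add: graded_unit_def)

lemma line_ext:
  fixes A B :: "'k::field mat"
  assumes "dim_row A = dim_row B" "dim_col A = Suc 0" "dim_col B = Suc 0"
    and "A *\<^sub>v unit_vec (Suc 0) 0 = B *\<^sub>v unit_vec (Suc 0) 0"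
  shows "A = B"
  by (rule mat_eq_if_unit_vec[of _ "dim_row B" "Suc 0"]) (use assms in auto)

lemma line_homI:
  fixes A :: "'k::field mat" and V :: "('g::{ab_group_add,finite}, 'k) graded_space"
  assumes "graded_space V" "dim_row A = gdim V" "dim_col A = Suc 0" "A *\<^sub>v unit_vec (Suc 0) 0 \<in> gcomp V x"
  shows "A \<in> graded_hom (line x) V"
proof (rule graded_homI)
  fix y and v :: "'k vec" assume v: "v \<in> gcomp (line x) y"
  then have vc: "v \<in> carrier_vec (Suc 0)" by (auto simp: gcomp_line split: if_splits)
  have "A *\<^sub>v v = v $ 0 \<cdot>\<^sub>v (A *\<^sub>v unit_vec (Suc 0) 0)"
    using assms by (subst vec_one_eq[OF vc]) simp
  also have "\<dots> \<in> gcomp V y"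
  proof (cases "y = x")
    case False
    then have "v = 0\<^sub>v (Suc 0)" using v by (simp add: gcomp_line)
    then have "v $ 0 \<cdot>\<^sub>v (A *\<^sub>v unit_vec (Suc 0) 0) = 0\<^sub>v (gdim V)" using assms(2) by (intro eq_vecI) auto
    then show ?thesis using assms(1) by simp
  qed (use assms in \<open>auto intro: gcomp_smult\<close>)
  finally show "A *\<^sub>v v \<in> gcomp V y" .
qed (use assms in auto)

text \<open>Tensoring with a line of degree \<open>a\<close> changes no coordinates and shifts the
  grading by \<open>a\<close>. The case \<open>a = 0\<close> yields the strict unit law.\<close>

lemma graded_tensor_line_mem:
  fixes V :: "('g::{ab_group_add,finite}, 'k::field) graded_space"
  assumes V: "graded_space V" and t: "t \<in> gcomp (graded_tensor (line a) V) z"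
  shows "t \<in> gcomp V (z - a)"
proof (rule gcomp_tensor_least[OF _ _ t])
  show "vec_subspace (gdim (line a) * gdim V) (gcomp V (z - a))" using graded_space_subspace[OF V] by simp
  fix x y and v w :: "'k vec" assume v: "v \<in> gcomp (line a) x" and w: "w \<in> gcomp V y" and xy: "x + y = z"
  have vc: "v \<in> carrier_vec (Suc 0)" using v by (auto simp: gcomp_line split: if_splits)
  have vw: "tensor_vec v w = v $ 0 \<cdot>\<^sub>v w" by (subst vec_one_eq[OF vc]) simp
  show "tensor_vec v w \<in> gcomp V (z - a)"
  proof (cases "x = a")
    case True
    then show ?thesis using vw w gcomp_smult[OF V w] xy by (metis add_diff_cancel_left')
  next
    case False
    then have "v = 0\<^sub>v (Suc 0)" using v by (simp add: gcomp_line)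
    then have "tensor_vec v w = 0\<^sub>v (gdim V)" using gcomp_dim[OF V w] by simp
    then show ?thesis using V by simp
  qed
qed

lemma graded_tensor_line_mem_right:
  fixes V :: "('g::{ab_group_add,finite}, 'k::field) graded_space"
  assumes V: "graded_space V" and t: "t \<in> gcomp (graded_tensor V (line a)) z"
  shows "t \<in> gcomp V (z - a)"
proof (rule gcomp_tensor_least[OF _ _ t])
  show "vec_subspace (gdim V * gdim (line a)) (gcomp V (z - a))" using graded_space_subspace[OF V] by simp
  fix x y and w v :: "'k vec" assume w: "w \<in> gcomp V x" and v: "v \<in> gcomp (line a) y" and xy: "x + y = z"
  have vc: "v \<in> carrier_vec (Suc 0)" using v by (auto simp: gcomp_line split: if_splits)
  have vw: "tensor_vec w v = v $ 0 \<cdot>\<^sub>v w" by (subst vec_one_eq[OF vc]) simp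
  show "tensor_vec w v \<in> gcomp V (z - a)"
  proof (cases "y = a")
    case True
    then show ?thesis using vw w gcomp_smult[OF V w] xy by (metis add_diff_cancel_right')
  next
    case False
    then have "v = 0\<^sub>v (Suc 0)" using v by (simp add: gcomp_line)
    then have "tensor_vec w v = 0\<^sub>v (gdim V)" using gcomp_dim[OF V w] by simp
    then show ?thesis using V by simp
  qed
qed

lemma graded_tensor_unit_left: "graded_space V \<Longrightarrow> graded_tensor graded_unit V = V"
  by (rule graded_space_eqI) (auto dest: graded_tensor_line_mem[where a = 0, unfolded line_zero, rotated])

lemma graded_tensor_unit_right: "graded_space V \<Longrightarrow> graded_tensor V graded_unit = V"
  by (rule graded_space_eqI) (auto dest: graded_tensor_line_mem_right[where a = 0, unfolded line_zero, rotated])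

lemma graded_tensor_line_line: "graded_tensor (line x) (line y) = (line (x + y) :: ('g::{ab_group_add,finite}, 'k::field) graded_space)"
proof (rule graded_space_eqI)
  fix z and t :: "'k vec" assume "t \<in> gcomp (graded_tensor (line x) (line y)) z"
  then have "t \<in> gcomp (line y) (z - x)" by (rule graded_tensor_line_mem[rotated]) simp
  then show "t \<in> gcomp (line (x + y)) z" by (auto simp: gcomp_line split: if_splits)
qed auto

section \<open>Dual spaces\<close>

lemma vec_eq_if_scalar_prod:
  fixes v w :: "'k::field vec"
  assumes "v \<in> carrier_vec n" "w \<in> carrier_vec n" "\<And>u. u \<in> carrier_vec n \<Longrightarrow> v \<bullet> u = w \<bullet> u"
  shows "v = w"
proof (rule eq_vecI)
  fix i assume "i < dim_vec w"
  then have "i < n" using assms by simp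
  then show "v $ i = w $ i" using assms(3)[of "unit_vec n i"] assms(1,2) by (simp add: scalar_prod_right_unit)
qed (use assms in auto)

lemma gdim_dual [simp]: "gdim (graded_dual V) = gdim V"
  by (simp add: graded_dual_def)

lemma gcomp_dual:
  "\<phi> \<in> gcomp (graded_dual V) x \<longleftrightarrow>
    \<phi> \<in> carrier_vec (gdim V) \<and> (\<forall>y v. y \<noteq> - x \<longrightarrow> v \<in> gcomp V y \<longrightarrow> \<phi> \<bullet> v = 0)"
  by (auto simp: graded_dual_def)

lemma transpose_scalar_prod:
  fixes A :: "'k::field mat"
  assumes "A \<in> carrier_mat m n" "\<phi> \<in> carrier_vec m" "v \<in> carrier_vec n"
  shows "(A\<^sup>T *\<^sub>v \<phi>) \<bullet> v = \<phi> \<bullet> (A *\<^sub>v v)"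
  using transpose_vec_mult_scalar[OF assms(1,3,2)] .

lemma scalar_prod_vec_sum_left:
  fixes v :: "'k::field vec"
  assumes "v \<in> carrier_vec n" "\<And>x. x \<in> S \<Longrightarrow> f x \<in> carrier_vec n"
  shows "vec_sum n S f \<bullet> v = (\<Sum>x\<in>S. f x \<bullet> v)"
proof -
  have "vec_sum n S f \<bullet> v = (\<Sum>i = 0..<n. \<Sum>x\<in>S. f x $ i * v $ i)"
    using assms(1) by (simp add: scalar_prod_def vec_sum_def sum_distrib_right)
  also have "\<dots> = (\<Sum>x\<in>S. f x \<bullet> v)"
    using assms(1) by (subst sum.swap) (simp add: scalar_prod_def)
  finally show ?thesis .
qed

lemma scalar_prod_vec_sum_right:
  fixes v :: "'k::field vec"
  assumes "v \<in> carrier_vec n" "\<And>x. x \<in> S \<Longrightarrow> f x \<in> carrier_vec n"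
  shows "v \<bullet> vec_sum n S f = (\<Sum>x\<in>S. v \<bullet> f x)"
proof -
  have "v \<bullet> vec_sum n S f = vec_sum n S f \<bullet> v" using assms(1) by (intro comm_scalar_prod) auto
  also have "\<dots> = (\<Sum>x\<in>S. v \<bullet> f x)"
    using assms by (subst scalar_prod_vec_sum_left) (auto intro!: sum.cong comm_scalar_prod)
  finally show ?thesis .
qed

text \<open>The transpose of the projection of \<open>V\<close> onto degree \<open>- x\<close> is
  the projection of the dual onto degree \<open>x\<close>. All conditions are tested by pairing with
  vectors of \<open>V\<close>.\<close>

lemma graded_space_dual [simp]:
  fixes V :: "('g::{ab_group_add,finite}, 'k::field) graded_space"
  assumes V: "graded_space V"
  shows "graded_space (graded_dual V)"
proof -
  let ?P = "\<lambda>x. (gproj V (- x))\<^sup>T"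
  have P: "?P x \<in> carrier_mat (gdim V) (gdim V)" for x by simp
  have adj: "(?P x *\<^sub>v \<phi>) \<bullet> v = \<phi> \<bullet> (gproj V (- x) *\<^sub>v v)"
    if "\<phi> \<in> carrier_vec (gdim V)" "v \<in> carrier_vec (gdim V)" for x \<phi> v
    using that by (intro transpose_scalar_prod) auto
  have Pc: "?P x *\<^sub>v \<phi> \<in> carrier_vec (gdim V)" for x \<phi> by (auto intro: carrier_vecI)
  have hom: "?P x *\<^sub>v \<phi> = (if x = y then \<phi> else 0\<^sub>v (gdim V))" if \<phi>: "\<phi> \<in> gcomp (graded_dual V) y" for x y \<phi>
  proof (rule vec_eq_if_scalar_prod[OF Pc])
    have \<phi>c: "\<phi> \<in> carrier_vec (gdim V)" and zero: "\<And>z v. z \<noteq> - y \<Longrightarrow> v \<in> gcomp V z \<Longrightarrow> \<phi> \<bullet> v = 0"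
      using \<phi> by (auto simp: gcomp_dual)
    show "(if x = y then \<phi> else 0\<^sub>v (gdim V)) \<in> carrier_vec (gdim V)" using \<phi>c by simp
    fix u :: "'k vec" assume u: "u \<in> carrier_vec (gdim V)"
    show "(?P x *\<^sub>v \<phi>) \<bullet> u = (if x = y then \<phi> else 0\<^sub>v (gdim V)) \<bullet> u"
    proof (cases "x = y")
      case False
      then have "\<phi> \<bullet> (gproj V (- x) *\<^sub>v u) = 0"
        by (intro zero[OF _ gproj_mem[OF V u]]) simp
      then show ?thesis using adj[OF \<phi>c u] u False by simp
    next
      case True
      have c: "gproj V z *\<^sub>v u \<in> carrier_vec (gdim V)" for z by (auto intro: carrier_vecI)
      have "\<phi> \<bullet> u = \<phi> \<bullet> vec_sum (gdim V) UNIV (\<lambda>z. gproj V z *\<^sub>v u)"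
        using gproj_sum[OF V u] by simp
      also have "\<dots> = (\<Sum>z\<in>UNIV. \<phi> \<bullet> (gproj V z *\<^sub>v u))"
        by (rule scalar_prod_vec_sum_right[OF \<phi>c c])
      also have "\<dots> = (\<Sum>z\<in>UNIV. if z = - y then \<phi> \<bullet> (gproj V (- y) *\<^sub>v u) else 0)"
        by (intro sum.cong refl) (auto intro: zero[OF _ gproj_mem[OF V u]])
      also have "\<dots> = \<phi> \<bullet> (gproj V (- y) *\<^sub>v u)" by simp
      finally show ?thesis using adj[OF \<phi>c u] True by simp
    qed
  qed
  show ?thesis
  proof (rule graded_spaceI[where P = ?P])
    show "vec_subspace (gdim (graded_dual V)) (gcomp (graded_dual V) x)" for x
      unfolding vec_subspace_def subset_iff using gcomp_carrier[OF V]
      by (auto simp: gcomp_dual add_scalar_prod_distrib[where n = "gdim V"] gcomp_dim[OF V])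
    show "?P x *\<^sub>v \<phi> = (if x = y then \<phi> else 0\<^sub>v (gdim (graded_dual V)))"
      if "\<phi> \<in> gcomp (graded_dual V) y" for x y \<phi>
      using hom[OF that] by simp
    fix \<phi> :: "'k vec" assume "\<phi> \<in> carrier_vec (gdim (graded_dual V))"
    then have \<phi>: "\<phi> \<in> carrier_vec (gdim V)" by simp
    show "?P x *\<^sub>v \<phi> \<in> gcomp (graded_dual V) x" for x
      unfolding gcomp_dual
    proof (intro conjI allI impI Pc)
      fix y v assume "y \<noteq> - x" and v: "v \<in> gcomp V y"
      then have "gproj V (- x) *\<^sub>v v = 0\<^sub>v (gdim V)" by (simp add: gproj_homogeneous[OF V v])
      then show "(?P x *\<^sub>v \<phi>) \<bullet> v = 0" using \<phi> adj[OF \<phi> gcomp_carrier[OF V v]] by simp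
    qed
    have "vec_sum (gdim V) UNIV (\<lambda>x. ?P x *\<^sub>v \<phi>) = \<phi>"
    proof (rule vec_eq_if_scalar_prod[OF vec_sum_carrier \<phi>])
      fix u :: "'k vec" assume u: "u \<in> carrier_vec (gdim V)"
      have c: "gproj V z *\<^sub>v u \<in> carrier_vec (gdim V)" for z by (auto intro: carrier_vecI)
      have "vec_sum (gdim V) UNIV (\<lambda>x. ?P x *\<^sub>v \<phi>) \<bullet> u = (\<Sum>x\<in>UNIV. \<phi> \<bullet> (gproj V (- x) *\<^sub>v u))"
        by (subst scalar_prod_vec_sum_left[OF u Pc]) (simp add: adj[OF \<phi> u])
      also have "\<dots> = (\<Sum>x\<in>UNIV. \<phi> \<bullet> (gproj V x *\<^sub>v u))"
        by (rule sum.reindex_bij_witness[where i = uminus and j = uminus]) auto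
      also have "\<dots> = \<phi> \<bullet> vec_sum (gdim V) UNIV (\<lambda>z. gproj V z *\<^sub>v u)"
        by (rule scalar_prod_vec_sum_right[OF \<phi> c, symmetric])
      finally show "vec_sum (gdim V) UNIV (\<lambda>x. ?P x *\<^sub>v \<phi>) \<bullet> u = \<phi> \<bullet> u"
        using gproj_sum[OF V u] by simp
    qed
    then show "vec_sum (gdim (graded_dual V)) UNIV (\<lambda>x. ?P x *\<^sub>v \<phi>) = \<phi>" by simp
  qed simp
qed

text \<open>This is an equality and not merely an isomorphism because functionals are coordinate
  vectors paired by the scalar product: the biduality map is the identity matrix, and the degree
  changes sign twice.\<close>

lemma graded_dual_dual [simp]:
  fixes V :: "('g::{ab_group_add,finite}, 'k::field) graded_space"
  assumes V: "graded_space V"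
  shows "graded_dual (graded_dual V) = V"
proof (rule graded_space_eqI[symmetric])
  fix x v assume v: "v \<in> gcomp V x"
  note vc = gcomp_carrier[OF V v]
  have "v \<bullet> \<phi> = 0" if "y \<noteq> - x" "\<phi> \<in> gcomp (graded_dual V) y" for y \<phi>
  proof -
    have "\<phi> \<bullet> v = 0" and "\<phi> \<in> carrier_vec (gdim V)"
      using that v unfolding gcomp_dual by (metis minus_minus)+
    then show ?thesis using comm_scalar_prod[OF vc] by simp
  qed
  then show "v \<in> gcomp (graded_dual (graded_dual V)) x"
    using vc unfolding gcomp_dual[of _ "graded_dual V"] by simp
qed (use V in auto)

section \<open>Evaluation and coevaluation\<close>

lemma dim_graded_ev [simp]:
  "dim_row (graded_ev V) = Suc 0" "dim_col (graded_ev V) = gdim V * gdim V"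
  by (simp_all add: graded_ev_def)

lemma dim_graded_coev [simp]:
  "dim_row (graded_coev V) = gdim V * gdim V" "dim_col (graded_coev V) = Suc 0"
  by (simp_all add: graded_coev_def)

lemma graded_ev_apply:
  fixes v w :: "'k::field vec"
  assumes "dim_vec v = gdim V" "dim_vec w = gdim V"
  shows "graded_ev V *\<^sub>v tensor_vec v w = (v \<bullet> w) \<cdot>\<^sub>v unit_vec (Suc 0) 0"
proof (rule eq_vecI)
  let ?n = "gdim V"
  fix i assume "i < dim_vec ((v \<bullet> w) \<cdot>\<^sub>v unit_vec (Suc 0) 0 :: 'k vec)"
  then have i: "i = 0" by simp
  have "(graded_ev V *\<^sub>v tensor_vec v w) $ 0 =
      (\<Sum>j = 0..<?n * ?n. (\<lambda>a b. (if a = b then 1 else 0) * (v $ a * w $ b)) (j div ?n) (j mod ?n))"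
    using assms by (auto simp: scalar_prod_def graded_ev_def index_tensor_vec intro!: sum.cong)
  also have "\<dots> = (\<Sum>a = 0..<?n. \<Sum>b = 0..<?n. (if a = b then v $ a * w $ b else 0))"
    by (subst sum_div_mod) (simp add: if_one_mult)
  also have "\<dots> = v \<bullet> w" using assms by (simp add: scalar_prod_def)
  finally show "(graded_ev V *\<^sub>v tensor_vec v w) $ i = ((v \<bullet> w) \<cdot>\<^sub>v unit_vec (Suc 0) 0) $ i"
    using i by simp
qed simp

lemma graded_coev_apply:
  "graded_coev V *\<^sub>v unit_vec (Suc 0) 0 =
    (vec_sum (gdim V * gdim V) {0..<gdim V} (\<lambda>i. tensor_vec (unit_vec (gdim V) i) (unit_vec (gdim V) i)) :: 'k::field vec)"
proof (rule eq_vecI)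
  let ?n = "gdim V"
  let ?r = "vec_sum (?n * ?n) {0..<?n} (\<lambda>i. tensor_vec (unit_vec ?n i) (unit_vec ?n i)) :: 'k vec"
  fix j assume "j < dim_vec ?r"
  then have j: "j < ?n * ?n" by simp
  note jm = less_mult_imp_div_mod[OF j]
  have "?r $ j = (\<Sum>i = 0..<?n. if i = j div ?n then (if j div ?n = j mod ?n then 1 else 0) else 0)"
    using j jm unfolding vec_sum_def by (simp add: index_tensor_vec unit_vec_def if_one_mult)
  also have "\<dots> = (if j div ?n = j mod ?n then 1 else 0)"
    using jm by simp
  also have "\<dots> = (graded_coev V *\<^sub>v unit_vec (Suc 0) 0) $ j"
    using j by (simp add: graded_coev_def scalar_prod_def)
  finally show "(graded_coev V *\<^sub>v unit_vec (Suc 0) 0) $ j = ?r $ j" ..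
qed simp

lemma graded_ev_hom:
  fixes V :: "('g::{ab_group_add,finite}, 'k::field) graded_space"
  assumes V: "graded_space V"
  shows "graded_ev V \<in> graded_hom (graded_tensor (graded_dual V) V) graded_unit"
proof (rule graded_tensor_homI)
  fix x y \<phi> v assume \<phi>: "\<phi> \<in> gcomp (graded_dual V) x" and v: "v \<in> gcomp V y"
  have d: "dim_vec \<phi> = gdim V" "dim_vec v = gdim V"
    using gcomp_dim[OF V v] \<phi> by (auto simp: gcomp_dual)
  have "\<phi> \<bullet> v = 0" if "x + y \<noteq> 0"
    using \<phi> v that unfolding gcomp_dual by (metis add.right_inverse)
  then show "graded_ev V *\<^sub>v tensor_vec \<phi> v \<in> gcomp graded_unit (x + y)"
    unfolding graded_ev_apply[OF d] line_zero[symmetric] gcomp_line by (auto intro!: eq_vecI)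
qed (use V in auto)

section \<open>The rigid braided category of graded spaces\<close>

lemma (in category) inverse_arrows_unique:
  assumes "X \<in> Ob C" "Y \<in> Ob C" "inverse_arrows C X Y f g" "inverse_arrows C X Y f h"
  shows "g = h"
proof -
  note g = assms(3)[unfolded inverse_arrows_def] and h = assms(4)[unfolded inverse_arrows_def]
  have "g = g \<cdot> (f \<cdot> h)" using g h cmp_ident_right[of Y X g] assms by simp
  also have "\<dots> = (g \<cdot> f) \<cdot> h" using cmp_assoc[of Y X Y X h f g] g h assms by simp
  also have "\<dots> = h" using g h cmp_ident_left[of Y X h] assms by simp
  finally show ?thesis .
qed

lemma (in category) inv_arrow_eqI:
  assumes "X \<in> Ob C" "Y \<in> Ob C" "inverse_arrows C X Y f g"
  shows "inv_arrow C X Y f = g"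
  unfolding inv_arrow_def using assms by (auto intro: the_equality inverse_arrows_unique)

lemma mult_mat_vec_sum_dim:
  fixes A :: "'a::field mat"
  assumes "dim_col A = n" "\<And>x. x \<in> S \<Longrightarrow> dim_vec (f x) = n"
  shows "A *\<^sub>v vec_sum n S f = vec_sum (dim_row A) S (\<lambda>x. A *\<^sub>v f x)"
  by (rule mult_mat_vec_sum) (use assms in \<open>auto intro: carrier_vecI\<close>)

lemma tensor_vec_sum_dim:
  fixes v :: "'a::field vec"
  assumes "\<And>x. x \<in> S \<Longrightarrow> dim_vec (f x) = n"
  shows "tensor_vec v (vec_sum n S f) = vec_sum (dim_vec v * n) S (\<lambda>x. tensor_vec v (f x))"
  by (rule tensor_vec_sum_right) (use assms in \<open>auto intro: carrier_vecI\<close>)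

lemma tensor_vec_scalar_prod:
  fixes a b c d :: "'a::field vec"
  assumes "dim_vec a = dim_vec c" "dim_vec b = dim_vec d"
  shows "tensor_vec a b \<bullet> tensor_vec c d = (a \<bullet> c) * (b \<bullet> d)"
proof -
  have "tensor_vec a b \<bullet> tensor_vec c d = (\<Sum>k = 0..<dim_vec c * dim_vec d.
      (\<lambda>i j. (a $ i * c $ i) * (b $ j * d $ j)) (k div dim_vec d) (k mod dim_vec d))"
    using assms unfolding scalar_prod_def by (intro sum.cong) (auto simp: index_tensor_vec)
  also have "\<dots> = (\<Sum>i = 0..<dim_vec c. a $ i * c $ i) * (\<Sum>j = 0..<dim_vec d. b $ j * d $ j)"
    by (subst sum_div_mod) (simp add: sum_product)
  finally show ?thesis by (simp add: scalar_prod_def)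
qed

text \<open>The factors keep their order here, since the scalar product of Kronecker products is
  computed factor by factor. The reversed order of the categorical dual appears later as a
  flip.\<close>

lemma graded_dual_tensor:
  fixes V W :: "('g::{ab_group_add,finite}, 'k::field) graded_space"
  assumes V: "graded_space V" and W: "graded_space W"
  shows "graded_dual (graded_tensor V W) = graded_tensor (graded_dual V) (graded_dual W)"
proof (rule graded_space_eqI[symmetric])
  note VW = graded_space_tensor[OF V W]
  fix z t assume t: "t \<in> gcomp (graded_tensor (graded_dual V) (graded_dual W)) z"
  have "vec_subspace (gdim (graded_dual V) * gdim (graded_dual W)) (gcomp (graded_dual (graded_tensor V W)) z)"
    using graded_space_subspace[OF graded_space_dual[OF VW]] by simp
  then show "t \<in> gcomp (graded_dual (graded_tensor V W)) z"
  proof (rule gcomp_tensor_least[OF _ _ t])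
    fix x y \<phi> \<psi>
    assume \<phi>: "\<phi> \<in> gcomp (graded_dual V) x" and \<psi>: "\<psi> \<in> gcomp (graded_dual W) y" and xy: "x + y = z"
    have dims: "dim_vec \<phi> = gdim V" "dim_vec \<psi> = gdim W"
      using \<phi> \<psi> by (auto simp: gcomp_dual)
    have "tensor_vec \<phi> \<psi> \<bullet> t = 0" if "a \<noteq> - z" and t: "t \<in> gcomp (graded_tensor V W) a" for a t
    proof -
      let ?T = "{t \<in> carrier_vec (gdim V * gdim W). tensor_vec \<phi> \<psi> \<bullet> t = 0}"
      have "tensor_vec \<phi> \<psi> \<in> carrier_vec (gdim V * gdim W)" using dims by (auto intro!: carrier_vecI)
      then have "vec_subspace (gdim V * gdim W) ?T"
        by (auto simp: vec_subspace_def scalar_prod_add_distrib[where n = "gdim V * gdim W"] dims)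
      then have "t \<in> ?T"
      proof (rule gcomp_tensor_least[OF _ _ t])
        fix b c v w assume v: "v \<in> gcomp V b" and w: "w \<in> gcomp W c" and bc: "b + c = a"
        have "b \<noteq> - x \<or> c \<noteq> - y" using bc xy \<open>a \<noteq> - z\<close> by auto
        then have "\<phi> \<bullet> v = 0 \<or> \<psi> \<bullet> w = 0"
          using \<phi> \<psi> v w unfolding gcomp_dual by blast
        then show "tensor_vec v w \<in> ?T"
          using dims gcomp_dim[OF V v] gcomp_dim[OF W w]
          by (auto simp: tensor_vec_scalar_prod intro!: carrier_vecI)
      qed
      then show ?thesis by simp
    qed
    then show "tensor_vec \<phi> \<psi> \<in> gcomp (graded_dual (graded_tensor V W)) z"
      using dims by (auto simp: gcomp_dual intro!: carrier_vecI)
  qed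
qed (use V W in auto)

lemma graded_hom_transpose:
  fixes V W :: "('g::{ab_group_add,finite}, 'k::field) graded_space"
  assumes V: "graded_space V" and A: "A \<in> graded_hom V W"
  shows "A\<^sup>T \<in> graded_hom (graded_dual W) (graded_dual V)"
proof (rule graded_homI)
  fix x \<phi> assume \<phi>: "\<phi> \<in> gcomp (graded_dual W) x"
  then have \<phi>c: "\<phi> \<in> carrier_vec (gdim W)" by (simp add: gcomp_dual)
  have "(A\<^sup>T *\<^sub>v \<phi>) \<bullet> v = 0" if "y \<noteq> - x" "v \<in> gcomp V y" for y v
    using transpose_scalar_prod[OF graded_homD(1)[OF A] \<phi>c gcomp_carrier[OF V that(2)]]
      \<phi> graded_homD(4)[OF A that(2)] that(1) by (simp add: gcomp_dual)
  then show "A\<^sup>T *\<^sub>v \<phi> \<in> gcomp (graded_dual V) x"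
    using graded_homD[OF A] by (auto simp: gcomp_dual intro!: carrier_vecI)
qed (use graded_homD[OF A] in auto)

lemma graded_dual_unit: "graded_dual graded_unit = (graded_unit :: ('g::{ab_group_add,finite}, 'k::field) graded_space)"
proof (rule graded_space_eqI[symmetric])
  fix x and v :: "'k vec" assume "v \<in> gcomp graded_unit x"
  then show "v \<in> gcomp (graded_dual graded_unit) x"
    unfolding gcomp_dual line_zero[symmetric] gcomp_line by (auto split: if_splits)
qed auto

lemma graded_coev_transpose: "graded_coev V = (graded_ev V)\<^sup>T"
  by (rule eq_matI) (auto simp: graded_coev_def graded_ev_def)

text \<open>Coevaluation is the transpose of evaluation, and transposes preserve degrees of dual
  spaces; so nothing has to be computed with the sum over a basis.\<close>

lemma graded_coev_hom:
  fixes V :: "('g::{ab_group_add,finite}, 'k::field) graded_space"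
  assumes V: "graded_space V"
  shows "graded_coev V \<in> graded_hom graded_unit (graded_tensor V (graded_dual V))"
proof -
  have "graded_coev V \<in> graded_hom (graded_dual graded_unit) (graded_dual (graded_tensor (graded_dual V) V))"
    unfolding graded_coev_transpose by (rule graded_hom_transpose[OF _ graded_ev_hom[OF V]]) (use V in simp)
  then show ?thesis using V by (simp add: graded_dual_unit graded_dual_tensor)
qed

text \<open>The unit object is invisible in coordinates: \<open>v\<close> is read as its tensor
  product with the basis vector of the unit, to which coevaluation is applied.\<close>

lemma coev_right_apply:
  fixes v :: "'k::field vec"
  assumes "dim_vec v = k"
  shows "tensor_mat (1\<^sub>m k) (graded_coev V) *\<^sub>v v = vec_sum (k * (gdim V * gdim V)) {0..<gdim V}
    (\<lambda>i. tensor_vec v (tensor_vec (unit_vec (gdim V) i) (unit_vec (gdim V) i)))"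
proof -
  have "tensor_mat (1\<^sub>m k) (graded_coev V) *\<^sub>v tensor_vec v (unit_vec (Suc 0) 0) =
      tensor_vec v (graded_coev V *\<^sub>v unit_vec (Suc 0) 0)"
    using assms by (subst tensor_mat_vec_mult) auto
  then show ?thesis using assms unfolding graded_coev_apply
    by (subst (asm) tensor_vec_sum_right[of _ k]) (auto intro!: carrier_vecI)
qed

lemma coev_left_apply:
  fixes v :: "'k::field vec"
  assumes "dim_vec v = k"
  shows "tensor_mat (graded_coev V) (1\<^sub>m k) *\<^sub>v v = vec_sum (gdim V * gdim V * k) {0..<gdim V}
    (\<lambda>i. tensor_vec (unit_vec (gdim V) i) (tensor_vec (unit_vec (gdim V) i) v))"
proof -
  have "tensor_mat (graded_coev V) (1\<^sub>m k) *\<^sub>v tensor_vec (unit_vec (Suc 0) 0) v =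
      tensor_vec (graded_coev V *\<^sub>v unit_vec (Suc 0) 0) v"
    using assms by (subst tensor_mat_vec_mult) auto
  then show ?thesis using assms unfolding graded_coev_apply
    by (subst (asm) tensor_vec_sum_left[of _ k]) (auto intro!: carrier_vecI simp: tensor_vec_assoc)
qed

lemma ev_left_apply:
  fixes u v w :: "'k::field vec"
  assumes "dim_vec u = gdim V" "dim_vec v = gdim V" "dim_vec w = k"
  shows "tensor_mat (graded_ev V) (1\<^sub>m k) *\<^sub>v tensor_vec u (tensor_vec v w) = (u \<bullet> v) \<cdot>\<^sub>v w"
  using assms by (simp add: tensor_mat_vec_mult_assoc graded_ev_apply)

lemma ev_right_apply:
  fixes u v w :: "'k::field vec"
  assumes "dim_vec u = gdim V" "dim_vec v = gdim V" "dim_vec w = k"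
  shows "tensor_mat (1\<^sub>m k) (graded_ev V) *\<^sub>v tensor_vec w (tensor_vec u v) = (u \<bullet> v) \<cdot>\<^sub>v w"
  using assms by (simp add: tensor_mat_vec_mult graded_ev_apply)

lemma vec_sum_unit_vec [simp]:
  fixes v :: "'k::field vec"
  assumes "dim_vec v = n"
  shows "vec_sum n {0..<n} (\<lambda>i. (v \<bullet> unit_vec n i) \<cdot>\<^sub>v unit_vec n i) = v"
    "vec_sum n {0..<n} (\<lambda>i. (unit_vec n i \<bullet> v) \<cdot>\<^sub>v unit_vec n i) = v"
    "vec_sum n {0..<n} (\<lambda>i. v $ i \<cdot>\<^sub>v unit_vec n i) = v"
proof -
  have v: "v \<in> carrier_vec n" using assms by (auto intro: carrier_vecI)
  show *: "vec_sum n {0..<n} (\<lambda>i. v $ i \<cdot>\<^sub>v unit_vec n i) = v"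
    by (rule vec_eq_sum_unit_vec[OF v])
  show "vec_sum n {0..<n} (\<lambda>i. (v \<bullet> unit_vec n i) \<cdot>\<^sub>v unit_vec n i) = v"
    by (subst (2) *[symmetric], rule vec_sum_cong) (auto simp: scalar_prod_right_unit)
  show "vec_sum n {0..<n} (\<lambda>i. (unit_vec n i \<bullet> v) \<cdot>\<^sub>v unit_vec n i) = v"
    by (subst (2) *[symmetric], rule vec_sum_cong) (auto simp: scalar_prod_left_unit[OF v])
qed

lemma mat_ext:
  fixes A B :: "'a::field mat"
  assumes "dim_row A = dim_row B" "dim_col A = n" "dim_col B = n"
    and "\<And>v. dim_vec v = n \<Longrightarrow> A *\<^sub>v v = B *\<^sub>v v"
  shows "A = B"
  by (rule mat_eq_if_unit_vec[of _ "dim_row B" n]) (use assms in auto)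

lemma zigzag_right:
  "tensor_mat (1\<^sub>m (gdim V)) (graded_ev V) * tensor_mat (graded_coev V) (1\<^sub>m (gdim V)) = (1\<^sub>m (gdim V) :: 'k::field mat)"
  by (rule mat_ext[of _ _ "gdim V"])
    (simp_all add: coev_left_apply mult_mat_vec_sum_dim mult.assoc ev_right_apply)

lemma zigzag_left:
  "tensor_mat (graded_ev V) (1\<^sub>m (gdim V)) * tensor_mat (1\<^sub>m (gdim V)) (graded_coev V) = (1\<^sub>m (gdim V) :: 'k::field mat)"
  by (rule mat_ext[of _ _ "gdim V"])
    (simp_all add: coev_right_apply mult_mat_vec_sum_dim mult.assoc ev_left_apply)

lemma Vec_simps [simp]:
  "Ob (Vec \<chi>) = {V. graded_space V}"
  "Hom (Vec \<chi>) = graded_hom"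
  "Ident (Vec \<chi>) V = 1\<^sub>m (gdim V)"
  "Cmp (Vec \<chi>) = (\<lambda>A C. A * C)"
  "tensor_ob (Vec \<chi>) = graded_tensor"
  "tensor_arr (Vec \<chi>) = tensor_mat"
  "unit_ob (Vec \<chi>) = graded_unit"
  "braid (Vec \<chi>) = graded_braid \<chi>"
  "ldual (Vec \<chi>) = graded_dual"
  "ev (Vec \<chi>) = graded_ev"
  "coev (Vec \<chi>) = graded_coev"
  by (simp_all add: Vec_def)

lemma category_Vec: "category (Vec \<chi>)"
  by unfold_locales (auto simp: graded_hom_mult graded_homD intro!: assoc_mult_mat graded_homD(1))

lemma strict_monoidal_Vec: "strict_monoidal_category (Vec \<chi>)"
proof -
  interpret category "Vec \<chi>" by (rule category_Vec)
  show ?thesis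
  proof
    show "(f' \<cdot>\<^bsub>Vec \<chi>\<^esub> f) \<otimes>\<^sub>m\<^bsub>Vec \<chi>\<^esub> (g' \<cdot>\<^bsub>Vec \<chi>\<^esub> g) = (f' \<otimes>\<^sub>m\<^bsub>Vec \<chi>\<^esub> g') \<cdot>\<^bsub>Vec \<chi>\<^esub> (f \<otimes>\<^sub>m\<^bsub>Vec \<chi>\<^esub> g)"
      if "f \<in> Hom (Vec \<chi>) X X'" "f' \<in> Hom (Vec \<chi>) X' X''" "g \<in> Hom (Vec \<chi>) Y Y'" "g' \<in> Hom (Vec \<chi>) Y' Y''"
      for X X' X'' Y Y' Y'' f f' g g'
      using that by (simp add: tensor_mat_mult graded_homD)
  qed (auto simp: tensor_mat_assoc tensor_mat_hom graded_tensor_assoc graded_tensor_unit_left graded_tensor_unit_right)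
qed

lemma bicharacterD:
  assumes "bicharacter \<chi>"
  shows "\<chi> x y \<noteq> 0" "\<chi> (x + x') y = \<chi> x y * \<chi> x' y" "\<chi> x (y + y') = \<chi> x y * \<chi> x y'"
    "\<chi> 0 y = 1" "\<chi> x 0 = 1" "\<chi> x (- y) = inverse (\<chi> x y)" "\<chi> (- x) y = inverse (\<chi> x y)"
proof -
  note b = assms[unfolded bicharacter_def]
  show nz: "\<chi> x y \<noteq> 0" for x y using b by blast
  show add: "\<chi> (x + x') y = \<chi> x y * \<chi> x' y" "\<chi> x (y + y') = \<chi> x y * \<chi> x y'" for x x' y y' using b by blast+
  show zero: "\<chi> 0 y = 1" "\<chi> x 0 = 1" for x y
    using add(1)[of 0 0 y] add(2)[of x 0 0] nz by auto
  show "\<chi> x (- y) = inverse (\<chi> x y)"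
    using add(2)[of x y "- y"] zero nz by (simp add: inverse_unique)
  show "\<chi> (- x) y = inverse (\<chi> x y)"
    using add(1)[of x "- x" y] zero nz by (simp add: inverse_unique)
qed

text \<open>Taking a braiding for the inverse of \<chi> with exchanged arguments, rather than an
  inverse matrix, makes dimensions, homogeneity and values on homogeneous tensors instances of the
  facts on \<open>graded_braid\<close>.\<close>

definition graded_braid_inv where
  "graded_braid_inv \<chi> = graded_braid (\<lambda>x y. inverse (\<chi> y x))"

lemma dim_graded_braid_inv [simp]:
  assumes "graded_space V" "graded_space W"
  shows "dim_row (graded_braid_inv \<chi> V W) = gdim W * gdim V" "dim_col (graded_braid_inv \<chi> V W) = gdim V * gdim W"
  using assms by (simp_all add: graded_braid_inv_def)

lemma graded_braid_inv_apply:
  assumes "graded_space V" "graded_space W" "v \<in> gcomp V x" "w \<in> gcomp W y"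
  shows "graded_braid_inv \<chi> V W *\<^sub>v tensor_vec v w = inverse (\<chi> y x) \<cdot>\<^sub>v tensor_vec w v"
  unfolding graded_braid_inv_def by (rule graded_braid_apply[OF assms])

lemma inverse_arrows_Vec_braid:
  assumes \<chi>: "bicharacter \<chi>" and V: "graded_space V" and W: "graded_space W"
  shows "inverse_arrows (Vec \<chi>) (graded_tensor V W) (graded_tensor W V) (graded_braid \<chi> V W) (graded_braid_inv \<chi> W V)"
proof -
  have "graded_braid_inv \<chi> W V * graded_braid \<chi> V W = 1\<^sub>m (gdim V * gdim W)"
    by (rule graded_tensor_ext[OF V W])
      (use V W in \<open>simp_all add: graded_braid_apply graded_braid_inv_apply gcomp_dim bicharacterD[OF \<chi>]\<close>)
  moreover have "graded_braid \<chi> V W * graded_braid_inv \<chi> W V = 1\<^sub>m (gdim W * gdim V)"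
    by (rule graded_tensor_ext[OF W V])
      (use V W in \<open>simp_all add: graded_braid_apply graded_braid_inv_apply gcomp_dim bicharacterD[OF \<chi>]\<close>)
  ultimately show ?thesis
    using V W graded_braid_hom[OF V W] graded_braid_hom[OF W V]
    by (auto simp: inverse_arrows_def graded_braid_inv_def)
qed

lemma braid_inv_Vec:
  assumes "bicharacter \<chi>" "graded_space V" "graded_space W"
  shows "braid_inv (Vec \<chi>) V W = graded_braid_inv \<chi> V W"
  unfolding braid_inv_def
  by (rule category.inv_arrow_eqI[OF category_Vec]) (use assms inverse_arrows_Vec_braid in auto)

lemma strict_braided_Vec:
  fixes \<chi> :: "'g::{ab_group_add,finite} \<Rightarrow> 'g \<Rightarrow> 'k::field"
  assumes \<chi>: "bicharacter \<chi>"
  shows "strict_braided_category (Vec \<chi>)"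
proof -
  interpret strict_monoidal_category "Vec \<chi>" by (rule strict_monoidal_Vec)
  show ?thesis
  proof
    fix X Y :: "('g, 'k) graded_space" assume "X \<in> Ob (Vec \<chi>)" "Y \<in> Ob (Vec \<chi>)"
    then show "iso_arrow (Vec \<chi>) (X \<otimes>\<^sub>o\<^bsub>Vec \<chi>\<^esub> Y) (Y \<otimes>\<^sub>o\<^bsub>Vec \<chi>\<^esub> X) (braid (Vec \<chi>) X Y)"
      using inverse_arrows_Vec_braid[OF \<chi>] by (auto simp: iso_arrow_def)
  next
    fix X X' Y Y' :: "('g, 'k) graded_space" and f g
    assume "X \<in> Ob (Vec \<chi>)" "X' \<in> Ob (Vec \<chi>)" "Y \<in> Ob (Vec \<chi>)" "Y' \<in> Ob (Vec \<chi>)"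
      and "f \<in> Hom (Vec \<chi>) X X'" "g \<in> Hom (Vec \<chi>) Y Y'"
    then have X: "graded_space X" "graded_space X'" and Y: "graded_space Y" "graded_space Y'"
      and f: "f \<in> graded_hom X X'" and g: "g \<in> graded_hom Y Y'" by auto
    have "graded_braid \<chi> X' Y' * tensor_mat f g = tensor_mat g f * graded_braid \<chi> X Y"
    proof (rule graded_tensor_ext[OF X(1) Y(1)])
      fix x y v w assume v: "v \<in> gcomp X x" and w: "w \<in> gcomp Y y"
      show "graded_braid \<chi> X' Y' * tensor_mat f g *\<^sub>v tensor_vec v w = tensor_mat g f * graded_braid \<chi> X Y *\<^sub>v tensor_vec v w"
        using X Y v w graded_homD(4)[OF f v] graded_homD(4)[OF g w]
        by (simp add: graded_homD(2,3)[OF f] graded_homD(2,3)[OF g] gcomp_dim tensor_apply graded_braid_apply)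
    qed (use X Y in \<open>auto simp: graded_homD[OF f] graded_homD[OF g]\<close>)
    then show "braid (Vec \<chi>) X' Y' \<cdot>\<^bsub>Vec \<chi>\<^esub> (f \<otimes>\<^sub>m\<^bsub>Vec \<chi>\<^esub> g) = (g \<otimes>\<^sub>m\<^bsub>Vec \<chi>\<^esub> f) \<cdot>\<^bsub>Vec \<chi>\<^esub> braid (Vec \<chi>) X Y"
      by simp
  next
    fix X Y Z :: "('g, 'k) graded_space" assume "X \<in> Ob (Vec \<chi>)" "Y \<in> Ob (Vec \<chi>)" "Z \<in> Ob (Vec \<chi>)"
    then have X: "graded_space X" and Y: "graded_space Y" and Z: "graded_space Z" by auto
    note XY = graded_space_tensor[OF X Y] and YZ = graded_space_tensor[OF Y Z]
    have "graded_braid \<chi> (graded_tensor X Y) Z = tensor_mat (graded_braid \<chi> X Z) (1\<^sub>m (gdim Y)) * tensor_mat (1\<^sub>m (gdim X)) (graded_braid \<chi> Y Z)"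
    proof (rule graded_tensor3_ext[OF X Y Z])
      fix x y z u v w assume u: "u \<in> gcomp X x" and v: "v \<in> gcomp Y y" and w: "w \<in> gcomp Z z"
      note dims = gcomp_dim[OF X u] gcomp_dim[OF Y v] gcomp_dim[OF Z w]
      show "graded_braid \<chi> (graded_tensor X Y) Z *\<^sub>v tensor_vec u (tensor_vec v w) =
          tensor_mat (graded_braid \<chi> X Z) (1\<^sub>m (gdim Y)) * tensor_mat (1\<^sub>m (gdim X)) (graded_braid \<chi> Y Z) *\<^sub>v tensor_vec u (tensor_vec v w)"
        using X Y Z dims graded_braid_apply[OF XY Z tensor_vec_mem[OF u v] w, of \<chi>]
        by (simp add: tensor_apply mult.assoc graded_braid_apply[OF X Z u w] graded_braid_apply[OF Y Z v w] bicharacterD[OF \<chi>] ac_simps)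
    qed (use X Y Z in \<open>auto simp: ac_simps\<close>)
    then show "braid (Vec \<chi>) (X \<otimes>\<^sub>o\<^bsub>Vec \<chi>\<^esub> Y) Z = (braid (Vec \<chi>) X Z \<otimes>\<^sub>m\<^bsub>Vec \<chi>\<^esub> Ident (Vec \<chi>) Y) \<cdot>\<^bsub>Vec \<chi>\<^esub> (Ident (Vec \<chi>) X \<otimes>\<^sub>m\<^bsub>Vec \<chi>\<^esub> braid (Vec \<chi>) Y Z)"
      by simp
    have "graded_braid \<chi> X (graded_tensor Y Z) = tensor_mat (1\<^sub>m (gdim Y)) (graded_braid \<chi> X Z) * tensor_mat (graded_braid \<chi> X Y) (1\<^sub>m (gdim Z))"
    proof (rule graded_tensor3_ext[OF X Y Z])
      fix x y z u v w assume u: "u \<in> gcomp X x" and v: "v \<in> gcomp Y y" and w: "w \<in> gcomp Z z"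
      note dims = gcomp_dim[OF X u] gcomp_dim[OF Y v] gcomp_dim[OF Z w]
      show "graded_braid \<chi> X (graded_tensor Y Z) *\<^sub>v tensor_vec u (tensor_vec v w) =
          tensor_mat (1\<^sub>m (gdim Y)) (graded_braid \<chi> X Z) * tensor_mat (graded_braid \<chi> X Y) (1\<^sub>m (gdim Z)) *\<^sub>v tensor_vec u (tensor_vec v w)"
        using X Y Z dims graded_braid_apply[OF X YZ u tensor_vec_mem[OF v w], of \<chi>]
        by (simp add: tensor_apply mult.assoc graded_braid_apply[OF X Z u w] graded_braid_apply[OF X Y u v] bicharacterD[OF \<chi>] ac_simps)
    qed (use X Y Z in \<open>auto simp: ac_simps\<close>)
    then show "braid (Vec \<chi>) X (Y \<otimes>\<^sub>o\<^bsub>Vec \<chi>\<^esub> Z) = (Ident (Vec \<chi>) Y \<otimes>\<^sub>m\<^bsub>Vec \<chi>\<^esub> braid (Vec \<chi>) X Z) \<cdot>\<^bsub>Vec \<chi>\<^esub> (braid (Vec \<chi>) X Y \<otimes>\<^sub>m\<^bsub>Vec \<chi>\<^esub> Ident (Vec \<chi>) Z)"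
      by simp
  qed
qed

lemma strict_rigid_braided_Vec:
  fixes \<chi> :: "'g::{ab_group_add,finite} \<Rightarrow> 'g \<Rightarrow> 'k::field"
  assumes \<chi>: "bicharacter \<chi>"
  shows "strict_rigid_braided_category (Vec \<chi>)"
proof -
  interpret strict_braided_category "Vec \<chi>" by (rule strict_braided_Vec[OF \<chi>])
  show ?thesis
    by unfold_locales (auto simp: graded_ev_hom graded_coev_hom zigzag_left zigzag_right)
qed

section \<open>The double dual functor and its monoidal structure\<close>

lemma transpose_arr_Vec:
  fixes f :: "'k::field mat"
  assumes "f \<in> carrier_mat (gdim Y) (gdim X)"
  shows "transpose_arr (Vec \<chi>) X Y f = f\<^sup>T"
proof (rule mat_ext[of _ _ "gdim Y"])
  fix v :: "'k vec" assume v: "dim_vec v = gdim Y"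
  have f: "dim_row f = gdim Y" "dim_col f = gdim X" using assms by auto
  have "transpose_arr (Vec \<chi>) X Y f *\<^sub>v v =
      vec_sum (gdim X) {0..<gdim X} (\<lambda>i. (v \<bullet> (f *\<^sub>v unit_vec (gdim X) i)) \<cdot>\<^sub>v unit_vec (gdim X) i)"
    using v f by (simp add: transpose_arr_def coev_right_apply mult_mat_vec_sum_dim tensor_mat_vec_mult ev_left_apply mult.assoc)
  also have "\<dots> = vec_sum (gdim X) {0..<gdim X} (\<lambda>i. ((f\<^sup>T *\<^sub>v v) \<bullet> unit_vec (gdim X) i) \<cdot>\<^sub>v unit_vec (gdim X) i)"
    by (intro vec_sum_cong refl, subst transpose_scalar_prod[OF assms]) (use v in \<open>auto intro: carrier_vecI\<close>)
  also have "\<dots> = f\<^sup>T *\<^sub>v v" using f by simp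
  finally show "transpose_arr (Vec \<chi>) X Y f *\<^sub>v v = f\<^sup>T *\<^sub>v v" .
qed (use assms in \<open>auto simp: transpose_arr_def\<close>)

lemma ddual_arr_Vec:
  assumes "f \<in> carrier_mat (gdim Y) (gdim X)"
  shows "ddual_arr (Vec \<chi>) X Y f = f"
  using assms by (simp add: ddual_arr_def transpose_arr_Vec)

lemma swap_mat_transpose: "(swap_mat m n)\<^sup>T = (swap_mat n m :: 'k::field mat)"
proof (rule eq_matI)
  fix i j assume "i < dim_row (swap_mat n m :: 'k mat)" "j < dim_col (swap_mat n m :: 'k mat)"
  then have i: "i < m * n" and j: "j < n * m" by auto
  have "i = (j mod m) * n + j div m \<longleftrightarrow> j = (i mod n) * m + i div n"
    using less_mult_imp_div_mod[OF i] less_mult_imp_div_mod[OF j] by auto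
  then show "(swap_mat m n)\<^sup>T $$ (i, j) = (swap_mat n m :: 'k mat) $$ (i, j)"
    using i j by (simp add: swap_mat_def)
qed auto

text \<open>In coordinates a functional on \<open>X \<otimes> Y\<close> has its indices in the order
  of \<open>X \<otimes> Y\<close>, whereas the tensor product of the duals is taken in the reversed
  order. The canonical comparison is therefore the flip.\<close>

lemma ldual_untensor_Vec:
  fixes X Y :: "('g::{ab_group_add,finite}, 'k::field) graded_space"
  shows "ldual_untensor (Vec \<chi>) X Y = swap_mat (gdim X) (gdim Y)"
proof (rule mat_eq_if_tensor_vec)
  let ?m = "gdim X" and ?n = "gdim Y"
  define c where "c = tensor_mat (1\<^sub>m ?m) (tensor_mat (graded_coev Y) (1\<^sub>m ?m)) * (graded_coev X :: 'k mat)"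
  have c [simp]: "dim_row c = ?m * (?n * ?n * ?m)" "dim_col c = Suc 0" by (simp_all add: c_def)
  have L: "ldual_untensor (Vec \<chi>) X Y =
      tensor_mat (graded_ev (graded_tensor X Y)) (1\<^sub>m (?n * ?m)) * tensor_mat (1\<^sub>m (?m * ?n)) c"
    by (simp add: ldual_untensor_def ldual_comparison_def c_def)
  show "ldual_untensor (Vec \<chi>) X Y \<in> carrier_mat (?n * ?m) (?m * ?n)" unfolding L by (auto simp: ac_simps)
  fix v w :: "'k vec" assume "v \<in> carrier_vec ?m" "w \<in> carrier_vec ?n"
  then have d: "dim_vec v = ?m" "dim_vec w = ?n" by auto
  let ?e = "unit_vec ?m" and ?f = "unit_vec ?n"
  let ?N = "?m * ?n * (?n * ?m)"
  have "c *\<^sub>v unit_vec (Suc 0) 0 = vec_sum ?N {0..<?m} (\<lambda>i. vec_sum ?N {0..<?n}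
      (\<lambda>j. tensor_vec (?e i) (tensor_vec (?f j) (tensor_vec (?f j) (?e i)))))"
    by (simp add: c_def graded_coev_apply mult_mat_vec_sum_dim tensor_mat_vec_mult coev_left_apply
      tensor_vec_sum_dim ac_simps)
  then have "tensor_mat (1\<^sub>m (?m * ?n)) c *\<^sub>v tensor_vec (tensor_vec v w) (unit_vec (Suc 0) 0) =
      vec_sum (?m * ?n * ?N) {0..<?m} (\<lambda>i. vec_sum (?m * ?n * ?N) {0..<?n}
      (\<lambda>j. tensor_vec (tensor_vec v w) (tensor_vec (tensor_vec (?e i) (?f j)) (tensor_vec (?f j) (?e i)))))"
    using d by (subst tensor_mat_vec_mult) (simp_all add: tensor_vec_sum_dim tensor_vec_assoc mult.assoc del: tensor_vec_unit)
  then have "ldual_untensor (Vec \<chi>) X Y *\<^sub>v tensor_vec v w = vec_sum (?n * ?m) {0..<?m} (\<lambda>i. vec_sum (?n * ?m) {0..<?n}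
      (\<lambda>j. ((v \<bullet> ?e i) * (w \<bullet> ?f j)) \<cdot>\<^sub>v tensor_vec (?f j) (?e i)))"
    unfolding L using d
    by (simp add: mult_mat_vec_sum_dim ev_left_apply tensor_vec_scalar_prod ac_simps del: tensor_vec_assoc)
  also have "\<dots> = vec_sum (?n * ?m) {0..<?m} (\<lambda>i. tensor_vec w ((v \<bullet> ?e i) \<cdot>\<^sub>v ?e i))"
  proof (intro vec_sum_cong refl)
    fix i
    have "vec_sum (?n * ?m) {0..<?n} (\<lambda>j. ((v \<bullet> ?e i) * (w \<bullet> ?f j)) \<cdot>\<^sub>v tensor_vec (?f j) (?e i)) =
        vec_sum (?n * ?m) {0..<?n} (\<lambda>j. tensor_vec ((w \<bullet> ?f j) \<cdot>\<^sub>v ?f j) ((v \<bullet> ?e i) \<cdot>\<^sub>v ?e i))"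
      by (intro vec_sum_cong) (auto simp: ac_simps)
    also have "\<dots> = tensor_vec w ((v \<bullet> ?e i) \<cdot>\<^sub>v ?e i)"
      using d by (subst tensor_vec_sum_left[symmetric]) auto
    finally show "vec_sum (?n * ?m) {0..<?n} (\<lambda>j. ((v \<bullet> ?e i) * (w \<bullet> ?f j)) \<cdot>\<^sub>v tensor_vec (?f j) (?e i)) =
      tensor_vec w ((v \<bullet> ?e i) \<cdot>\<^sub>v ?e i)" .
  qed
  also have "\<dots> = tensor_vec w v"
    using d by (subst tensor_vec_sum_right[symmetric]) (auto intro: carrier_vecI)
  finally show "ldual_untensor (Vec \<chi>) X Y *\<^sub>v tensor_vec v w = swap_mat ?m ?n *\<^sub>v tensor_vec v w"
    using d by (simp add: swap_mat_apply)
qed auto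

lemma ldual_tensor_Vec:
  fixes X Y :: "('g::{ab_group_add,finite}, 'k::field) graded_space"
  shows "ldual_tensor (Vec \<chi>) X Y = swap_mat (gdim Y) (gdim X)"
proof (rule mat_eq_if_tensor_vec)
  let ?m = "gdim X" and ?n = "gdim Y"
  define e where "e = graded_ev Y * tensor_mat (1\<^sub>m ?n) (tensor_mat (graded_ev X) (1\<^sub>m ?n) :: 'k mat)"
  have e [simp]: "dim_row e = Suc 0" "dim_col e = ?n * (?m * ?m * ?n)" by (simp_all add: e_def)
  have L: "ldual_tensor (Vec \<chi>) X Y = tensor_mat e (1\<^sub>m (?m * ?n)) * tensor_mat (1\<^sub>m (?n * ?m)) (graded_coev (graded_tensor X Y))"
    by (simp add: ldual_tensor_def ldual_comparison_def e_def)
  show "ldual_tensor (Vec \<chi>) X Y \<in> carrier_mat (?m * ?n) (?n * ?m)" unfolding L by (auto simp: ac_simps)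
  fix v w :: "'k vec" assume "v \<in> carrier_vec ?n" "w \<in> carrier_vec ?m"
  then have d: "dim_vec v = ?n" "dim_vec w = ?m" by auto
  have e_apply: "e *\<^sub>v tensor_vec (tensor_vec v w) t = (tensor_vec w v \<bullet> t) \<cdot>\<^sub>v unit_vec (Suc 0) 0"
    if t: "t = unit_vec (?m * ?n) k" "k < ?m * ?n" for t k
  proof -
    define a where "a = (unit_vec ?m (k div ?n) :: 'k vec)"
    define b where "b = (unit_vec ?n (k mod ?n) :: 'k vec)"
    have ab: "dim_vec a = ?m" "dim_vec b = ?n" by (simp_all add: a_def b_def)
    have tab: "t = tensor_vec a b" using t by (simp add: unit_vec_tensor a_def b_def)
    show ?thesis unfolding tab using d ab
      by (simp add: e_def tensor_vec_assoc tensor_mat_vec_mult ev_left_apply graded_ev_apply tensor_vec_scalar_prod)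
  qed
  let ?g = "unit_vec (?m * ?n)"
  have "ldual_tensor (Vec \<chi>) X Y *\<^sub>v tensor_vec v w =
      vec_sum (?m * ?n) {0..<?m * ?n} (\<lambda>k. tensor_mat e (1\<^sub>m (?m * ?n)) *\<^sub>v tensor_vec (tensor_vec v w) (tensor_vec (?g k) (?g k)))"
    unfolding L using d by (simp add: coev_right_apply mult_mat_vec_sum_dim ac_simps)
  also have "\<dots> = vec_sum (?m * ?n) {0..<?m * ?n} (\<lambda>k. (tensor_vec w v \<bullet> ?g k) \<cdot>\<^sub>v ?g k)"
    using d by (intro vec_sum_cong refl, subst tensor_mat_vec_mult_assoc) (auto simp: e_apply ac_simps)
  also have "\<dots> = tensor_vec w v" using d by simp
  finally show "ldual_tensor (Vec \<chi>) X Y *\<^sub>v tensor_vec v w = swap_mat ?n ?m *\<^sub>v tensor_vec v w"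
    using d by (simp add: swap_mat_apply)
qed auto

text \<open>One flip comes from the transpose of \<open>ldual_untensor\<close>, the other from
  \<open>ldual_tensor\<close> for the duals, and they are inverse to each other. Thus the canonical
  isomorphism disappears from \<open>HH_structure\<close>.\<close>

lemma ddual_tensor_Vec:
  fixes X Y :: "('g::{ab_group_add,finite}, 'k::field) graded_space"
  shows "ddual_tensor (Vec \<chi>) X Y = 1\<^sub>m (gdim X * gdim Y)"
proof -
  have "transpose_arr (Vec \<chi>) (graded_dual (graded_tensor X Y)) (graded_tensor (graded_dual Y) (graded_dual X))
      (swap_mat (gdim X) (gdim Y)) = (swap_mat (gdim X) (gdim Y))\<^sup>T"
    by (rule transpose_arr_Vec) auto
  then show ?thesis
    by (simp add: ddual_tensor_def ldual_untensor_Vec ldual_tensor_Vec swap_mat_transpose swap_mat_involution)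
qed

lemma ddual_unit_Vec: "ddual_unit (Vec \<chi>) = 1\<^sub>m (Suc 0)"
proof -
  have ev: "graded_ev graded_unit = 1\<^sub>m (Suc 0)" and coev: "graded_coev graded_unit = 1\<^sub>m (Suc 0)"
    by (rule eq_matI; auto simp: graded_ev_def graded_coev_def)+
  have "transpose_arr (Vec \<chi>) (graded_dual graded_unit) graded_unit (1\<^sub>m (Suc 0)) = (1\<^sub>m (Suc 0))\<^sup>T"
    by (rule transpose_arr_Vec) auto
  then show ?thesis by (simp add: ddual_unit_def ev coev)
qed

section \<open>Anti-twists given by characters\<close>

lemma natural_iso_graded_scaling:
  fixes \<chi> :: "'g::{ab_group_add,finite} \<Rightarrow> 'g \<Rightarrow> 'k::field"
  assumes "\<And>x. f x \<noteq> 0"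
  shows "ident_automorphism (Vec \<chi>) (graded_scaling f)"
proof -
  have "inverse_arrows (Vec \<chi>) V V (graded_scaling f V) (graded_scaling (\<lambda>x. inverse (f x)) V)" if "graded_space V" for V
    using that assms by (simp add: inverse_arrows_def graded_scaling_hom graded_scaling_mult graded_scaling_one)
  then show ?thesis
    by (auto simp: ident_automorphism_def natural_iso_def iso_arrow_def graded_scaling_commute)
qed

text \<open>When \<open>\<chi> (x + y) (- (x + y))\<close> is expanded, the two cross terms form the
  scalar of the inverse double braiding, and the remaining terms belong to \<open>x\<close> and
  \<open>y\<close> alone. The factor \<open>l\<close> is multiplicative.\<close>

lemma anti_twist_character:
  fixes \<chi> :: "'g::{ab_group_add,finite} \<Rightarrow> 'g \<Rightarrow> 'k::field"
  assumes \<chi>: "bicharacter \<chi>" and l: "l \<in> character_group"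
  shows "anti_twist (Vec \<chi>) (character_anti_twist \<chi> l)"
  unfolding anti_twist_def
proof (intro conjI ballI)
  show "ident_automorphism (Vec \<chi>) (character_anti_twist \<chi> l)"
    unfolding character_anti_twist_def using \<chi> l
    by (intro natural_iso_graded_scaling) (auto simp: bicharacterD character_group_def)
  fix X Y :: "('g, 'k) graded_space" assume "X \<in> Ob (Vec \<chi>)" "Y \<in> Ob (Vec \<chi>)"
  then have X: "graded_space X" and Y: "graded_space Y" by auto
  note XY = graded_space_tensor[OF X Y]
  let ?s = "character_anti_twist \<chi> l"
  let ?t = "graded_braid \<chi> Y X * graded_braid \<chi> X Y"
  let ?t' = "graded_braid_inv \<chi> Y X * graded_braid_inv \<chi> X Y"
  have "inverse_arrows (Vec \<chi>) (graded_tensor X Y) (graded_tensor X Y) ?t ?t'"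
  proof -
    have one: "\<chi> x y * \<chi> y x * (inverse (\<chi> y x) * inverse (\<chi> x y)) = 1"
      "inverse (\<chi> y x) * inverse (\<chi> x y) * (\<chi> x y * \<chi> y x) = 1" for x y
      using bicharacterD(1)[OF \<chi>] by (simp_all add: field_simps)
    have "?t' * ?t = 1\<^sub>m (gdim X * gdim Y)"
      by (rule graded_tensor_ext[OF X Y])
        (use X Y in \<open>simp_all add: graded_braid_apply graded_braid_inv_apply gcomp_dim one\<close>)
    moreover have "?t * ?t' = 1\<^sub>m (gdim X * gdim Y)"
      by (rule graded_tensor_ext[OF X Y])
        (use X Y in \<open>simp_all add: graded_braid_apply graded_braid_inv_apply gcomp_dim one\<close>)
    ultimately show ?thesis
      using graded_braid_hom[OF X Y] graded_braid_hom[OF Y X]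
      by (auto simp: inverse_arrows_def graded_braid_inv_def intro!: graded_hom_mult X Y graded_space_tensor)
  qed
  then have inv: "inv_arrow (Vec \<chi>) (graded_tensor X Y) (graded_tensor X Y) ?t = ?t'"
    by (rule category.inv_arrow_eqI[OF category_Vec, rotated -1]) (use XY in auto)
  have "?s (graded_tensor X Y) = ?t' * tensor_mat (?s X) (?s Y)"
  proof (rule graded_tensor_ext[OF X Y])
    fix x y v w assume v: "v \<in> gcomp X x" and w: "w \<in> gcomp Y y"
    show "?s (graded_tensor X Y) *\<^sub>v tensor_vec v w = ?t' * tensor_mat (?s X) (?s Y) *\<^sub>v tensor_vec v w"
      using X Y l graded_scaling_apply[OF XY tensor_vec_mem[OF v w]] gcomp_dim[OF X v] gcomp_dim[OF Y w]
      by (simp add: character_anti_twist_def tensor_apply graded_scaling_apply[OF X v] graded_scaling_apply[OF Y w]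
          graded_braid_inv_apply[OF X Y v w] graded_braid_inv_apply[OF Y X w v] bicharacterD[OF \<chi>]
          character_group_def field_simps flip: diff_conv_add_uminus minus_add_distrib)
  qed (use X Y in \<open>auto simp: character_anti_twist_def\<close>)
  then show "?s (X \<otimes>\<^sub>o\<^bsub>Vec \<chi>\<^esub> Y) = inv_arrow (Vec \<chi>) (X \<otimes>\<^sub>o\<^bsub>Vec \<chi>\<^esub> Y) (X \<otimes>\<^sub>o\<^bsub>Vec \<chi>\<^esub> Y)
      (braid (Vec \<chi>) Y X \<cdot>\<^bsub>Vec \<chi>\<^esub> braid (Vec \<chi>) X Y) \<cdot>\<^bsub>Vec \<chi>\<^esub> (?s X \<otimes>\<^sub>m\<^bsub>Vec \<chi>\<^esub> ?s Y)"
    by (simp add: inv)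
qed

section \<open>Module categories of graded representations\<close>

lemma (in category) inverse_arrows_cmp:
  assumes "X \<in> Ob C" "Y \<in> Ob C" "Z \<in> Ob C"
    and "inverse_arrows C X Y f f'" "inverse_arrows C Y Z g g'"
  shows "inverse_arrows C X Z (g \<cdot> f) (f' \<cdot> g')"
proof -
  note f = assms(4)[unfolded inverse_arrows_def] and g = assms(5)[unfolded inverse_arrows_def]
  have gf: "g \<cdot> f \<in> Hom C X Z" "f' \<cdot> g' \<in> Hom C Z X"
    using cmp_hom f g assms(1-3) by blast+
  have "(f' \<cdot> g') \<cdot> (g \<cdot> f) = f' \<cdot> ((g' \<cdot> g) \<cdot> f)"
    using cmp_assoc[of X Z Y X "g \<cdot> f" g' f'] cmp_assoc[of X Y Z Y f g g'] f g gf assms(1-3) by simp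
  also have "\<dots> = Ident C X" using f g cmp_ident_left[of X Y f] assms(1-3) by simp
  finally have 1: "(f' \<cdot> g') \<cdot> (g \<cdot> f) = Ident C X" .
  have "(g \<cdot> f) \<cdot> (f' \<cdot> g') = g \<cdot> ((f \<cdot> f') \<cdot> g')"
    using cmp_assoc[of Z X Y Z "f' \<cdot> g'" f g] cmp_assoc[of Z Y X Y g' f' f] f g gf assms(1-3) by simp
  also have "\<dots> = Ident C Z" using f g cmp_ident_left[of Z Y g'] assms(1-3) by simp
  finally show ?thesis using 1 gf by (simp add: inverse_arrows_def)
qed

lemma inverse_arrows_sym: "inverse_arrows C X Y f g \<Longrightarrow> inverse_arrows C Y X g f"
  by (simp add: inverse_arrows_def)

lemma inverse_arrows_iso: "inverse_arrows C X Y f g \<Longrightarrow> iso_arrow C X Y f"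
  by (auto simp: iso_arrow_def)

lemma graded_scaling_tensor:
  fixes f :: "'g::{ab_group_add,finite} \<Rightarrow> 'k::field"
  assumes "graded_space V" "graded_space W" "\<And>x y. f (x + y) = f x * f y"
  shows "graded_scaling f (graded_tensor V W) = tensor_mat (graded_scaling f V) (graded_scaling f W)"
proof (rule graded_tensor_ext[OF assms(1,2)])
  fix x y v w assume v: "v \<in> gcomp V x" and w: "w \<in> gcomp W y"
  show "graded_scaling f (graded_tensor V W) *\<^sub>v tensor_vec v w = tensor_mat (graded_scaling f V) (graded_scaling f W) *\<^sub>v tensor_vec v w"
    using assms gcomp_dim[OF assms(1) v] gcomp_dim[OF assms(2) w]
    by (simp add: tensor_mat_vec_mult graded_scaling_apply[OF graded_space_tensor[OF assms(1,2)] tensor_vec_mem[OF v w]]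
      graded_scaling_apply[OF assms(1) v] graded_scaling_apply[OF assms(2) w] mult.commute)
qed (use assms in auto)

lemma graded_scaling_line:
  fixes f :: "'g::{ab_group_add,finite} \<Rightarrow> 'k::field"
  shows "graded_scaling f (line x) = f x \<cdot>\<^sub>m 1\<^sub>m (Suc 0)"
  by (rule line_ext) (simp_all add: graded_scaling_apply[OF graded_space_line line_mem])

lemma graded_scaling_unit:
  fixes f :: "'g::{ab_group_add,finite} \<Rightarrow> 'k::field"
  assumes "f 0 = 1"
  shows "graded_scaling f graded_unit = 1\<^sub>m (Suc 0)"
proof -
  have "1 \<cdot>\<^sub>m (1\<^sub>m (Suc 0) :: 'k mat) = 1\<^sub>m (Suc 0)" by (rule eq_matI) auto
  then show ?thesis unfolding line_zero[symmetric] graded_scaling_line using assms by simp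
qed

section \<open>Representations that preserve the grading, and the action on them\<close>

definition graded_rep :: "('g::{ab_group_add,finite}, 'k::field) graded_space \<Rightarrow> ('g \<Rightarrow> 'k mat) \<Rightarrow> bool" where
  "graded_rep V T \<longleftrightarrow> (\<forall>z. T z \<in> graded_hom V V) \<and> T 0 = 1\<^sub>m (gdim V) \<and> (\<forall>z w. T (z + w) = T z * T w)"

lemma graded_repD:
  assumes "graded_rep V T"
  shows "T z \<in> graded_hom V V" "T 0 = 1\<^sub>m (gdim V)" "T (z + w) = T z * T w"
    "T z \<in> carrier_mat (gdim V) (gdim V)" "dim_row (T z) = gdim V" "dim_col (T z) = gdim V"
    "v \<in> gcomp V x \<Longrightarrow> T z *\<^sub>v v \<in> gcomp V x"
    "dim_vec v = gdim V \<Longrightarrow> T z *\<^sub>v (T w *\<^sub>v v) = T (z + w) *\<^sub>v v"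
    "T z * T w = T w * T z"
proof -
  note r = assms[unfolded graded_rep_def]
  show T: "T z \<in> graded_hom V V" for z using r by blast
  show add: "T 0 = 1\<^sub>m (gdim V)" "T (z + w) = T z * T w" for z w using r by blast+
  show "T z \<in> carrier_mat (gdim V) (gdim V)" and d: "dim_row (T z) = gdim V" "dim_col (T z) = gdim V" for z
    using graded_homD[OF T] by blast+
  show "v \<in> gcomp V x \<Longrightarrow> T z *\<^sub>v v \<in> gcomp V x" using graded_homD[OF T] by blast
  show "dim_vec v = gdim V \<Longrightarrow> T z *\<^sub>v (T w *\<^sub>v v) = T (z + w) *\<^sub>v v"
    by (simp add: add d)
  show "T z * T w = T w * T z" by (metis add(2) add.commute)
qed

text \<open>The sign of \<open>z\<close> reflects that in \<open>HH(B)\<close> a line of degree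
  \<open>z\<close> passes \<open>X\<close> by an inverse braiding: \<open>\<chi> x (- z)\<close> is
  the inverse of \<open>\<chi> x z\<close>.\<close>

definition tensor_rep :: "('g::{ab_group_add,finite} \<Rightarrow> 'g \<Rightarrow> 'k::field) \<Rightarrow> ('g, 'k) graded_space \<Rightarrow> ('g \<Rightarrow> 'k mat) \<Rightarrow> 'g \<Rightarrow> 'k mat" where
  "tensor_rep \<chi> X T = (\<lambda>z. tensor_mat (graded_scaling (\<lambda>x. \<chi> x (- z)) X) (T z))"

lemma tensor_rep_apply:
  assumes "graded_space X" "graded_rep V T" "v \<in> gcomp X x" "dim_vec w = gdim V"
  shows "tensor_rep \<chi> X T z *\<^sub>v tensor_vec v w = \<chi> x (- z) \<cdot>\<^sub>v tensor_vec v (T z *\<^sub>v w)"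
  using assms by (simp add: tensor_rep_def tensor_mat_vec_mult graded_repD graded_scaling_apply gcomp_dim)

lemma graded_rep_tensor:
  assumes \<chi>: "bicharacter \<chi>" and X: "graded_space X" and V: "graded_space V" and T: "graded_rep V T"
  shows "graded_rep (graded_tensor X V) (tensor_rep \<chi> X T)"
  unfolding graded_rep_def
proof (intro conjI allI)
  show "tensor_rep \<chi> X T z \<in> graded_hom (graded_tensor X V) (graded_tensor X V)" for z
    unfolding tensor_rep_def using X V T by (intro tensor_mat_hom graded_scaling_hom) (auto simp: graded_repD)
  show "tensor_rep \<chi> X T 0 = 1\<^sub>m (gdim (graded_tensor X V))"
    using X by (simp add: tensor_rep_def graded_repD[OF T] bicharacterD[OF \<chi>] graded_scaling_one)
  show "tensor_rep \<chi> X T (z + w) = tensor_rep \<chi> X T z * tensor_rep \<chi> X T w" for z w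
    using X by (simp add: tensor_rep_def graded_repD[OF T] bicharacterD[OF \<chi>] graded_scaling_mult flip: tensor_mat_mult minus_add_distrib)
qed

lemma tensor_rep_assoc:
  assumes \<chi>: "bicharacter \<chi>" and X: "graded_space X" and Y: "graded_space Y"
  shows "tensor_rep \<chi> (graded_tensor X Y) T = tensor_rep \<chi> X (tensor_rep \<chi> Y T)"
  using X Y by (simp add: tensor_rep_def graded_scaling_tensor bicharacterD[OF \<chi>] tensor_mat_assoc)

lemma tensor_rep_unit:
  assumes \<chi>: "bicharacter \<chi>"
  shows "tensor_rep \<chi> graded_unit T = T"
  by (simp add: tensor_rep_def graded_scaling_unit bicharacterD[OF \<chi>])

text \<open>Common description of \<open>HH(B)\<close> and of the modules of anti-twists: an object \<open>N\<close> is a graded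
  space \<open>U N\<close> with a representation \<open>R N\<close> of the group which preserves the grading. In the case of
  \<open>HH(B)\<close>, \<open>R N z\<close> is the half braiding with a line of degree \<open>z\<close>.\<close>

locale graded_rep_module =
  fixes \<chi> :: "'g::{ab_group_add,finite} \<Rightarrow> 'g \<Rightarrow> 'k::field"
    and M :: "(('g, 'k) graded_space, 'k mat, 'x, 'k mat) stable_braided_module"
    and U :: "'x \<Rightarrow> ('g, 'k) graded_space" and R :: "'x \<Rightarrow> 'g \<Rightarrow> 'k mat"
  assumes bichar: "bicharacter \<chi>"
    and space: "N \<in> Ob M \<Longrightarrow> graded_space (U N)"
    and rep: "N \<in> Ob M \<Longrightarrow> graded_rep (U N) (R N)"
    and Hom_eq: "N \<in> Ob M \<Longrightarrow> N' \<in> Ob M \<Longrightarrow>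
      Hom M N N' = {f \<in> graded_hom (U N) (U N'). \<forall>z. f * R N z = R N' z * f}"
    and Ident_eq: "N \<in> Ob M \<Longrightarrow> Ident M N = 1\<^sub>m (gdim (U N))"
    and Cmp_eq: "Cmp M = (\<lambda>A C. A * C)"
    and act_arr_eq: "act_arr M = tensor_mat"
    and act_closed: "graded_space X \<Longrightarrow> N \<in> Ob M \<Longrightarrow> act_ob M X N \<in> Ob M"
    and space_act: "graded_space X \<Longrightarrow> N \<in> Ob M \<Longrightarrow> U (act_ob M X N) = graded_tensor X (U N)"
    and rep_act: "graded_space X \<Longrightarrow> N \<in> Ob M \<Longrightarrow> R (act_ob M X N) = tensor_rep \<chi> X (R N)"
    and act_tensor: "graded_space X \<Longrightarrow> graded_space Y \<Longrightarrow> N \<in> Ob M \<Longrightarrow>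
      act_ob M (graded_tensor X Y) N = act_ob M X (act_ob M Y N)"
    and act_unit: "N \<in> Ob M \<Longrightarrow> act_ob M graded_unit N = N"
    and mstable_carrier: "N \<in> Ob M \<Longrightarrow> mstable M N \<in> carrier_mat (gdim (U N)) (gdim (U N))"
    and mstable_apply: "N \<in> Ob M \<Longrightarrow> v \<in> gcomp (U N) y \<Longrightarrow> mstable M N *\<^sub>v v = R N y *\<^sub>v v"
    and mbraid_eq: "graded_space X \<Longrightarrow> N \<in> Ob M \<Longrightarrow> mbraid M X N = mstable M (act_ob M X N) *
      inv_arrow (Vec \<chi>) (graded_tensor X (U N)) (graded_tensor X (U N)) (tensor_mat (1\<^sub>m (gdim X)) (mstable M N))"
begin

lemma dim_rep [simp]: "N \<in> Ob M \<Longrightarrow> dim_row (R N z) = gdim (U N)" "N \<in> Ob M \<Longrightarrow> dim_col (R N z) = gdim (U N)"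
  using graded_repD(5,6)[OF rep] by auto

lemma dim_mstable [simp]: "N \<in> Ob M \<Longrightarrow> dim_row (mstable M N) = gdim (U N)" "N \<in> Ob M \<Longrightarrow> dim_col (mstable M N) = gdim (U N)"
  using mstable_carrier by auto

lemma homD:
  assumes "f \<in> Hom M N N'" "N \<in> Ob M" "N' \<in> Ob M"
  shows "f \<in> graded_hom (U N) (U N')" "f * R N z = R N' z * f"
    "dim_row f = gdim (U N')" "dim_col f = gdim (U N)"
    "dim_vec v = gdim (U N) \<Longrightarrow> f *\<^sub>v (R N z *\<^sub>v v) = R N' z *\<^sub>v (f *\<^sub>v v)"
    "v \<in> gcomp (U N) x \<Longrightarrow> f *\<^sub>v v \<in> gcomp (U N') x"
proof -
  show f: "f \<in> graded_hom (U N) (U N')" and c: "f * R N z = R N' z * f"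
    using assms by (auto simp: Hom_eq)
  show d: "dim_row f = gdim (U N')" "dim_col f = gdim (U N)" using graded_homD[OF f] by auto
  show "dim_vec v = gdim (U N) \<Longrightarrow> f *\<^sub>v (R N z *\<^sub>v v) = R N' z *\<^sub>v (f *\<^sub>v v)"
    using c d assms by (metis dim_rep mult_mat_vec_assoc)
  show "v \<in> gcomp (U N) x \<Longrightarrow> f *\<^sub>v v \<in> gcomp (U N') x" using graded_homD[OF f] by auto
qed

lemma category: "category M"
proof
  fix X Y Z f g assume ob: "X \<in> Ob M" "Y \<in> Ob M" "Z \<in> Ob M" and f: "f \<in> Hom M X Y" and g: "g \<in> Hom M Y Z"
  have "g * f * R X z = R Z z * (g * f)" for z
    by (rule mat_ext[of _ _ "gdim (U X)"]) (use ob in \<open>simp_all add: homD[OF f] homD[OF g]\<close>)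
  then show "g \<cdot>\<^bsub>M\<^esub> f \<in> Hom M X Z"
    using graded_hom_mult[OF space homD(1)[OF f] homD(1)[OF g]] ob by (simp add: Cmp_eq Hom_eq)
next
  fix W X Y Z f g h assume "W \<in> Ob M" "X \<in> Ob M" "Y \<in> Ob M" "Z \<in> Ob M"
    "f \<in> Hom M W X" "g \<in> Hom M X Y" "h \<in> Hom M Y Z"
  then show "(h \<cdot>\<^bsub>M\<^esub> g) \<cdot>\<^bsub>M\<^esub> f = h \<cdot>\<^bsub>M\<^esub> (g \<cdot>\<^bsub>M\<^esub> f)"
    unfolding Cmp_eq by (auto simp: Hom_eq intro!: assoc_mult_mat graded_homD(1))
qed (auto simp: Ident_eq Cmp_eq Hom_eq space graded_homD)

lemma inverse_arrowsI:
  assumes N: "N \<in> Ob M" "N' \<in> Ob M" and f: "f \<in> Hom M N N'"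
    and f': "dim_row f' = gdim (U N)" "dim_col f' = gdim (U N')"
    and inv: "f' * f = 1\<^sub>m (gdim (U N))" "f * f' = 1\<^sub>m (gdim (U N'))"
  shows "inverse_arrows M N N' f f'"
proof -
  note d = homD(3,4)[OF f N]
  have f'f: "f' *\<^sub>v (f *\<^sub>v v) = v" if "dim_vec v = gdim (U N)" for v
    using inv(1) that f' d by (metis mult_mat_vec_assoc one_mult_mat_vec_dim)
  have ff': "f *\<^sub>v (f' *\<^sub>v v) = v" if "dim_vec v = gdim (U N')" for v
    using inv(2) that f' d by (metis mult_mat_vec_assoc one_mult_mat_vec_dim)
  have "f' \<in> graded_hom (U N') (U N)"
    by (rule inverse_graded_hom[OF _ _ homD(1)[OF f]]) (use N f' inv space in auto)
  moreover have "f' * R N' z = R N z * f'" for z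
  proof (rule mat_ext[of _ _ "gdim (U N')"])
    fix v :: "'k vec" assume v: "dim_vec v = gdim (U N')"
    have "f' *\<^sub>v (R N' z *\<^sub>v v) = f' *\<^sub>v (R N' z *\<^sub>v (f *\<^sub>v (f' *\<^sub>v v)))" using v by (simp add: ff')
    also have "\<dots> = f' *\<^sub>v (f *\<^sub>v (R N z *\<^sub>v (f' *\<^sub>v v)))" using N v f' by (simp add: homD(5)[OF f])
    also have "\<dots> = R N z *\<^sub>v (f' *\<^sub>v v)" using N by (simp add: f'f)
    finally show "f' * R N' z *\<^sub>v v = R N z * f' *\<^sub>v v" using N v f' by simp
  qed (use N f' in auto)
  ultimately have "f' \<in> Hom M N' N" using N by (simp add: Hom_eq)
  then show ?thesis using f inv N by (simp add: inverse_arrows_def Ident_eq Cmp_eq)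
qed

lemma strict_module: "strict_module_category (Vec \<chi>) M"
proof -
  interpret strict_rigid_braided_category "Vec \<chi>" by (rule strict_rigid_braided_Vec[OF bichar])
  interpret M: category M by (rule category)
  show ?thesis
  proof
    fix X X' N N' f h
    assume "X \<in> Ob (Vec \<chi>)" "X' \<in> Ob (Vec \<chi>)" and N: "N \<in> Ob M" "N' \<in> Ob M"
      and "f \<in> Hom (Vec \<chi>) X X'" and h: "h \<in> Hom M N N'"
    then have X: "graded_space X" "graded_space X'" and f: "f \<in> graded_hom X X'" by auto
    have "tensor_mat f h * tensor_rep \<chi> X (R N) z = tensor_rep \<chi> X' (R N') z * tensor_mat f h" for z
      unfolding tensor_rep_def
      using X N by (simp add: graded_scaling_commute f homD[OF h] graded_homD[OF f] flip: tensor_mat_mult)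
    moreover have "tensor_mat f h \<in> graded_hom (graded_tensor X (U N)) (graded_tensor X' (U N'))"
      using X N space f homD(1)[OF h] by (intro tensor_mat_hom) auto
    ultimately show "f \<rhd>\<^sub>m\<^bsub>M\<^esub> h \<in> Hom M (X \<rhd>\<^sub>o\<^bsub>M\<^esub> N) (X' \<rhd>\<^sub>o\<^bsub>M\<^esub> N')"
      using X N by (simp add: Hom_eq act_closed space_act rep_act act_arr_eq)
  next
    fix X X' X'' N N' N'' f f' h h'
    assume "f \<in> Hom (Vec \<chi>) X X'" "f' \<in> Hom (Vec \<chi>) X' X''" "h \<in> Hom M N N'" "h' \<in> Hom M N' N''"
      "N \<in> Ob M" "N' \<in> Ob M" "N'' \<in> Ob M"
    then show "(f' \<cdot>\<^bsub>Vec \<chi>\<^esub> f) \<rhd>\<^sub>m\<^bsub>M\<^esub> (h' \<cdot>\<^bsub>M\<^esub> h) = (f' \<rhd>\<^sub>m\<^bsub>M\<^esub> h') \<cdot>\<^bsub>M\<^esub> (f \<rhd>\<^sub>m\<^bsub>M\<^esub> h)"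
      by (simp add: Cmp_eq act_arr_eq tensor_mat_mult graded_homD(2,3) homD(3,4))
    next
    show "X \<in> Ob (Vec \<chi>) \<Longrightarrow> N \<in> Ob M \<Longrightarrow> X \<rhd>\<^sub>o\<^bsub>M\<^esub> N \<in> Ob M" for X N
      by (simp add: act_closed)
  next
    show "X \<in> Ob (Vec \<chi>) \<Longrightarrow> N \<in> Ob M \<Longrightarrow> Ident (Vec \<chi>) X \<rhd>\<^sub>m\<^bsub>M\<^esub> Ident M N = Ident M (X \<rhd>\<^sub>o\<^bsub>M\<^esub> N)" for X N
      by (simp add: act_closed Ident_eq act_arr_eq space_act)
  next
    show "X \<in> Ob (Vec \<chi>) \<Longrightarrow> Y \<in> Ob (Vec \<chi>) \<Longrightarrow> N \<in> Ob M \<Longrightarrow>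
      (X \<otimes>\<^sub>o\<^bsub>Vec \<chi>\<^esub> Y) \<rhd>\<^sub>o\<^bsub>M\<^esub> N = X \<rhd>\<^sub>o\<^bsub>M\<^esub> (Y \<rhd>\<^sub>o\<^bsub>M\<^esub> N)" for X Y N
      by (simp add: act_tensor)
  next
    show "(f \<otimes>\<^sub>m\<^bsub>Vec \<chi>\<^esub> g) \<rhd>\<^sub>m\<^bsub>M\<^esub> h = f \<rhd>\<^sub>m\<^bsub>M\<^esub> (g \<rhd>\<^sub>m\<^bsub>M\<^esub> h)" for f g h
      by (simp add: act_arr_eq tensor_mat_assoc)
  next
    show "N \<in> Ob M \<Longrightarrow> unit_ob (Vec \<chi>) \<rhd>\<^sub>o\<^bsub>M\<^esub> N = N" for N
      by (simp add: act_unit)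
  next
    show "Ident (Vec \<chi>) (unit_ob (Vec \<chi>)) \<rhd>\<^sub>m\<^bsub>M\<^esub> h = h" for h
      by (simp add: act_arr_eq)
  qed
qed

text \<open>In degree \<open>y\<close> the stable structure is \<open>R N y\<close>. As
  \<open>R N (- y)\<close> inverts it and preserves the degree, the inverse can be glued degree by
  degree.\<close>

definition mstable_inv :: "'x \<Rightarrow> 'k mat" where
  "mstable_inv N = graded_op (U N) (gdim (U N)) (\<lambda>y. R N (- y))"

lemma dim_mstable_inv [simp]: "dim_row (mstable_inv N) = gdim (U N)" "dim_col (mstable_inv N) = gdim (U N)"
  by (simp_all add: mstable_inv_def graded_op_def)

lemma mstable_inv_apply:
  "N \<in> Ob M \<Longrightarrow> v \<in> gcomp (U N) y \<Longrightarrow> mstable_inv N *\<^sub>v v = R N (- y) *\<^sub>v v"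
  unfolding mstable_inv_def by (rule graded_op_apply[OF space]) (auto intro: graded_repD(4)[OF rep])

lemma mstable_inverse: "N \<in> Ob M \<Longrightarrow> inverse_arrows M N N (mstable M N) (mstable_inv N)"
proof (rule inverse_arrowsI)
  assume N: "N \<in> Ob M"
  note S = space[OF N] and rd = graded_repD[OF rep[OF N]]
  have "mstable M N \<in> graded_hom (U N) (U N)"
    by (rule graded_homI[OF mstable_carrier[OF N]]) (simp add: mstable_apply[OF N] rd)
  moreover have "mstable M N * R N z = R N z * mstable M N" for z
  proof (rule graded_ext[OF S])
    fix y v assume v: "v \<in> gcomp (U N) y"
    show "mstable M N * R N z *\<^sub>v v = R N z * mstable M N *\<^sub>v v"
      using N by (simp add: gcomp_dim[OF S v] mstable_apply[OF N v] mstable_apply[OF N rd(7)[OF v]] rd(5,6,8) add.commute)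
  qed (use N in auto)
  ultimately show "mstable M N \<in> Hom M N N" using N by (simp add: Hom_eq)
  show "mstable_inv N * mstable M N = 1\<^sub>m (gdim (U N))"
    by (rule graded_ext[OF S])
      (use N in \<open>simp_all add: gcomp_dim[OF S] mstable_apply[OF N] mstable_inv_apply[OF N]
        mstable_apply[OF N rd(7)] mstable_inv_apply[OF N rd(7)] rd(5,6,8), simp_all add: rd(2) gcomp_dim[OF S]\<close>)
  show "mstable M N * mstable_inv N = 1\<^sub>m (gdim (U N))"
    by (rule graded_ext[OF S])
      (use N in \<open>simp_all add: gcomp_dim[OF S] mstable_apply[OF N] mstable_inv_apply[OF N]
        mstable_apply[OF N rd(7)] mstable_inv_apply[OF N rd(7)] rd(5,6,8), simp_all add: rd(2) gcomp_dim[OF S]\<close>)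
qed auto

lemma act_mstable_inverse:
  assumes X: "graded_space X" and N: "N \<in> Ob M"
  shows "inverse_arrows M (act_ob M X N) (act_ob M X N) (tensor_mat (1\<^sub>m (gdim X)) (mstable M N)) (tensor_mat (1\<^sub>m (gdim X)) (mstable_inv N))"
proof -
  interpret strict_module_category "Vec \<chi>" M by (rule strict_module)
  note i = mstable_inverse[OF N, unfolded inverse_arrows_def Cmp_eq Ident_eq[OF N]]
  have m: "dim_row (mstable M N) = gdim (U N)" "dim_col (mstable M N) = gdim (U N)" using N by auto
  show ?thesis
  proof (rule inverse_arrowsI)
    show "tensor_mat (1\<^sub>m (gdim X)) (mstable M N) \<in> Hom M (act_ob M X N) (act_ob M X N)"
      using act_hom[of X X N N "1\<^sub>m (gdim X)" "mstable M N"] X N i by (simp add: act_arr_eq)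
    show "tensor_mat (1\<^sub>m (gdim X)) (mstable_inv N) * tensor_mat (1\<^sub>m (gdim X)) (mstable M N) = 1\<^sub>m (gdim (U (act_ob M X N)))"
      using i by (simp add: space_act[OF X N] m flip: tensor_mat_mult)
    show "tensor_mat (1\<^sub>m (gdim X)) (mstable M N) * tensor_mat (1\<^sub>m (gdim X)) (mstable_inv N) = 1\<^sub>m (gdim (U (act_ob M X N)))"
      using i by (simp add: space_act[OF X N] m flip: tensor_mat_mult)
  qed (simp_all add: act_closed[OF X N] space_act[OF X N])
qed

text \<open>The axiom of a stable module inverts in \<open>M\<close>, while the definitions of
  \<open>mbraid\<close> for \<open>HH(B)\<close> and for anti-twist modules invert in the category
  of graded spaces. One matrix serves both.\<close>

lemma inv_arrow_act_mstable:
  assumes X: "graded_space X" and N: "N \<in> Ob M"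
  shows "inv_arrow M (act_ob M X N) (act_ob M X N) (tensor_mat (1\<^sub>m (gdim X)) (mstable M N)) = tensor_mat (1\<^sub>m (gdim X)) (mstable_inv N)"
    "inv_arrow (Vec \<chi>) (graded_tensor X (U N)) (graded_tensor X (U N)) (tensor_mat (1\<^sub>m (gdim X)) (mstable M N)) = tensor_mat (1\<^sub>m (gdim X)) (mstable_inv N)"
proof -
  note i = act_mstable_inverse[OF X N]
  show "inv_arrow M (act_ob M X N) (act_ob M X N) (tensor_mat (1\<^sub>m (gdim X)) (mstable M N)) = tensor_mat (1\<^sub>m (gdim X)) (mstable_inv N)"
    by (rule category.inv_arrow_eqI[OF category _ _ i]) (use X N in \<open>auto simp: act_closed\<close>)
  have "inverse_arrows (Vec \<chi>) (graded_tensor X (U N)) (graded_tensor X (U N)) (tensor_mat (1\<^sub>m (gdim X)) (mstable M N)) (tensor_mat (1\<^sub>m (gdim X)) (mstable_inv N))"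
    using i X N by (simp add: inverse_arrows_def Cmp_eq Hom_eq Ident_eq act_closed space_act)
  then show "inv_arrow (Vec \<chi>) (graded_tensor X (U N)) (graded_tensor X (U N)) (tensor_mat (1\<^sub>m (gdim X)) (mstable M N)) = tensor_mat (1\<^sub>m (gdim X)) (mstable_inv N)"
    by (rule category.inv_arrow_eqI[OF category_Vec, rotated -1]) (use X space[OF N] in auto)
qed

lemma dim_mbraid [simp]:
  assumes "graded_space X" "N \<in> Ob M"
  shows "dim_row (mbraid M X N) = gdim X * gdim (U N)" "dim_col (mbraid M X N) = gdim X * gdim (U N)"
  using assms by (simp_all add: mbraid_eq inv_arrow_act_mstable act_closed space_act)

text \<open>The stable structure of the acted object contributes \<open>R N (x + y)\<close> and a
  value of \<chi>, and the inverse on \<open>N\<close> contributes \<open>R N (- y)\<close>; the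
  representation property leaves \<open>R N x\<close>. The axioms of a braided module are read off
  from this formula.\<close>

lemma mbraid_apply:
  assumes X: "graded_space X" and N: "N \<in> Ob M" and v: "v \<in> gcomp X x" and w: "w \<in> gcomp (U N) y"
  shows "mbraid M X N *\<^sub>v tensor_vec v w = \<chi> x (- (x + y)) \<cdot>\<^sub>v tensor_vec v (R N x *\<^sub>v w)"
proof -
  note dims = gcomp_dim[OF X v] gcomp_dim[OF space[OF N] w]
  note rd = graded_repD[OF rep[OF N]]
  have mem: "tensor_vec v (R N (- y) *\<^sub>v w) \<in> gcomp (U (act_ob M X N)) (x + y)"
    using X N rd(7)[OF w] v by (simp add: space_act tensor_vec_mem)
  show ?thesis
    using X N dims mstable_apply[OF act_closed[OF X N] mem]
    by (simp add: mbraid_eq inv_arrow_act_mstable act_closed space_act tensor_mat_vec_mult mstable_inv_apply[OF N w]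
      rep_act tensor_rep_apply[OF X rep[OF N] v] rd(5,6,8))
qed

lemma braided_module: "braided_module_category (Vec \<chi>) M"
proof -
  interpret strict_module_category "Vec \<chi>" M by (rule strict_module)
  show ?thesis
  proof
    fix X N assume "X \<in> Ob (Vec \<chi>)" and N: "N \<in> Ob M"
    then have X: "graded_space X" by simp
    note XN = act_closed[OF X N]
    show "iso_arrow M (X \<rhd>\<^sub>o\<^bsub>M\<^esub> N) (X \<rhd>\<^sub>o\<^bsub>M\<^esub> N) (mbraid M X N)"
      using M.inverse_arrows_cmp[OF XN XN XN inverse_arrows_sym[OF act_mstable_inverse[OF X N]] mstable_inverse[OF XN]]
      by (auto simp: mbraid_eq[OF X N] inv_arrow_act_mstable[OF X N] Cmp_eq intro: inverse_arrows_iso)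
  next
    fix X X' N N' f h
    assume "X \<in> Ob (Vec \<chi>)" "X' \<in> Ob (Vec \<chi>)" and N: "N \<in> Ob M" "N' \<in> Ob M"
      and "f \<in> Hom (Vec \<chi>) X X'" and h: "h \<in> Hom M N N'"
    then have X: "graded_space X" "graded_space X'" and f: "f \<in> graded_hom X X'" by auto
    have "mbraid M X' N' * tensor_mat f h = tensor_mat f h * mbraid M X N"
    proof (rule graded_tensor_ext[OF X(1) space[OF N(1)]])
      fix x y v w assume v: "v \<in> gcomp X x" and w: "w \<in> gcomp (U N) y"
      show "mbraid M X' N' * tensor_mat f h *\<^sub>v tensor_vec v w = tensor_mat f h * mbraid M X N *\<^sub>v tensor_vec v w"
        using X N gcomp_dim[OF X(1) v] gcomp_dim[OF space[OF N(1)] w]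
        by (simp add: graded_homD[OF f] homD[OF h] tensor_mat_vec_mult mbraid_apply[OF X(1) N(1) v w]
          mbraid_apply[OF X(2) N(2) graded_homD(4)[OF f v] homD(6)[OF h N w]])
    qed (use X N in \<open>auto simp: graded_homD[OF f] homD[OF h]\<close>)
    then show "mbraid M X' N' \<cdot>\<^bsub>M\<^esub> (f \<rhd>\<^sub>m\<^bsub>M\<^esub> h) = (f \<rhd>\<^sub>m\<^bsub>M\<^esub> h) \<cdot>\<^bsub>M\<^esub> mbraid M X N"
      by (simp add: Cmp_eq act_arr_eq)
  next
    fix X Y N assume "X \<in> Ob (Vec \<chi>)" "Y \<in> Ob (Vec \<chi>)" and N: "N \<in> Ob M"
    then have X: "graded_space X" and Y: "graded_space Y" by auto
    note S = space[OF N] and XN = act_closed[OF X N] and rd = graded_repD[OF rep[OF N]]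
    note XS = graded_space_tensor[OF X S] and YX = graded_space_tensor[OF Y X]
    show "mbraid M Y (X \<rhd>\<^sub>o\<^bsub>M\<^esub> N) =
        (braid_inv (Vec \<chi>) X Y \<rhd>\<^sub>m\<^bsub>M\<^esub> Ident M N) \<cdot>\<^bsub>M\<^esub> (Ident (Vec \<chi>) X \<rhd>\<^sub>m\<^bsub>M\<^esub> mbraid M Y N) \<cdot>\<^bsub>M\<^esub>
        (braid_inv (Vec \<chi>) Y X \<rhd>\<^sub>m\<^bsub>M\<^esub> Ident M N)"
    proof -
      \<comment> \<open>On the right both inverse braidings contribute a factor, the inverses of
        \<open>\<chi> x y\<close> and \<open>\<chi> y x\<close>. On the left the second one comes
        from the degree \<open>x\<close> inside \<open>x + c\<close>, the first one from
        \<open>tensor_rep\<close>.\<close>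
      have "mbraid M Y (act_ob M X N) = tensor_mat (graded_braid_inv \<chi> X Y) (1\<^sub>m (gdim (U N))) *
        (tensor_mat (1\<^sub>m (gdim X)) (mbraid M Y N) * tensor_mat (graded_braid_inv \<chi> Y X) (1\<^sub>m (gdim (U N))))"
      proof (rule graded_tensor3_ext[OF Y X S])
        fix y x c v u w assume v: "v \<in> gcomp Y y" and u: "u \<in> gcomp X x" and w: "w \<in> gcomp (U N) c"
        note dims = gcomp_dim[OF Y v] gcomp_dim[OF X u] gcomp_dim[OF S w]
        have uw: "tensor_vec u w \<in> gcomp (U (act_ob M X N)) (x + c)"
          using X N u w by (simp add: space_act tensor_vec_mem)
        show "mbraid M Y (act_ob M X N) *\<^sub>v tensor_vec v (tensor_vec u w) =
          tensor_mat (graded_braid_inv \<chi> X Y) (1\<^sub>m (gdim (U N))) *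
          (tensor_mat (1\<^sub>m (gdim X)) (mbraid M Y N) * tensor_mat (graded_braid_inv \<chi> Y X) (1\<^sub>m (gdim (U N)))) *\<^sub>v tensor_vec v (tensor_vec u w)"
          using X Y N dims mbraid_apply[OF Y XN v uw]
          by (simp add: rep_act tensor_rep_apply[OF X rep[OF N] u] tensor_apply mult.assoc
            graded_braid_inv_apply[OF Y X v u] graded_braid_inv_apply[OF X Y u v] mbraid_apply[OF Y N v w]
            bicharacterD[OF bichar] del: minus_add_distrib)
             (simp add: field_simps bicharacterD[OF bichar])
      qed (use X Y N XN in \<open>auto simp: space_act ac_simps\<close>)
      then show ?thesis
        using X Y N by (simp add: Cmp_eq act_arr_eq Ident_eq braid_inv_Vec[OF bichar])
    qed
    show "mbraid M (Y \<otimes>\<^sub>o\<^bsub>Vec \<chi>\<^esub> X) N = mbraid M Y (X \<rhd>\<^sub>o\<^bsub>M\<^esub> N) \<cdot>\<^bsub>M\<^esub> (Ident (Vec \<chi>) Y \<rhd>\<^sub>m\<^bsub>M\<^esub> mbraid M X N)"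
    proof -
      \<comment> \<open>The factor \<open>\<chi> x (- y)\<close>, by which the two scalars seem to
        differ, is supplied by \<open>tensor_rep\<close>, through which degree \<open>y\<close> acts
        on \<open>X\<close>.\<close>
      have "mbraid M (graded_tensor Y X) N = mbraid M Y (act_ob M X N) * tensor_mat (1\<^sub>m (gdim Y)) (mbraid M X N)"
      proof (rule graded_tensor3_ext[OF Y X S])
        fix y x c v u w assume v: "v \<in> gcomp Y y" and u: "u \<in> gcomp X x" and w: "w \<in> gcomp (U N) c"
        note dims = gcomp_dim[OF Y v] gcomp_dim[OF X u] gcomp_dim[OF S w]
        note rw = rd(7)[OF w, of x]
        have uw: "tensor_vec u (R N x *\<^sub>v w) \<in> gcomp (U (act_ob M X N)) (x + c)"
          using X N u rw by (simp add: space_act tensor_vec_mem)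
        show "mbraid M (graded_tensor Y X) N *\<^sub>v tensor_vec v (tensor_vec u w) =
          mbraid M Y (act_ob M X N) * tensor_mat (1\<^sub>m (gdim Y)) (mbraid M X N) *\<^sub>v tensor_vec v (tensor_vec u w)"
          using X Y N XN dims mbraid_apply[OF Y XN v uw] mbraid_apply[OF YX N tensor_vec_mem[OF v u] w]
          by (simp add: rep_act tensor_rep_apply[OF X rep[OF N] u] tensor_apply mult.assoc space_act
            mbraid_apply[OF X N u w] rd(5,6,8) bicharacterD[OF bichar] del: minus_add_distrib)
             (simp add: field_simps bicharacterD[OF bichar])
      qed (use X Y N XN in \<open>auto simp: space_act ac_simps\<close>)
      then show ?thesis by (simp add: Cmp_eq act_arr_eq)
    qed
  qed
qed

lemma stable_braided_module: "stable_braided_module_category (Vec \<chi>) M"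
proof -
  interpret braided_module_category "Vec \<chi>" M by (rule braided_module)
  show ?thesis
  proof
    show "ident_automorphism M (mstable M)"
      unfolding ident_automorphism_def natural_iso_def
    proof (intro conjI ballI)
      show "iso_arrow M N N (mstable M N)" if "N \<in> Ob M" for N
        using mstable_inverse[OF that] by (rule inverse_arrows_iso)
      fix N N' f assume N: "N \<in> Ob M" "N' \<in> Ob M" and f: "f \<in> Hom M N N'"
      have "mstable M N' * f = f * mstable M N"
        by (rule graded_ext[OF space[OF N(1)]])
          (use N in \<open>simp_all add: homD[OF f] gcomp_dim[OF space[OF N(1)]] mstable_apply[OF N(1)] mstable_apply[OF N(2) homD(6)[OF f]]\<close>)
      then show "mstable M N' \<cdot>\<^bsub>M\<^esub> f = f \<cdot>\<^bsub>M\<^esub> mstable M N" by (simp add: Cmp_eq)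
    qed
    fix X N assume "X \<in> Ob (Vec \<chi>)" "N \<in> Ob M"
    then show "mbraid M X N = mstable M (X \<rhd>\<^sub>o\<^bsub>M\<^esub> N) \<cdot>\<^bsub>M\<^esub>
        inv_arrow M (X \<rhd>\<^sub>o\<^bsub>M\<^esub> N) (X \<rhd>\<^sub>o\<^bsub>M\<^esub> N) (Ident (Vec \<chi>) X \<rhd>\<^sub>m\<^bsub>M\<^esub> mstable M N)"
      by (simp add: mbraid_eq inv_arrow_act_mstable Cmp_eq act_arr_eq)
  qed
qed

end

section \<open>Half braidings\<close>

lemma mat_of_cols_unit_vec:
  fixes v :: "'k::field vec"
  assumes "dim_vec v = n"
  shows "mat_of_cols n [v] *\<^sub>v unit_vec (Suc 0) 0 = v"
  using assms by (intro eq_vecI) (auto simp: scalar_prod_def mat_of_cols_def)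

text \<open>In the manner of a controlled gate, the degree of the first factor selects the operator
  applied to the second. Followed by the flip this is the half braiding of \<open>T\<close>.\<close>

definition controlled_mat :: "('g::{ab_group_add,finite}, 'k::field) graded_space \<Rightarrow> nat \<Rightarrow> ('g \<Rightarrow> 'k mat) \<Rightarrow> 'k mat" where
  "controlled_mat X k T = mat_sum (gdim X * k) (gdim X * k) UNIV (\<lambda>x. tensor_mat (gproj X x) (T x))"

lemma dim_controlled_mat [simp]:
  "dim_row (controlled_mat X k T) = gdim X * k" "dim_col (controlled_mat X k T) = gdim X * k"
  by (simp_all add: controlled_mat_def)

lemma controlled_mat_apply:
  assumes X: "graded_space X" and T: "\<And>x. T x \<in> carrier_mat k k" and v: "v \<in> gcomp X x" and w: "dim_vec w = k"
  shows "controlled_mat X k T *\<^sub>v tensor_vec v w = tensor_vec v (T x *\<^sub>v w)"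
proof -
  have dT: "dim_row (T a) = k" "dim_col (T a) = k" for a using T[of a] by auto
  note dv = gcomp_dim[OF X v]
  have "controlled_mat X k T *\<^sub>v tensor_vec v w = vec_sum (gdim X * k) UNIV
      (\<lambda>a. tensor_mat (gproj X a) (T a) *\<^sub>v tensor_vec v w)"
    unfolding controlled_mat_def using dv w by (intro mat_sum_mult_vec) (auto simp: dT intro: carrier_vecI)
  also have "\<dots> = vec_sum (gdim X * k) UNIV (\<lambda>a. if a = x then tensor_vec v (T x *\<^sub>v w) else 0\<^sub>v (gdim X * k))"
    using dv w by (intro vec_sum_cong) (auto simp: tensor_mat_vec_mult dT gproj_homogeneous[OF X v])
  also have "\<dots> = tensor_vec v (T x *\<^sub>v w)" using dv by (intro vec_sum_delta) (auto simp: dT intro: carrier_vecI)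
  finally show ?thesis .
qed

definition half_braiding :: "('g::{ab_group_add,finite}, 'k::field) graded_space \<Rightarrow> ('g \<Rightarrow> 'k mat)
    \<Rightarrow> ('g, 'k) graded_space \<Rightarrow> 'k mat" where
  "half_braiding M T = (\<lambda>X\<in>{X. graded_space X}. swap_mat (gdim X) (gdim M) * controlled_mat X (gdim M) T)"

lemma dim_half_braiding:
  assumes "graded_space X"
  shows "dim_row (half_braiding M T X) = gdim M * gdim X" "dim_col (half_braiding M T X) = gdim X * gdim M"
  using assms by (simp_all add: half_braiding_def)

lemma half_braiding_apply:
  assumes "graded_rep M T" "graded_space X" "v \<in> gcomp X x" "dim_vec w = gdim M"
  shows "half_braiding M T X *\<^sub>v tensor_vec v w = tensor_vec (T x *\<^sub>v w) v"
proof -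
  have "controlled_mat X (gdim M) T *\<^sub>v tensor_vec v w = tensor_vec v (T x *\<^sub>v w)"
    by (rule controlled_mat_apply) (use assms in \<open>auto intro: graded_repD(4)\<close>)
  then show ?thesis
    using assms by (simp add: half_braiding_def swap_mat_apply gcomp_dim graded_repD)
qed

lemma half_braiding_eqI:
  assumes M: "graded_space M" and T: "graded_rep M T"
    and ext: "t \<in> extensional {X. graded_space X}"
    and dim: "\<And>X. graded_space X \<Longrightarrow> dim_row (t X) = gdim M * gdim X" "\<And>X. graded_space X \<Longrightarrow> dim_col (t X) = gdim X * gdim M"
    and eq: "\<And>X x v y w. graded_space X \<Longrightarrow> v \<in> gcomp X x \<Longrightarrow> w \<in> gcomp M y \<Longrightarrow>
      t X *\<^sub>v tensor_vec v w = tensor_vec (T x *\<^sub>v w) v"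
  shows "t = half_braiding M T"
proof (rule extensionalityI[OF ext])
  show "half_braiding M T \<in> extensional {X. graded_space X}" by (simp add: half_braiding_def)
  fix X :: "('a, 'b) graded_space" assume "X \<in> {X. graded_space X}"
  then have X: "graded_space X" by simp
  show "t X = half_braiding M T X"
    by (rule graded_tensor_ext[OF X M])
      (use X in \<open>simp_all add: dim dim_half_braiding eq half_braiding_apply[OF T] gcomp_dim[OF M]\<close>)
qed

lemma half_braiding_line:
  assumes T: "graded_rep M T"
  shows "half_braiding M T (line x) = T x"
proof (rule mat_ext[of _ _ "gdim M"])
  fix w :: "'b vec" assume w: "dim_vec w = gdim M"
  show "half_braiding M T (line x) *\<^sub>v w = T x *\<^sub>v w"
    using half_braiding_apply[OF T graded_space_line line_mem w] by simp
qed (use T in \<open>simp_all add: dim_half_braiding graded_repD\<close>)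

lemma HH_structure_half_braiding:
  fixes M :: "('g::{ab_group_add,finite}, 'k::field) graded_space"
  assumes M: "graded_space M" and T: "graded_rep M T"
  shows "HH_structure (Vec \<chi>) M (half_braiding M T)"
proof -
  let ?t = "half_braiding M T"
  note rd = graded_repD[OF T]
  have dT: "dim_row (T z) = gdim M" "dim_col (T z) = gdim M" for z using rd by auto
  have t_apply: "?t X *\<^sub>v tensor_vec v w = tensor_vec (T x *\<^sub>v w) v"
    if "graded_space X" "v \<in> gcomp X x" "dim_vec w = gdim M" for X x v w
    using half_braiding_apply[OF T that] .
  have hom: "?t X \<in> graded_hom (graded_tensor X M) (graded_tensor M X)" if X: "graded_space X" for X
  proof (rule graded_tensor_homI[OF X M graded_space_tensor[OF M X]])
    fix x y v w assume v: "v \<in> gcomp X x" and w: "w \<in> gcomp M y"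
    show "?t X *\<^sub>v tensor_vec v w \<in> gcomp (graded_tensor M X) (x + y)"
      unfolding t_apply[OF X v gcomp_dim[OF M w]] using tensor_vec_mem[OF rd(7)[OF w] v] by (simp add: add.commute)
  qed (simp_all add: dim_half_braiding X)
  have iso: "iso_arrow (Vec \<chi>) (graded_tensor X M) (graded_tensor M X) (?t X)" if X: "graded_space X" for X
  proof -
    \<comment> \<open>The inverse first exchanges the factors back and then undoes
      \<open>T x\<close> by \<open>T (- x)\<close>.\<close>
    let ?s = "controlled_mat X (gdim M) (\<lambda>x. T (- x)) * swap_mat (gdim M) (gdim X)"
    have c: "controlled_mat X (gdim M) (\<lambda>x. T (- x)) *\<^sub>v tensor_vec v w = tensor_vec v (T (- x) *\<^sub>v w)"
      if "v \<in> gcomp X x" "dim_vec w = gdim M" for v x w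
      by (rule controlled_mat_apply[OF X]) (use that rd in auto)
    have one: "?s * ?t X = 1\<^sub>m (gdim X * gdim M)"
      by (rule graded_tensor_ext[OF X M])
        (use X M in \<open>simp_all add: dim_half_braiding t_apply[OF X] gcomp_dim swap_mat_apply dT c rd(8), simp_all add: rd(2) gcomp_dim\<close>)
    have two: "?t X * ?s = 1\<^sub>m (gdim M * gdim X)"
      by (rule graded_tensor_ext[OF M X])
        (use X M in \<open>simp_all add: dim_half_braiding t_apply[OF X] gcomp_dim swap_mat_apply dT c rd(8), simp_all add: rd(2) gcomp_dim\<close>)
    have "?s \<in> graded_hom (graded_tensor M X) (graded_tensor X M)"
      by (rule inverse_graded_hom[OF _ _ hom[OF X]]) (use X M one two in auto)
    then show ?thesis
      using hom[OF X] one two by (auto simp: iso_arrow_def inverse_arrows_def)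
  qed
  have nat: "?t Y * tensor_mat f (1\<^sub>m (gdim M)) = tensor_mat (1\<^sub>m (gdim M)) f * ?t X"
    if X: "graded_space X" and Y: "graded_space Y" and f: "f \<in> graded_hom X Y" for X Y f
  proof (rule graded_tensor_ext[OF X M])
    fix x y v w assume v: "v \<in> gcomp X x" and w: "w \<in> gcomp M y"
    show "?t Y * tensor_mat f (1\<^sub>m (gdim M)) *\<^sub>v tensor_vec v w = tensor_mat (1\<^sub>m (gdim M)) f * ?t X *\<^sub>v tensor_vec v w"
      using gcomp_dim[OF X v] gcomp_dim[OF M w]
      by (simp add: dim_half_braiding X Y tensor_mat_vec_mult graded_homD(2,3)[OF f] t_apply[OF X v] t_apply[OF Y graded_homD(4)[OF f v]] dT)
  qed (simp_all add: dim_half_braiding X Y graded_homD(2,3)[OF f])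
  have unit: "?t graded_unit = 1\<^sub>m (gdim M)"
    using half_braiding_line[OF T, of 0] by (simp add: line_zero rd(2))
  have tensor: "?t (graded_tensor X Y) = tensor_mat (?t X) (1\<^sub>m (gdim Y)) * tensor_mat (1\<^sub>m (gdim X)) (?t Y)"
    if X: "graded_space X" and Y: "graded_space Y" for X Y
  proof (rule graded_tensor3_ext[OF X Y M])
    note XY = graded_space_tensor[OF X Y]
    fix x y z u v w assume u: "u \<in> gcomp X x" and v: "v \<in> gcomp Y y" and w: "w \<in> gcomp M z"
    note dims = gcomp_dim[OF X u] gcomp_dim[OF Y v] gcomp_dim[OF M w]
    show "?t (graded_tensor X Y) *\<^sub>v tensor_vec u (tensor_vec v w) =
        tensor_mat (?t X) (1\<^sub>m (gdim Y)) * tensor_mat (1\<^sub>m (gdim X)) (?t Y) *\<^sub>v tensor_vec u (tensor_vec v w)"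
      using t_apply[OF XY tensor_vec_mem[OF u v] dims(3)] dims
      by (simp add: dim_half_braiding X Y tensor_apply mult.assoc t_apply[OF X u] t_apply[OF Y v] dT rd(8))
  qed (simp_all add: dim_half_braiding X Y ac_simps)
  show ?thesis
    unfolding HH_structure_def Vec_simps
  proof (intro conjI ballI)
    show "?t \<in> extensional {V. graded_space V}" by (simp add: half_braiding_def)
  qed (use M iso nat unit tensor in \<open>auto simp: ddual_arr_Vec graded_homD(1) ddual_unit_Vec ddual_tensor_Vec dim_half_braiding ac_simps\<close>)
qed

lemma HH_structureD:
  fixes M :: "('g::{ab_group_add,finite}, 'k::field) graded_space"
  assumes M: "graded_space M" and t: "HH_structure (Vec \<chi>) M t"
  shows "graded_rep M (\<lambda>z. t (line z))" "t = half_braiding M (\<lambda>z. t (line z))"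
proof -
  let ?T = "\<lambda>z. t (line z)"
  note d = t[unfolded HH_structure_def Vec_simps]
  have ext: "t \<in> extensional {V. graded_space V}" using d by blast
  have hom: "t X \<in> graded_hom (graded_tensor X M) (graded_tensor M X)" if X: "graded_space X" for X
    using d X by (auto simp: iso_arrow_def inverse_arrows_def)
  have dim: "dim_row (t X) = gdim M * gdim X" "dim_col (t X) = gdim X * gdim M" if "graded_space X" for X
    using graded_homD(2,3)[OF hom[OF that]] by simp_all
  have dT: "dim_row (t (line z)) = gdim M" "dim_col (t (line z)) = gdim M" for z
    using dim[OF graded_space_line, of z] by simp_all
  have T: "?T z \<in> graded_hom M M" for z
  proof (rule graded_homI)
    fix y w assume w: "w \<in> gcomp M y"
    have "tensor_vec (unit_vec (Suc 0) 0) w \<in> gcomp (graded_tensor (line z) M) (z + y)"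
      by (rule tensor_vec_mem[OF line_mem w])
    \<comment> \<open>The line occurs on both sides of the half braiding, so its degree is added and
      subtracted again.\<close>
    then have "t (line z) *\<^sub>v w \<in> gcomp (graded_tensor M (line z)) (z + y)"
      using graded_homD(4)[OF hom[OF graded_space_line]] by simp
    from graded_tensor_line_mem_right[OF M this] show "t (line z) *\<^sub>v w \<in> gcomp M y" by simp
  qed (use dT in auto)
  have mult: "?T (x + y) = ?T x * ?T y" for x y
  proof -
    have "t (graded_tensor (line x) (line y)) = tensor_mat (1\<^sub>m (gdim M)) (1\<^sub>m (Suc 0)) *
      (tensor_mat (t (line x)) (1\<^sub>m (Suc 0)) * tensor_mat (1\<^sub>m (Suc 0)) (t (line y)))"
      using d by (simp add: ddual_tensor_Vec del: tensor_mat_one)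
    then show ?thesis by (simp add: graded_tensor_line_line dT)
  qed
  have "?T 0 = 1\<^sub>m (gdim M)"
    using d by (simp add: line_zero ddual_unit_Vec)
  then show rep: "graded_rep M ?T" using T mult by (simp add: graded_rep_def)
  show "t = half_braiding M ?T"
  proof (rule half_braiding_eqI[OF M rep ext dim])
    fix X :: "('g, 'k) graded_space" and x y v w
    assume X: "graded_space X" and v: "v \<in> gcomp X x" and w: "w \<in> gcomp M y"
    \<comment> \<open>\<open>?f\<close> is the morphism from the line of degree \<open>x\<close>
      that picks out \<open>v\<close>. It is its own double dual, so naturality at \<open>?f\<close>
      expresses \<open>t X\<close> through \<open>t (line x)\<close>.\<close>
    let ?f = "mat_of_cols (gdim X) [v]" and ?e = "unit_vec (Suc 0) 0 :: 'k vec"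
    note dims = gcomp_dim[OF X v] gcomp_dim[OF M w]
    have fe: "?f *\<^sub>v ?e = v" using dims by (simp add: mat_of_cols_unit_vec)
    have f: "?f \<in> graded_hom (line x) X"
      by (rule line_homI[OF X]) (use v fe in auto)
    have "t X * tensor_mat ?f (1\<^sub>m (gdim M)) = tensor_mat (1\<^sub>m (gdim M)) ?f * t (line x)"
    proof -
      have "\<forall>X\<in>{V. graded_space V}. \<forall>Y\<in>{V. graded_space V}. \<forall>f\<in>graded_hom X Y.
          t Y * tensor_mat f (1\<^sub>m (gdim M)) = tensor_mat (1\<^sub>m (gdim M)) (ddual_arr (Vec \<chi>) X Y f) * t X"
        using d by blast
      then have "t X * tensor_mat ?f (1\<^sub>m (gdim M)) = tensor_mat (1\<^sub>m (gdim M)) (ddual_arr (Vec \<chi>) (line x) X ?f) * t (line x)"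
        using X f graded_space_line by blast
      then show ?thesis using graded_homD(1)[OF f] by (simp add: ddual_arr_Vec)
    qed
    then have "t X *\<^sub>v (tensor_mat ?f (1\<^sub>m (gdim M)) *\<^sub>v tensor_vec ?e w) =
        tensor_mat (1\<^sub>m (gdim M)) ?f *\<^sub>v (t (line x) *\<^sub>v tensor_vec ?e w)"
      using dim[OF X] dims dT by (subst (1 2) mult_mat_vec_assoc[symmetric]) auto
    moreover have "tensor_mat ?f (1\<^sub>m (gdim M)) *\<^sub>v tensor_vec ?e w = tensor_vec v w"
      using dims fe by (subst tensor_mat_vec_mult) auto
    moreover have "tensor_mat (1\<^sub>m (gdim M)) ?f *\<^sub>v tensor_vec (t (line x) *\<^sub>v w) ?e = tensor_vec (t (line x) *\<^sub>v w) v"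
      using dims dT fe by (subst tensor_mat_vec_mult) auto
    ultimately show "t X *\<^sub>v tensor_vec v w = tensor_vec (t (line x) *\<^sub>v w) v" by simp
  qed
qed

section \<open>\<open>HH(B)\<close> in terms of graded representations\<close>

definition HH_rep :: "('g::{ab_group_add,finite}, 'k::field) graded_space \<times> (('g, 'k) graded_space \<Rightarrow> 'k mat) \<Rightarrow> 'g \<Rightarrow> 'k mat" where
  "HH_rep N = (\<lambda>z. snd N (line z))"

lemma HH_rep_Pair [simp]: "HH_rep (M, t) = (\<lambda>z. t (line z))"
  by (simp add: HH_rep_def)

lemma HH_ObD:
  assumes "N \<in> Ob (HH (Vec \<chi>))"
  shows "graded_space (fst N)" "graded_rep (fst N) (HH_rep N)" "snd N = half_braiding (fst N) (HH_rep N)"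
  using assms HH_structureD[of "fst N" \<chi> "snd N"] by (auto simp: HH_def HH_rep_def)

lemma HH_ObI: "graded_space M \<Longrightarrow> graded_rep M T \<Longrightarrow> (M, half_braiding M T) \<in> Ob (HH (Vec \<chi>))"
  by (simp add: HH_def HH_structure_half_braiding)

lemma HH_act_Vec:
  fixes N :: "('g::{ab_group_add,finite}, 'k::field) graded_space \<times> (('g, 'k) graded_space \<Rightarrow> 'k mat)"
  assumes \<chi>: "bicharacter \<chi>" and X: "graded_space X" and N: "N \<in> Ob (HH (Vec \<chi>))"
  shows "HH_act (Vec \<chi>) X N = (graded_tensor X (fst N), half_braiding (graded_tensor X (fst N)) (tensor_rep \<chi> X (HH_rep N)))"
proof -
  obtain M t where Nt: "N = (M, t)" by (cases N)
  define T where "T = (\<lambda>z. t (line z))"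
  have M: "graded_space M" and T: "graded_rep M T" and t: "t = half_braiding M T"
    using HH_ObD[OF N] by (simp_all add: Nt T_def)
  note XM = graded_space_tensor[OF X M] and XT = graded_rep_tensor[OF \<chi> X M T]
  have "(\<lambda>Y\<in>{Y. graded_space Y}. tensor_mat (1\<^sub>m (gdim X)) (t Y) * tensor_mat (braid_inv (Vec \<chi>) Y X) (1\<^sub>m (gdim M))) =
      half_braiding (graded_tensor X M) (tensor_rep \<chi> X T)" (is "?u = _")
  proof (rule half_braiding_eqI[OF XM XT])
    fix Y :: "('g, 'k) graded_space" assume Y: "graded_space Y"
    note dims = dim_half_braiding[OF Y] dim_graded_braid_inv[OF X Y] dim_graded_braid_inv[OF Y X]
    show dr: "dim_row (?u Y) = gdim (graded_tensor X M) * gdim Y" and dc: "dim_col (?u Y) = gdim Y * gdim (graded_tensor X M)"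
      using Y X by (simp_all add: t dims braid_inv_Vec[OF \<chi>])
    fix y v z s assume v: "v \<in> gcomp Y y" and s: "s \<in> gcomp (graded_tensor X M) z"
    \<comment> \<open>The vector \<open>s\<close> need not be a pure tensor, so the two maps are
      first compared on tensors of three homogeneous vectors.\<close>
    have "?u Y = half_braiding (graded_tensor X M) (tensor_rep \<chi> X T) Y"
    proof (rule graded_tensor3_ext[OF Y X M])
      fix y x c v u w assume v: "v \<in> gcomp Y y" and u: "u \<in> gcomp X x" and w: "w \<in> gcomp M c"
      note d = gcomp_dim[OF Y v] gcomp_dim[OF X u] gcomp_dim[OF M w]
      show "?u Y *\<^sub>v tensor_vec v (tensor_vec u w) =
          half_braiding (graded_tensor X M) (tensor_rep \<chi> X T) Y *\<^sub>v tensor_vec v (tensor_vec u w)"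
        using X Y d half_braiding_apply[OF XT Y v, of "tensor_vec u w"]
        by (simp add: braid_inv_Vec[OF \<chi>] t dims tensor_apply mult.assoc graded_braid_inv_apply[OF Y X v u]
          half_braiding_apply[OF T Y v] tensor_rep_apply[OF X T u] bicharacterD[OF \<chi>])
    qed (use dr dc Y in \<open>simp_all add: dims\<close>)
    then show "?u Y *\<^sub>v tensor_vec v s = tensor_vec (tensor_rep \<chi> X T y *\<^sub>v s) v"
      using half_braiding_apply[OF XT Y v gcomp_dim[OF XM s]] by simp
  qed simp
  then show ?thesis by (simp add: HH_act_def Nt T_def)
qed

text \<open>Coevaluation inserts the sum of e \<otimes> e over the basis. The half braiding takes v
  \<otimes> e to \<open>T y\<close> e \<otimes> v, where \<open>y\<close> is the degree of
  \<open>v\<close>, and evaluation pairs \<open>v\<close> with the second copy of e; the sum is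
  \<open>T y\<close> applied to \<open>v\<close>.\<close>

lemma HH_stable_apply:
  fixes N :: "('g::{ab_group_add,finite}, 'k::field) graded_space \<times> (('g, 'k) graded_space \<Rightarrow> 'k mat)"
  assumes N: "N \<in> Ob (HH (Vec \<chi>))" and v: "v \<in> gcomp (fst N) y"
  shows "HH_stable (Vec \<chi>) N *\<^sub>v v = HH_rep N y *\<^sub>v v"
    "HH_stable (Vec \<chi>) N \<in> carrier_mat (gdim (fst N)) (gdim (fst N))"
proof -
  obtain M t where Nt: "N = (M, t)" by (cases N)
  define T where "T = (\<lambda>z. t (line z))"
  have M: "graded_space M" and T: "graded_rep M T" and t: "t = half_braiding M T"
    using HH_ObD[OF N] by (simp_all add: Nt T_def)
  let ?n = "gdim M"
  let ?e = "\<lambda>i. unit_vec ?n i :: 'k vec"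
  note dims = dim_half_braiding[OF M] graded_repD(5,6)[OF T]
  have v': "v \<in> gcomp M y" using v Nt by simp
  note dv = gcomp_dim[OF M v']
  have "HH_stable (Vec \<chi>) N *\<^sub>v v = vec_sum ?n {0..<?n} (\<lambda>i. (v \<bullet> ?e i) \<cdot>\<^sub>v (T y *\<^sub>v ?e i))"
    using dv by (simp add: HH_stable_def Nt t dims coev_right_apply mult_mat_vec_sum_dim mult.assoc
      tensor_mat_vec_mult_assoc half_braiding_apply[OF T M v'] tensor_vec_assoc ev_right_apply)
  also have "\<dots> = T y *\<^sub>v vec_sum ?n {0..<?n} (\<lambda>i. (v \<bullet> ?e i) \<cdot>\<^sub>v ?e i)"
    by (subst mult_mat_vec_sum_dim) (simp_all add: dims)
  also have "\<dots> = HH_rep N y *\<^sub>v v" using dv by (simp add: Nt T_def)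
  finally show "HH_stable (Vec \<chi>) N *\<^sub>v v = HH_rep N y *\<^sub>v v" .
  show "HH_stable (Vec \<chi>) N \<in> carrier_mat (gdim (fst N)) (gdim (fst N))"
    by (auto simp: HH_stable_def Nt dims)
qed

lemma HH_graded_rep_module:
  fixes \<chi> :: "'g::{ab_group_add,finite} \<Rightarrow> 'g \<Rightarrow> 'k::field"
  assumes \<chi>: "bicharacter \<chi>"
  shows "graded_rep_module \<chi> (HH (Vec \<chi>)) fst HH_rep"
proof
  let ?H = "HH (Vec \<chi>)"
  have act: "act_ob ?H = HH_act (Vec \<chi>)" by (simp add: HH_def)
  have ob: "(graded_tensor X (fst N), half_braiding (graded_tensor X (fst N)) (tensor_rep \<chi> X (HH_rep N))) \<in> Ob ?H"
    if "graded_space X" "N \<in> Ob ?H" for X and N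
    using that HH_ObD[OF that(2)] by (intro HH_ObI graded_rep_tensor[OF \<chi>]) auto
  show "bicharacter \<chi>" by (rule \<chi>)
  show "graded_space (fst N)" "graded_rep (fst N) (HH_rep N)" if "N \<in> Ob ?H" for N
    using HH_ObD[OF that] by auto
  show "Ident ?H N = 1\<^sub>m (gdim (fst N))" for N by (cases N) (simp add: HH_def)
  show "Cmp ?H = (\<lambda>A C. A * C)" "act_arr ?H = tensor_mat" by (simp_all add: HH_def)
  show "act_ob ?H X N \<in> Ob ?H" "fst (act_ob ?H X N) = graded_tensor X (fst N)" "HH_rep (act_ob ?H X N) = tensor_rep \<chi> X (HH_rep N)"
    if X: "graded_space X" and N: "N \<in> Ob ?H" for X N
    unfolding act HH_act_Vec[OF \<chi> X N] using ob[OF X N] HH_ObD[OF N] X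
    by (simp_all add: half_braiding_line graded_rep_tensor[OF \<chi>])
  show "act_ob ?H (graded_tensor X Y) N = act_ob ?H X (act_ob ?H Y N)"
    if X: "graded_space X" and Y: "graded_space Y" and N: "N \<in> Ob ?H" for X Y N
    unfolding act HH_act_Vec[OF \<chi> Y N] HH_act_Vec[OF \<chi> X ob[OF Y N]] HH_act_Vec[OF \<chi> graded_space_tensor[OF X Y] N]
    using X Y HH_ObD[OF N]
    by (simp add: half_braiding_line graded_rep_tensor[OF \<chi>] graded_tensor_assoc tensor_rep_assoc[OF \<chi>])
  show "act_ob ?H graded_unit N = N" if N: "N \<in> Ob ?H" for N
    unfolding act HH_act_Vec[OF \<chi> graded_space_unit N] using HH_ObD[OF N]
    by (simp add: graded_tensor_unit_left tensor_rep_unit[OF \<chi>] prod_eq_iff)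
  show "mstable ?H N *\<^sub>v v = HH_rep N y *\<^sub>v v" if "N \<in> Ob ?H" "v \<in> gcomp (fst N) y" for N v y
    using HH_stable_apply(1)[OF that] by (simp add: HH_def)
  show "mstable ?H N \<in> carrier_mat (gdim (fst N)) (gdim (fst N))" if "N \<in> Ob ?H" for N
    using HH_stable_apply(2)[OF that gcomp_zero[OF HH_ObD(1)[OF that]]] by (simp add: HH_def)
  show "mbraid ?H X N = mstable ?H (act_ob ?H X N) *
      inv_arrow (Vec \<chi>) (graded_tensor X (fst N)) (graded_tensor X (fst N)) (tensor_mat (1\<^sub>m (gdim X)) (mstable ?H N))" for X N
    by (simp add: HH_def)
  show "Hom ?H N N' = {f \<in> graded_hom (fst N) (fst N'). \<forall>z. f * HH_rep N z = HH_rep N' z * f}"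
    if N: "N \<in> Ob ?H" and N': "N' \<in> Ob ?H" for N N'
  proof -
    obtain M t M' t' where Nt: "N = (M, t)" "N' = (M', t')" by (cases N, cases N')
    define T T' where "T = (\<lambda>z. t (line z))" and "T' = (\<lambda>z. t' (line z))"
    have M: "graded_space M" and T: "graded_rep M T" and t: "t = half_braiding M T"
      using HH_ObD[OF N] by (simp_all add: Nt T_def)
    have M': "graded_space M'" and T': "graded_rep M' T'" and t': "t' = half_braiding M' T'"
      using HH_ObD[OF N'] by (simp_all add: Nt T'_def)
    have "(\<forall>X\<in>{X. graded_space X}. t' X * tensor_mat (1\<^sub>m (gdim X)) f = tensor_mat f (1\<^sub>m (gdim X)) * t X) \<longleftrightarrow>
        (\<forall>z. f * T z = T' z * f)" (is "?L \<longleftrightarrow> ?R") if f: "f \<in> graded_hom M M'" for f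
    proof
      assume ?L
      then have "t' (line z) * tensor_mat (1\<^sub>m (gdim (line z :: ('g, 'k) graded_space))) f =
          tensor_mat f (1\<^sub>m (gdim (line z :: ('g, 'k) graded_space))) * t (line z)" for z
        using graded_space_line by blast
      then show ?R by (simp add: T_def T'_def)
    next
      assume R: ?R
      have fT: "f *\<^sub>v (T z *\<^sub>v w) = T' z *\<^sub>v (f *\<^sub>v w)" if "dim_vec w = gdim M" for z w
        using R that graded_homD(2,3)[OF f] graded_repD(5,6)[OF T] graded_repD(5,6)[OF T'] by (metis mult_mat_vec_assoc)
      show ?L
      proof
        fix X :: "('g, 'k) graded_space" assume "X \<in> {X. graded_space X}"
        then have X: "graded_space X" by simp
        show "t' X * tensor_mat (1\<^sub>m (gdim X)) f = tensor_mat f (1\<^sub>m (gdim X)) * t X"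
        proof (rule graded_tensor_ext[OF X M])
          fix x y v w assume v: "v \<in> gcomp X x" and w: "w \<in> gcomp M y"
          show "t' X * tensor_mat (1\<^sub>m (gdim X)) f *\<^sub>v tensor_vec v w = tensor_mat f (1\<^sub>m (gdim X)) * t X *\<^sub>v tensor_vec v w"
            using gcomp_dim[OF X v] gcomp_dim[OF M w]
            by (simp add: t t' dim_half_braiding[OF X] tensor_mat_vec_mult graded_homD(2,3)[OF f] fT graded_repD(5,6)[OF T]
              half_braiding_apply[OF T X v] half_braiding_apply[OF T' X v])
        qed (simp_all add: t t' dim_half_braiding[OF X] graded_homD(2,3)[OF f])
      qed
    qed
    then show ?thesis by (auto simp: HH_def Nt T_def T'_def)
  qed
qed

text \<open>This is \<open>T z\<close> solved from the requirement that \<open>\<chi> y z\<close>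
  times \<open>T z\<close> be the scalar \<open>l z\<close> in degree \<open>y\<close>. For z = y
  its value is the scalar of \<open>character_anti_twist\<close>.\<close>

definition character_rep :: "('g::{ab_group_add,finite} \<Rightarrow> 'g \<Rightarrow> 'k::field) \<Rightarrow> ('g \<Rightarrow> 'k) \<Rightarrow> ('g, 'k) graded_space \<Rightarrow> 'g \<Rightarrow> 'k mat" where
  "character_rep \<chi> l V = (\<lambda>z. graded_scaling (\<lambda>y. l z * \<chi> y (- z)) V)"

lemma character_groupD:
  assumes "l \<in> character_group"
  shows "l x \<noteq> 0" "l (x + y) = l x * l y" "l 0 = 1" "l (- x) = inverse (l x)"
proof -
  show nz: "l x \<noteq> 0" and add: "l (x + y) = l x * l y" for x y using assms by (auto simp: character_group_def)
  show zero: "l 0 = 1" using add[of 0 0] nz[of 0] by simp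
  show "l (- x) = inverse (l x)" using add[of x "- x"] zero nz[of x] by (simp add: inverse_unique)
qed

lemma graded_rep_character:
  assumes \<chi>: "bicharacter \<chi>" and l: "l \<in> character_group" and V: "graded_space V"
  shows "graded_rep V (character_rep \<chi> l V)"
  unfolding graded_rep_def character_rep_def
  using V by (auto simp: graded_scaling_hom graded_scaling_mult graded_scaling_one character_groupD[OF l] bicharacterD[OF \<chi>] ac_simps simp del: minus_add_distrib)

text \<open>The representation is scalar in each degree, so all degree preserving maps commute with
  it and the condition on morphisms is vacuous. Compatibility with the action is multiplicativity of
  \<chi> in its first argument.\<close>

lemma anti_twist_graded_rep_module:
  fixes \<chi> :: "'g::{ab_group_add,finite} \<Rightarrow> 'g \<Rightarrow> 'k::field"
  assumes \<chi>: "bicharacter \<chi>" and l: "l \<in> character_group"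
  shows "graded_rep_module \<chi> (anti_twist_module (Vec \<chi>) (character_anti_twist \<chi> l)) (\<lambda>V. V) (character_rep \<chi> l)"
proof
  fix X N :: "('g, 'k) graded_space"
  assume X: "graded_space X" and "N \<in> Ob (anti_twist_module (Vec \<chi>) (character_anti_twist \<chi> l))"
  then have N: "graded_space N" by (simp add: anti_twist_module_def)
  have "character_rep \<chi> l (graded_tensor X N) z = tensor_rep \<chi> X (character_rep \<chi> l N) z" for z
  proof (rule graded_tensor_ext[OF X N])
    fix x y v w assume v: "v \<in> gcomp X x" and w: "w \<in> gcomp N y"
    show "character_rep \<chi> l (graded_tensor X N) z *\<^sub>v tensor_vec v w = tensor_rep \<chi> X (character_rep \<chi> l N) z *\<^sub>v tensor_vec v w"
      using tensor_rep_apply[OF X graded_rep_character[OF \<chi> l N] v gcomp_dim[OF N w]]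
      by (simp add: character_rep_def graded_scaling_apply[OF graded_space_tensor[OF X N] tensor_vec_mem[OF v w]]
        graded_scaling_apply[OF N w] bicharacterD[OF \<chi>] ac_simps)
  qed (use X N in \<open>simp_all add: character_rep_def tensor_rep_def\<close>)
  then show "character_rep \<chi> l (act_ob (anti_twist_module (Vec \<chi>) (character_anti_twist \<chi> l)) X N) = tensor_rep \<chi> X (character_rep \<chi> l N)"
    by (auto simp: anti_twist_module_def)
qed (auto simp: anti_twist_module_def \<chi> graded_rep_character[OF \<chi> l, unfolded character_rep_def] graded_tensor_assoc graded_tensor_unit_left
  graded_scaling_carrier graded_scaling_apply character_anti_twist_def character_rep_def graded_scaling_commute mult.commute)

section \<open>Characters of finite abelian groups\<close>

primrec nat_mult :: "nat \<Rightarrow> 'g::ab_group_add \<Rightarrow> 'g" where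
  "nat_mult 0 g = 0"
| "nat_mult (Suc n) g = g + nat_mult n g"

lemma nat_mult_add: "nat_mult (m + n) g = nat_mult m g + nat_mult n g"
  by (induction m) (auto simp: add.assoc)

lemma nat_mult_times: "nat_mult (m * n) g = nat_mult m (nat_mult n g)"
  by (induction m) (auto simp: nat_mult_add)

lemma exists_nat_mult_eq_0: "\<exists>n>0. nat_mult n (g :: 'g::{ab_group_add,finite}) = 0"
proof -
  have "\<not> inj (\<lambda>n. nat_mult n g)"
  proof
    assume "inj (\<lambda>n. nat_mult n g)"
    then have "finite (UNIV :: nat set)" using finite_imageD[of "\<lambda>n. nat_mult n g" UNIV] by simp
    then show False by simp
  qed
  then obtain m n where mn: "nat_mult m g = nat_mult n g" "m < n"
    unfolding inj_def by (metis linorder_neqE_nat)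
  have "nat_mult n g = nat_mult (n - m) g + nat_mult m g"
    using mn nat_mult_add[of "n - m" m g] by simp
  then have "nat_mult (n - m) g = 0" using mn by simp
  then show ?thesis using mn by (intro exI[of _ "n - m"]) auto
qed

text \<open>A character of a subgroup, kept as a total function whose values off \<open>H\<close>
  are arbitrary; successive extensions then need no change of type.\<close>

definition partial_character :: "'g::ab_group_add set \<Rightarrow> ('g \<Rightarrow> 'k::field) \<Rightarrow> bool" where
  "partial_character H l \<longleftrightarrow> 0 \<in> H \<and> (\<forall>x\<in>H. - x \<in> H) \<and> (\<forall>x\<in>H. \<forall>y\<in>H. x + y \<in> H) \<and>
     (\<forall>x\<in>H. l x \<noteq> 0) \<and> (\<forall>x\<in>H. \<forall>y\<in>H. l (x + y) = l x * l y)"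

text \<open>Here \<open>m\<close> is the order of \<open>g\<close> modulo \<open>H\<close>, and \<open>c\<close> is the prescribed value at \<open>g\<close>.\<close>

lemma partial_character_extend:
  fixes g :: "'g::{ab_group_add,finite}" and l :: "'g \<Rightarrow> 'k::field"
  assumes H: "partial_character H l" and g: "g \<notin> H"
  obtains m where "m > 1" "nat_mult m g \<in> H"
    "\<And>c. c ^ m = l (nat_mult m g) \<Longrightarrow>
      \<exists>H' l'. partial_character H' l' \<and> H \<subset> H' \<and> (\<forall>x\<in>H. l' x = l x) \<and> l' g = c \<and> g \<in> H'"
proof -
  have H0: "0 \<in> H" and Hm: "\<And>x. x \<in> H \<Longrightarrow> - x \<in> H" and Ha: "\<And>x y. x \<in> H \<Longrightarrow> y \<in> H \<Longrightarrow> x + y \<in> H"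
    and lnz: "\<And>x. x \<in> H \<Longrightarrow> l x \<noteq> 0" and la: "\<And>x y. x \<in> H \<Longrightarrow> y \<in> H \<Longrightarrow> l (x + y) = l x * l y"
    using H by (auto simp: partial_character_def)
  have Hd: "x - y \<in> H" if "x \<in> H" "y \<in> H" for x y using Ha[OF that(1) Hm[OF that(2)]] by simp
  define P where "P = (\<lambda>n. n > 0 \<and> nat_mult n g \<in> H)"
  have "\<exists>n. P n" using exists_nat_mult_eq_0[of g] H0 by (auto simp: P_def)
  define m where "m = (LEAST n. P n)"
  have Pm: "P m" unfolding m_def using \<open>\<exists>n. P n\<close> by (rule LeastI_ex)
  then have mpos: "m > 0" and mH: "nat_mult m g \<in> H" by (auto simp: P_def)
  have least: "m \<le> n" if "P n" for n unfolding m_def using that by (rule Least_le)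
  have "m \<noteq> 1" using mH g by auto
  then have m1: "m > 1" using mpos by simp
  have l0: "l 0 = 1" using la[OF H0 H0] lnz[OF H0] by simp
  have multH: "nat_mult k x \<in> H \<and> l (nat_mult k x) = l x ^ k" if "x \<in> H" for k x
    by (induction k) (use that H0 l0 in \<open>auto simp: Ha la\<close>)
  \<comment> \<open>By minimality of \<open>m\<close> the remainder of \<open>k\<close> must vanish:
    otherwise a smaller positive multiple of \<open>g\<close> would lie in \<open>H\<close>.\<close>
  have dvd: "m dvd k" if "nat_mult k g \<in> H" for k
  proof (rule ccontr)
    assume "\<not> m dvd k"
    then have "k mod m > 0" by (simp add: mod_greater_zero_iff_not_dvd)
    moreover have "nat_mult (k mod m) g \<in> H"
    proof -
      have "nat_mult k g = nat_mult (k div m) (nat_mult m g) + nat_mult (k mod m) g"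
        by (simp flip: nat_mult_times nat_mult_add)
      then have "nat_mult (k mod m) g = nat_mult k g - nat_mult (k div m) (nat_mult m g)" by simp
      then show ?thesis using Hd[OF that] multH[OF mH] by simp
    qed
    ultimately have "m \<le> k mod m" by (intro least) (simp add: P_def)
    then show False using mpos by (meson mod_less_divisor not_le)
  qed
  show ?thesis
  proof (rule that[OF m1 mH])
    fix c assume c: "c ^ m = l (nat_mult m g)"
    have cnz: "c \<noteq> 0" using c lnz[OF mH] zero_power[OF mpos] by metis
    \<comment> \<open>The condition at \<open>m\<close> propagates to all multiples of
      \<open>m\<close>. So the value \<open>c\<close> agrees with \<open>l\<close> wherever
      multiples of \<open>g\<close> fall into \<open>H\<close>.\<close>
    have cmult: "c ^ k = l (nat_mult k g)" if k: "nat_mult k g \<in> H" for k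
    proof -
      obtain q where q: "k = q * m" using dvd[OF k] by (metis dvd_div_mult_self)
      have "c ^ k = l (nat_mult m g) ^ q" by (simp add: q power_mult mult.commute[of q] flip: c)
      also have "\<dots> = l (nat_mult k g)" using multH[OF mH, of q] by (simp add: q nat_mult_times)
      finally show ?thesis .
    qed
    \<comment> \<open>Natural multiples of \<open>g\<close> suffice: closure under negation is
      recovered in \<open>uminus'\<close> from the finite order of group elements.\<close>
    define H' where "H' = {h + nat_mult k g | h k. h \<in> H}"
    have wd: "l h * c ^ k = l h' * c ^ k'" if "h \<in> H" "h' \<in> H" "h + nat_mult k g = h' + nat_mult k' g" for h h' k k'
    proof -
      \<comment> \<open>The case k \<le> k' comes first because the difference of exponents has to
        be a natural number; the other case is symmetric.\<close>
      have *: "l h * c ^ k = l h' * c ^ k'" if "h \<in> H" "h' \<in> H" "h + nat_mult k g = h' + nat_mult k' g" "k \<le> k'" for h h' k k'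
      proof -
        have "nat_mult k' g = nat_mult (k' - k) g + nat_mult k g" using that(4) by (simp flip: nat_mult_add)
        then have e: "h = h' + nat_mult (k' - k) g" using that(3) by (simp add: add.assoc[symmetric])
        then have "nat_mult (k' - k) g = h - h'" by simp
        then have kH: "nat_mult (k' - k) g \<in> H" using Hd that by simp
        have "l h * c ^ k = l h' * (c ^ (k' - k) * c ^ k)"
          unfolding e using la[OF that(2) kH] cmult[OF kH] by simp
        then show ?thesis using that(4) by (simp flip: power_add)
      qed
      show ?thesis
      proof (cases "k \<le> k'")
        case False
        then show ?thesis using *[OF that(2,1) that(3)[symmetric]] by simp
      qed (use * that in blast)
    qed
    define l' where "l' = (\<lambda>x. THE y. \<exists>h k. h \<in> H \<and> x = h + nat_mult k g \<and> y = l h * c ^ k)"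
    have l': "l' (h + nat_mult k g) = l h * c ^ k" if "h \<in> H" for h k
      unfolding l'_def
    proof (rule the_equality)
      show "\<exists>h' k'. h' \<in> H \<and> h + nat_mult k g = h' + nat_mult k' g \<and> l h * c ^ k = l h' * c ^ k'"
        using that by blast
      fix y assume "\<exists>h' k'. h' \<in> H \<and> h + nat_mult k g = h' + nat_mult k' g \<and> y = l h' * c ^ k'"
      then obtain h' k' where "h' \<in> H" "h + nat_mult k g = h' + nat_mult k' g" "y = l h' * c ^ k'" by blast
      then show "y = l h * c ^ k" using wd[OF that, of h' k k'] by simp
    qed
    have HH': "x \<in> H'" if "x \<in> H" for x
      unfolding H'_def using that by (intro CollectI exI[of _ x] exI[of _ "0::nat"]) simp
    have gH': "g \<in> H'"
      unfolding H'_def using H0 by (intro CollectI exI[of _ 0] exI[of _ "Suc 0"]) simp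
    have add': "x + y \<in> H' \<and> l' (x + y) = l' x * l' y" if x: "x \<in> H'" and y: "y \<in> H'" for x y
    proof -
      obtain h k h' k' where h: "h \<in> H" "x = h + nat_mult k g" and h': "h' \<in> H" "y = h' + nat_mult k' g"
        using x y by (auto simp: H'_def)
      have e: "x + y = (h + h') + nat_mult (k + k') g" by (simp add: h h' nat_mult_add ac_simps)
      then have "x + y \<in> H'" unfolding H'_def using Ha[OF h(1) h'(1)] by blast
      moreover have "l' (x + y) = l' x * l' y"
        unfolding e using h h' by (simp add: l' Ha la power_add)
      ultimately show ?thesis by simp
    qed
    have uminus': "- x \<in> H'" if x: "x \<in> H'" for x
    proof -
      have nm: "nat_mult k x \<in> H'" for k
        by (induction k) (use x HH'[OF H0] add' in auto)
      obtain n where n: "n > 0" "nat_mult n x = 0" using exists_nat_mult_eq_0[of x] by blast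
      then have "x + nat_mult (n - 1) x = 0" by (cases n) auto
      then have "- x = nat_mult (n - 1) x" by (rule minus_unique)
      then show ?thesis using nm by simp
    qed
    have nz': "l' x \<noteq> 0" if "x \<in> H'" for x
      using that lnz cnz by (auto simp: H'_def l')
    have ll: "l' x = l x" if "x \<in> H" for x
      using l'[OF that, of 0] by simp
    have "l' g = c" using l'[OF H0, of "Suc 0"] l0 by simp
    moreover have "partial_character H' l'"
      unfolding partial_character_def using HH'[OF H0] add' uminus' nz' by blast
    ultimately show "\<exists>H' l'. partial_character H' l' \<and> H \<subset> H' \<and> (\<forall>x\<in>H. l' x = l x) \<and> l' g = c \<and> g \<in> H'"
      using HH' gH' g ll by (intro exI[of _ H'] exI[of _ l']) auto
  qed
qed

text \<open>A root of 1 + c + ... + c^(m-1) is an m-th root of unity. It is not 1, since the value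
  at 1 is m, which is nonzero in characteristic 0.\<close>

lemma exists_nontrivial_root_of_unity:
  assumes "m > 1"
  shows "\<exists>c :: 'k::{alg_closed_field,field_char_0}. c ^ m = 1 \<and> c \<noteq> 1"
proof -
  obtain c :: 'k where c: "(\<Sum>k\<le>m - 1. 1 * c ^ k) = 0"
    using alg_closed[of "m - 1" "\<lambda>_. 1"] assms by auto
  have "{..m - 1} = {..<m}" using assms by auto
  then have s: "(\<Sum>k<m. c ^ k) = 0" using c by simp
  have "c \<noteq> 1"
  proof
    assume "c = 1"
    then show False using s assms by simp
  qed
  moreover have "c ^ m - 1 = 0" using s power_diff_1_eq[of c m] by simp
  ultimately show ?thesis by auto
qed

text \<open>The trivial character of the zero subgroup is extended to \<open>z\<close> with a value
  other than 1. Among the subgroups with a character of this kind, one of largest cardinality is the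
  whole group, for otherwise extracting a root would enlarge it.\<close>

lemma exists_separating_character:
  fixes z :: "'g::{ab_group_add,finite}"
  assumes "z \<noteq> 0"
  shows "\<exists>l :: 'g \<Rightarrow> 'k::{alg_closed_field,field_char_0}. l \<in> character_group \<and> l z \<noteq> 1"
proof -
  define Q where "Q = (\<lambda>H. \<exists>l :: 'g \<Rightarrow> 'k. partial_character H l \<and> z \<in> H \<and> l z \<noteq> 1)"
  have "partial_character {0} (\<lambda>_. 1 :: 'k)" "z \<notin> {0}"
    using assms by (auto simp: partial_character_def)
  \<comment> \<open>Over the zero subgroup the condition on the value \<open>c\<close> at
    \<open>z\<close> is merely c^m = 1, which leaves room for a nontrivial root of unity.\<close>
  then obtain m where "m > 1" and m: "\<And>c :: 'k. c ^ m = 1 \<Longrightarrow>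
      \<exists>H' l'. partial_character H' l' \<and> {0} \<subset> H' \<and> (\<forall>x\<in>{0}. l' x = 1) \<and> l' z = c \<and> z \<in> H'"
    by (rule partial_character_extend) blast
  obtain c :: 'k where c: "c ^ m = 1" "c \<noteq> 1" using exists_nontrivial_root_of_unity[OF \<open>m > 1\<close>] by blast
  then have "\<exists>H. Q H" using m[of c] unfolding Q_def by blast
  moreover have "finite {H. Q H}" by (rule finite_subset[OF subset_UNIV finite])
  ultimately obtain H where QH: "Q H" and max: "\<And>H'. Q H' \<Longrightarrow> card H' \<le> card H"
    using finite_has_maximal[of "card ` {H. Q H}"]
    by (auto simp: image_iff) (metis nle_le)
  obtain l :: "'g \<Rightarrow> 'k" where l: "partial_character H l" "z \<in> H" "l z \<noteq> 1" using QH by (auto simp: Q_def)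
  have "H = UNIV"
  proof (rule ccontr)
    assume "H \<noteq> UNIV"
    then obtain g where g: "g \<notin> H" by blast
    obtain m where "m > 1" and m: "\<And>c. c ^ m = l (nat_mult m g) \<Longrightarrow>
        \<exists>H' l'. partial_character H' l' \<and> H \<subset> H' \<and> (\<forall>x\<in>H. l' x = l x) \<and> l' g = c \<and> g \<in> H'"
      using l(1) g by (rule partial_character_extend) blast
    obtain c where "c ^ m = l (nat_mult m g)" using nth_root_exists[of m] \<open>m > 1\<close> by auto
    then obtain H' l' where H': "partial_character H' l'" "H \<subset> H'" "\<forall>x\<in>H. l' x = l x" using m by blast
    then have "Q H'" using l unfolding Q_def by (intro exI[of _ l']) auto
    then have "card H' \<le> card H" by (rule max)
    moreover have "card H < card H'" using H'(2) by (intro psubset_card_mono) auto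
    ultimately show False by simp
  qed
  then have "l \<in> character_group" using l(1) by (auto simp: partial_character_def character_group_def)
  then show ?thesis using l by blast
qed

text \<open>Each value \<open>l x\<close> is a root of c^n - 1, where n annihilates
  \<open>x\<close>, and such a polynomial has finitely many roots.\<close>

lemma finite_character_group: "finite (character_group :: ('g::{ab_group_add,finite} \<Rightarrow> 'k::field) set)"
proof -
  define n where "n = (\<lambda>x :: 'g. SOME n. n > 0 \<and> nat_mult n x = 0)"
  have n: "n x > 0 \<and> nat_mult (n x) x = 0" for x
    unfolding n_def using exists_nat_mult_eq_0[of x] by (rule someI_ex)
  have "finite {c :: 'k. c ^ n x = 1}" for x
  proof -
    have "finite {c :: 'k. poly (monom 1 (n x) - 1) c = 0}"
    proof (rule poly_roots_finite, rule notI)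
      assume h: "monom 1 (n x) - 1 = (0 :: 'k poly)"
      have "coeff (monom 1 (n x) - 1 :: 'k poly) 0 = - 1" using n[of x] by simp
      then show False unfolding h by simp
    qed
    then show ?thesis by (simp add: poly_monom)
  qed
  then have "finite (\<Pi>\<^sub>E x\<in>UNIV. {c :: 'k. c ^ n x = 1})" by (intro finite_PiE) auto
  moreover have "(character_group :: ('g \<Rightarrow> 'k) set) \<subseteq> (\<Pi>\<^sub>E x\<in>UNIV. {c :: 'k. c ^ n x = 1})"
  proof
    fix l :: "'g \<Rightarrow> 'k" assume l: "l \<in> character_group"
    have "l (nat_mult k x) = l x ^ k" for k x
      by (induction k) (auto simp: character_groupD[OF l])
    then have "l x ^ n x = 1" for x using n[of x] character_groupD(3)[OF l] by metis
    then show "l \<in> (\<Pi>\<^sub>E x\<in>UNIV. {c :: 'k. c ^ n x = 1})" by auto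
  qed
  ultimately show ?thesis by (rule rev_finite_subset)
qed

lemma one_character: "(\<lambda>_. 1) \<in> character_group"
  by (simp add: character_group_def)

lemma mult_character:
  "l \<in> character_group \<Longrightarrow> l' \<in> character_group \<Longrightarrow> (\<lambda>x. l x * l' x) \<in> character_group"
  by (simp add: character_group_def)

lemma inverse_character: "l \<in> character_group \<Longrightarrow> (\<lambda>x. inverse (l x)) \<in> character_group"
  by (simp add: character_group_def)

text \<open>Translation by an element \<open>y\<close> permutes the terms and also multiplies the
  sum by \<open>l y\<close>; if some \<open>l y\<close> differs from 1, the sum vanishes.\<close>

lemma sum_character:
  fixes l :: "'g::{ab_group_add,finite} \<Rightarrow> 'k::field"
  assumes l: "l \<in> character_group"
  shows "(\<Sum>x\<in>UNIV. l x) = (if l = (\<lambda>_. 1) then of_nat (card (UNIV :: 'g set)) else 0)"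
proof (cases "l = (\<lambda>_. 1)")
  case False
  then obtain y where y: "l y \<noteq> 1" by (auto simp: fun_eq_iff)
  have "l y * (\<Sum>x\<in>UNIV. l x) = (\<Sum>x\<in>UNIV. l (y + x))"
    by (simp add: sum_distrib_left character_groupD(2)[OF l])
  also have "\<dots> = (\<Sum>x\<in>UNIV. l x)"
    by (rule sum.reindex_bij_witness[where i = "\<lambda>x. x - y" and j = "\<lambda>x. y + x"]) auto
  finally have "(l y - 1) * (\<Sum>x\<in>UNIV. l x) = 0" by (simp add: algebra_simps)
  then show ?thesis using y False by simp
qed simp

text \<open>The dual orthogonality relation. Off 0, multiplication by a separating character
  permutes the terms. At 0 the sum is the number of characters, which is found by summing
  \<open>l z\<close> over all pairs in both orders.\<close>

lemma sum_characters:
  fixes z :: "'g::{ab_group_add,finite}"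
  shows "(\<Sum>l\<in>character_group. l z) = (if z = 0 then of_nat (card (UNIV :: 'g set)) else (0 :: 'k::{alg_closed_field,field_char_0}))"
proof -
  let ?G = "character_group :: ('g \<Rightarrow> 'k) set"
  have zero: "(\<Sum>l\<in>?G. l z) = 0" if z: "z \<noteq> 0" for z
  proof -
    obtain l0 :: "'g \<Rightarrow> 'k" where l0: "l0 \<in> character_group" "l0 z \<noteq> 1"
      using exists_separating_character[OF z] by blast
    have nz: "l0 x \<noteq> 0" for x using character_groupD(1)[OF l0(1)] .
    have "l0 z * (\<Sum>l\<in>?G. l z) = (\<Sum>l\<in>?G. (\<lambda>x. l0 x * l x) z)"
      by (simp add: sum_distrib_left)
    also have "\<dots> = (\<Sum>l\<in>?G. l z)"
      by (rule sum.reindex_bij_witness[where i = "\<lambda>l x. inverse (l0 x) * l x" and j = "\<lambda>l x. l0 x * l x"])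
        (use l0 nz in \<open>auto simp: mult_character inverse_character mult.assoc[symmetric]\<close>)
    finally have "(l0 z - 1) * (\<Sum>l\<in>?G. l z) = 0" by (simp add: algebra_simps)
    then show ?thesis using l0 by simp
  qed
  have "of_nat (card ?G) = (\<Sum>l\<in>?G. l 0)" by (simp add: character_groupD(3))
  also have "\<dots> = (\<Sum>z\<in>UNIV. if z = 0 then \<Sum>l\<in>?G. l z else 0)" by simp
  also have "\<dots> = (\<Sum>z\<in>UNIV. \<Sum>l\<in>?G. l z)" by (rule sum.cong) (auto simp: zero)
  also have "\<dots> = (\<Sum>l\<in>?G. \<Sum>z\<in>UNIV. l z)" by (rule sum.swap)
  also have "\<dots> = (\<Sum>l\<in>?G. if l = (\<lambda>_. 1) then of_nat (card (UNIV :: 'g set)) else 0)"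
    by (rule sum.cong) (auto simp: sum_character)
  also have "\<dots> = of_nat (card (UNIV :: 'g set))"
    by (subst sum.delta[OF finite_character_group]) (simp add: one_character)
  finally have "of_nat (card ?G) = (of_nat (card (UNIV :: 'g set)) :: 'k)" .
  then show ?thesis using zero by (simp add: character_groupD(3))
qed

section \<open>Splitting of idempotents and biproducts\<close>

text \<open>If \<open>n < r\<close>, padding both matrices with zeros to size \<open>r\<close> keeps
  the left inverse. For square matrices it is two-sided, but the padded product in the other order
  has the entry 0 at \<open>(n, n)\<close>. The lemma bounds the size of partial splittings.\<close>

lemma left_invertible_dim_le:
  fixes A :: "'k::field mat"
  assumes A: "A \<in> carrier_mat n r" and C: "C \<in> carrier_mat r n" and CA: "C * A = 1\<^sub>m r"
  shows "r \<le> n"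
proof (rule ccontr)
  assume "\<not> r \<le> n"
  then have nr: "n < r" by simp
  define A' where "A' = mat r r (\<lambda>(i, j). if i < n then A $$ (i, j) else 0)"
  define C' where "C' = mat r r (\<lambda>(i, j). if j < n then C $$ (i, j) else 0)"
  have "C' * A' = 1\<^sub>m r"
  proof (rule eq_matI)
    fix i j assume "i < dim_row (1\<^sub>m r :: 'k mat)" "j < dim_col (1\<^sub>m r :: 'k mat)"
    then have ij: "i < r" "j < r" by auto
    have "(C' * A') $$ (i, j) = (\<Sum>k = 0..<r. if k < n then C $$ (i, k) * A $$ (k, j) else 0)"
      using ij by (auto simp: C'_def A'_def scalar_prod_def intro!: sum.cong)
    also have "\<dots> = (\<Sum>k = 0..<n. C $$ (i, k) * A $$ (k, j))"
      using nr by (intro sum.mono_neutral_cong_right) auto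
    also have "\<dots> = (C * A) $$ (i, j)" using A C ij by (simp add: scalar_prod_def)
    finally show "(C' * A') $$ (i, j) = 1\<^sub>m r $$ (i, j)" using CA by simp
  qed (auto simp: A'_def C'_def)
  then have "A' * C' = 1\<^sub>m r"
    by (rule mat_mult_left_right_inverse[rotated 2]) (simp_all add: A'_def C'_def)
  then have "(A' * C') $$ (n, n) = 1" using nr by simp
  then show False using nr by (simp add: A'_def C'_def scalar_prod_def)
qed

text \<open>A nonzero entry of the complementary idempotent \<open>Q - A * C\<close> yields a column, to be added to \<open>A\<close>,
  and a normalized row, to be added to \<open>C\<close>.\<close>

lemma idempotent_split_step:
  fixes Q :: "'k::field mat"
  assumes Q: "Q \<in> carrier_mat n n" "Q * Q = Q"
    and A: "A \<in> carrier_mat n r" and C: "C \<in> carrier_mat r n" and CA: "C * A = 1\<^sub>m r"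
    and QA: "Q * A = A" and CQ: "C * Q = C" and ne: "A * C \<noteq> Q"
  shows "\<exists>A C. A \<in> carrier_mat n (Suc r) \<and> C \<in> carrier_mat (Suc r) n \<and> C * A = 1\<^sub>m (Suc r) \<and> Q * A = A \<and> C * Q = C"
proof -
  \<comment> \<open>\<open>E\<close> is the part of \<open>Q\<close> not yet split: an idempotent
    fixed by \<open>Q\<close> on both sides, with \<open>C * E\<close> and \<open>E * A\<close>
    equal to zero.\<close>
  define E where "E = Q - A * C"
  have AC: "A * C \<in> carrier_mat n n" using A C by simp
  have E: "E \<in> carrier_mat n n" unfolding E_def by (rule minus_carrier_mat[OF AC])
  have QE: "Q * E = E"
    unfolding E_def using Q A C AC QA
    by (simp add: mult_minus_distrib_mat[OF Q(1) Q(1) AC] assoc_mult_mat[OF Q(1) A C, symmetric])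
  have EQ: "E * Q = E"
    unfolding E_def using Q A C AC CQ
    by (simp add: minus_mult_distrib_mat[OF Q(1) AC Q(1)] assoc_mult_mat[OF A C Q(1)])
  have CE: "C * E = 0\<^sub>m r n"
    unfolding E_def using A C CA CQ
    by (simp add: mult_minus_distrib_mat[OF C Q(1) AC] assoc_mult_mat[OF C A C, symmetric])
  have EA: "E * A = 0\<^sub>m n r"
    unfolding E_def using A C CA QA
    by (simp add: minus_mult_distrib_mat[OF Q(1) AC A] assoc_mult_mat[OF A C A])
  have EE: "E * E = E"
  proof -
    have "E * E = E * Q - E * (A * C)" unfolding E_def[of, symmetric]
      by (subst (2) E_def) (rule mult_minus_distrib_mat[OF E Q(1) AC])
    also have "E * (A * C) = 0\<^sub>m n n" using EA A C E by (simp add: assoc_mult_mat[OF E A C, symmetric])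
    finally show ?thesis using EQ E by (auto intro!: eq_matI)
  qed
  have "\<exists>i j. i < n \<and> j < n \<and> E $$ (i, j) \<noteq> 0"
  proof (rule ccontr)
    assume *: "\<not> ?thesis"
    have "A * C = Q"
    proof (rule eq_matI)
      fix i j assume "i < dim_row Q" "j < dim_col Q"
      then have ij: "i < n" "j < n" using Q by auto
      then have "E $$ (i, j) = 0" using * by blast
      then show "(A * C) $$ (i, j) = Q $$ (i, j)" using ij A C by (simp add: E_def)
    qed (use Q AC in auto)
    then show False using ne by simp
  qed
  then obtain i0 j0 where ij: "i0 < n" "j0 < n" "E $$ (i0, j0) \<noteq> 0" by blast
  define A' where "A' = mat n (Suc r) (\<lambda>(i, j). if j < r then A $$ (i, j) else E $$ (i, j0))"
  define C' where "C' = mat (Suc r) n (\<lambda>(j, i). if j < r then C $$ (j, i) else E $$ (i0, i) / E $$ (i0, j0))"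
  have prod_entry: "(\<Sum>k = 0..<n. X $$ (a, k) * Y $$ (k, b)) = (X * Y) $$ (a, b)"
    if "X \<in> carrier_mat p n" "Y \<in> carrier_mat n q" "a < p" "b < q" for X Y :: "'k mat" and p q a b
    using that by (simp add: scalar_prod_def)
  have "C' * A' = 1\<^sub>m (Suc r)"
  proof (rule eq_matI)
    fix a b assume "a < dim_row (1\<^sub>m (Suc r) :: 'k mat)" "b < dim_col (1\<^sub>m (Suc r) :: 'k mat)"
    then have ab: "a < Suc r" "b < Suc r" by auto
    have *: "(C' * A') $$ (a, b) = (\<Sum>k = 0..<n. C' $$ (a, k) * A' $$ (k, b))"
      using ab by (simp add: C'_def A'_def scalar_prod_def)
    consider "a < r" "b < r" | "a < r" "b = r" | "a = r" "b < r" | "a = r" "b = r" using ab by linarith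
    then show "(C' * A') $$ (a, b) = 1\<^sub>m (Suc r) $$ (a, b)"
    proof cases
      case 1
      then show ?thesis unfolding * using prod_entry[OF C A] CA by (simp add: A'_def C'_def)
    next
      case 2
      then show ?thesis unfolding * using prod_entry[OF C E] CE ij by (simp add: A'_def C'_def)
    next
      case 3
      then have "(\<Sum>k = 0..<n. C' $$ (a, k) * A' $$ (k, b)) = (\<Sum>k = 0..<n. E $$ (i0, k) * A $$ (k, b)) / E $$ (i0, j0)"
        by (simp add: A'_def C'_def sum_divide_distrib)
      then show ?thesis unfolding * using prod_entry[OF E A] EA ij 3 by simp
    next
      \<comment> \<open>Here idempotence enters: row \<open>i0\<close> of \<open>E\<close> times
        column \<open>j0\<close> is the entry of \<open>E * E = E\<close> at
        \<open>(i0, j0)\<close>, which the normalization turns into 1.\<close>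
      case 4
      then have "(\<Sum>k = 0..<n. C' $$ (a, k) * A' $$ (k, b)) = (\<Sum>k = 0..<n. E $$ (i0, k) * E $$ (k, j0)) / E $$ (i0, j0)"
        by (simp add: A'_def C'_def sum_divide_distrib)
      then show ?thesis unfolding * using prod_entry[OF E E] EE ij 4 by simp
    qed
  qed (auto simp: A'_def C'_def)
  moreover have "Q * A' = A'"
  proof (rule eq_matI)
    fix a b assume "a < dim_row A'" "b < dim_col A'"
    then have ab: "a < n" "b < Suc r" by (auto simp: A'_def)
    have "(Q * A') $$ (a, b) = (\<Sum>k = 0..<n. Q $$ (a, k) * A' $$ (k, b))"
      using ab Q by (simp add: A'_def scalar_prod_def)
    also have "\<dots> = (if b < r then (Q * A) $$ (a, b) else (Q * E) $$ (a, j0))"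
      using ab ij prod_entry[OF Q(1) A] prod_entry[OF Q(1) E] by (simp add: A'_def)
    also have "\<dots> = A' $$ (a, b)" using ab QA QE by (simp add: A'_def)
    finally show "(Q * A') $$ (a, b) = A' $$ (a, b)" .
  qed (use Q in \<open>auto simp: A'_def\<close>)
  moreover have "C' * Q = C'"
  proof (rule eq_matI)
    fix a b assume "a < dim_row C'" "b < dim_col C'"
    then have ab: "a < Suc r" "b < n" by (auto simp: C'_def)
    have "(C' * Q) $$ (a, b) = (\<Sum>k = 0..<n. C' $$ (a, k) * Q $$ (k, b))"
      using ab Q by (simp add: C'_def scalar_prod_def)
    also have "\<dots> = (if a < r then (C * Q) $$ (a, b) else (E * Q) $$ (i0, b) / E $$ (i0, j0))"
      using ab ij prod_entry[OF C Q(1)] prod_entry[OF E Q(1)] by (simp add: C'_def sum_divide_distrib[symmetric])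
    also have "\<dots> = C' $$ (a, b)" using ab CQ EQ by (simp add: C'_def)
    finally show "(C' * Q) $$ (a, b) = C' $$ (a, b)" .
  qed (use Q in \<open>auto simp: C'_def\<close>)
  ultimately show ?thesis by (intro exI[of _ A'] exI[of _ C']) (auto simp: A'_def C'_def)
qed

text \<open>A partial splitting of the largest possible size exhausts \<open>Q\<close>, as
  \<open>idempotent_split_step\<close> enlarges any other.\<close>

lemma idempotent_split:
  fixes Q :: "'k::field mat"
  assumes Q: "Q \<in> carrier_mat n n" "Q * Q = Q"
  shows "\<exists>r A C. A \<in> carrier_mat n r \<and> C \<in> carrier_mat r n \<and> C * A = 1\<^sub>m r \<and> A * C = Q"
proof -
  define S where "S = {r. \<exists>A C. A \<in> carrier_mat n r \<and> C \<in> carrier_mat r n \<and> C * A = 1\<^sub>m r \<and> Q * A = A \<and> C * Q = C}"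
  have "S \<subseteq> {..n}" using left_invertible_dim_le by (auto simp: S_def)
  then have fin: "finite S" by (rule finite_subset) simp
  \<comment> \<open>Matrices without columns or without rows give the empty splitting, so the set of
    sizes has a maximum.\<close>
  have "0 \<in> S" unfolding S_def using Q
    by (intro CollectI exI[of _ "0\<^sub>m n 0"] exI[of _ "0\<^sub>m 0 n"]) (auto intro!: eq_matI)
  then have "Max S \<in> S" using fin by (intro Max_in) auto
  then obtain A C where AC: "A \<in> carrier_mat n (Max S)" "C \<in> carrier_mat (Max S) n" "C * A = 1\<^sub>m (Max S)" "Q * A = A" "C * Q = C"
    by (auto simp: S_def)
  have "A * C = Q"
  proof (rule ccontr)
    assume "A * C \<noteq> Q"
    then have "Suc (Max S) \<in> S" using idempotent_split_step[OF Q AC] by (subst S_def) (rule CollectI)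
    then have "Suc (Max S) \<le> Max S" using fin by (rule Max_ge[rotated])
    then show False by simp
  qed
  then show ?thesis using AC by blast
qed

text \<open>The basis of the direct sum is the disjoint union of the bases of the summands, numbered
  by a bijection \<open>h\<close>; inclusions and projections are the corresponding 0-1 matrices.
  Essential surjectivity assembles an object from its components in this way.\<close>

lemma exists_biproduct:
  fixes r :: "'i \<Rightarrow> nat"
  assumes I: "finite I"
  shows "\<exists>n (A :: 'i \<Rightarrow> 'k::field mat) C. (\<forall>i\<in>I. A i \<in> carrier_mat n (r i) \<and> C i \<in> carrier_mat (r i) n) \<and>
    (\<forall>i\<in>I. \<forall>j\<in>I. C i * A j = (if i = j then 1\<^sub>m (r i) else 0\<^sub>m (r i) (r j))) \<and>
    mat_sum n n I (\<lambda>i. A i * C i) = 1\<^sub>m n"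
proof -
  let ?S = "Sigma I (\<lambda>i. {0..<r i})"
  define n where "n = card ?S"
  have "finite ?S" using I by auto
  then obtain h where h: "bij_betw h ?S {0..<n}" using ex_bij_betw_finite_nat n_def by blast
  have hn: "h (i, a) < n" if "i \<in> I" "a < r i" for i a
    using bij_betwE[OF h] that by auto
  have hinj: "h (i, a) = h (j, b) \<longleftrightarrow> i = j \<and> a = b" if "i \<in> I" "a < r i" "j \<in> I" "b < r j" for i a j b
    using inj_on_eq_iff[OF bij_betw_imp_inj_on[OF h], of "(i, a)" "(j, b)"] that by simp
  define A where "A = (\<lambda>i. mat n (r i) (\<lambda>(k, a). if k = h (i, a) then 1 else (0 :: 'k)))"
  define C where "C = (\<lambda>i. mat (r i) n (\<lambda>(a, k). if k = h (i, a) then 1 else (0 :: 'k)))"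
  have "C i * A j = (if i = j then 1\<^sub>m (r i) else 0\<^sub>m (r i) (r j))" if "i \<in> I" "j \<in> I" for i j
  proof (rule eq_matI)
    fix a b assume "a < dim_row (if i = j then 1\<^sub>m (r i) else 0\<^sub>m (r i) (r j) :: 'k mat)"
      "b < dim_col (if i = j then 1\<^sub>m (r i) else 0\<^sub>m (r i) (r j) :: 'k mat)"
    then have ab: "a < r i" "b < r j" by (auto split: if_splits)
    have "h (i, a) < n" using hn that ab by blast
    then have "(C i * A j) $$ (a, b) = (if h (i, a) = h (j, b) then 1 else 0)"
      using ab unfolding A_def C_def by (simp add: scalar_prod_def if_one_mult)
    then show "(C i * A j) $$ (a, b) = (if i = j then 1\<^sub>m (r i) else 0\<^sub>m (r i) (r j)) $$ (a, b)"
      using ab that by (auto simp: hinj)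
  qed (auto simp: A_def C_def)
  moreover have "mat_sum n n I (\<lambda>i. A i * C i) = 1\<^sub>m n"
  proof (rule eq_matI)
    fix a b assume "a < dim_row (1\<^sub>m n :: 'k mat)" "b < dim_col (1\<^sub>m n :: 'k mat)"
    then have ab: "a < n" "b < n" by auto
    obtain i c where ic: "i \<in> I" "c < r i" "a = h (i, c)"
    proof -
      have "a \<in> h ` ?S" using ab(1) h by (simp add: bij_betw_def)
      then show ?thesis using that by auto
    qed
    have "mat_sum n n I (\<lambda>i. A i * C i) $$ (a, b) = (\<Sum>j\<in>I. \<Sum>k = 0..<r j. if a = h (j, k) \<and> b = h (j, k) then 1 else 0)"
      using ab by (auto simp: mat_sum_def A_def C_def scalar_prod_def intro!: sum.cong)
    also have "\<dots> = (\<Sum>(j, k)\<in>?S. if a = h (j, k) \<and> b = h (j, k) then 1 else 0)"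
      using I by (subst sum.Sigma) auto
    also have "\<dots> = (\<Sum>p\<in>?S. if p = (i, c) then (if b = a then 1 else 0) else 0)"
      using ic by (intro sum.cong) (auto simp: hinj)
    also have "\<dots> = (if b = a then 1 else 0)" using ic I by simp
    finally show "mat_sum n n I (\<lambda>i. A i * C i) $$ (a, b) = 1\<^sub>m n $$ (a, b)" using ab by auto
  qed auto
  ultimately show ?thesis
    by (intro exI[of _ n] exI[of _ A] exI[of _ C]) (auto simp: A_def C_def)
qed

section \<open>Equivalences and direct sums\<close>

lemma is_equivalence_if_fully_faithful:
  assumes "category C" "category D" and F: "is_functor C D Fo Fm"
    and ff: "\<And>X Y. X \<in> Ob C \<Longrightarrow> Y \<in> Ob C \<Longrightarrow> bij_betw (Fm X Y) (Hom C X Y) (Hom D (Fo X) (Fo Y))"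
    and es: "\<And>Y. Y \<in> Ob D \<Longrightarrow> \<exists>X\<in>Ob C. \<exists>e. iso_arrow D (Fo X) Y e"
  shows "is_equivalence C D Fo Fm"
proof -
  interpret C: category C by fact
  interpret D: category D by fact
  have Fo: "Fo X \<in> Ob D" if "X \<in> Ob C" for X using F that by (auto simp: is_functor_def)
  have Fhom: "Fm X Y f \<in> Hom D (Fo X) (Fo Y)" if "X \<in> Ob C" "Y \<in> Ob C" "f \<in> Hom C X Y" for X Y f
    using F that by (auto simp: is_functor_def)
  have Fid: "Fm X X (Ident C X) = Ident D (Fo X)" if "X \<in> Ob C" for X using F that by (auto simp: is_functor_def)
  have Fcmp: "Fm X Z (g \<cdot>\<^bsub>C\<^esub> f) = Fm Y Z g \<cdot>\<^bsub>D\<^esub> Fm X Y f"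
    if "X \<in> Ob C" "Y \<in> Ob C" "Z \<in> Ob C" "f \<in> Hom C X Y" "g \<in> Hom C Y Z" for X Y Z f g
    using F that by (auto simp: is_functor_def)
  have "\<forall>Y\<in>Ob D. \<exists>X a b. X \<in> Ob C \<and> inverse_arrows D (Fo X) Y a b"
    using es unfolding iso_arrow_def by blast
  then obtain Go a b where Go: "\<And>Y. Y \<in> Ob D \<Longrightarrow> Go Y \<in> Ob C"
    and inv: "\<And>Y. Y \<in> Ob D \<Longrightarrow> inverse_arrows D (Fo (Go Y)) Y (a Y) (b Y)" by metis
  have ah: "a Y \<in> Hom D (Fo (Go Y)) Y" and bh: "b Y \<in> Hom D Y (Fo (Go Y))"
    and ba: "b Y \<cdot>\<^bsub>D\<^esub> a Y = Ident D (Fo (Go Y))" and ab: "a Y \<cdot>\<^bsub>D\<^esub> b Y = Ident D Y"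
    if "Y \<in> Ob D" for Y
    using inv[OF that] by (auto simp: inverse_arrows_def)
  define K where "K = (\<lambda>X Y. the_inv_into (Hom C X Y) (Fm X Y))"
  have K: "K X Y g \<in> Hom C X Y" "Fm X Y (K X Y g) = g"
    if "X \<in> Ob C" "Y \<in> Ob C" "g \<in> Hom D (Fo X) (Fo Y)" for X Y g
    using ff[OF that(1,2)] that(3) unfolding K_def bij_betw_def
    by (auto intro: the_inv_into_into f_the_inv_into_f)
  have faithful: "f = g" if "X \<in> Ob C" "Y \<in> Ob C" "f \<in> Hom C X Y" "g \<in> Hom C X Y" "Fm X Y f = Fm X Y g" for X Y f g
    using ff[OF that(1,2)] that(3-) unfolding bij_betw_def inj_on_def by blast
  \<comment> \<open>Conjugation by the chosen isomorphisms gives a map between values of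
    \<open>Fo\<close>, which fullness lifts. Identities between lifts are then tested after applying
    \<open>Fm\<close>, by faithfulness.\<close>
  define Gm where "Gm = (\<lambda>Y Z g. K (Go Y) (Go Z) (b Z \<cdot>\<^bsub>D\<^esub> (g \<cdot>\<^bsub>D\<^esub> a Y)))"
  have conj: "b Z \<cdot>\<^bsub>D\<^esub> (g \<cdot>\<^bsub>D\<^esub> a Y) \<in> Hom D (Fo (Go Y)) (Fo (Go Z))"
    if "Y \<in> Ob D" "Z \<in> Ob D" "g \<in> Hom D Y Z" for Y Z g
    using D.cmp_hom[OF _ _ _ D.cmp_hom[OF _ _ _ ah that(3)] bh] that Fo Go by auto
  have Gm: "Gm Y Z g \<in> Hom C (Go Y) (Go Z)" "Fm (Go Y) (Go Z) (Gm Y Z g) = b Z \<cdot>\<^bsub>D\<^esub> (g \<cdot>\<^bsub>D\<^esub> a Y)"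
    if "Y \<in> Ob D" "Z \<in> Ob D" "g \<in> Hom D Y Z" for Y Z g
    unfolding Gm_def using K[OF Go Go conj] that by auto
  have aGm: "a Z \<cdot>\<^bsub>D\<^esub> Fm (Go Y) (Go Z) (Gm Y Z g) = g \<cdot>\<^bsub>D\<^esub> a Y"
    if "Y \<in> Ob D" "Z \<in> Ob D" "g \<in> Hom D Y Z" for Y Z g
  proof -
    have ga: "g \<cdot>\<^bsub>D\<^esub> a Y \<in> Hom D (Fo (Go Y)) Z" using D.cmp_hom[OF _ _ _ ah that(3)] that Fo Go by auto
    have "a Z \<cdot>\<^bsub>D\<^esub> (b Z \<cdot>\<^bsub>D\<^esub> (g \<cdot>\<^bsub>D\<^esub> a Y)) = (a Z \<cdot>\<^bsub>D\<^esub> b Z) \<cdot>\<^bsub>D\<^esub> (g \<cdot>\<^bsub>D\<^esub> a Y)"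
      using D.cmp_assoc[OF _ _ _ _ ga bh ah] that Fo Go by auto
    then show ?thesis using Gm(2)[OF that] ab[OF that(2)] D.cmp_ident_left[OF _ _ ga] that Fo Go by auto
  qed
  have G_functor: "is_functor D C Go Gm"
    unfolding is_functor_def
  proof (intro conjI ballI)
    show "Go Y \<in> Ob C" if "Y \<in> Ob D" for Y using Go[OF that] .
    show "Gm Y Z g \<in> Hom C (Go Y) (Go Z)" if "Y \<in> Ob D" "Z \<in> Ob D" "g \<in> Hom D Y Z" for Y Z g
      using Gm(1)[OF that] .
    show "Gm Y Y (Ident D Y) = Ident C (Go Y)" if Y: "Y \<in> Ob D" for Y
    proof (rule faithful[OF Go[OF Y] Go[OF Y] Gm(1)[OF Y Y D.ident_hom[OF Y]] C.ident_hom[OF Go[OF Y]]])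
      show "Fm (Go Y) (Go Y) (Gm Y Y (Ident D Y)) = Fm (Go Y) (Go Y) (Ident C (Go Y))"
        using Gm(2)[OF Y Y D.ident_hom[OF Y]] D.cmp_ident_left[OF _ Y ah[OF Y]] ba[OF Y] Fid[OF Go[OF Y]] Fo[OF Go[OF Y]] by simp
    qed
    fix X Y Z f g assume X: "X \<in> Ob D" and Y: "Y \<in> Ob D" and Z: "Z \<in> Ob D"
      and f: "f \<in> Hom D X Y" and g: "g \<in> Hom D Y Z"
    note ob = Fo[OF Go[OF X]] Fo[OF Go[OF Y]] Fo[OF Go[OF Z]]
    have gf: "g \<cdot>\<^bsub>D\<^esub> f \<in> Hom D X Z" by (rule D.cmp_hom[OF X Y Z f g])
    show "Gm X Z (g \<cdot>\<^bsub>D\<^esub> f) = Gm Y Z g \<cdot>\<^bsub>C\<^esub> Gm X Y f"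
    proof (rule faithful[OF Go[OF X] Go[OF Z] Gm(1)[OF X Z gf] C.cmp_hom[OF Go[OF X] Go[OF Y] Go[OF Z] Gm(1)[OF X Y f] Gm(1)[OF Y Z g]]])
      have FGf: "Fm (Go X) (Go Y) (Gm X Y f) \<in> Hom D (Fo (Go X)) (Fo (Go Y))"
        using Fhom[OF Go[OF X] Go[OF Y] Gm(1)[OF X Y f]] .
      have "Fm (Go X) (Go Z) (Gm Y Z g \<cdot>\<^bsub>C\<^esub> Gm X Y f) = (b Z \<cdot>\<^bsub>D\<^esub> (g \<cdot>\<^bsub>D\<^esub> a Y)) \<cdot>\<^bsub>D\<^esub> Fm (Go X) (Go Y) (Gm X Y f)"
        using Fcmp[OF Go[OF X] Go[OF Y] Go[OF Z] Gm(1)[OF X Y f] Gm(1)[OF Y Z g]] Gm(2)[OF Y Z g] by simp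
      also have "\<dots> = b Z \<cdot>\<^bsub>D\<^esub> ((g \<cdot>\<^bsub>D\<^esub> a Y) \<cdot>\<^bsub>D\<^esub> Fm (Go X) (Go Y) (Gm X Y f))"
        by (rule D.cmp_assoc[OF ob(1,2) Z ob(3) FGf D.cmp_hom[OF ob(2) Y Z ah[OF Y] g] bh[OF Z]])
      also have "(g \<cdot>\<^bsub>D\<^esub> a Y) \<cdot>\<^bsub>D\<^esub> Fm (Go X) (Go Y) (Gm X Y f) = g \<cdot>\<^bsub>D\<^esub> (a Y \<cdot>\<^bsub>D\<^esub> Fm (Go X) (Go Y) (Gm X Y f))"
        by (rule D.cmp_assoc[OF ob(1,2) Y Z FGf ah[OF Y] g])
      also have "\<dots> = (g \<cdot>\<^bsub>D\<^esub> f) \<cdot>\<^bsub>D\<^esub> a X"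
        using aGm[OF X Y f] D.cmp_assoc[OF ob(1) X Y Z ah[OF X] f g] by simp
      finally show "Fm (Go X) (Go Z) (Gm X Z (g \<cdot>\<^bsub>D\<^esub> f)) = Fm (Go X) (Go Z) (Gm Y Z g \<cdot>\<^bsub>C\<^esub> Gm X Y f)"
        using Gm(2)[OF X Z gf] by simp
    qed
  qed
  \<comment> \<open>The unit is the lift of \<open>b (Fo X)\<close>. Under \<open>Fm\<close> all
    claims about it become identities between \<open>a\<close> and \<open>b\<close>.\<close>
  define \<eta> where "\<eta> = (\<lambda>X. K X (Go (Fo X)) (b (Fo X)))"
  have \<eta>: "\<eta> X \<in> Hom C X (Go (Fo X))" "Fm X (Go (Fo X)) (\<eta> X) = b (Fo X)" if "X \<in> Ob C" for X
    unfolding \<eta>_def using K[OF that Go[OF Fo[OF that]] bh[OF Fo[OF that]]] by auto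
  have \<eta>_iso: "iso_arrow C X (Go (Fo X)) (\<eta> X)" if X: "X \<in> Ob C" for X
  proof -
    note FX = Fo[OF X] and GFX = Go[OF Fo[OF X]]
    let ?k = "K (Go (Fo X)) X (a (Fo X))"
    note k = K[OF GFX X ah[OF FX]]
    have "?k \<cdot>\<^bsub>C\<^esub> \<eta> X = Ident C X"
      by (rule faithful[OF X X C.cmp_hom[OF X GFX X \<eta>(1)[OF X] k(1)] C.ident_hom[OF X]])
        (simp add: Fcmp[OF X GFX X \<eta>(1)[OF X] k(1)] k(2) \<eta>(2)[OF X] ab[OF FX] Fid[OF X])
    moreover have "\<eta> X \<cdot>\<^bsub>C\<^esub> ?k = Ident C (Go (Fo X))"
      by (rule faithful[OF GFX GFX C.cmp_hom[OF GFX X GFX k(1) \<eta>(1)[OF X]] C.ident_hom[OF GFX]])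
        (simp add: Fcmp[OF GFX X GFX k(1) \<eta>(1)[OF X]] k(2) \<eta>(2)[OF X] ba[OF FX] Fid[OF GFX])
    ultimately show ?thesis
      using k(1) \<eta>(1)[OF X] by (auto simp: iso_arrow_def inverse_arrows_def)
  qed
  have "natural_iso C C (\<lambda>X. X) (\<lambda>X Y f. f) (\<lambda>X. Go (Fo X)) (\<lambda>X Y f. Gm (Fo X) (Fo Y) (Fm X Y f)) \<eta>"
    unfolding natural_iso_def
  proof (intro conjI ballI)
    show "iso_arrow C X (Go (Fo X)) (\<eta> X)" if "X \<in> Ob C" for X using \<eta>_iso[OF that] .
    fix X Y f assume X: "X \<in> Ob C" and Y: "Y \<in> Ob C" and f: "f \<in> Hom C X Y"
    note Ff = Fhom[OF X Y f] and GX = Go[OF Fo[OF X]] and GY = Go[OF Fo[OF Y]]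
    note g = Gm[OF Fo[OF X] Fo[OF Y] Ff]
    show "\<eta> Y \<cdot>\<^bsub>C\<^esub> f = Gm (Fo X) (Fo Y) (Fm X Y f) \<cdot>\<^bsub>C\<^esub> \<eta> X"
    proof (rule faithful[OF X GY C.cmp_hom[OF X Y GY f \<eta>(1)[OF Y]] C.cmp_hom[OF X GX GY \<eta>(1)[OF X] g(1)]])
      have "Fm X (Go (Fo Y)) (Gm (Fo X) (Fo Y) (Fm X Y f) \<cdot>\<^bsub>C\<^esub> \<eta> X) = (b (Fo Y) \<cdot>\<^bsub>D\<^esub> (Fm X Y f \<cdot>\<^bsub>D\<^esub> a (Fo X))) \<cdot>\<^bsub>D\<^esub> b (Fo X)"
        by (simp add: Fcmp[OF X GX GY \<eta>(1)[OF X] g(1)] g(2) \<eta>(2)[OF X])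
      also have "\<dots> = b (Fo Y) \<cdot>\<^bsub>D\<^esub> ((Fm X Y f \<cdot>\<^bsub>D\<^esub> a (Fo X)) \<cdot>\<^bsub>D\<^esub> b (Fo X))"
        by (rule D.cmp_assoc[OF Fo[OF X] Fo[OF GX] Fo[OF Y] Fo[OF GY] bh[OF Fo[OF X]]
          D.cmp_hom[OF Fo[OF GX] Fo[OF X] Fo[OF Y] ah[OF Fo[OF X]] Ff] bh[OF Fo[OF Y]]])
      also have "(Fm X Y f \<cdot>\<^bsub>D\<^esub> a (Fo X)) \<cdot>\<^bsub>D\<^esub> b (Fo X) = Fm X Y f"
        using D.cmp_assoc[OF Fo[OF X] Fo[OF GX] Fo[OF X] Fo[OF Y] bh[OF Fo[OF X]] ah[OF Fo[OF X]] Ff]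
          ab[OF Fo[OF X]] D.cmp_ident_right[OF Fo[OF X] Fo[OF Y] Ff] by simp
      finally show "Fm X (Go (Fo Y)) (\<eta> Y \<cdot>\<^bsub>C\<^esub> f) = Fm X (Go (Fo Y)) (Gm (Fo X) (Fo Y) (Fm X Y f) \<cdot>\<^bsub>C\<^esub> \<eta> X)"
        by (simp add: Fcmp[OF X Y GY f \<eta>(1)[OF Y]] \<eta>(2)[OF Y])
    qed
  qed
  moreover have "natural_iso D D (\<lambda>X. Fo (Go X)) (\<lambda>X Y f. Fm (Go X) (Go Y) (Gm X Y f)) (\<lambda>X. X) (\<lambda>X Y f. f) a"
    unfolding natural_iso_def using inv aGm by (auto simp: iso_arrow_def)
  ultimately show ?thesis
    unfolding is_equivalence_def using F G_functor by blast
qed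

section \<open>Direct sums of stable braided modules\<close>

lemma module_direct_sum_simps [simp]:
  "Ob (module_direct_sum I M) = (\<Pi>\<^sub>E i\<in>I. Ob (M i))"
  "Hom (module_direct_sum I M) N N' = (\<Pi>\<^sub>E i\<in>I. Hom (M i) (N i) (N' i))"
  "Ident (module_direct_sum I M) N = (\<lambda>i\<in>I. Ident (M i) (N i))"
  "Cmp (module_direct_sum I M) g f = (\<lambda>i\<in>I. g i \<cdot>\<^bsub>M i\<^esub> f i)"
  "act_ob (module_direct_sum I M) X N = (\<lambda>i\<in>I. X \<rhd>\<^sub>o\<^bsub>M i\<^esub> N i)"
  "act_arr (module_direct_sum I M) h f = (\<lambda>i\<in>I. h \<rhd>\<^sub>m\<^bsub>M i\<^esub> f i)"
  "mbraid (module_direct_sum I M) X N = (\<lambda>i\<in>I. mbraid (M i) X (N i))"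
  "mstable (module_direct_sum I M) N = (\<lambda>i\<in>I. mstable (M i) (N i))"
  by (simp_all add: module_direct_sum_def)

lemma direct_sum_ObD: "N \<in> Ob (module_direct_sum I M) \<Longrightarrow> i \<in> I \<Longrightarrow> N i \<in> Ob (M i)"
  by auto

lemma direct_sum_HomD: "f \<in> Hom (module_direct_sum I M) N N' \<Longrightarrow> i \<in> I \<Longrightarrow> f i \<in> Hom (M i) (N i) (N' i)"
  by auto

lemma inverse_arrows_direct_sum:
  assumes "\<And>i. i \<in> I \<Longrightarrow> inverse_arrows (M i) (N i) (N' i) (f i) (g i)"
  shows "inverse_arrows (module_direct_sum I M) N N' (restrict f I) (restrict g I)"
  using assms by (auto simp: inverse_arrows_def intro!: restrict_ext)

lemma category_direct_sum:
  assumes M: "\<And>i. i \<in> I \<Longrightarrow> category (M i)"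
  shows "category (module_direct_sum I M)"
proof
  let ?S = "module_direct_sum I M"
  show "Ident ?S X \<in> Hom ?S X X" if "X \<in> Ob ?S" for X
    using that by (auto intro!: category.ident_hom[OF M])
  show "g \<cdot>\<^bsub>?S\<^esub> f \<in> Hom ?S X Z"
    if h: "X \<in> Ob ?S" "Y \<in> Ob ?S" "Z \<in> Ob ?S" "f \<in> Hom ?S X Y" "g \<in> Hom ?S Y Z" for X Y Z f g
  proof -
    have "g i \<cdot>\<^bsub>M i\<^esub> f i \<in> Hom (M i) (X i) (Z i)" if "i \<in> I" for i
      by (rule category.cmp_hom[OF M[OF that], of "X i" "Y i" "Z i"]) (use h that in \<open>auto simp: PiE_iff\<close>)
    then show ?thesis by auto
  qed
  show "f \<cdot>\<^bsub>?S\<^esub> Ident ?S X = f" if "X \<in> Ob ?S" "Y \<in> Ob ?S" and f: "f \<in> Hom ?S X Y" for X Y f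
  proof -
    \<comment> \<open>Composition in the sum is restricted to \<open>I\<close>. Arrows of the sum
      are undefined off \<open>I\<close>, so restriction does not change them.\<close>
    have "f \<cdot>\<^bsub>?S\<^esub> Ident ?S X = restrict f I"
      using category.cmp_ident_right[OF M that(1,2)[THEN direct_sum_ObD] f[THEN direct_sum_HomD]]
      by (auto intro!: restrict_ext)
    then show ?thesis using f by (simp add: PiE_restrict)
  qed
  show "Ident ?S Y \<cdot>\<^bsub>?S\<^esub> f = f" if "X \<in> Ob ?S" "Y \<in> Ob ?S" and f: "f \<in> Hom ?S X Y" for X Y f
  proof -
    have "Ident ?S Y \<cdot>\<^bsub>?S\<^esub> f = restrict f I"
      using category.cmp_ident_left[OF M that(1,2)[THEN direct_sum_ObD] f[THEN direct_sum_HomD]]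
      by (auto intro!: restrict_ext)
    then show ?thesis using f by (simp add: PiE_restrict)
  qed
  show "(h \<cdot>\<^bsub>?S\<^esub> g) \<cdot>\<^bsub>?S\<^esub> f = h \<cdot>\<^bsub>?S\<^esub> (g \<cdot>\<^bsub>?S\<^esub> f)"
    if *: "W \<in> Ob ?S" "X \<in> Ob ?S" "Y \<in> Ob ?S" "Z \<in> Ob ?S" "f \<in> Hom ?S W X" "g \<in> Hom ?S X Y" "h \<in> Hom ?S Y Z" for W X Y Z f g h
    using category.cmp_assoc[OF M *(1-4)[THEN direct_sum_ObD] *(5-7)[THEN direct_sum_HomD]]
    by (auto intro!: restrict_ext)
qed

text \<open>\<open>inv_arrow\<close> is a definite description. To invert a family componentwise in
  a direct sum, each component must first be known to have an inverse.\<close>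

lemma (in stable_braided_module_category) act_mstable_inverse:
  assumes "X \<in> Ob B" "N \<in> Ob M"
  shows "inverse_arrows M (X \<rhd>\<^sub>o\<^bsub>M\<^esub> N) (X \<rhd>\<^sub>o\<^bsub>M\<^esub> N) (Ident B X \<rhd>\<^sub>m\<^bsub>M\<^esub> mstable M N)
    (inv_arrow M (X \<rhd>\<^sub>o\<^bsub>M\<^esub> N) (X \<rhd>\<^sub>o\<^bsub>M\<^esub> N) (Ident B X \<rhd>\<^sub>m\<^bsub>M\<^esub> mstable M N))"
proof -
  obtain g where g: "inverse_arrows M N N (mstable M N) g"
    using mstable_automorphism assms by (auto simp: ident_automorphism_def natural_iso_def iso_arrow_def)
  note g' = g[unfolded inverse_arrows_def]
  have "inverse_arrows M (X \<rhd>\<^sub>o\<^bsub>M\<^esub> N) (X \<rhd>\<^sub>o\<^bsub>M\<^esub> N) (Ident B X \<rhd>\<^sub>m\<^bsub>M\<^esub> mstable M N) (Ident B X \<rhd>\<^sub>m\<^bsub>M\<^esub> g)"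
    unfolding inverse_arrows_def
    using act_cmp[of X X X N N N "Ident B X" "Ident B X" "mstable M N" g]
      act_cmp[of X X X N N N "Ident B X" "Ident B X" g "mstable M N"]
      act_hom[of X X N N "Ident B X" "mstable M N"] act_hom[of X X N N "Ident B X" g]
      act_ident[of X N] ident_hom[of X] cmp_ident_left[of X X "Ident B X"] g' assms by simp
  then show ?thesis
    using M.inv_arrow_eqI[OF act_ob act_ob] assms by metis
qed

lemma stable_braided_direct_sum:
  fixes B :: "('o, 'm, 'z) rigid_braided_category_scheme"
    and M :: "'i \<Rightarrow> ('o, 'm, 'x, 'f) stable_braided_module"
  assumes B: "strict_rigid_braided_category B"
    and M: "\<And>i. i \<in> I \<Longrightarrow> stable_braided_module_category B (M i)"
  shows "stable_braided_module_category B (module_direct_sum I M)"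
proof -
  let ?S = "module_direct_sum I M"
  have bm: "braided_module_category B (M i)" if "i \<in> I" for i
    using M[OF that] by (rule stable_braided_module_category.axioms)
  have sm: "strict_module_category B (M i)" if "i \<in> I" for i
    using bm[OF that] by (rule braided_module_category.axioms)
  have cat: "category (M i)" if "i \<in> I" for i
    using sm[OF that] by (rule strict_module_category.axioms)
  interpret strict_rigid_braided_category B by (rule B)
  interpret S: category ?S by (rule category_direct_sum[OF cat])
  have strict: "strict_module_category B ?S"
  proof
    show "X \<rhd>\<^sub>o\<^bsub>?S\<^esub> N \<in> Ob ?S" if "X \<in> Ob B" "N \<in> Ob ?S" for X N
      using that by (auto intro!: strict_module_category.act_ob[OF sm])
    show "f \<rhd>\<^sub>m\<^bsub>?S\<^esub> h \<in> Hom ?S (X \<rhd>\<^sub>o\<^bsub>?S\<^esub> N) (X' \<rhd>\<^sub>o\<^bsub>?S\<^esub> N')"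
      if *: "X \<in> Ob B" "X' \<in> Ob B" "N \<in> Ob ?S" "N' \<in> Ob ?S" "f \<in> Hom B X X'" "h \<in> Hom ?S N N'" for X X' N N' f h
    proof -
      have "f \<rhd>\<^sub>m\<^bsub>M i\<^esub> h i \<in> Hom (M i) (X \<rhd>\<^sub>o\<^bsub>M i\<^esub> N i) (X' \<rhd>\<^sub>o\<^bsub>M i\<^esub> N' i)" if "i \<in> I" for i
        by (rule strict_module_category.act_hom[OF sm[OF that]]) (use * that in \<open>auto simp: PiE_iff\<close>)
      then show ?thesis by auto
    qed
    show "Ident B X \<rhd>\<^sub>m\<^bsub>?S\<^esub> Ident ?S N = Ident ?S (X \<rhd>\<^sub>o\<^bsub>?S\<^esub> N)" if "X \<in> Ob B" "N \<in> Ob ?S" for X N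
      using that by (auto intro!: restrict_ext strict_module_category.act_ident[OF sm])
    show "(f' \<cdot>\<^bsub>B\<^esub> f) \<rhd>\<^sub>m\<^bsub>?S\<^esub> (h' \<cdot>\<^bsub>?S\<^esub> h) = (f' \<rhd>\<^sub>m\<^bsub>?S\<^esub> h') \<cdot>\<^bsub>?S\<^esub> (f \<rhd>\<^sub>m\<^bsub>?S\<^esub> h)"
      if *: "X \<in> Ob B" "X' \<in> Ob B" "X'' \<in> Ob B" "N \<in> Ob ?S" "N' \<in> Ob ?S" "N'' \<in> Ob ?S"
        "f \<in> Hom B X X'" "f' \<in> Hom B X' X''" "h \<in> Hom ?S N N'" "h' \<in> Hom ?S N' N''" for X X' X'' N N' N'' f f' h h'
      using strict_module_category.act_cmp[OF sm *(1-3) *(4-6)[THEN direct_sum_ObD] *(7,8) *(9,10)[THEN direct_sum_HomD]]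
      by (auto intro!: restrict_ext)
    show "(X \<otimes>\<^sub>o\<^bsub>B\<^esub> Y) \<rhd>\<^sub>o\<^bsub>?S\<^esub> N = X \<rhd>\<^sub>o\<^bsub>?S\<^esub> (Y \<rhd>\<^sub>o\<^bsub>?S\<^esub> N)" if "X \<in> Ob B" "Y \<in> Ob B" "N \<in> Ob ?S" for X Y N
      using that by (auto intro!: restrict_ext strict_module_category.act_ob_tensor[OF sm])
    show "(f \<otimes>\<^sub>m\<^bsub>B\<^esub> g) \<rhd>\<^sub>m\<^bsub>?S\<^esub> h = f \<rhd>\<^sub>m\<^bsub>?S\<^esub> (g \<rhd>\<^sub>m\<^bsub>?S\<^esub> h)"
      if *: "X \<in> Ob B" "X' \<in> Ob B" "Y \<in> Ob B" "Y' \<in> Ob B" "N \<in> Ob ?S" "N' \<in> Ob ?S"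
        "f \<in> Hom B X X'" "g \<in> Hom B Y Y'" "h \<in> Hom ?S N N'" for X X' Y Y' N N' f g h
      using strict_module_category.act_arr_tensor[OF sm *(1-4) *(5,6)[THEN direct_sum_ObD] *(7,8) *(9)[THEN direct_sum_HomD]]
      by (auto intro!: restrict_ext)
    show "unit_ob B \<rhd>\<^sub>o\<^bsub>?S\<^esub> N = N" if N: "N \<in> Ob ?S" for N
    proof -
      have "unit_ob B \<rhd>\<^sub>o\<^bsub>?S\<^esub> N = restrict N I"
        unfolding module_direct_sum_simps
        by (intro restrict_ext strict_module_category.act_ob_unit[OF sm] direct_sum_ObD[OF N])
      then show ?thesis using N by (simp add: PiE_restrict)
    qed
    show "Ident B (unit_ob B) \<rhd>\<^sub>m\<^bsub>?S\<^esub> h = h" if N: "N \<in> Ob ?S" "N' \<in> Ob ?S" and h: "h \<in> Hom ?S N N'" for N N' h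
    proof -
      have "Ident B (unit_ob B) \<rhd>\<^sub>m\<^bsub>?S\<^esub> h = restrict h I"
        using strict_module_category.act_arr_unit[OF sm N[THEN direct_sum_ObD] h[THEN direct_sum_HomD]]
        by (auto intro!: restrict_ext)
      then show ?thesis using h by (simp add: PiE_restrict)
    qed
  qed
  interpret S: strict_module_category B ?S by (rule strict)
  have braided: "braided_module_category B ?S"
  proof
    show "iso_arrow ?S (X \<rhd>\<^sub>o\<^bsub>?S\<^esub> N) (X \<rhd>\<^sub>o\<^bsub>?S\<^esub> N) (mbraid ?S X N)" if X: "X \<in> Ob B" and N: "N \<in> Ob ?S" for X N
    proof -
      have "\<forall>i\<in>I. \<exists>g. inverse_arrows (M i) (X \<rhd>\<^sub>o\<^bsub>M i\<^esub> N i) (X \<rhd>\<^sub>o\<^bsub>M i\<^esub> N i) (mbraid (M i) X (N i)) g"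
        using braided_module_category.mbraid_iso[OF bm X] N by (auto simp: iso_arrow_def)
      then obtain g where "\<forall>i\<in>I. inverse_arrows (M i) (X \<rhd>\<^sub>o\<^bsub>M i\<^esub> N i) (X \<rhd>\<^sub>o\<^bsub>M i\<^esub> N i) (mbraid (M i) X (N i)) (g i)"
        by metis
      then have "inverse_arrows ?S (X \<rhd>\<^sub>o\<^bsub>?S\<^esub> N) (X \<rhd>\<^sub>o\<^bsub>?S\<^esub> N) (\<lambda>i\<in>I. mbraid (M i) X (N i)) (restrict g I)"
        by (intro inverse_arrows_direct_sum) auto
      then show ?thesis by (auto intro: inverse_arrows_iso)
    qed
    show "mbraid ?S X' N' \<cdot>\<^bsub>?S\<^esub> (f \<rhd>\<^sub>m\<^bsub>?S\<^esub> h) = (f \<rhd>\<^sub>m\<^bsub>?S\<^esub> h) \<cdot>\<^bsub>?S\<^esub> mbraid ?S X N"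
      if *: "X \<in> Ob B" "X' \<in> Ob B" "N \<in> Ob ?S" "N' \<in> Ob ?S" "f \<in> Hom B X X'" "h \<in> Hom ?S N N'" for X X' N N' f h
      using braided_module_category.mbraid_natural[OF bm *(1,2) *(3,4)[THEN direct_sum_ObD] *(5) *(6)[THEN direct_sum_HomD]]
      by (auto intro!: restrict_ext)
    show "mbraid ?S Y (X \<rhd>\<^sub>o\<^bsub>?S\<^esub> N) = (braid_inv B X Y \<rhd>\<^sub>m\<^bsub>?S\<^esub> Ident ?S N) \<cdot>\<^bsub>?S\<^esub>
        (Ident B X \<rhd>\<^sub>m\<^bsub>?S\<^esub> mbraid ?S Y N) \<cdot>\<^bsub>?S\<^esub> (braid_inv B Y X \<rhd>\<^sub>m\<^bsub>?S\<^esub> Ident ?S N)"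
      if "X \<in> Ob B" "Y \<in> Ob B" "N \<in> Ob ?S" for X Y N
      using that by (auto intro!: restrict_ext braided_module_category.mbraid_act[OF bm])
    show "mbraid ?S (Y \<otimes>\<^sub>o\<^bsub>B\<^esub> X) N = mbraid ?S Y (X \<rhd>\<^sub>o\<^bsub>?S\<^esub> N) \<cdot>\<^bsub>?S\<^esub> (Ident B Y \<rhd>\<^sub>m\<^bsub>?S\<^esub> mbraid ?S X N)"
      if "X \<in> Ob B" "Y \<in> Ob B" "N \<in> Ob ?S" for X Y N
      using that by (auto intro!: restrict_ext braided_module_category.mbraid_tensor[OF bm])
  qed
  interpret S: braided_module_category B ?S by (rule braided)
  show ?thesis
  proof
    have aut: "ident_automorphism (M i) (mstable (M i))" if "i \<in> I" for i
      using stable_braided_module_category.mstable_automorphism[OF M[OF that]] .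
    show "ident_automorphism ?S (mstable ?S)"
      unfolding ident_automorphism_def natural_iso_def
    proof (intro conjI ballI)
      fix N assume N: "N \<in> Ob ?S"
      have "\<forall>i\<in>I. \<exists>g. inverse_arrows (M i) (N i) (N i) (mstable (M i) (N i)) g"
        using aut direct_sum_ObD[OF N] unfolding ident_automorphism_def natural_iso_def iso_arrow_def by blast
      then obtain g where "\<forall>i\<in>I. inverse_arrows (M i) (N i) (N i) (mstable (M i) (N i)) (g i)"
        by metis
      then have "inverse_arrows ?S N N (\<lambda>i\<in>I. mstable (M i) (N i)) (restrict g I)"
        by (intro inverse_arrows_direct_sum) auto
      then show "iso_arrow ?S N N (mstable ?S N)" by (auto intro: inverse_arrows_iso)
    next
      fix N N' f assume *: "N \<in> Ob ?S" "N' \<in> Ob ?S" "f \<in> Hom ?S N N'"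
      have "mstable (M i) (N' i) \<cdot>\<^bsub>M i\<^esub> f i = f i \<cdot>\<^bsub>M i\<^esub> mstable (M i) (N i)" if "i \<in> I" for i
        using aut[OF that] *(1,2)[THEN direct_sum_ObD, OF that] direct_sum_HomD[OF *(3) that]
        unfolding ident_automorphism_def natural_iso_def by blast
      then show "mstable ?S N' \<cdot>\<^bsub>?S\<^esub> f = f \<cdot>\<^bsub>?S\<^esub> mstable ?S N"
        by (auto intro!: restrict_ext)
    qed
    fix X N assume X: "X \<in> Ob B" and N: "N \<in> Ob ?S"
    have "inverse_arrows ?S (X \<rhd>\<^sub>o\<^bsub>?S\<^esub> N) (X \<rhd>\<^sub>o\<^bsub>?S\<^esub> N) (\<lambda>i\<in>I. Ident B X \<rhd>\<^sub>m\<^bsub>M i\<^esub> mstable (M i) (N i))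
      (\<lambda>i\<in>I. inv_arrow (M i) (X \<rhd>\<^sub>o\<^bsub>M i\<^esub> N i) (X \<rhd>\<^sub>o\<^bsub>M i\<^esub> N i) (Ident B X \<rhd>\<^sub>m\<^bsub>M i\<^esub> mstable (M i) (N i)))"
      using stable_braided_module_category.act_mstable_inverse[OF M X] N by (intro inverse_arrows_direct_sum) auto
    then have "inv_arrow ?S (X \<rhd>\<^sub>o\<^bsub>?S\<^esub> N) (X \<rhd>\<^sub>o\<^bsub>?S\<^esub> N) (\<lambda>i\<in>I. Ident B X \<rhd>\<^sub>m\<^bsub>M i\<^esub> mstable (M i) (N i)) =
      (\<lambda>i\<in>I. inv_arrow (M i) (X \<rhd>\<^sub>o\<^bsub>M i\<^esub> N i) (X \<rhd>\<^sub>o\<^bsub>M i\<^esub> N i) (Ident B X \<rhd>\<^sub>m\<^bsub>M i\<^esub> mstable (M i) (N i)))"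
      by (rule S.inv_arrow_eqI[OF S.act_ob[OF X N] S.act_ob[OF X N]])
    moreover have "Ident B X \<rhd>\<^sub>m\<^bsub>?S\<^esub> mstable ?S N = (\<lambda>i\<in>I. Ident B X \<rhd>\<^sub>m\<^bsub>M i\<^esub> mstable (M i) (N i))"
      by (auto intro!: restrict_ext)
    ultimately show "mbraid ?S X N = mstable ?S (X \<rhd>\<^sub>o\<^bsub>?S\<^esub> N) \<cdot>\<^bsub>?S\<^esub>
        inv_arrow ?S (X \<rhd>\<^sub>o\<^bsub>?S\<^esub> N) (X \<rhd>\<^sub>o\<^bsub>?S\<^esub> N) (Ident B X \<rhd>\<^sub>m\<^bsub>?S\<^esub> mstable ?S N)"
      using N by (auto intro!: restrict_ext stable_braided_module_category.mbraid_eq_mstable[OF M X])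
  qed
qed

section \<open>Isotypic projections\<close>

text \<open>The classical projector: the average of the operators \<open>U z\<close> weighted by the
  inverse character, with \<open>l (- z)\<close> as the inverse of \<open>l z\<close>.\<close>

definition isotypic_proj :: "nat \<Rightarrow> ('g::{ab_group_add,finite} \<Rightarrow> 'k::field mat) \<Rightarrow> ('g \<Rightarrow> 'k) \<Rightarrow> 'k mat" where
  "isotypic_proj n U l = mat_sum n n UNIV (\<lambda>z. (l (- z) / of_nat (card (UNIV :: 'g set))) \<cdot>\<^sub>m U z)"

lemma dim_isotypic_proj [simp]: "dim_row (isotypic_proj n U l) = n" "dim_col (isotypic_proj n U l) = n"
  by (simp_all add: isotypic_proj_def)

lemma isotypic_proj_carrier [simp]: "isotypic_proj n U l \<in> carrier_mat n n"
  by (simp add: isotypic_proj_def)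

lemma mat_mult_assoc_dim:
  fixes A :: "'a::field mat"
  assumes "dim_col A = dim_row B" "dim_col B = dim_row C"
  shows "A * B * C = A * (B * C)"
  by (rule assoc_mult_mat[of A "dim_row A" "dim_col A" B "dim_col B" C "dim_col C"]) (use assms in auto)

lemma isotypic_proj_natural:
  fixes f :: "'k::field mat"
  assumes U: "\<And>z. U z \<in> carrier_mat n n" and U': "\<And>z. U' z \<in> carrier_mat m m" and f: "f \<in> carrier_mat m n"
    and fU: "\<And>z. f * U z = U' z * f"
  shows "f * isotypic_proj n U l = isotypic_proj m U' l * f"
proof -
  have "f * isotypic_proj n U l = mat_sum m n UNIV (\<lambda>z. f * ((l (- z) / of_nat (card (UNIV :: 'a set))) \<cdot>\<^sub>m U z))"
    unfolding isotypic_proj_def by (rule mult_mat_sum[OF f]) (use U in auto)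
  also have "\<dots> = mat_sum m n UNIV (\<lambda>z. ((l (- z) / of_nat (card (UNIV :: 'a set))) \<cdot>\<^sub>m U' z) * f)"
    by (intro mat_sum_cong refl)
      (simp add: mult_smult_distrib[OF f U] mult_smult_assoc_mat[OF U' f] fU)
  also have "\<dots> = isotypic_proj m U' l * f"
    unfolding isotypic_proj_def by (rule mat_sum_mult[symmetric, OF f]) (use U' in auto)
  finally show ?thesis .
qed

context
  fixes n :: nat and U :: "'g::{ab_group_add,finite} \<Rightarrow> 'k::{alg_closed_field,field_char_0} mat"
  assumes U: "\<And>z. U z \<in> carrier_mat n n" and U0: "U 0 = 1\<^sub>m n" and Uadd: "\<And>z w. U (z + w) = U z * U w"
begin

text \<open>Multiplication by \<open>U w\<close> translates the summation index by \<open>w\<close>,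
  which the weights turn into the scalar \<open>l w\<close>.\<close>

lemma rep_mult_isotypic_proj:
  assumes l: "l \<in> character_group"
  shows "U w * isotypic_proj n U l = l w \<cdot>\<^sub>m isotypic_proj n U l"
proof -
  let ?c = "\<lambda>z. l (- z) / of_nat (card (UNIV :: 'g set))"
  have "U w * isotypic_proj n U l = mat_sum n n UNIV (\<lambda>z. U w * (?c z \<cdot>\<^sub>m U z))"
    unfolding isotypic_proj_def by (rule mult_mat_sum) (use U in auto)
  also have "\<dots> = mat_sum n n UNIV (\<lambda>z. ?c z \<cdot>\<^sub>m U (w + z))"
    by (intro mat_sum_cong refl) (simp add: mult_smult_distrib[OF U U] Uadd)
  also have "\<dots> = l w \<cdot>\<^sub>m isotypic_proj n U l"
  proof (rule eq_matI)
    fix i j assume "i < dim_row (l w \<cdot>\<^sub>m isotypic_proj n U l)" "j < dim_col (l w \<cdot>\<^sub>m isotypic_proj n U l)"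
    then have ij: "i < n" "j < n" by auto
    have d: "dim_row (U z) = n" "dim_col (U z) = n" for z using U[of z] by auto
    have "l w * l (- (w + z)) = l (- z)" for z
      by (simp flip: character_groupD(2)[OF l])
    then have lw: "l w * (?c (w + z) * u) = ?c z * u" for z u
      by (simp add: mult.assoc[symmetric] del: minus_add_distrib)
    have "mat_sum n n UNIV (\<lambda>z. ?c z \<cdot>\<^sub>m U (w + z)) $$ (i, j) = (\<Sum>z\<in>UNIV. ?c z * U (w + z) $$ (i, j))"
      using ij by (simp add: mat_sum_def d)
    also have "\<dots> = (\<Sum>z\<in>UNIV. l w * (?c z * U z $$ (i, j)))"
    proof (rule sum.reindex_bij_witness[where i = "\<lambda>z. z - w" and j = "\<lambda>z. w + z"])
      show "l w * (?c (w + z) * U (w + z) $$ (i, j)) = ?c z * U (w + z) $$ (i, j)" for z by (rule lw)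
    qed simp_all
    also have "\<dots> = (l w \<cdot>\<^sub>m isotypic_proj n U l) $$ (i, j)"
      using ij by (simp add: isotypic_proj_def mat_sum_def d sum_distrib_left)
    finally show "mat_sum n n UNIV (\<lambda>z. ?c z \<cdot>\<^sub>m U (w + z)) $$ (i, j) = (l w \<cdot>\<^sub>m isotypic_proj n U l) $$ (i, j)" .
  qed simp_all
  finally show ?thesis .
qed

lemma isotypic_proj_mult_rep:
  assumes l: "l \<in> character_group"
  shows "isotypic_proj n U l * U w = l w \<cdot>\<^sub>m isotypic_proj n U l"
proof -
  have "U w * U z = U z * U w" for z using Uadd[of w z] Uadd[of z w] by (simp add: add.commute)
  then have "U w * isotypic_proj n U l = isotypic_proj n U l * U w"
    by (intro isotypic_proj_natural[OF U U U]) 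
  then show ?thesis using rep_mult_isotypic_proj[OF l] by simp
qed

text \<open>On the projector for \<open>l\<close> each \<open>U z\<close> acts by
  \<open>l z\<close>. The product is therefore a multiple of this projector, by the average of the
  character \<open>d\<close>, and \<open>sum_character\<close> applies.\<close>

lemma isotypic_proj_mult:
  assumes l: "l \<in> character_group" and l': "l' \<in> character_group"
  shows "isotypic_proj n U l' * isotypic_proj n U l = (if l' = l then isotypic_proj n U l else 0\<^sub>m n n)"
proof -
  let ?N = "of_nat (card (UNIV :: 'g set)) :: 'k"
  have N: "?N \<noteq> 0" by simp
  let ?Q = "isotypic_proj n U l"
  have "isotypic_proj n U l' * ?Q = mat_sum n n UNIV (\<lambda>z. ((l' (- z) / ?N) \<cdot>\<^sub>m U z) * ?Q)"
    unfolding isotypic_proj_def[of n U l'] by (rule mat_sum_mult) (use U in auto)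
  also have "\<dots> = mat_sum n n UNIV (\<lambda>z. (l' (- z) / ?N * l z) \<cdot>\<^sub>m ?Q)"
    by (intro mat_sum_cong refl)
      (auto simp: mult_smult_assoc_mat[OF U isotypic_proj_carrier] rep_mult_isotypic_proj[OF l] intro!: eq_matI)
  also have "\<dots> = (if l' = l then ?Q else 0\<^sub>m n n)"
  proof (rule eq_matI)
    fix i j assume "i < dim_row (if l' = l then ?Q else 0\<^sub>m n n)" "j < dim_col (if l' = l then ?Q else 0\<^sub>m n n)"
    then have ij: "i < n" "j < n" by (auto split: if_splits)
    define d where "d = (\<lambda>x. inverse (l' x) * l x)"
    have d: "d \<in> character_group" unfolding d_def by (rule mult_character[OF inverse_character[OF l'] l])
    have d1: "d = (\<lambda>_. 1) \<longleftrightarrow> l' = l"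
    proof
      assume "d = (\<lambda>_. 1)"
      then have "inverse (l' x) * l x = 1" for x unfolding d_def by (rule fun_cong)
      then have "l' x = l x" for x using character_groupD(1)[OF l', of x] by (simp add: field_simps)
      then show "l' = l" by blast
    next
      assume "l' = l"
      then show "d = (\<lambda>_. 1)" using character_groupD(1)[OF l] by (simp add: d_def)
    qed
    have "mat_sum n n UNIV (\<lambda>z. (l' (- z) / ?N * l z) \<cdot>\<^sub>m ?Q) $$ (i, j) = (\<Sum>z\<in>UNIV. d z * (?Q $$ (i, j) / ?N))"
      using ij by (auto simp: mat_sum_def d_def character_groupD(4)[OF l'] intro!: sum.cong)
    also have "\<dots> = (\<Sum>z\<in>UNIV. d z) * (?Q $$ (i, j) / ?N)" by (simp only: sum_distrib_right)
    also have "\<dots> = (if l' = l then ?Q else 0\<^sub>m n n) $$ (i, j)"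
      using ij N unfolding sum_character[OF d] d1 by simp
    finally show "mat_sum n n UNIV (\<lambda>z. (l' (- z) / ?N * l z) \<cdot>\<^sub>m ?Q) $$ (i, j) = (if l' = l then ?Q else 0\<^sub>m n n) $$ (i, j)" .
  qed auto
  finally show ?thesis .
qed

text \<open>Summation over all characters leaves only the term of z = 0, by
  \<open>sum_characters\<close>. The existence of separating characters enters the decomposition at
  this point.\<close>

lemma sum_isotypic_proj: "mat_sum n n character_group (isotypic_proj n U) = 1\<^sub>m n"
proof (rule eq_matI)
  let ?N = "of_nat (card (UNIV :: 'g set)) :: 'k"
  fix i j assume "i < dim_row (1\<^sub>m n :: 'k mat)" "j < dim_col (1\<^sub>m n :: 'k mat)"
  then have ij: "i < n" "j < n" by auto
  have d: "dim_row (U z) = n" "dim_col (U z) = n" for z using U[of z] by auto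
  have "mat_sum n n character_group (isotypic_proj n U) $$ (i, j) = (\<Sum>l\<in>character_group. \<Sum>z\<in>UNIV. l (- z) * (U z $$ (i, j) / ?N))"
    using ij by (simp add: mat_sum_def isotypic_proj_def d)
  also have "\<dots> = (\<Sum>z\<in>UNIV. (\<Sum>l\<in>character_group. l (- z)) * (U z $$ (i, j) / ?N))"
    by (subst sum.swap) (simp only: sum_distrib_right)
  also have "\<dots> = (\<Sum>z\<in>(UNIV :: 'g set). if z = 0 then U 0 $$ (i, j) else 0)"
    by (rule sum.cong[OF refl]) (simp add: sum_characters)
  also have "\<dots> = 1\<^sub>m n $$ (i, j)" by (simp add: U0)
  finally show "mat_sum n n character_group (isotypic_proj n U) $$ (i, j) = 1\<^sub>m n $$ (i, j)" .
qed simp_all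

end

text \<open>The image of an injective matrix as an object of \<open>B\<close>: a coordinate space of
  its own, graded by pulling back the grading of \<open>V\<close> along \<open>A\<close>.\<close>

definition graded_image :: "('g::{ab_group_add,finite}, 'k::field) graded_space \<Rightarrow> 'k mat \<Rightarrow> ('g, 'k) graded_space" where
  "graded_image V A = \<lparr>gdim = dim_col A, gcomp = (\<lambda>x. {v \<in> carrier_vec (dim_col A). A *\<^sub>v v \<in> gcomp V x})\<rparr>"

lemma gdim_graded_image [simp]: "gdim (graded_image V A) = dim_col A"
  by (simp add: graded_image_def)

lemma gcomp_graded_image: "v \<in> gcomp (graded_image V A) x \<longleftrightarrow> dim_vec v = dim_col A \<and> A *\<^sub>v v \<in> gcomp V x"
  by (auto simp: graded_image_def intro: carrier_vecI)

text \<open>The idempotent \<open>A * C\<close> preserves degrees, so the homogeneous parts of a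
  vector of the image lead back into the image under \<open>C\<close>. This gives the projections
  \<open>C * (gproj V x * A)\<close>.\<close>

lemma
  assumes V: "graded_space V" and A: "dim_row A = gdim V" and C: "dim_row C = dim_col A" "dim_col C = gdim V"
    and CA: "C * A = 1\<^sub>m (dim_col A)" and Q: "A * C \<in> graded_hom V V"
  shows graded_space_image: "graded_space (graded_image V A)"
    and graded_image_incl: "A \<in> graded_hom (graded_image V A) V"
    and graded_image_proj: "C \<in> graded_hom V (graded_image V A)"
proof -
  have CAv: "C *\<^sub>v (A *\<^sub>v v) = v" if "dim_vec v = dim_col A" for v
    using CA A C that by (metis mult_mat_vec_assoc one_mult_mat_vec_dim)
  have Qv: "A *\<^sub>v (C *\<^sub>v v) \<in> gcomp V x" if "v \<in> gcomp V x" for v x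
    using graded_homD(4)[OF Q that] A C gcomp_dim[OF V that] by simp
  show "C \<in> graded_hom V (graded_image V A)"
    by (rule graded_homI) (use A C Qv in \<open>auto simp: gcomp_graded_image\<close>)
  show "A \<in> graded_hom (graded_image V A) V"
    by (rule graded_homI) (use A in \<open>auto simp: gcomp_graded_image\<close>)
  let ?P = "\<lambda>x. C * (gproj V x * A)"
  show "graded_space (graded_image V A)"
  proof (rule graded_spaceI[where P = ?P])
    show "vec_subspace (gdim (graded_image V A)) (gcomp (graded_image V A) x)" for x
      unfolding graded_image_def graded_space.simps
      by (rule vec_subspace_preimage[OF graded_space_subspace[OF V]]) (use A in auto)
    show "?P x \<in> carrier_mat (gdim (graded_image V A)) (gdim (graded_image V A))" for x
      using C by auto
    show "?P x *\<^sub>v v \<in> gcomp (graded_image V A) x" if "v \<in> carrier_vec (gdim (graded_image V A))" for x v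
    proof -
      have "A *\<^sub>v v \<in> carrier_vec (gdim V)" using A by (auto intro: carrier_vecI)
      then show ?thesis using that A C Qv[OF gproj_mem[OF V]] by (simp add: gcomp_graded_image)
    qed
    show "?P x *\<^sub>v v = (if x = y then v else 0\<^sub>v (gdim (graded_image V A)))" if "v \<in> gcomp (graded_image V A) y" for x y v
      using that A C by (auto simp: gcomp_graded_image gproj_homogeneous[OF V] CAv)
    show "vec_sum (gdim (graded_image V A)) UNIV (\<lambda>x. ?P x *\<^sub>v v) = v" if "v \<in> carrier_vec (gdim (graded_image V A))" for v
    proof -
      have v: "dim_vec v = dim_col A" using that by simp
      have Av: "A *\<^sub>v v \<in> carrier_vec (gdim V)" using A by (auto intro: carrier_vecI)
      have "vec_sum (dim_col A) UNIV (\<lambda>x. ?P x *\<^sub>v v) = vec_sum (dim_col A) UNIV (\<lambda>x. C *\<^sub>v (gproj V x *\<^sub>v (A *\<^sub>v v)))"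
        using v A C by (intro vec_sum_cong) auto
      also have "\<dots> = C *\<^sub>v vec_sum (gdim V) UNIV (\<lambda>x. gproj V x *\<^sub>v (A *\<^sub>v v))"
        using C by (subst mult_mat_vec_sum_dim) auto
      also have "\<dots> = v" by (simp add: gproj_sum[OF V Av] CAv[OF v])
      finally show ?thesis by simp
    qed
  qed
qed

definition is_splitting :: "'k::field mat \<Rightarrow> 'k mat \<times> 'k mat \<Rightarrow> bool" where
  "is_splitting Q = (\<lambda>(A, C). dim_row A = dim_row Q \<and> dim_col C = dim_row Q \<and> dim_row C = dim_col A \<and>
     C * A = 1\<^sub>m (dim_col A) \<and> A * C = Q)"

definition splitting :: "'k::field mat \<Rightarrow> 'k mat \<times> 'k mat" where
  "splitting Q = (SOME p. is_splitting Q p)"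

lemma is_splitting:
  assumes "Q \<in> carrier_mat n n" "Q * Q = Q"
  shows "is_splitting Q (splitting Q)"
  unfolding splitting_def
proof (rule someI_ex)
  obtain r A C where "A \<in> carrier_mat n r" "C \<in> carrier_mat r n" "C * A = 1\<^sub>m r" "A * C = Q"
    using idempotent_split[OF assms] by blast
  then have "is_splitting Q (A, C)" using assms by (auto simp: is_splitting_def)
  then show "\<exists>p. is_splitting Q p" by blast
qed

section \<open>The decomposition of \<open>HH(B)\<close>\<close>

lemma anti_twist_module_simps [simp]:
  "Ob (anti_twist_module (Vec \<chi>) s) = {V. graded_space V}"
  "Hom (anti_twist_module (Vec \<chi>) s) = graded_hom"
  "Ident (anti_twist_module (Vec \<chi>) s) V = 1\<^sub>m (gdim V)"
  "Cmp (anti_twist_module (Vec \<chi>) s) = (\<lambda>A C. A * C)"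
  "act_ob (anti_twist_module (Vec \<chi>) s) = graded_tensor"
  "act_arr (anti_twist_module (Vec \<chi>) s) = tensor_mat"
  "mstable (anti_twist_module (Vec \<chi>) s) = s"
  by (simp_all add: anti_twist_module_def)

lemma mult_smult_dim:
  fixes A B :: "'a::field mat"
  assumes "dim_col A = dim_row B"
  shows "A * (k \<cdot>\<^sub>m B) = k \<cdot>\<^sub>m (A * B)" "(k \<cdot>\<^sub>m A) * B = k \<cdot>\<^sub>m (A * B)"
  by (rule mult_smult_distrib[of _ "dim_row A" "dim_col A" _ "dim_col B"];
      use assms in auto)
     (rule mult_smult_assoc_mat[of _ "dim_row A" "dim_col A" _ "dim_col B"]; use assms in auto)

lemma smult_vec_cancel:
  fixes v w :: "'a::field vec"
  assumes "a \<noteq> 0" "a \<cdot>\<^sub>v v = a \<cdot>\<^sub>v w"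
  shows "v = w"
proof -
  have "inverse a \<cdot>\<^sub>v (a \<cdot>\<^sub>v v) = inverse a \<cdot>\<^sub>v (a \<cdot>\<^sub>v w)" using assms by simp
  then show ?thesis using assms(1) by simp
qed

text \<open>Together with \<open>twisted_rep_act\<close> this makes the isotypic projectors
  compatible with the action of \<open>B\<close>.\<close>

lemma isotypic_proj_tensor:
  fixes U :: "'g::{ab_group_add,finite} \<Rightarrow> 'k::field mat"
  assumes U: "\<And>z. U z \<in> carrier_mat n n"
  shows "isotypic_proj (m * n) (\<lambda>z. tensor_mat (1\<^sub>m m) (U z)) l = tensor_mat (1\<^sub>m m) (isotypic_proj n U l)"
proof (rule mat_eq_if_tensor_vec)
  fix v w :: "'k vec" assume v: "v \<in> carrier_vec m" and w: "w \<in> carrier_vec n"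
  let ?c = "\<lambda>z. l (- z) / of_nat (card (UNIV :: 'g set))"
  have d: "dim_row (U z) = n" "dim_col (U z) = n" for z using U[of z] by auto
  have "isotypic_proj (m * n) (\<lambda>z. tensor_mat (1\<^sub>m m) (U z)) l *\<^sub>v tensor_vec v w =
      vec_sum (m * n) UNIV (\<lambda>z. (?c z \<cdot>\<^sub>m tensor_mat (1\<^sub>m m) (U z)) *\<^sub>v tensor_vec v w)"
    unfolding isotypic_proj_def using v w d by (intro mat_sum_mult_vec) (auto intro: carrier_vecI)
  also have "\<dots> = vec_sum (m * n) UNIV (\<lambda>z. tensor_vec v ((?c z \<cdot>\<^sub>m U z) *\<^sub>v w))"
    using v w d by (intro vec_sum_cong refl) (simp add: tensor_mat_vec_mult)
  also have "\<dots> = tensor_vec v (vec_sum n UNIV (\<lambda>z. (?c z \<cdot>\<^sub>m U z) *\<^sub>v w))"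
    using v d by (subst tensor_vec_sum_right[OF v]) (auto intro: carrier_vecI)
  also have "vec_sum n UNIV (\<lambda>z. (?c z \<cdot>\<^sub>m U z) *\<^sub>v w) = isotypic_proj n U l *\<^sub>v w"
    unfolding isotypic_proj_def using w d by (intro mat_sum_mult_vec[symmetric]) auto
  finally show "isotypic_proj (m * n) (\<lambda>z. tensor_mat (1\<^sub>m m) (U z)) l *\<^sub>v tensor_vec v w =
      tensor_mat (1\<^sub>m m) (isotypic_proj n U l) *\<^sub>v tensor_vec v w"
    using v w by (simp add: tensor_mat_vec_mult)
qed auto

locale vec_bicharacter =
  fixes \<chi> :: "'g::{ab_group_add,finite} \<Rightarrow> 'g \<Rightarrow> 'k::{alg_closed_field,field_char_0}"
  assumes bichar: "bicharacter \<chi>"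
begin

abbreviation H where "H \<equiv> HH (Vec \<chi>)"

abbreviation S where "S \<equiv> module_direct_sum character_group
  (\<lambda>l. anti_twist_module (Vec \<chi>) (character_anti_twist \<chi> l))"

sublocale H: graded_rep_module \<chi> H fst HH_rep
  by (rule HH_graded_rep_module[OF bichar])

text \<open>The twist by \<open>\<chi>\<close> cancels the scalars which the action introduces in \<open>HH_rep\<close>, so the isotypic
  components of \<open>twisted_rep\<close> are stable under the action.\<close>

definition twisted_rep where
  "twisted_rep N z = HH_rep N z * graded_scaling (\<lambda>y. \<chi> y z) (fst N)"

lemma twisted_rep_apply:
  assumes N: "N \<in> Ob H" and v: "v \<in> gcomp (fst N) y"
  shows "twisted_rep N z *\<^sub>v v = \<chi> y z \<cdot>\<^sub>v (HH_rep N z *\<^sub>v v)"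
  using H.space[OF N] N gcomp_dim[OF H.space[OF N] v]
  by (simp add: twisted_rep_def graded_scaling_apply[OF H.space[OF N] v])

text \<open>\<open>HH_rep\<close> preserves degrees, so the twists for \<open>z\<close> and
  \<open>w\<close> are taken at the same degree \<open>y\<close>, where \<open>\<chi> y\<close> is
  multiplicative.\<close>

lemma graded_rep_twisted:
  assumes N: "N \<in> Ob H"
  shows "graded_rep (fst N) (twisted_rep N)"
proof -
  note sp = H.space[OF N] and rp = H.rep[OF N]
  have sc: "graded_scaling f (fst N) * HH_rep N z = HH_rep N z * graded_scaling f (fst N)" for f z
    by (rule graded_scaling_commute[OF sp sp graded_repD(1)[OF rp]])
  have "twisted_rep N (z + w) = twisted_rep N z * twisted_rep N w" for z w
  proof (rule graded_ext[OF sp])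
    fix y v assume v: "v \<in> gcomp (fst N) y"
    note dv = gcomp_dim[OF sp v] and m = graded_repD(7)[OF rp v, of w]
    have "twisted_rep N z * twisted_rep N w *\<^sub>v v = twisted_rep N z *\<^sub>v (twisted_rep N w *\<^sub>v v)"
      using N sp dv by (simp add: twisted_rep_def)
    also have "\<dots> = twisted_rep N z *\<^sub>v (\<chi> y w \<cdot>\<^sub>v (HH_rep N w *\<^sub>v v))" by (simp add: twisted_rep_apply[OF N v])
    also have "\<dots> = \<chi> y w \<cdot>\<^sub>v (\<chi> y z \<cdot>\<^sub>v (HH_rep N z *\<^sub>v (HH_rep N w *\<^sub>v v)))"
      using N sp by (subst mult_mat_vec_smult) (simp_all add: twisted_rep_apply[OF N m], simp_all add: twisted_rep_def)
    also have "\<dots> = twisted_rep N (z + w) *\<^sub>v v"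
      using dv by (simp add: twisted_rep_apply[OF N v] graded_repD(8)[OF rp] bicharacterD[OF bichar] mult.commute)
    finally show "twisted_rep N (z + w) *\<^sub>v v = twisted_rep N z * twisted_rep N w *\<^sub>v v" ..
  qed (use N sp in \<open>simp_all add: twisted_rep_def\<close>)
  moreover have "twisted_rep N z \<in> graded_hom (fst N) (fst N)" for z
    unfolding twisted_rep_def by (rule graded_hom_mult[OF sp graded_scaling_hom[OF sp] graded_repD(1)[OF rp]])
  moreover have "twisted_rep N 0 = 1\<^sub>m (gdim (fst N))"
    using sp by (simp add: twisted_rep_def graded_repD(2)[OF rp] bicharacterD[OF bichar] graded_scaling_one)
  ultimately show ?thesis by (simp add: graded_rep_def)
qed

lemma dim_twisted_rep [simp]:
  assumes "N \<in> Ob H"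
  shows "dim_row (twisted_rep N z) = gdim (fst N)" "dim_col (twisted_rep N z) = gdim (fst N)"
  using graded_repD(5,6)[OF graded_rep_twisted[OF assms]] by auto

text \<open>A degree preserving map meets the same nonzero scalar \<open>\<chi> y z\<close> on both
  sides, so intertwining one representation means intertwining the other. Hence the projectors of
  the twisted representation are natural for morphisms of \<open>HH(B)\<close>.\<close>

lemma HH_Hom_iff_twisted:
  assumes N: "N \<in> Ob H" and N': "N' \<in> Ob H"
  shows "f \<in> Hom H N N' \<longleftrightarrow> f \<in> graded_hom (fst N) (fst N') \<and> (\<forall>z. f * twisted_rep N z = twisted_rep N' z * f)"
proof -
  note sp = H.space[OF N] and sp' = H.space[OF N']
  have "f * HH_rep N z = HH_rep N' z * f \<longleftrightarrow> f * twisted_rep N z = twisted_rep N' z * f"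
    if f: "f \<in> graded_hom (fst N) (fst N')" for z
  proof
    assume eq: "f * HH_rep N z = HH_rep N' z * f"
    show "f * twisted_rep N z = twisted_rep N' z * f"
    proof (rule graded_ext[OF sp])
      fix y v assume v: "v \<in> gcomp (fst N) y"
      note d = gcomp_dim[OF sp v] graded_homD(2,3)[OF f]
      have "f *\<^sub>v (HH_rep N z *\<^sub>v v) = HH_rep N' z *\<^sub>v (f *\<^sub>v v)"
        using eq d N N' by (metis H.dim_rep mult_mat_vec_assoc)
      then show "f * twisted_rep N z *\<^sub>v v = twisted_rep N' z * f *\<^sub>v v"
        using d N N' by (simp add: twisted_rep_apply[OF N v] twisted_rep_apply[OF N' graded_homD(4)[OF f v]])
    qed (use graded_homD(2,3)[OF f] N N' in auto)
  next
    assume eq: "f * twisted_rep N z = twisted_rep N' z * f"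
    show "f * HH_rep N z = HH_rep N' z * f"
    proof (rule graded_ext[OF sp])
      fix y v assume v: "v \<in> gcomp (fst N) y"
      note d = gcomp_dim[OF sp v] graded_homD(2,3)[OF f]
      have "f *\<^sub>v (twisted_rep N z *\<^sub>v v) = twisted_rep N' z *\<^sub>v (f *\<^sub>v v)"
        using eq d N N' by (metis dim_twisted_rep mult_mat_vec_assoc)
      then have "\<chi> y z \<cdot>\<^sub>v (f *\<^sub>v (HH_rep N z *\<^sub>v v)) = \<chi> y z \<cdot>\<^sub>v (HH_rep N' z *\<^sub>v (f *\<^sub>v v))"
        using d N N' by (simp add: twisted_rep_apply[OF N v] twisted_rep_apply[OF N' graded_homD(4)[OF f v]])
      then have "f *\<^sub>v (HH_rep N z *\<^sub>v v) = HH_rep N' z *\<^sub>v (f *\<^sub>v v)"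
        by (rule smult_vec_cancel[rotated]) (rule bicharacterD(1)[OF bichar])
      then show "f * HH_rep N z *\<^sub>v v = HH_rep N' z * f *\<^sub>v v" using d N N' by simp
    qed (use graded_homD(2,3)[OF f] N N' in auto)
  qed
  then show ?thesis using H.Hom_eq[OF N N'] by auto
qed

text \<open>In total degree x + y the twist is \<open>\<chi> (x + y) z\<close>, whose factor
  \<open>\<chi> x z\<close> cancels the scalar \<open>\<chi> x (- z)\<close> of
  \<open>tensor_rep\<close>.\<close>

lemma twisted_rep_act:
  assumes X: "graded_space X" and N: "N \<in> Ob H"
  shows "twisted_rep (act_ob H X N) z = tensor_mat (1\<^sub>m (gdim X)) (twisted_rep N z)"
proof (rule graded_tensor_ext[OF X H.space[OF N]])
  fix x y v w assume v: "v \<in> gcomp X x" and w: "w \<in> gcomp (fst N) y"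
  note d = gcomp_dim[OF X v] gcomp_dim[OF H.space[OF N] w]
  have vw: "tensor_vec v w \<in> gcomp (fst (act_ob H X N)) (x + y)"
    using X N v w by (simp add: H.space_act tensor_vec_mem)
  have "\<chi> (x + y) z * \<chi> x (- z) = \<chi> y z"
    using bicharacterD(1)[OF bichar] by (simp add: bicharacterD[OF bichar])
  then show "twisted_rep (act_ob H X N) z *\<^sub>v tensor_vec v w = tensor_mat (1\<^sub>m (gdim X)) (twisted_rep N z) *\<^sub>v tensor_vec v w"
    using X N d
    by (simp add: twisted_rep_apply[OF H.act_closed[OF X N] vw] twisted_rep_apply[OF N w] H.rep_act
      tensor_rep_apply[OF X H.rep[OF N] v] tensor_mat_vec_mult)
qed (use X N in \<open>simp_all add: H.act_closed H.space_act\<close>)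

definition Q where "Q N = isotypic_proj (gdim (fst N)) (twisted_rep N)"

lemma dim_Q [simp]: "dim_row (Q N l) = gdim (fst N)" "dim_col (Q N l) = gdim (fst N)"
  by (simp_all add: Q_def)

lemma Q_mult:
  assumes "N \<in> Ob H" "l \<in> character_group" "l' \<in> character_group"
  shows "Q N l' * Q N l = (if l' = l then Q N l else 0\<^sub>m (gdim (fst N)) (gdim (fst N)))"
  unfolding Q_def by (rule isotypic_proj_mult) (use assms graded_repD[OF graded_rep_twisted[OF assms(1)]] in blast)+

lemma Q_sum: "N \<in> Ob H \<Longrightarrow> mat_sum (gdim (fst N)) (gdim (fst N)) character_group (Q N) = 1\<^sub>m (gdim (fst N))"
  unfolding Q_def by (rule sum_isotypic_proj) (use graded_repD[OF graded_rep_twisted] in blast)+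

lemma twisted_rep_Q:
  assumes "N \<in> Ob H" "l \<in> character_group"
  shows "twisted_rep N z * Q N l = l z \<cdot>\<^sub>m Q N l" "Q N l * twisted_rep N z = l z \<cdot>\<^sub>m Q N l"
  unfolding Q_def
  by (rule rep_mult_isotypic_proj isotypic_proj_mult_rep;
      use assms graded_repD[OF graded_rep_twisted[OF assms(1)]] in blast)+

lemma Q_hom:
  assumes N: "N \<in> Ob H"
  shows "Q N l \<in> graded_hom (fst N) (fst N)"
  unfolding Q_def isotypic_proj_def
  using H.space[OF N] graded_repD(1)[OF graded_rep_twisted[OF N]]
  by (intro graded_hom_sum graded_hom_smult) auto

lemma Q_natural:
  assumes N: "N \<in> Ob H" "N' \<in> Ob H" and f: "f \<in> Hom H N N'"
  shows "f * Q N l = Q N' l * f"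
  unfolding Q_def
  by (rule isotypic_proj_natural)
    (use f HH_Hom_iff_twisted[OF N] graded_repD(4)[OF graded_rep_twisted] N graded_homD(1) in blast)+

lemma Q_act:
  assumes X: "graded_space X" and N: "N \<in> Ob H"
  shows "Q (act_ob H X N) l = tensor_mat (1\<^sub>m (gdim X)) (Q N l)"
proof -
  have "twisted_rep (act_ob H X N) = (\<lambda>z. tensor_mat (1\<^sub>m (gdim X)) (twisted_rep N z))"
    using twisted_rep_act[OF X N] by blast
  then show ?thesis
    using isotypic_proj_tensor[of "twisted_rep N" "gdim (fst N)", OF graded_repD(4)[OF graded_rep_twisted[OF N]]]
    by (simp add: Q_def H.space_act[OF X N])
qed

definition incl where "incl N l = fst (splitting (Q N l))"

definition proj where "proj N l = snd (splitting (Q N l))"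

lemma split_Q:
  assumes "N \<in> Ob H" "l \<in> character_group"
  shows "dim_row (incl N l) = gdim (fst N)" "dim_row (proj N l) = dim_col (incl N l)" "dim_col (proj N l) = gdim (fst N)"
    "proj N l * incl N l = 1\<^sub>m (dim_col (incl N l))" "incl N l * proj N l = Q N l"
proof -
  have "is_splitting (Q N l) (splitting (Q N l))"
    by (rule is_splitting[of _ "gdim (fst N)"]) (use Q_mult[OF assms assms(2)] in auto)
  then show "dim_row (incl N l) = gdim (fst N)" "dim_row (proj N l) = dim_col (incl N l)" "dim_col (proj N l) = gdim (fst N)"
    "proj N l * incl N l = 1\<^sub>m (dim_col (incl N l))" "incl N l * proj N l = Q N l"
    by (simp_all add: is_splitting_def incl_def proj_def split_beta)
qed

text \<open>The versions with a further factor \<open>Y\<close> or \<open>Z\<close> rewrite inside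
  products that have been associated to the right.\<close>

lemma split_Q_absorb:
  assumes N: "N \<in> Ob H" and l: "l \<in> character_group"
  shows "Q N l * incl N l = incl N l" "proj N l * Q N l = proj N l"
    "dim_row Y = dim_col (incl N l) \<Longrightarrow> proj N l * (incl N l * Y) = Y"
    "dim_row Z = gdim (fst N) \<Longrightarrow> incl N l * (proj N l * Z) = Q N l * Z"
    "dim_row Y = dim_col (incl N l) \<Longrightarrow> Q N l * (incl N l * Y) = incl N l * Y"
    "dim_row Z = gdim (fst N) \<Longrightarrow> proj N l * (Q N l * Z) = proj N l * Z"
proof -
  note s = split_Q[OF N l]
  show QA: "Q N l * incl N l = incl N l"
    unfolding s(5)[symmetric] by (subst mat_mult_assoc_dim) (simp_all add: s)
  show CQ: "proj N l * Q N l = proj N l"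
    unfolding s(5)[symmetric] by (subst mat_mult_assoc_dim[symmetric]) (simp_all add: s)
  show "dim_row Y = dim_col (incl N l) \<Longrightarrow> proj N l * (incl N l * Y) = Y"
    by (subst mat_mult_assoc_dim[symmetric]) (simp_all add: s)
  show "dim_row Z = gdim (fst N) \<Longrightarrow> incl N l * (proj N l * Z) = Q N l * Z"
    by (subst mat_mult_assoc_dim[symmetric]) (simp_all add: s)
  show "dim_row Y = dim_col (incl N l) \<Longrightarrow> Q N l * (incl N l * Y) = incl N l * Y"
    by (subst mat_mult_assoc_dim[symmetric]) (simp_all add: s QA)
  show "dim_row Z = gdim (fst N) \<Longrightarrow> proj N l * (Q N l * Z) = proj N l * Z"
    by (subst mat_mult_assoc_dim[symmetric]) (simp_all add: s CQ)
qed

text \<open>For different characters, insert the idempotents which the two splittings absorb; the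
  product of these idempotents is zero.\<close>

lemma proj_incl:
  assumes N: "N \<in> Ob H" and l: "l \<in> character_group" and l': "l' \<in> character_group"
  shows "proj N l * incl N l' = (if l = l' then 1\<^sub>m (dim_col (incl N l)) else 0\<^sub>m (dim_col (incl N l)) (dim_col (incl N l')))"
proof (cases "l = l'")
  case False
  note s = split_Q[OF N l] and s' = split_Q[OF N l']
  have "proj N l * incl N l' = (proj N l * Q N l) * (Q N l' * incl N l')"
    by (simp add: split_Q_absorb(1,2)[OF N] l l')
  also have "\<dots> = proj N l * ((Q N l * Q N l') * incl N l')"
    by (simp add: mat_mult_assoc_dim s s')
  also have "\<dots> = 0\<^sub>m (dim_col (incl N l)) (dim_col (incl N l'))"
    using False by (simp add: Q_mult[OF N l' l] s s')
  finally show ?thesis using False by simp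
qed (use split_Q(4)[OF N l] in simp)

lemma twisted_rep_incl:
  assumes N: "N \<in> Ob H" and l: "l \<in> character_group"
  shows "twisted_rep N z * incl N l = l z \<cdot>\<^sub>m incl N l" "proj N l * twisted_rep N z = l z \<cdot>\<^sub>m proj N l"
proof -
  note s = split_Q[OF N l]
  have "twisted_rep N z * incl N l = twisted_rep N z * (Q N l * incl N l)" by (simp add: split_Q_absorb(1)[OF N l])
  also have "\<dots> = (twisted_rep N z * Q N l) * incl N l" by (subst mat_mult_assoc_dim) (simp_all add: N s)
  also have "\<dots> = l z \<cdot>\<^sub>m incl N l"
    by (simp add: twisted_rep_Q[OF N l] mult_smult_dim s split_Q_absorb(1)[OF N l])
  finally show "twisted_rep N z * incl N l = l z \<cdot>\<^sub>m incl N l" .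
  have "proj N l * twisted_rep N z = (proj N l * Q N l) * twisted_rep N z" by (simp add: split_Q_absorb(2)[OF N l])
  also have "\<dots> = proj N l * (Q N l * twisted_rep N z)" by (subst mat_mult_assoc_dim) (simp_all add: N s)
  also have "\<dots> = l z \<cdot>\<^sub>m proj N l"
    by (simp add: twisted_rep_Q[OF N l] mult_smult_dim s split_Q_absorb(2)[OF N l])
  finally show "proj N l * twisted_rep N z = l z \<cdot>\<^sub>m proj N l" .
qed

section \<open>The functor to the direct sum\<close>

definition Fo where "Fo N = (\<lambda>l\<in>character_group. graded_image (fst N) (incl N l))"

definition Fm where "Fm N N' f = (\<lambda>l\<in>character_group. proj N' l * (f * incl N l))"

text \<open>The idempotent of the acted object is the tensor product of 1 with that of
  \<open>N\<close>, but the two have been split independently. This is the canonical comparison of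
  two splittings of the same idempotent.\<close>

definition equiv_iso where
  "equiv_iso X N = (\<lambda>l\<in>character_group. tensor_mat (1\<^sub>m (gdim X)) (proj N l) * incl (act_ob H X N) l)"

lemma image_incl:
  assumes N: "N \<in> Ob H" and l: "l \<in> character_group"
  shows "graded_space (graded_image (fst N) (incl N l))"
    "incl N l \<in> graded_hom (graded_image (fst N) (incl N l)) (fst N)"
    "proj N l \<in> graded_hom (fst N) (graded_image (fst N) (incl N l))"
proof -
  note s = split_Q[OF N l]
  note i = graded_space_image graded_image_incl graded_image_proj
  show "graded_space (graded_image (fst N) (incl N l))"
    "incl N l \<in> graded_hom (graded_image (fst N) (incl N l)) (fst N)"
    "proj N l \<in> graded_hom (fst N) (graded_image (fst N) (incl N l))"
    by (rule i[OF H.space[OF N], where C = "proj N l"], simp_all add: s Q_hom[OF N])+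
qed

lemma Fo_simps:
  assumes "l \<in> character_group"
  shows "Fo N l = graded_image (fst N) (incl N l)" "gdim (Fo N l) = dim_col (incl N l)"
  using assms by (simp_all add: Fo_def)

lemma Fo_Ob: "N \<in> Ob H \<Longrightarrow> Fo N \<in> Ob S"
  by (auto simp: Fo_def image_incl)

lemma Fm_Hom:
  assumes N: "N \<in> Ob H" "N' \<in> Ob H" and f: "f \<in> Hom H N N'"
  shows "Fm N N' f \<in> Hom S (Fo N) (Fo N')"
proof -
  have "proj N' l * (f * incl N l) \<in> graded_hom (Fo N l) (Fo N' l)" if l: "l \<in> character_group" for l
    using image_incl[OF N(1) l] image_incl[OF N(2) l] H.homD(1)[OF f N]
    by (auto simp: Fo_simps[OF l] intro!: graded_hom_mult)
  then show ?thesis by (simp add: Fm_def)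
qed

lemma Q_natural_assoc:
  assumes N: "N \<in> Ob H" "N' \<in> Ob H" and f: "f \<in> Hom H N N'" and Y: "dim_row Y = gdim (fst N)"
  shows "f * (Q N l * Y) = Q N' l * (f * Y)"
  using Q_natural[OF N f, of l] Y H.homD(3,4)[OF f N]
  by (simp flip: mat_mult_assoc_dim)

lemma Fm_functor: "is_functor H S Fo Fm"
  unfolding is_functor_def
proof (intro conjI ballI)
  show "Fo N \<in> Ob S" if "N \<in> Ob H" for N using Fo_Ob[OF that] .
  show "Fm N N' f \<in> Hom S (Fo N) (Fo N')" if "N \<in> Ob H" "N' \<in> Ob H" "f \<in> Hom H N N'" for N N' f
    using Fm_Hom[OF that] .
  show "Fm N N (Ident H N) = Ident S (Fo N)" if N: "N \<in> Ob H" for N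
    by (auto simp: Fm_def Fo_simps H.Ident_eq[OF N] split_Q[OF N] intro!: restrict_ext)
  fix N N' N'' f g assume N: "N \<in> Ob H" "N' \<in> Ob H" "N'' \<in> Ob H" and f: "f \<in> Hom H N N'" and g: "g \<in> Hom H N' N''"
  \<comment> \<open>The projector \<open>Q N' l\<close> that arises between \<open>g\<close> and
    \<open>f\<close> moves to the left through \<open>g\<close> and is absorbed by
    \<open>proj N'' l\<close>.\<close>
  have "proj N'' l * (g * f * incl N l) = (proj N'' l * (g * incl N' l)) * (proj N' l * (f * incl N l))" if l: "l \<in> character_group" for l
    by (simp add: mat_mult_assoc_dim split_Q[OF _ l] split_Q_absorb[OF _ l] N H.homD(3,4)[OF f N(1,2)] H.homD(3,4)[OF g N(2,3)]
      Q_natural_assoc[OF N(2,3) g])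
  then show "Fm N N'' (g \<cdot>\<^bsub>H\<^esub> f) = Fm N' N'' g \<cdot>\<^bsub>S\<^esub> Fm N N' f"
    by (auto simp: Fm_def H.Cmp_eq intro!: restrict_ext)
qed

text \<open>The inverse of \<open>Fm N N'\<close>: the map with the diagonal blocks
  \<open>g l\<close> with respect to the isotypic decompositions.\<close>

definition glue where
  "glue N N' g = mat_sum (gdim (fst N')) (gdim (fst N)) character_group (\<lambda>l. incl N' l * (g l * proj N l))"

text \<open>A morphism commutes with the projectors, so it has no blocks between different
  characters and is recovered from the diagonal ones. Conversely, arbitrary homogeneous diagonal
  blocks intertwine, because both representations act by \<open>l z\<close> on the components of
  \<open>l\<close>.\<close>

lemma Fm_bij:
  assumes N: "N \<in> Ob H" and N': "N' \<in> Ob H"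
  shows "bij_betw (Fm N N') (Hom H N N') (Hom S (Fo N) (Fo N'))"
proof (rule bij_betw_byWitness[where f' = "glue N N'"])
  let ?n = "gdim (fst N)" and ?n' = "gdim (fst N')"
  show "Fm N N' ` Hom H N N' \<subseteq> Hom S (Fo N) (Fo N')" using Fm_Hom[OF N N'] by blast
  show "\<forall>f\<in>Hom H N N'. glue N N' (Fm N N' f) = f"
  proof
    fix f assume f: "f \<in> Hom H N N'"
    note d = H.homD(3,4)[OF f N N']
    have "glue N N' (Fm N N' f) = mat_sum ?n' ?n character_group (\<lambda>l. f * Q N l)"
      unfolding glue_def
    proof (rule mat_sum_cong[OF refl])
      fix l :: "'g \<Rightarrow> 'k" assume l: "l \<in> character_group"
      show "incl N' l * (Fm N N' f l * proj N l) = f * Q N l"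
        using l by (simp add: Fm_def mat_mult_assoc_dim split_Q[OF _ l] split_Q_absorb[OF _ l] N N' d Q_mult
          flip: Q_natural_assoc[OF N N' f])
    qed
    also have "\<dots> = f * mat_sum ?n ?n character_group (Q N)"
      by (rule mult_mat_sum[symmetric]) (use d in auto)
    also have "\<dots> = f" using d by (simp add: Q_sum[OF N])
    finally show "glue N N' (Fm N N' f) = f" .
  qed
  have g_dim: "dim_row (g l) = dim_col (incl N' l)" "dim_col (g l) = dim_col (incl N l)" "g l \<in> graded_hom (graded_image (fst N) (incl N l)) (graded_image (fst N') (incl N' l))"
    if "g \<in> Hom S (Fo N) (Fo N')" "l \<in> character_group" for g l
    using direct_sum_HomD[OF that] by (auto simp: Fo_simps[OF that(2)] graded_homD)
  show "glue N N' ` Hom S (Fo N) (Fo N') \<subseteq> Hom H N N'"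
  proof (rule image_subsetI)
    fix g assume g: "g \<in> Hom S (Fo N) (Fo N')"
    note gd = g_dim[OF g]
    have "glue N N' g \<in> graded_hom (fst N) (fst N')"
      unfolding glue_def
      by (rule graded_hom_sum[OF H.space[OF N] H.space[OF N'] finite_character_group])
        (rule graded_hom_mult[OF H.space[OF N] graded_hom_mult[OF H.space[OF N] image_incl(3)[OF N] gd(3)] image_incl(2)[OF N']])
    moreover have "glue N N' g * twisted_rep N z = twisted_rep N' z * glue N N' g" for z
    proof -
      have "glue N N' g * twisted_rep N z = mat_sum ?n' ?n character_group (\<lambda>l. incl N' l * (g l * proj N l) * twisted_rep N z)"
        unfolding glue_def by (rule mat_sum_mult) (use N N' gd in \<open>auto simp: split_Q\<close>)
      also have "\<dots> = mat_sum ?n' ?n character_group (\<lambda>l. twisted_rep N' z * (incl N' l * (g l * proj N l)))"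
      proof (rule mat_sum_cong[OF refl])
        fix l :: "'g \<Rightarrow> 'k" assume l: "l \<in> character_group"
        note s = split_Q[OF N l] split_Q[OF N' l]
        have "incl N' l * (g l * proj N l) * twisted_rep N z = incl N' l * (g l * (proj N l * twisted_rep N z))"
          by (simp add: mat_mult_assoc_dim s gd[OF l] N)
        also have "\<dots> = (twisted_rep N' z * incl N' l) * (g l * proj N l)"
          by (simp add: twisted_rep_incl N N' l mult_smult_dim s gd[OF l])
        also have "\<dots> = twisted_rep N' z * (incl N' l * (g l * proj N l))"
          by (simp add: mat_mult_assoc_dim s gd[OF l] N')
        finally show "incl N' l * (g l * proj N l) * twisted_rep N z = twisted_rep N' z * (incl N' l * (g l * proj N l))" .
      qed
      also have "\<dots> = twisted_rep N' z * glue N N' g"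
        unfolding glue_def by (rule mult_mat_sum[symmetric]) (use N N' gd in \<open>auto simp: split_Q\<close>)
      finally show ?thesis .
    qed
    ultimately show "glue N N' g \<in> Hom H N N'" by (simp add: HH_Hom_iff_twisted[OF N N'])
  qed
  show "\<forall>g\<in>Hom S (Fo N) (Fo N'). Fm N N' (glue N N' g) = g"
  proof
    fix g assume g: "g \<in> Hom S (Fo N) (Fo N')"
    note gd = g_dim[OF g]
    have "proj N' l * (glue N N' g * incl N l) = g l" if l: "l \<in> character_group" for l
    proof -
      note s = split_Q[OF N l] split_Q[OF N' l]
      have "glue N N' g * incl N l = mat_sum ?n' (dim_col (incl N l)) character_group (\<lambda>k. incl N' k * (g k * proj N k) * incl N l)"
        unfolding glue_def by (rule mat_sum_mult) (use N N' gd s in \<open>auto simp: split_Q\<close>)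
      then have "proj N' l * (glue N N' g * incl N l) = proj N' l * mat_sum ?n' (dim_col (incl N l)) character_group (\<lambda>k. incl N' k * (g k * proj N k) * incl N l)"
        by (rule arg_cong)
      also have "\<dots> = mat_sum (dim_col (incl N' l)) (dim_col (incl N l)) character_group (\<lambda>k. proj N' l * (incl N' k * (g k * proj N k) * incl N l))"
        by (rule mult_mat_sum) (use N N' gd s in \<open>auto simp: split_Q\<close>)
      also have "\<dots> = mat_sum (dim_col (incl N' l)) (dim_col (incl N l)) character_group
          (\<lambda>k. if k = l then g l else 0\<^sub>m (dim_col (incl N' l)) (dim_col (incl N l)))"
      proof (rule mat_sum_cong[OF refl])
        fix k :: "'g \<Rightarrow> 'k" assume k: "k \<in> character_group"
        note sk = split_Q[OF N k] split_Q[OF N' k]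
        have "proj N' l * (incl N' k * (g k * proj N k) * incl N l) = (proj N' l * incl N' k) * (g k * (proj N k * incl N l))"
          by (simp add: mat_mult_assoc_dim s(1-3,6-8) sk(1-3,6-8) gd[OF k])
        also have "\<dots> = (if k = l then g l else 0\<^sub>m (dim_col (incl N' l)) (dim_col (incl N l)))"
          using gd[OF k] gd[OF l] by (auto simp: proj_incl N N' l k)
        finally show "proj N' l * (incl N' k * (g k * proj N k) * incl N l) = (if k = l then g l else 0\<^sub>m (dim_col (incl N' l)) (dim_col (incl N l)))" .
      qed
      also have "\<dots> = g l"
      proof (rule eq_matI)
        fix i j assume ij: "i < dim_row (g l)" "j < dim_col (g l)"
        then have "(\<Sum>k\<in>character_group. (if k = l then g l else 0\<^sub>m (dim_col (incl N' l)) (dim_col (incl N l))) $$ (i, j)) =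
            (\<Sum>k\<in>character_group. if k = l then g l $$ (i, j) else 0)"
          using gd[OF l] by (intro sum.cong) auto
        also have "\<dots> = g l $$ (i, j)" by (subst sum.delta[OF finite_character_group]) (simp add: l)
        finally show "mat_sum (dim_col (incl N' l)) (dim_col (incl N l)) character_group
          (\<lambda>k. if k = l then g l else 0\<^sub>m (dim_col (incl N' l)) (dim_col (incl N l))) $$ (i, j) = g l $$ (i, j)"
          using ij gd[OF l] by (simp add: mat_sum_def)
      qed (use gd[OF l] in auto)
      finally show ?thesis .
    qed
    then have "Fm N N' (glue N N' g) = restrict g character_group"
      unfolding Fm_def by (intro restrict_ext)
    then show "Fm N N' (glue N N' g) = g" using g by (simp add: PiE_restrict)
  qed
qed

lemma HH_rep_incl:
  assumes N: "N \<in> Ob H" and l: "l \<in> character_group" and v: "v \<in> gcomp (graded_image (fst N) (incl N l)) y"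
  shows "HH_rep N z *\<^sub>v (incl N l *\<^sub>v v) = (\<chi> y (- z) * l z) \<cdot>\<^sub>v (incl N l *\<^sub>v v)"
proof -
  have Av: "incl N l *\<^sub>v v \<in> gcomp (fst N) y" and dv: "dim_vec v = dim_col (incl N l)"
    using v by (auto simp: gcomp_graded_image)
  have "twisted_rep N z *\<^sub>v (incl N l *\<^sub>v v) = (twisted_rep N z * incl N l) *\<^sub>v v"
    using N dv split_Q[OF N l] by simp
  also have "\<dots> = l z \<cdot>\<^sub>v (incl N l *\<^sub>v v)" using dv by (simp add: twisted_rep_incl[OF N l])
  finally have "\<chi> y z \<cdot>\<^sub>v (HH_rep N z *\<^sub>v (incl N l *\<^sub>v v)) = l z \<cdot>\<^sub>v (incl N l *\<^sub>v v)"
    by (simp add: twisted_rep_apply[OF N Av])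
  also have "\<dots> = \<chi> y z \<cdot>\<^sub>v ((\<chi> y (- z) * l z) \<cdot>\<^sub>v (incl N l *\<^sub>v v))"
    using bicharacterD(1)[OF bichar] by (simp add: bicharacterD[OF bichar] flip: mult.assoc)
  finally show ?thesis
    by (rule smult_vec_cancel[rotated]) (rule bicharacterD(1)[OF bichar])
qed

text \<open>The stable structure is \<open>HH_rep N y\<close> in degree \<open>y\<close>, so
  \<open>HH_rep_incl\<close> at z = y gives the scalar \<open>\<chi> y (- y) * l y\<close> of the
  anti-twist.\<close>

lemma Fm_mstable:
  assumes N: "N \<in> Ob H"
  shows "Fm N N (mstable H N) = mstable S (Fo N)"
proof -
  have "proj N l * (mstable H N * incl N l) = character_anti_twist \<chi> l (graded_image (fst N) (incl N l))" if l: "l \<in> character_group" for l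
  proof (rule graded_ext[OF image_incl(1)[OF N l]])
    note s = split_Q[OF N l]
    fix y v assume v: "v \<in> gcomp (graded_image (fst N) (incl N l)) y"
    then have Av: "incl N l *\<^sub>v v \<in> gcomp (fst N) y" and dv: "dim_vec v = dim_col (incl N l)"
      by (auto simp: gcomp_graded_image)
    have CA: "proj N l *\<^sub>v (incl N l *\<^sub>v v) = v"
      using s dv by (metis mult_mat_vec_assoc one_mult_mat_vec_dim)
    show "proj N l * (mstable H N * incl N l) *\<^sub>v v = character_anti_twist \<chi> l (graded_image (fst N) (incl N l)) *\<^sub>v v"
      using s(1-3) dv N CA
      by (simp add: H.mstable_apply[OF N Av] HH_rep_incl[OF N l v] character_anti_twist_def
        graded_scaling_apply[OF image_incl(1)[OF N l] v])
  qed (use split_Q[OF N l] image_incl(1)[OF N l] in \<open>simp_all add: character_anti_twist_def\<close>)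
  then show ?thesis by (auto simp: Fm_def Fo_simps intro!: restrict_ext)
qed

section \<open>Equivariance and stability of the functor\<close>

lemma tensor_mat_mult_assoc:
  fixes A B C D Z :: "'a::field mat"
  assumes "dim_col A = dim_row C" "dim_col B = dim_row D" "dim_col C * dim_col D = dim_row Z"
  shows "tensor_mat A B * (tensor_mat C D * Z) = tensor_mat (A * C) (B * D) * Z"
  using assms by (simp add: tensor_mat_mult mat_mult_assoc_dim)

lemma iso_arrow_equiv_iso:
  assumes X: "graded_space X" and N: "N \<in> Ob H"
  shows "iso_arrow S (Fo (act_ob H X N)) (act_ob S X (Fo N)) (equiv_iso X N)"
proof -
  let ?XN = "act_ob H X N"
  note XN = H.act_closed[OF X N]
  \<comment> \<open>The comparison in the opposite direction, with the roles of the two splittings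
    exchanged. Both composites contain the common idempotent, which is absorbed.\<close>
  define J where "J = (\<lambda>l. proj ?XN l * tensor_mat (1\<^sub>m (gdim X)) (incl N l))"
  have "inverse_arrows (anti_twist_module (Vec \<chi>) (character_anti_twist \<chi> l)) (Fo ?XN l) (act_ob S X (Fo N) l)
      (tensor_mat (1\<^sub>m (gdim X)) (proj N l) * incl ?XN l) (J l)" if l: "l \<in> character_group" for l
  proof -
    note s = split_Q[OF N l] and sX = split_Q[OF XN l, unfolded H.space_act[OF X N], simplified]
    note i = image_incl[OF N l] and iX = image_incl[OF XN l, unfolded H.space_act[OF X N]]
    have 1: "J l * (tensor_mat (1\<^sub>m (gdim X)) (proj N l) * incl ?XN l) = 1\<^sub>m (dim_col (incl ?XN l))"
    proof -
      have "J l * (tensor_mat (1\<^sub>m (gdim X)) (proj N l) * incl ?XN l) = proj ?XN l * (Q ?XN l * incl ?XN l)"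
        unfolding J_def Q_act[OF X N]
        by (simp add: mat_mult_assoc_dim tensor_mat_mult_assoc s sX)
      then show ?thesis by (simp add: split_Q_absorb[OF XN l] sX)
    qed
    have 2: "tensor_mat (1\<^sub>m (gdim X)) (proj N l) * incl ?XN l * J l = 1\<^sub>m (gdim X * dim_col (incl N l))"
    proof -
      have "tensor_mat (1\<^sub>m (gdim X)) (proj N l) * incl ?XN l * J l =
          tensor_mat (1\<^sub>m (gdim X)) (proj N l) * (Q ?XN l * tensor_mat (1\<^sub>m (gdim X)) (incl N l))"
        unfolding J_def
        by (simp add: mat_mult_assoc_dim s(1-3) sX(1-3) split_Q_absorb(4)[OF XN l] H.space_act[OF X N])
      also have "\<dots> = 1\<^sub>m (gdim X * dim_col (incl N l))"
        unfolding Q_act[OF X N] by (simp add: s split_Q_absorb[OF N l] flip: tensor_mat_mult)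
      finally show ?thesis .
    qed
    have 3: "tensor_mat (1\<^sub>m (gdim X)) (proj N l) * incl ?XN l \<in> graded_hom (graded_image (graded_tensor X (fst N)) (incl ?XN l))
        (graded_tensor X (graded_image (fst N) (incl N l)))"
      using X i iX H.space[OF N] by (intro graded_hom_mult[OF iX(1,2)] tensor_mat_hom) auto
    have 4: "J l \<in> graded_hom (graded_tensor X (graded_image (fst N) (incl N l))) (graded_image (graded_tensor X (fst N)) (incl ?XN l))"
      unfolding J_def using X i iX H.space[OF N]
      by (intro graded_hom_mult[OF graded_space_tensor[OF X i(1)] _ iX(3)] tensor_mat_hom) auto
    show ?thesis
      using 1 2 3 4 l by (simp add: inverse_arrows_def Fo_simps H.space_act[OF X N])
  qed
  from inverse_arrows_direct_sum[of character_group, OF this]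
  show ?thesis unfolding equiv_iso_def by (rule inverse_arrows_iso)
qed

lemma Fm_equivariant: "equivariant_functor (Vec \<chi>) H S Fo Fm equiv_iso"
  unfolding equivariant_functor_def
proof (intro conjI ballI)
  show "is_functor H S Fo Fm" by (rule Fm_functor)
  show "iso_arrow S (Fo (act_ob H X N)) (act_ob S X (Fo N)) (equiv_iso X N)" if "X \<in> Ob (Vec \<chi>)" "N \<in> Ob H" for X N
    using iso_arrow_equiv_iso that by simp
next
  fix X X' N N' f g
  assume "X \<in> Ob (Vec \<chi>)" "X' \<in> Ob (Vec \<chi>)" and N: "N \<in> Ob H" and N': "N' \<in> Ob H"
    and "f \<in> Hom (Vec \<chi>) X X'" and g: "g \<in> Hom H N N'"
  then have X: "graded_space X" and X': "graded_space X'" and f: "f \<in> graded_hom X X'" by auto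
  note XN = H.act_closed[OF X N] and XN' = H.act_closed[OF X' N']
  note df = graded_homD(2,3)[OF f] and dg = H.homD(3,4)[OF g N N']
  have fg: "tensor_mat f g \<in> Hom H (act_ob H X N) (act_ob H X' N')"
    using strict_module_category.act_hom[OF H.strict_module, of X X' N N' f g] X X' N N' f g by (simp add: H.act_arr_eq)
  have "tensor_mat (1\<^sub>m (gdim X')) (proj N' l) * incl (act_ob H X' N') l * (proj (act_ob H X' N') l * (tensor_mat f g * incl (act_ob H X N) l)) =
      tensor_mat f (proj N' l * (g * incl N l)) * (tensor_mat (1\<^sub>m (gdim X)) (proj N l) * incl (act_ob H X N) l)" if l: "l \<in> character_group" for l
  proof -
    note s = split_Q[OF N l] and s' = split_Q[OF N' l]
    note sX = split_Q[OF XN l, unfolded H.space_act[OF X N], simplified]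
    note sX' = split_Q[OF XN' l, unfolded H.space_act[OF X' N'], simplified]
    have "tensor_mat (1\<^sub>m (gdim X')) (proj N' l) * incl (act_ob H X' N') l * (proj (act_ob H X' N') l * (tensor_mat f g * incl (act_ob H X N) l)) =
        tensor_mat (1\<^sub>m (gdim X')) (proj N' l) * (Q (act_ob H X' N') l * (tensor_mat f g * incl (act_ob H X N) l))"
      by (simp add: mat_mult_assoc_dim s(1-3) s'(1-3) sX(1-3) sX'(1-3) df dg split_Q_absorb(4)[OF XN' l] H.space_act[OF X' N'])
    also have "\<dots> = tensor_mat f (proj N' l * g) * incl (act_ob H X N) l"
      unfolding Q_act[OF X' N']
      by (simp add: tensor_mat_mult_assoc s(1-3) s'(1-3) sX(1-3) sX'(1-3) df dg split_Q_absorb[OF N' l])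
    \<comment> \<open>The projector \<open>Q N' l\<close> is inserted next to
      \<open>proj N' l\<close> and carried through \<open>g\<close>. It becomes
      \<open>Q N l\<close>, whose splitting provides the two factors on the right-hand side.\<close>
    also have "\<dots> = tensor_mat f (proj N' l * (g * Q N l)) * incl (act_ob H X N) l"
      unfolding Q_natural[OF N N' g] by (simp add: split_Q_absorb[OF N' l] dg)
    also have "\<dots> = tensor_mat f (proj N' l * (g * incl N l)) * (tensor_mat (1\<^sub>m (gdim X)) (proj N l) * incl (act_ob H X N) l)"
      by (simp add: tensor_mat_mult_assoc mat_mult_assoc_dim s s'(1-3) sX(1-3) df dg)
    finally show ?thesis .
  qed
  then show "equiv_iso X' N' \<cdot>\<^bsub>S\<^esub> Fm (act_ob H X N) (act_ob H X' N') (f \<rhd>\<^sub>m\<^bsub>H\<^esub> g) = (f \<rhd>\<^sub>m\<^bsub>S\<^esub> Fm N N' g) \<cdot>\<^bsub>S\<^esub> equiv_iso X N"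
    by (auto simp: equiv_iso_def Fm_def H.act_arr_eq intro!: restrict_ext)
next
  fix X Y N assume "X \<in> Ob (Vec \<chi>)" "Y \<in> Ob (Vec \<chi>)" and N: "N \<in> Ob H"
  then have X: "graded_space X" and Y: "graded_space Y" by auto
  note YN = H.act_closed[OF Y N] and XYN = H.act_closed[OF X H.act_closed[OF Y N]]
  have "tensor_mat (1\<^sub>m (gdim X * gdim Y)) (proj N l) * incl (act_ob H X (act_ob H Y N)) l =
      tensor_mat (1\<^sub>m (gdim X)) (tensor_mat (1\<^sub>m (gdim Y)) (proj N l) * incl (act_ob H Y N) l) *
      (tensor_mat (1\<^sub>m (gdim X)) (proj (act_ob H Y N) l) * incl (act_ob H X (act_ob H Y N)) l)" if l: "l \<in> character_group" for l
  proof -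
    note s = split_Q[OF N l]
    note sY = split_Q[OF YN l, unfolded H.space_act[OF Y N], simplified]
    note sX = split_Q[OF XYN l, unfolded H.space_act[OF X YN] H.space_act[OF Y N], simplified]
    \<comment> \<open>The chosen splitting for the intermediate object cancels from the composite:
      it leaves its idempotent, which \<open>proj N l\<close> absorbs.\<close>
    have "tensor_mat (1\<^sub>m (gdim X)) (tensor_mat (1\<^sub>m (gdim Y)) (proj N l) * incl (act_ob H Y N) l) *
      (tensor_mat (1\<^sub>m (gdim X)) (proj (act_ob H Y N) l) * incl (act_ob H X (act_ob H Y N)) l) =
      tensor_mat (1\<^sub>m (gdim X)) (tensor_mat (1\<^sub>m (gdim Y)) (proj N l) * Q (act_ob H Y N) l) * incl (act_ob H X (act_ob H Y N)) l"
      by (simp add: tensor_mat_mult_assoc mat_mult_assoc_dim s(1-3) sY sX(1-3))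
    also have "tensor_mat (1\<^sub>m (gdim Y)) (proj N l) * Q (act_ob H Y N) l = tensor_mat (1\<^sub>m (gdim Y)) (proj N l)"
      unfolding Q_act[OF Y N] by (simp add: s(1-3) split_Q_absorb[OF N l] flip: tensor_mat_mult)
    finally show ?thesis by (simp flip: tensor_mat_assoc)
  qed
  then show "equiv_iso (X \<otimes>\<^sub>o\<^bsub>Vec \<chi>\<^esub> Y) N = (Ident (Vec \<chi>) X \<rhd>\<^sub>m\<^bsub>S\<^esub> equiv_iso Y N) \<cdot>\<^bsub>S\<^esub> equiv_iso X (Y \<rhd>\<^sub>o\<^bsub>H\<^esub> N)"
    by (auto simp: equiv_iso_def H.act_tensor[OF X Y N] intro!: restrict_ext)
next
  fix N assume N: "N \<in> Ob H"
  then show "equiv_iso (unit_ob (Vec \<chi>)) N = Ident S (Fo N)"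
    by (auto simp: equiv_iso_def H.act_unit[OF N] Fo_simps split_Q intro!: restrict_ext)
qed

lemma Fm_stable: "stable_functor (Vec \<chi>) H S Fo Fm equiv_iso"
  unfolding stable_functor_def using Fm_equivariant Fm_mstable by blast

text \<open>The preimage is the direct sum of the spaces \<open>W l\<close>, on which the group acts
  through \<open>character_rep \<chi> l\<close>. Its isotypic projectors are the projections onto
  the summands, so that \<open>Fo N l\<close> and \<open>W l\<close> split the same
  idempotent.\<close>

lemma Fo_essentially_surjective:
  assumes W: "W \<in> Ob S"
  shows "\<exists>N\<in>Ob H. \<exists>e. iso_arrow S (Fo N) W e"
proof -
  let ?G = "character_group :: ('g \<Rightarrow> 'k) set"
  have Wl: "graded_space (W l)" if "l \<in> ?G" for l using direct_sum_ObD[OF W that] by simp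
  obtain n I P where IP: "\<forall>l\<in>?G. I l \<in> carrier_mat n (gdim (W l)) \<and> P l \<in> carrier_mat (gdim (W l)) n"
    and PI: "\<forall>l\<in>?G. \<forall>k\<in>?G. P l * I k = (if l = k then 1\<^sub>m (gdim (W l)) else 0\<^sub>m (gdim (W l)) (gdim (W k)))"
    and sum: "mat_sum n n ?G (\<lambda>l. I l * P l) = (1\<^sub>m n :: 'k mat)"
    using exists_biproduct[OF finite_character_group, of "\<lambda>l. gdim (W l)"] by blast
  have I: "dim_row (I l) = n" "dim_col (I l) = gdim (W l)" "dim_row (P l) = gdim (W l)" "dim_col (P l) = n" if "l \<in> ?G" for l
    using IP that by auto
  have PIv: "P l *\<^sub>v (I k *\<^sub>v v) = (if l = k then v else 0\<^sub>v (gdim (W l)))"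
    if "l \<in> ?G" "k \<in> ?G" "dim_vec v = gdim (W k)" for l k v
  proof -
    have "P l *\<^sub>v (I k *\<^sub>v v) = (P l * I k) *\<^sub>v v" using that by (simp add: I)
    then show ?thesis using PI that by simp
  qed
  have sum_vec: "vec_sum n ?G (\<lambda>l. I l *\<^sub>v (P l *\<^sub>v v)) = v" if v: "v \<in> carrier_vec n" for v
  proof -
    have "vec_sum n ?G (\<lambda>l. I l *\<^sub>v (P l *\<^sub>v v)) = vec_sum n ?G (\<lambda>l. I l * P l *\<^sub>v v)"
      using v by (intro vec_sum_cong refl) (simp add: I)
    also have "\<dots> = mat_sum n n ?G (\<lambda>l. I l * P l) *\<^sub>v v"
      using v by (intro mat_sum_mult_vec[symmetric]) (auto simp: I)
    finally show ?thesis using v by (simp add: sum)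
  qed
  define V where "V = \<lparr>gdim = n, gcomp = (\<lambda>x. {v \<in> carrier_vec n. \<forall>l\<in>?G. P l *\<^sub>v v \<in> gcomp (W l) x})\<rparr>"
  have gdimV [simp]: "gdim V = n" by (simp add: V_def)
  have gcompV: "v \<in> gcomp V x \<longleftrightarrow> dim_vec v = n \<and> (\<forall>l\<in>?G. P l *\<^sub>v v \<in> gcomp (W l) x)" for v x
    by (auto simp: V_def intro: carrier_vecI)
  \<comment> \<open>Block diagonal operators. The projections of the grading of \<open>V\<close> and
    the representation on \<open>V\<close> both have this form.\<close>
  define L where "L = (\<lambda>F :: ('g \<Rightarrow> 'k) \<Rightarrow> 'k mat. mat_sum n n ?G (\<lambda>l. I l * (F l * P l)))"
  have L_dim [simp]: "dim_row (L F) = n" "dim_col (L F) = n" for F by (simp_all add: L_def)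
  have L_apply: "L F *\<^sub>v v = vec_sum n ?G (\<lambda>l. I l *\<^sub>v (F l *\<^sub>v (P l *\<^sub>v v)))"
    if F: "\<And>l. l \<in> ?G \<Longrightarrow> F l \<in> carrier_mat (gdim (W l)) (gdim (W l))" and v: "dim_vec v = n" for F v
  proof -
    have dF: "dim_row (F l) = gdim (W l)" "dim_col (F l) = gdim (W l)" if "l \<in> ?G" for l using F[OF that] by auto
    have "L F *\<^sub>v v = vec_sum n ?G (\<lambda>l. I l * (F l * P l) *\<^sub>v v)"
      unfolding L_def using v by (intro mat_sum_mult_vec) (auto simp: I dF intro: carrier_vecI)
    also have "\<dots> = vec_sum n ?G (\<lambda>l. I l *\<^sub>v (F l *\<^sub>v (P l *\<^sub>v v)))"
      using v by (intro vec_sum_cong refl) (simp add: I dF)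
    finally show ?thesis .
  qed
  have P_L: "P k *\<^sub>v (L F *\<^sub>v v) = F k *\<^sub>v (P k *\<^sub>v v)"
    if F: "\<And>l. l \<in> ?G \<Longrightarrow> F l \<in> carrier_mat (gdim (W l)) (gdim (W l))" and v: "dim_vec v = n" and k: "k \<in> ?G" for F v k
  proof -
    have dF: "dim_row (F l) = gdim (W l)" "dim_col (F l) = gdim (W l)" if "l \<in> ?G" for l using F[OF that] by auto
    have "P k *\<^sub>v (L F *\<^sub>v v) = vec_sum (gdim (W k)) ?G (\<lambda>l. P k *\<^sub>v (I l *\<^sub>v (F l *\<^sub>v (P l *\<^sub>v v))))"
    proof -
      have "L F *\<^sub>v v = vec_sum n ?G (\<lambda>l. I l *\<^sub>v (F l *\<^sub>v (P l *\<^sub>v v)))" using F v by (rule L_apply)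
      then show ?thesis using k by (simp add: mult_mat_vec_sum_dim I)
    qed
    also have "\<dots> = vec_sum (gdim (W k)) ?G (\<lambda>l. if l = k then F k *\<^sub>v (P k *\<^sub>v v) else 0\<^sub>v (gdim (W k)))"
      using k by (intro vec_sum_cong refl) (auto simp: PIv dF)
    also have "\<dots> = F k *\<^sub>v (P k *\<^sub>v v)"
      using k by (intro vec_sum_delta[OF finite_character_group]) (auto simp: dF intro: carrier_vecI)
    finally show ?thesis .
  qed
  \<comment> \<open>The projections \<open>P l\<close> are jointly injective because the biproduct
    idempotents add up to 1. Identities in \<open>V\<close> are tested on components from here
    on.\<close>
  have eqI: "u = v" if "dim_vec u = n" "dim_vec v = n" "\<And>l. l \<in> ?G \<Longrightarrow> P l *\<^sub>v u = P l *\<^sub>v v" for u v :: "'k vec"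
  proof -
    have "vec_sum n ?G (\<lambda>l. I l *\<^sub>v (P l *\<^sub>v u)) = vec_sum n ?G (\<lambda>l. I l *\<^sub>v (P l *\<^sub>v v))"
      by (intro vec_sum_cong refl) (simp add: that(3))
    then show ?thesis using sum_vec[OF carrier_vecI[OF that(1)]] sum_vec[OF carrier_vecI[OF that(2)]] by simp
  qed
  have gp: "gproj (W l) x \<in> carrier_mat (gdim (W l)) (gdim (W l))" for l x by simp
  have Pc: "P l *\<^sub>v v \<in> carrier_vec (gdim (W l))" if "l \<in> ?G" for l v using that by (auto simp: I intro: carrier_vecI)
  have V: "graded_space V"
  proof (rule graded_spaceI[where P = "\<lambda>x. L (\<lambda>l. gproj (W l) x)"])
    fix x
    show "vec_subspace (gdim V) (gcomp V x)"
      unfolding vec_subspace_def subset_iff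
      by (auto simp: gcompV I mult_mat_vec_add gcomp_add gcomp_smult Wl intro: carrier_vecI)
    show "L (\<lambda>l. gproj (W l) x) \<in> carrier_mat (gdim V) (gdim V)" by auto
  next
    fix x and v :: "'k vec" assume v: "v \<in> carrier_vec (gdim V)"
    then have dv: "dim_vec v = n" by simp
    show "L (\<lambda>l. gproj (W l) x) *\<^sub>v v \<in> gcomp V x"
      by (auto simp: gcompV P_L[OF gp dv] intro!: gproj_mem Wl Pc)
  next
    fix v :: "'k vec" assume v: "v \<in> carrier_vec (gdim V)"
    then have dv: "dim_vec v = n" by simp
    show "vec_sum (gdim V) UNIV (\<lambda>x. L (\<lambda>l. gproj (W l) x) *\<^sub>v v) = v"
    proof (rule eqI)
      fix k assume k: "k \<in> ?G"
      have "P k *\<^sub>v vec_sum (gdim V) UNIV (\<lambda>x. L (\<lambda>l. gproj (W l) x) *\<^sub>v v) = vec_sum (gdim (W k)) UNIV (\<lambda>x. gproj (W k) x *\<^sub>v (P k *\<^sub>v v))"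
        using k by (subst mult_mat_vec_sum_dim) (simp_all add: I P_L[OF gp dv])
      also have "\<dots> = P k *\<^sub>v v" by (rule gproj_sum[OF Wl[OF k] Pc[OF k]])
      finally show "P k *\<^sub>v vec_sum (gdim V) UNIV (\<lambda>x. L (\<lambda>l. gproj (W l) x) *\<^sub>v v) = P k *\<^sub>v v" .
    qed (use dv in auto)
  next
    fix x y v assume v: "v \<in> gcomp V y"
    then have dv: "dim_vec v = n" and m: "\<And>l. l \<in> ?G \<Longrightarrow> P l *\<^sub>v v \<in> gcomp (W l) y" by (auto simp: gcompV)
    show "L (\<lambda>l. gproj (W l) x) *\<^sub>v v = (if x = y then v else 0\<^sub>v (gdim V))"
      by (rule eqI) (auto simp: dv P_L[OF gp dv] gproj_homogeneous[OF Wl m] I)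
  qed
  define T where "T = (\<lambda>z. L (\<lambda>l. character_rep \<chi> l (W l) z))"
  have R: "graded_rep (W l) (character_rep \<chi> l (W l))" if "l \<in> ?G" for l
    by (rule graded_rep_character[OF bichar that Wl[OF that]])
  have Rc: "l \<in> ?G \<Longrightarrow> character_rep \<chi> l (W l) z \<in> carrier_mat (gdim (W l)) (gdim (W l))" for l z
    using graded_repD(4)[OF R] by blast
  have dT [simp]: "dim_row (T z) = n" "dim_col (T z) = n" for z by (simp_all add: T_def)
  have PT: "P k *\<^sub>v (T z *\<^sub>v v) = character_rep \<chi> k (W k) z *\<^sub>v (P k *\<^sub>v v)" if "dim_vec v = n" "k \<in> ?G" for z v k
    unfolding T_def by (rule P_L[OF Rc that])
  have T: "graded_rep V T"
    unfolding graded_rep_def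
  proof (intro conjI allI)
    show "T z \<in> graded_hom V V" for z
    proof (rule graded_homI)
      fix x v assume "v \<in> gcomp V x"
      then show "T z *\<^sub>v v \<in> gcomp V x"
        unfolding gcompV by (simp add: PT graded_repD(7)[OF R])
    qed auto
    show "T 0 = 1\<^sub>m (gdim V)"
    proof (rule mat_ext[of _ _ n])
      fix v :: "'k vec" assume v: "dim_vec v = n"
      show "T 0 *\<^sub>v v = 1\<^sub>m (gdim V) *\<^sub>v v"
        by (rule eqI) (simp_all add: v PT graded_repD(2)[OF R] I)
    qed simp_all
    show "T (z + w) = T z * T w" for z w
    proof (rule mat_ext[of _ _ n])
      fix v :: "'k vec" assume v: "dim_vec v = n"
      show "T (z + w) *\<^sub>v v = T z * T w *\<^sub>v v"
        by (rule eqI) (simp_all add: v PT graded_repD(8)[OF R] I)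
    qed simp_all
  qed
  define N where "N = (V, half_braiding V T)"
  have N: "N \<in> Ob H" unfolding N_def by (rule HH_ObI[OF V T])
  have fstN [simp]: "fst N = V" by (simp add: N_def)
  have repN: "HH_rep N = T" by (simp add: N_def half_braiding_line[OF T])
  \<comment> \<open>The twist removes the factor \<open>\<chi> y (- z)\<close> of
    \<open>character_rep\<close>, which leaves a scalar independent of the degree. The identity is
    proved for matrices because the scalars depending on \<open>y\<close> are available on
    homogeneous vectors only.\<close>
  have P_tw: "P l *\<^sub>v (twisted_rep N z *\<^sub>v v) = l z \<cdot>\<^sub>v (P l *\<^sub>v v)" if l: "l \<in> ?G" and v: "dim_vec v = n" for l z v
  proof -
    have "P l * twisted_rep N z = l z \<cdot>\<^sub>m P l"
    proof (rule graded_ext[OF V])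
      fix y v assume v: "v \<in> gcomp V y"
      then have dv: "dim_vec v = n" and Pv: "P l *\<^sub>v v \<in> gcomp (W l) y" using l by (auto simp: gcompV)
      have tw: "twisted_rep N z *\<^sub>v v = \<chi> y z \<cdot>\<^sub>v (T z *\<^sub>v v)" using twisted_rep_apply[OF N, of v y z] v by (simp add: repN)
      have "P l * twisted_rep N z *\<^sub>v v = \<chi> y z \<cdot>\<^sub>v (P l *\<^sub>v (T z *\<^sub>v v))" using l dv N by (simp add: I tw)
      also have "\<dots> = l z \<cdot>\<^sub>v (P l *\<^sub>v v)"
        using bicharacterD(1)[OF bichar, of y z]
        by (simp add: PT[OF dv l] character_rep_def graded_scaling_apply[OF Wl[OF l] Pv] bicharacterD[OF bichar] mult.left_commute[of "\<chi> y z"])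
      finally show "P l * twisted_rep N z *\<^sub>v v = (l z \<cdot>\<^sub>m P l) *\<^sub>v v" using l dv by (simp add: I)
    qed (use l N in \<open>simp_all add: I\<close>)
    then have "(P l * twisted_rep N z) *\<^sub>v v = (l z \<cdot>\<^sub>m P l) *\<^sub>v v" by simp
    then show ?thesis using l v N by (simp add: I)
  qed
  \<comment> \<open>On the component of \<open>k\<close> the projector is the average of
    \<open>inverse (l z) * k z\<close>, so that \<open>sum_character\<close> identifies it with the
    projection onto the component of \<open>l\<close>.\<close>
  have P_Q: "P k *\<^sub>v (Q N l *\<^sub>v v) = (if k = l then P k *\<^sub>v v else 0\<^sub>v (gdim (W k)))"
    if l: "l \<in> ?G" and k: "k \<in> ?G" and v: "dim_vec v = n" for k l v
  proof -
    let ?M = "of_nat (card (UNIV :: 'g set)) :: 'k"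
    have "Q N l *\<^sub>v v = vec_sum n UNIV (\<lambda>z. (l (- z) / ?M) \<cdot>\<^sub>v (twisted_rep N z *\<^sub>v v))"
      unfolding Q_def isotypic_proj_def using v N
      by (subst mat_sum_mult_vec) (auto intro: carrier_vecI)
    then have "P k *\<^sub>v (Q N l *\<^sub>v v) = vec_sum (gdim (W k)) UNIV (\<lambda>z. (l (- z) / ?M * k z) \<cdot>\<^sub>v (P k *\<^sub>v v))"
      using k N v by (simp add: mult_mat_vec_sum_dim I P_tw)
    also have "\<dots> = (if k = l then P k *\<^sub>v v else 0\<^sub>v (gdim (W k)))"
    proof (rule eq_vecI)
      fix i assume "i < dim_vec (if k = l then P k *\<^sub>v v else 0\<^sub>v (gdim (W k)))"
      then have i: "i < gdim (W k)" using k by (auto simp: I split: if_splits)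
      have ch: "(\<lambda>z. inverse (l z) * k z) \<in> character_group" by (rule mult_character[OF inverse_character[OF l] k])
      have "inverse (l z) * k z = 1 \<longleftrightarrow> k z = l z" for z
        using character_groupD(1)[OF l, of z] by (auto simp: field_simps)
      then have iff: "(\<lambda>z. inverse (l z) * k z) = (\<lambda>_. 1) \<longleftrightarrow> k = l" by (auto simp: fun_eq_iff)
      have "vec_sum (gdim (W k)) UNIV (\<lambda>z. (l (- z) / ?M * k z) \<cdot>\<^sub>v (P k *\<^sub>v v)) $ i =
          (\<Sum>z\<in>UNIV. (inverse (l z) * k z) * ((P k *\<^sub>v v) $ i / ?M))"
        using i k unfolding vec_sum_def by (simp add: I character_groupD(4)[OF l] del: index_mult_mat_vec)
      also have "\<dots> = (\<Sum>z\<in>UNIV. inverse (l z) * k z) * ((P k *\<^sub>v v) $ i / ?M)" by (simp only: sum_distrib_right)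
      also have "\<dots> = (if k = l then P k *\<^sub>v v else 0\<^sub>v (gdim (W k))) $ i"
        unfolding sum_character[OF ch] iff using i by simp
      finally show "vec_sum (gdim (W k)) UNIV (\<lambda>z. (l (- z) / ?M * k z) \<cdot>\<^sub>v (P k *\<^sub>v v)) $ i =
          (if k = l then P k *\<^sub>v v else 0\<^sub>v (gdim (W k))) $ i" .
    qed (use k in \<open>auto simp: I\<close>)
    finally show ?thesis .
  qed
  have Q_I: "Q N l *\<^sub>v (I l *\<^sub>v v) = I l *\<^sub>v v" if l: "l \<in> ?G" and v: "dim_vec v = gdim (W l)" for l v
    by (rule eqI) (use l v in \<open>auto simp: I P_Q PIv\<close>)
  have I_P: "I l *\<^sub>v (P l *\<^sub>v v) = Q N l *\<^sub>v v" if l: "l \<in> ?G" and v: "dim_vec v = n" for l v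
    by (rule eqI) (use l v in \<open>auto simp: I P_Q PIv\<close>)
  have P_hom: "P l \<in> graded_hom V (W l)" if "l \<in> ?G" for l
    by (rule graded_homI) (use that IP in \<open>auto simp: gcompV\<close>)
  have I_hom: "I l \<in> graded_hom (W l) V" if l: "l \<in> ?G" for l
    by (rule graded_homI) (use l IP in \<open>auto simp: gcompV I PIv Wl gcomp_dim[OF Wl]\<close>)
  \<comment> \<open>By \<open>I_P\<close> the pair \<open>I l\<close>, \<open>P l\<close> splits
    \<open>Q N l\<close>, as does the chosen pair; the two splittings are compared as in
    \<open>equiv_iso\<close>.\<close>
  have inv: "inverse_arrows (anti_twist_module (Vec \<chi>) (character_anti_twist \<chi> l)) (Fo N l) (W l) (P l * incl N l) (proj N l * I l)"
    if l: "l \<in> ?G" for l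
  proof -
    note s = split_Q[OF N l, simplified] and i = image_incl[OF N l, simplified]
    have CA: "proj N l *\<^sub>v (incl N l *\<^sub>v v) = v" if "dim_vec v = dim_col (incl N l)" for v
      using s that by (metis mult_mat_vec_assoc one_mult_mat_vec_dim)
    have AC: "incl N l *\<^sub>v (proj N l *\<^sub>v v) = Q N l *\<^sub>v v" if "dim_vec v = n" for v
      using s that by (metis mult_mat_vec_assoc)
    have QA: "Q N l *\<^sub>v (incl N l *\<^sub>v v) = incl N l *\<^sub>v v" if "dim_vec v = dim_col (incl N l)" for v
      using AC[of "incl N l *\<^sub>v v"] CA[OF that] s that by simp
    have "proj N l * I l * (P l * incl N l) = 1\<^sub>m (dim_col (incl N l))"
      by (rule mat_ext[of _ _ "dim_col (incl N l)"]) (simp_all add: s(1-3) I[OF l] I_P[OF l] QA CA)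
    moreover have "P l * incl N l * (proj N l * I l) = 1\<^sub>m (gdim (W l))"
      by (rule mat_ext[of _ _ "gdim (W l)"]) (simp_all add: s(1-3) I[OF l] AC Q_I[OF l] PIv[OF l l])
    moreover have "P l * incl N l \<in> graded_hom (graded_image V (incl N l)) (W l)"
      using i P_hom[OF l] by (intro graded_hom_mult) auto
    moreover have "proj N l * I l \<in> graded_hom (W l) (graded_image V (incl N l))"
      using i I_hom[OF l] Wl[OF l] by (intro graded_hom_mult) auto
    ultimately show ?thesis by (simp add: inverse_arrows_def Fo_simps[OF l])
  qed
  have "iso_arrow S (Fo N) W (restrict (\<lambda>l. P l * incl N l) ?G)"
    by (rule inverse_arrows_iso, rule inverse_arrows_direct_sum, rule inv)
  with N show ?thesis by blast
qed

lemma stable_braided_S: "stable_braided_module_category (Vec \<chi>) S"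
  by (rule stable_braided_direct_sum[OF strict_rigid_braided_Vec[OF bichar]])
    (rule graded_rep_module.stable_braided_module[OF anti_twist_graded_rep_module[OF bichar]])

lemma Fm_equivalence: "is_equivalence H S Fo Fm"
proof (rule is_equivalence_if_fully_faithful[OF H.category _ Fm_functor Fm_bij])
  show "category S"
    using stable_braided_S
    by (intro strict_module_category.axioms(2) braided_module_category.axioms(1) stable_braided_module_category.axioms(1))
  show "\<exists>N\<in>Ob H. \<exists>e. iso_arrow S (Fo N) W e" if "W \<in> Ob S" for W
    by (rule Fo_essentially_surjective[OF that])
qed

end

theorem lemma3p26:
  fixes \<chi> :: "'g::{ab_group_add,finite} \<Rightarrow> 'g \<Rightarrow> 'k::{alg_closed_field,field_char_0}"
  assumes "bicharacter \<chi>"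
  shows "(\<forall>l\<in>character_group. anti_twist (Vec \<chi>) (character_anti_twist \<chi> l)) \<and>
    stable_braided_equivalent (Vec \<chi>) (HH (Vec \<chi>))
      (module_direct_sum character_group
        (\<lambda>l. anti_twist_module (Vec \<chi>) (character_anti_twist \<chi> l)))"
proof -
  interpret vec_bicharacter \<chi> by unfold_locales (rule assms)
  show ?thesis
    using anti_twist_character[OF assms] H.stable_braided_module stable_braided_S Fm_stable Fm_equivalence
    unfolding stable_braided_equivalent_def by blast
qed

end
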